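(* Let the system data, the functions $g_i(\cdot)=[\phi_i^\top\ \varphi_i^\top\ f_i^\top]^\top$ and matrices $M_i$, $\widehat A_i,\widehat B_i,\widehat C_i,\widehat{\mathfrak B}_i$ ($i\in\mathbb N_\nu$), the matrices $\Gamma_i,\mathfrak H_i,\mathfrak E_i,\mathfrak F_i$ and their Cholesky factors, and the supply rate function $\mathsf s$ with parameters $\widetilde J,J_1,J_2,J_3$ be given as described in the context. Suppose there exist $K\in\mathbb R^{p\times n}$, $P_1\in\mathbb S^n$, $P_2\in\mathbb R^{n\times dn}$, $P_3\in\mathbb S^{dn}$ and $Q_i,R_i\in\mathbb S^n$, $i\in\mathbb N_\nu$, such that $$\begin{bmatrix}P_1&P_2\\ *&P_3\end{bmatrix}+\Big[\mathsf O_n\oplus\big(\mathrm{diag}_{i=1}^{\nu}\, I_{d_i}\otimes Q_i\big)\Big]\succ 0,$$ $$\mathbf Q=\mathrm{diag}_{i=1}^{\nu}Q_i\succ0,\qquad \mathbf R=\mathrm{diag}_{i=1}^{\nu}R_i\succ 0,$$ $$\begin{bmatrix}\boldsymbol\Psi&\boldsymbol\Sigma^\top\widetilde J^\top\\ *&J_1\end{bmatrix}=\mathrm{Sy}\big[\mathbf P^\top\boldsymbol\Pi\big]+\boldsymbol\Phi\prec0,$$ where $\boldsymbol\Omega=\mathbf A+\mathbf B_1[(I_\beta\otimes K)\oplus\mathsf O_q]$, $\boldsymbol\Sigma=\mathbf C+\mathbf B_2[(I_\beta\otimes K)\oplus\mathsf O_q]$, $$\boldsymbol\Psi=\mathrm{Sy}\left(S^\top\begin{bmatrix}P_1&P_2\\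 *&P_3\end{bmatrix}\begin{bmatrix}\boldsymbol\Omega\\ [\,\mathbf M\otimes I_n\ \ \mathsf O_{dn,(\mu n+q)}]\end{bmatrix}-\begin{bmatrix}\mathsf O_{(\beta n),m}\\ J_2^\top\end{bmatrix}\boldsymbol\Sigma\right)+\Xi,$$ $$S=\begin{bmatrix}I_n&\mathsf O_{n,\nu n}&\mathsf O_{n,\varkappa n}&\mathsf O_{n,\mu n}&\mathsf O_{n,q}\\ \mathsf O_{dn,n}&\mathsf O_{dn,\nu n}&\widehat I&\mathsf O_{dn,\mu n}&\mathsf O_{dn,q}\end{bmatrix},$$ $$\Xi=\big[(\mathbf Q+\mathbf R\Lambda)\oplus\mathsf O_n\oplus\mathsf O_{\kappa n}\oplus\mathsf O_q\big]-\big[\mathsf O_n\oplus\mathbf Q\oplus(\mathrm{diag}_{i=1}^\nu I_{\varkappa_i}\otimes R_i)\oplus(\mathrm{diag}_{i=1}^\nu I_{\mu_i}\otimes R_i)\oplus J_3\big],$$ $$\widehat I=\big(\mathrm{diag}_{i=1}^\nu \mathfrak L_{f_i}^{-1}[\mathsf O_{d_i,\delta_i}\ \ I_{d_i}]\,\mathfrak L_{h_i}\big)\otimes I_n,\qquad \Lambda=\mathrm{diag}_{i=1}^\nu (r_i-r_{i-1})I_n,$$ $$\mathbf M=\big[\mathrm{diag}_{i=1}^\nu\mathfrak L_{f_i}^{-1}f_i(-r_{i-1})\ \ \mathbf 0_d\ \ \mathsf O_{d,\varkappa}\big]-\big[\mathbf 0_d\ \ \mathrm{diag}_{i=1}^\nu\mathfrak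 L_{f_i}^{-1}f_i(-r_i)\ \ \mathrm{diag}_{i=1}^\nu\mathfrak L_{f_i}^{-1}M_i\mathfrak L_{h_i}\big],$$ $$\mathbf P=\big[P_1\ \ \mathsf O_{n,\nu n}\ \ P_2\widehat I\ \ \mathsf O_{n,(\mu n+q+m)}\big],\qquad \boldsymbol\Pi=[\boldsymbol\Omega\ \ \mathsf O_{n,m}],$$ $$\boldsymbol\Phi=\mathrm{Sy}\left(\begin{bmatrix}P_2\\ \mathsf O_{\nu n,dn}\\ \widehat I^\top P_3\\ \mathsf O_{(\mu n+q+m),dn}\end{bmatrix}\big[\mathbf M\otimes I_n\ \ \mathsf O_{dn,(\mu n+q+m)}\big]+\begin{bmatrix}\mathsf O_{(\beta n),m}\\ -J_2^\top\\ \widetilde J\end{bmatrix}\big[\boldsymbol\Sigma\ \ \mathsf O_m\big]\right)+[\Xi\oplus J_1].$$ Then the closed-loop system with gain $K$ (defined in the context) with supply rate $\mathsf s$ is dissipative, and the trivial solution of the closed-loop system with $w(t)\equiv\mathbf 0_q$ is exponentially stable. Moreover, the number of scalar unknowns in these conditions is $(0.5d^2+d+\nu+0.5)n^2+(0.5d+0.5+\nu+p)n\in\mathcal O(d^2n^2)$.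
   Context: **Notation.** $\mathbb N_\nu=\{1,\dots,\nu\}$; $\mathbb S^n$: real symmetric $n\times n$ matrices; $\mathrm{Sy}(X)=X+X^\top$; $X\oplus Y$ is the block-diagonal matrix with blocks $X,Y$ and $\mathrm{diag}_{i=1}^\nu X_i=X_1\oplus\dots\oplus X_\nu$ (blocks may be rectangular); $\otimes$ is the Kronecker product; $\mathrm{Row}_{i=a}^{b}X_i=[X_a\cdots X_b]$ and $\mathrm{Col}_{i=a}^{b}X_i=[X_a^\top\cdots X_b^\top]^\top$; $*$ denotes a block determined by symmetry; $\mathsf O_{n,m}$ is the $n\times m$ zero matrix, $\mathsf O_n=\mathsf O_{n,n}$, $\mathbf 0_n$ the $n\times1$ zero vector. Matrix products bind tighter than $\otimes$, which binds tighter than $\oplus,\mathrm{diag}$. Empty matrices (zero rows or columns) are allowed, with the usual conventions; blocks of zero size are absent. $L^2(\mathcal X;\cdot)$ is the space of measurable square-integrable functions; $W^{1,2}(\mathcal X;\mathbb R^d)$ is the space of $L^2$ functions with weak derivative in $L^2$ (evaluated pointwise via the continuous representative). **Data.** $n,m,p,q,\nu\in\mathbb N$; $0=r_0<r_1<\dots<r_\nu=r$; $\mathcal J=[-r,0]$; $\mathcal I_i=[-r_i,-r_{i-1}]$; $t_0\in\mathbb R$. Constant matrices $A_i\in\mathbb R^{n\times n}$, $B_i\in\mathbb R^{n\times p}$, $C_i\in\mathbb R^{m\times n}$, $\mathfrak B_i\in\mathbb R^{m\times p}$ ($i=0,\dots,\nu$), $D_1\in\mathbb R^{n\times q}$, $D_2\in\mathbb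 R^{m\times q}$, and kernels $\widetilde A_i\in L^2(\mathcal I_i;\mathbb R^{n\times n})$, $\widetilde B_i\in L^2(\mathcal I_i;\mathbb R^{n\times p})$, $\widetilde C_i\in L^2(\mathcal I_i;\mathbb R^{m\times n})$, $\widetilde{\mathfrak B}_i\in L^2(\mathcal I_i;\mathbb R^{m\times p})$ ($i\in\mathbb N_\nu$). **Kernel decomposition.** For each $i\in\mathbb N_\nu$ let $d_i\in\mathbb N$, $\delta_i,\mu_i\in\mathbb N\cup\{0\}$, $\varkappa_i=d_i+\delta_i$, $\kappa_i=d_i+\delta_i+\mu_i$, and $f_i\in W^{1,2}(\mathcal I_i;\mathbb R^{d_i})$, $\varphi_i\in L^2(\mathcal I_i;\mathbb R^{\delta_i})$, $\phi_i\in L^2(\mathcal I_i;\mathbb R^{\mu_i})$, $h_i=\begin{bmatrix}\varphi_i\\ f_i\end{bmatrix}$, $g_i=\begin{bmatrix}\phi_i\\ h_i\end{bmatrix}$, $M_i\in\mathbb R^{d_i\times\varkappa_i}$ satisfy $\frac{\mathrm d f_i(\tau)}{\mathrm d\tau}=M_ih_i(\tau)$ (weak derivative) and $\int_{\mathcal I_i}g_i(\tau)g_i^\top(\tau)\,\mathrm d\tau\succ0$, and let $\widehat A_i\in\mathbb R^{n\times\kappa_in}$, $\widehat B_i\in\mathbb R^{n\times\kappa_ip}$, $\widehat C_i\in\mathbb R^{m\times\kappa_in}$, $\widehat{\mathfrak B}_i\in\mathbb R^{m\times\kappa_ip}$ satisfy on $\mathcal I_i$: $\widetilde A_i(\tau)=\widehat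 A_i(g_i(\tau)\otimes I_n)$, $\widetilde B_i(\tau)=\widehat B_i(g_i(\tau)\otimes I_p)$, $\widetilde C_i(\tau)=\widehat C_i(g_i(\tau)\otimes I_n)$, $\widetilde{\mathfrak B}_i(\tau)=\widehat{\mathfrak B}_i(g_i(\tau)\otimes I_p)$. Put $\mathfrak F_i=\int_{\mathcal I_i}f_if_i^\top\mathrm d\tau$, $\mathfrak H_i=\int_{\mathcal I_i}h_ih_i^\top\mathrm d\tau$, $\Gamma_i=\int_{\mathcal I_i}\phi_ih_i^\top\mathrm d\tau$, $\varepsilon_i(\tau)=\phi_i(\tau)-\Gamma_i\mathfrak H_i^{-1}h_i(\tau)$, $\mathfrak E_i=\int_{\mathcal I_i}\varepsilon_i\varepsilon_i^\top\mathrm d\tau$; these Gram matrices are positive definite, with lower-triangular Cholesky factorizations $\mathfrak F_i=\mathfrak L_{f_i}\mathfrak L_{f_i}^\top$, $\mathfrak H_i=\mathfrak L_{h_i}\mathfrak L_{h_i}^\top$, $\mathfrak E_i=\mathfrak L_{\varepsilon_i}\mathfrak L_{\varepsilon_i}^\top$. Put $T_i=\begin{bmatrix}\Gamma_i\mathfrak H_i^{-1}\\ I_{\varkappa_i}\end{bmatrix}\mathfrak L_{h_i}$, $\widetilde T_i=\begin{bmatrix}I_{\mu_i}\\ \mathsf O_{\varkappa_i,\mu_i}\end{bmatrix}\mathfrak L_{\varepsilon_i}$. Let $d=\sum_i d_i$, $\varkappa=\sum_i\varkappa_i$, $\mu=\sum_i\mu_i$, $\kappa=\sum_i\kappa_i$,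 $\beta=1+\nu+\kappa$. **Closed-loop system with gain $K\in\mathbb R^{p\times n}$** (obtained from state feedback $u(t)=Kx(t)$): for almost all $t\ge t_0$, $\dot x(t)=D_1w(t)+\sum_{i=0}^\nu(A_i+B_iK)x(t-r_i)+\sum_{i=1}^\nu\int_{\mathcal I_i}[\widetilde A_i(\tau)+\widetilde B_i(\tau)K]x(t+\tau)\mathrm d\tau$, $z(t)=D_2w(t)+\sum_{i=0}^\nu(C_i+\mathfrak B_iK)x(t-r_i)+\sum_{i=1}^\nu\int_{\mathcal I_i}[\widetilde C_i(\tau)+\widetilde{\mathfrak B}_i(\tau)K]x(t+\tau)\mathrm d\tau$, with $x(t_0+\theta)=\psi(\theta)$ for $\theta\in\mathcal J$, $\psi\in C(\mathcal J;\mathbb R^n)$, disturbance $w\in L^2(\mathbb R_{\ge t_0};\mathbb R^q)$; solutions $x(t)\in\mathbb R^n$ are absolutely continuous for $t\ge t_0$ (Carathéodory sense). Equivalently $\dot x(t)=(\mathbf A+\mathbf B_1[(I_\beta\otimes K)\oplus\mathsf O_q])\vartheta(t)$, $z(t)=(\mathbf C+\mathbf B_2[(I_\beta\otimes K)\oplus\mathsf O_q])\vartheta(t)$, where $\mathbf A=[\mathrm{Row}_{i=0}^\nu A_i\ \ \mathrm{Row}_{i=1}^\nu\widehat A_i(T_i\otimes I_n)\ \ \mathrm{Row}_{i=1}^\nu\widehat A_i(\widetilde T_i\otimes I_n)\ \ D_1]$, $\mathbf B_1=[\mathrm{Row}_{i=0}^\nu B_i\ \ \mathrm{Row}_{i=1}^\nu\widehat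 B_i(T_i\otimes I_p)\ \ \mathrm{Row}_{i=1}^\nu\widehat B_i(\widetilde T_i\otimes I_p)\ \ \mathsf O_{n,q}]$, $\mathbf C=[\mathrm{Row}_{i=0}^\nu C_i\ \ \mathrm{Row}_{i=1}^\nu\widehat C_i(T_i\otimes I_n)\ \ \mathrm{Row}_{i=1}^\nu\widehat C_i(\widetilde T_i\otimes I_n)\ \ D_2]$, $\mathbf B_2=[\mathrm{Row}_{i=0}^\nu\mathfrak B_i\ \ \mathrm{Row}_{i=1}^\nu\widehat{\mathfrak B}_i(T_i\otimes I_p)\ \ \mathrm{Row}_{i=1}^\nu\widehat{\mathfrak B}_i(\widetilde T_i\otimes I_p)\ \ \mathsf O_{m,q}]$, $\vartheta(t)=\mathrm{Col}\big(\mathrm{Col}_{i=0}^\nu x(t-r_i),\ \mathrm{Col}_{i=1}^\nu\int_{\mathcal I_i}(\mathfrak L_{h_i}^{-1}h_i(\tau)\otimes I_n)x(t+\tau)\mathrm d\tau,\ \mathrm{Col}_{i=1}^\nu\int_{\mathcal I_i}(\mathfrak L_{\varepsilon_i}^{-1}\varepsilon_i(\tau)\otimes I_n)x(t+\tau)\mathrm d\tau,\ w(t)\big)$. **Supply rate.** $\mathsf s(z,w)=\begin{bmatrix}z\\ w\end{bmatrix}^\top\begin{bmatrix}\widetilde J^\top J_1^{-1}\widetilde J&J_2\\ *&J_3\end{bmatrix}\begin{bmatrix}z\\ w\end{bmatrix}$ with $\widetilde J\in\mathbb R^{m\times m}$, $J_1\in\mathbb S^m$, $J_1^{-1}\prec0$,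 $\widetilde J^\top J_1^{-1}\widetilde J\preceq 0$, $J_2\in\mathbb R^{m\times q}$, $J_3\in\mathbb S^q$. **Dissipativity.** The closed-loop system with supply rate $\mathsf s$ is dissipative if there is $\mathsf v\in C^1(C(\mathcal J;\mathbb R^n);\mathbb R)$ such that $\frac{\mathrm d}{\mathrm dt}\mathsf v(\mathsf x_t(\cdot))-\mathsf s(z(t),w(t))\le0$ for almost all $t\ge t_0$ along its trajectories, where $\mathsf x_t(\theta)=x(t+\theta)$, $\theta\in\mathcal J$. **Exponential stability** of the trivial solution has its usual meaning for functional differential equations, with initial functions in $C(\mathcal J;\mathbb R^n)$ and the sup norm. *)

theory Defs
  imports
    "HOL-Analysis.Analysis"
    "HOL-Library.Function_Algebras"
    "HOL-Library.Landau_Symbols"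
    "Jordan_Normal_Form.Matrix"
begin

hide_type (open) Finite_Cartesian_Product.vec
hide_const (open) Finite_Cartesian_Product.vec Finite_Cartesian_Product.mat
  Finite_Cartesian_Product.row
unbundle no vec_syntax
unbundle no inner_syntax

definition kronecker :: "real mat \<Rightarrow> real mat \<Rightarrow> real mat" (infixl \<open>\<otimes>\<^sub>K\<close> 68) where
  "A \<otimes>\<^sub>K B = mat (dim_row A * dim_row B) (dim_col A * dim_col B)
     (\<lambda>(i, j). A $$ (i div dim_row B, j div dim_col B) * B $$ (i mod dim_row B, j mod dim_col B))"

text \<open>Block rows and columns. The first argument is the common number of rows (resp. columns)
  of the blocks; it is needed for the empty list of blocks only.\<close>

definition hcat :: "nat \<Rightarrow> real mat list \<Rightarrow> real mat" where
  "hcat nr As = foldr (\<lambda>A B. four_block_mat A B (0\<^sub>m 0 (dim_col A)) (0\<^sub>m 0 (dim_col B))) As (0\<^sub>m nr 0)"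

definition vcat :: "nat \<Rightarrow> real mat list \<Rightarrow> real mat" where
  "vcat nc As = foldr (@\<^sub>r) As (0\<^sub>m 0 nc)"

definition col_mat :: "real vec \<Rightarrow> real mat" where
  "col_mat v = mat_of_cols (dim_vec v) [v]"

definition mat_inv :: "real mat \<Rightarrow> real mat" where
  "mat_inv A = (THE B. B \<in> carrier_mat (dim_row A) (dim_row A) \<and> inverts_mat A B \<and> inverts_mat B A)"

definition Sy :: "real mat \<Rightarrow> real mat" where
  "Sy X = X + X\<^sup>T"

definition sym_block :: "real mat \<Rightarrow> real mat \<Rightarrow> real mat \<Rightarrow> real mat" where
  "sym_block A B C = four_block_mat A B B\<^sup>T C"

definition sym_mats :: "nat \<Rightarrow> real mat set" where
  "sym_mats k = {X \<in> carrier_mat k k. X\<^sup>T = X}"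

definition pos_def :: "real mat \<Rightarrow> bool" where
  "pos_def A \<longleftrightarrow> A \<in> sym_mats (dim_row A) \<and>
     (\<forall>v \<in> carrier_vec (dim_row A). v \<noteq> 0\<^sub>v (dim_row A) \<longrightarrow> 0 < scalar_prod v (A *\<^sub>v v))"

definition neg_def :: "real mat \<Rightarrow> bool" where
  "neg_def A \<longleftrightarrow> pos_def (- A)"

definition neg_semidef :: "real mat \<Rightarrow> bool" where
  "neg_semidef A \<longleftrightarrow> A \<in> sym_mats (dim_row A) \<and>
     (\<forall>v \<in> carrier_vec (dim_row A). scalar_prod v (A *\<^sub>v v) \<le> 0)"

definition cholesky :: "real mat \<Rightarrow> real mat \<Rightarrow> bool" where
  "cholesky A L \<longleftrightarrow> L \<in> carrier_mat (dim_row A) (dim_row A) \<and> upper_triangular (L\<^sup>T) \<and>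
     (\<forall>i < dim_row A. 0 < L $$ (i, i)) \<and> A = L * L\<^sup>T"

definition vnorm :: "real vec \<Rightarrow> real" where
  "vnorm v = sqrt (scalar_prod v v)"

definition int_vec :: "real set \<Rightarrow> nat \<Rightarrow> (real \<Rightarrow> real vec) \<Rightarrow> real vec" where
  "int_vec I k v = vec k (\<lambda>j. LINT \<tau>|lebesgue_on I. v \<tau> $ j)"

definition int_mat :: "real set \<Rightarrow> nat \<Rightarrow> nat \<Rightarrow> (real \<Rightarrow> real mat) \<Rightarrow> real mat" where
  "int_mat I k l X = mat k l (\<lambda>(i, j). LINT \<tau>|lebesgue_on I. X \<tau> $$ (i, j))"

definition sq_int :: "real set \<Rightarrow> (real \<Rightarrow> real) \<Rightarrow> bool" where
  "sq_int I u \<longleftrightarrow> u \<in> borel_measurable (lebesgue_on I) \<and> integrable (lebesgue_on I) (\<lambda>\<tau>. (u \<tau>)\<^sup>2)"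

definition L2_vec :: "real set \<Rightarrow> nat \<Rightarrow> (real \<Rightarrow> real vec) set" where
  "L2_vec I k = {v. (\<forall>\<tau>\<in>I. v \<tau> \<in> carrier_vec k) \<and> (\<forall>j<k. sq_int I (\<lambda>\<tau>. v \<tau> $ j))}"

definition L2_mat :: "real set \<Rightarrow> nat \<Rightarrow> nat \<Rightarrow> (real \<Rightarrow> real mat) set" where
  "L2_mat I k l = {X. (\<forall>\<tau>\<in>I. X \<tau> \<in> carrier_mat k l) \<and>
     (\<forall>i<k. \<forall>j<l. sq_int I (\<lambda>\<tau>. X \<tau> $$ (i, j)))}"

definition test_functions :: "real \<Rightarrow> real \<Rightarrow> (real \<Rightarrow> real) set" where
  "test_functions a b = {\<eta>. (\<forall>k x. (deriv ^^ k) \<eta> field_differentiable at x) \<and>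
     (\<exists>c d. a < c \<and> d < b \<and> (\<forall>x. x \<notin> {c..d} \<longrightarrow> \<eta> x = 0))}"

definition weak_deriv :: "real \<Rightarrow> real \<Rightarrow> (real \<Rightarrow> real) \<Rightarrow> (real \<Rightarrow> real) \<Rightarrow> bool" where
  "weak_deriv a b u g \<longleftrightarrow> (\<forall>\<eta> \<in> test_functions a b.
     (LINT \<tau>|lebesgue_on {a..b}. u \<tau> * deriv \<eta> \<tau>) = - (LINT \<tau>|lebesgue_on {a..b}. g \<tau> * \<eta> \<tau>))"

text \<open>Elements of $W^{1,2}$ are identified with their continuous representatives, so that
  their point values are meaningful.\<close>

definition W12_vec :: "real \<Rightarrow> real \<Rightarrow> nat \<Rightarrow> (real \<Rightarrow> real vec) set" where
  "W12_vec a b k = {v \<in> L2_vec {a..b} k. \<forall>j<k. continuous_on {a..b} (\<lambda>\<tau>. v \<tau> $ j) \<and>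
     (\<exists>g. sq_int {a..b} g \<and> weak_deriv a b (\<lambda>\<tau>. v \<tau> $ j) g)}"

definition abs_cont_on :: "real \<Rightarrow> real \<Rightarrow> (real \<Rightarrow> real) \<Rightarrow> bool" where
  "abs_cont_on a b u \<longleftrightarrow> (\<forall>\<epsilon>>0. \<exists>\<delta>>0. \<forall>D :: (real \<times> real) set.
     finite D \<and> (\<forall>(s, t) \<in> D. a \<le> s \<and> s \<le> t \<and> t \<le> b) \<and>
     disjoint_family_on (\<lambda>(s, t). {s<..<t}) D \<and> (\<Sum>(s, t)\<in>D. t - s) < \<delta> \<longrightarrow>
     (\<Sum>(s, t)\<in>D. \<bar>u t - u s\<bar>) < \<epsilon>)"

definition cspace :: "real set \<Rightarrow> nat \<Rightarrow> (real \<Rightarrow> real vec) set" where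
  "cspace J k = {\<psi> \<in> J \<rightarrow>\<^sub>E carrier_vec k. \<forall>j<k. continuous_on J (\<lambda>\<theta>. \<psi> \<theta> $ j)}"

definition cnorm :: "real set \<Rightarrow> (real \<Rightarrow> real vec) \<Rightarrow> real" where
  "cnorm J \<psi> = (SUP \<theta>\<in>J. vnorm (\<psi> \<theta>))"

definition cadd :: "real set \<Rightarrow> (real \<Rightarrow> real vec) \<Rightarrow> (real \<Rightarrow> real vec) \<Rightarrow> real \<Rightarrow> real vec" where
  "cadd J \<psi> h = (\<lambda>\<theta>\<in>J. \<psi> \<theta> + h \<theta>)"

definition cscale :: "real set \<Rightarrow> real \<Rightarrow> (real \<Rightarrow> real vec) \<Rightarrow> real \<Rightarrow> real vec" where
  "cscale J c \<psi> = (\<lambda>\<theta>\<in>J. c \<cdot>\<^sub>v \<psi> \<theta>)"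

definition bounded_linear_functional :: "real set \<Rightarrow> nat \<Rightarrow> ((real \<Rightarrow> real vec) \<Rightarrow> real) \<Rightarrow> bool" where
  "bounded_linear_functional J k l \<longleftrightarrow>
     (\<forall>g \<in> cspace J k. \<forall>h \<in> cspace J k. l (cadd J g h) = l g + l h) \<and>
     (\<forall>c. \<forall>h \<in> cspace J k. l (cscale J c h) = c * l h) \<and>
     (\<exists>B. \<forall>h \<in> cspace J k. \<bar>l h\<bar> \<le> B * cnorm J h)"

text \<open>Frechet differentiability everywhere, with a derivative that is continuous for the
  operator norm.\<close>

definition C1_functional :: "real set \<Rightarrow> nat \<Rightarrow> ((real \<Rightarrow> real vec) \<Rightarrow> real) \<Rightarrow> bool" where
  "C1_functional J k v \<longleftrightarrow> (\<exists>Dv. \<forall>\<psi> \<in> cspace J k.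
     bounded_linear_functional J k (Dv \<psi>) \<and>
     (\<forall>\<epsilon>>0. \<exists>\<delta>>0. \<forall>h \<in> cspace J k. cnorm J h < \<delta> \<longrightarrow>
        \<bar>v (cadd J \<psi> h) - v \<psi> - Dv \<psi> h\<bar> \<le> \<epsilon> * cnorm J h) \<and>
     (\<forall>\<epsilon>>0. \<exists>\<delta>>0. \<forall>g \<in> cspace J k. cnorm J g < \<delta> \<longrightarrow>
        (\<forall>h \<in> cspace J k. \<bar>Dv (cadd J \<psi> g) h - Dv \<psi> h\<bar> \<le> \<epsilon> * cnorm J h)))"

text \<open>\<open>dimx, dimz, dimu, dimw\<close> are $n, m, p, q$, \<open>ndel\<close> is $\nu$ and \<open>del i\<close> is $r_i$. The input
  matrices and kernels of the output equation, written with a Fraktur B on paper, carry the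
  letter E.\<close>

record delay_system =
  dimx :: nat
  dimz :: nat
  dimu :: nat
  dimw :: nat
  ndel :: nat
  del :: "nat \<Rightarrow> real"
  tinit :: real
  matA :: "nat \<Rightarrow> real mat"
  matB :: "nat \<Rightarrow> real mat"
  matC :: "nat \<Rightarrow> real mat"
  matE :: "nat \<Rightarrow> real mat"
  matD1 :: "real mat"
  matD2 :: "real mat"
  kerA :: "nat \<Rightarrow> real \<Rightarrow> real mat"
  kerB :: "nat \<Rightarrow> real \<Rightarrow> real mat"
  kerC :: "nat \<Rightarrow> real \<Rightarrow> real mat"
  kerE :: "nat \<Rightarrow> real \<Rightarrow> real mat"

definition ivl :: "'a delay_system_scheme \<Rightarrow> nat \<Rightarrow> real set" where
  "ivl S i = {- del S i .. - del S (i - 1)}"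

definition hist :: "'a delay_system_scheme \<Rightarrow> real set" where
  "hist S = {- del S (ndel S) .. 0}"

definition valid_system :: "'a delay_system_scheme \<Rightarrow> bool" where
  "valid_system S \<longleftrightarrow>
     1 \<le> dimx S \<and> 1 \<le> dimz S \<and> 1 \<le> dimu S \<and> 1 \<le> dimw S \<and> 1 \<le> ndel S \<and>
     del S 0 = 0 \<and> (\<forall>i < ndel S. del S i < del S (Suc i)) \<and>
     (\<forall>i \<in> {0..ndel S}.
        matA S i \<in> carrier_mat (dimx S) (dimx S) \<and> matB S i \<in> carrier_mat (dimx S) (dimu S) \<and>
        matC S i \<in> carrier_mat (dimz S) (dimx S) \<and> matE S i \<in> carrier_mat (dimz S) (dimu S)) \<and>
     matD1 S \<in> carrier_mat (dimx S) (dimw S) \<and> matD2 S \<in> carrier_mat (dimz S) (dimw S) \<and>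
     (\<forall>i \<in> {1..ndel S}.
        kerA S i \<in> L2_mat (ivl S i) (dimx S) (dimx S) \<and> kerB S i \<in> L2_mat (ivl S i) (dimx S) (dimu S) \<and>
        kerC S i \<in> L2_mat (ivl S i) (dimz S) (dimx S) \<and> kerE S i \<in> L2_mat (ivl S i) (dimz S) (dimu S))"

definition state_rhs ::
  "'a delay_system_scheme \<Rightarrow> real mat \<Rightarrow> (real \<Rightarrow> real vec) \<Rightarrow> (real \<Rightarrow> real vec) \<Rightarrow> real \<Rightarrow> real vec" where
  "state_rhs S K w x t =
     matD1 S *\<^sub>v w t
     + finsum_vec TYPE(real) (dimx S) (\<lambda>i. (matA S i + matB S i * K) *\<^sub>v x (t - del S i)) {0..ndel S}
     + finsum_vec TYPE(real) (dimx S)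
         (\<lambda>i. int_vec (ivl S i) (dimx S) (\<lambda>\<tau>. (kerA S i \<tau> + kerB S i \<tau> * K) *\<^sub>v x (t + \<tau>))) {1..ndel S}"

definition output_rhs ::
  "'a delay_system_scheme \<Rightarrow> real mat \<Rightarrow> (real \<Rightarrow> real vec) \<Rightarrow> (real \<Rightarrow> real vec) \<Rightarrow> real \<Rightarrow> real vec" where
  "output_rhs S K w x t =
     matD2 S *\<^sub>v w t
     + finsum_vec TYPE(real) (dimz S) (\<lambda>i. (matC S i + matE S i * K) *\<^sub>v x (t - del S i)) {0..ndel S}
     + finsum_vec TYPE(real) (dimz S)
         (\<lambda>i. int_vec (ivl S i) (dimz S) (\<lambda>\<tau>. (kerC S i \<tau> + kerE S i \<tau> * K) *\<^sub>v x (t + \<tau>))) {1..ndel S}"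

text \<open>Caratheodory solutions: absolute continuity on $[t_0, \infty)$ means absolute continuity on
  every compact subinterval.\<close>

definition state_solution ::
  "'a delay_system_scheme \<Rightarrow> real mat \<Rightarrow> (real \<Rightarrow> real vec) \<Rightarrow> (real \<Rightarrow> real vec) \<Rightarrow> (real \<Rightarrow> real vec) \<Rightarrow> bool" where
  "state_solution S K \<psi> w x \<longleftrightarrow>
     (\<forall>t \<ge> tinit S - del S (ndel S). x t \<in> carrier_vec (dimx S)) \<and>
     (\<forall>\<theta> \<in> hist S. x (tinit S + \<theta>) = \<psi> \<theta>) \<and>
     (\<forall>T \<ge> tinit S. \<forall>j < dimx S. abs_cont_on (tinit S) T (\<lambda>t. x t $ j)) \<and>
     (AE t in lebesgue_on {tinit S..}. \<forall>j < dimx S.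
        ((\<lambda>s. x s $ j) has_real_derivative state_rhs S K w x t $ j) (at t))"

definition output_equation ::
  "'a delay_system_scheme \<Rightarrow> real mat \<Rightarrow> (real \<Rightarrow> real vec) \<Rightarrow> (real \<Rightarrow> real vec) \<Rightarrow> (real \<Rightarrow> real vec) \<Rightarrow> bool" where
  "output_equation S K w x z \<longleftrightarrow> (AE t in lebesgue_on {tinit S..}. z t = output_rhs S K w x t)"

definition segment :: "'a delay_system_scheme \<Rightarrow> (real \<Rightarrow> real vec) \<Rightarrow> real \<Rightarrow> real \<Rightarrow> real vec" where
  "segment S x t = (\<lambda>\<theta> \<in> hist S. x (t + \<theta>))"

record supply_data =
  matJt :: "real mat"
  matJ1 :: "real mat"
  matJ2 :: "real mat"
  matJ3 :: "real mat"

definition valid_supply :: "nat \<Rightarrow> nat \<Rightarrow> supply_data \<Rightarrow> bool" where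
  "valid_supply m q J \<longleftrightarrow>
     matJt J \<in> carrier_mat m m \<and> matJ1 J \<in> sym_mats m \<and> invertible_mat (matJ1 J) \<and>
     neg_def (mat_inv (matJ1 J)) \<and> neg_semidef ((matJt J)\<^sup>T * mat_inv (matJ1 J) * matJt J) \<and>
     matJ2 J \<in> carrier_mat m q \<and> matJ3 J \<in> sym_mats q"

definition supply_rate :: "supply_data \<Rightarrow> real vec \<Rightarrow> real vec \<Rightarrow> real" where
  "supply_rate J z w = scalar_prod (z @\<^sub>v w)
     (sym_block ((matJt J)\<^sup>T * mat_inv (matJ1 J) * matJt J) (matJ2 J) (matJ3 J) *\<^sub>v (z @\<^sub>v w))"

definition dissipative :: "'a delay_system_scheme \<Rightarrow> real mat \<Rightarrow> supply_data \<Rightarrow> bool" where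
  "dissipative S K J \<longleftrightarrow> (\<exists>v. C1_functional (hist S) (dimx S) v \<and>
     (\<forall>\<psi> \<in> cspace (hist S) (dimx S). \<forall>w \<in> L2_vec {tinit S..} (dimw S). \<forall>x z.
        state_solution S K \<psi> w x \<and> output_equation S K w x z \<longrightarrow>
        (AE t in lebesgue_on {tinit S..}.
           \<exists>D. ((\<lambda>s. v (segment S x s)) has_real_derivative D) (at t) \<and>
               D - supply_rate J (z t) (w t) \<le> 0)))"

definition exponentially_stable :: "'a delay_system_scheme \<Rightarrow> real mat \<Rightarrow> bool" where
  "exponentially_stable S K \<longleftrightarrow> (\<exists>\<alpha>>0. \<exists>c>0.
     \<forall>\<psi> \<in> cspace (hist S) (dimx S). \<forall>x. state_solution S K \<psi> (\<lambda>t. 0\<^sub>v (dimw S)) x \<longrightarrow>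
       (\<forall>t \<ge> tinit S. vnorm (x t) \<le> \<alpha> * exp (- c * (t - tinit S)) * cnorm (hist S) \<psi>))"

text \<open>\<open>dimf, dimvphi, dimphi\<close> are $d_i, \delta_i, \mu_i$; \<open>fnf, fnvphi, fnphi\<close> are
  $f_i, \varphi_i, \phi_i$ (\<open>fnvphi\<close> is the varphi that enters $h_i$). \<open>cholF, cholH, cholE\<close> are
  the Cholesky factors of the Gram matrices of $f_i, h_i, \varepsilon_i$.\<close>

record decomposed_system = delay_system +
  dimf :: "nat \<Rightarrow> nat"
  dimvphi :: "nat \<Rightarrow> nat"
  dimphi :: "nat \<Rightarrow> nat"
  fnf :: "nat \<Rightarrow> real \<Rightarrow> real vec"
  fnvphi :: "nat \<Rightarrow> real \<Rightarrow> real vec"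
  fnphi :: "nat \<Rightarrow> real \<Rightarrow> real vec"
  matM :: "nat \<Rightarrow> real mat"
  hatA :: "nat \<Rightarrow> real mat"
  hatB :: "nat \<Rightarrow> real mat"
  hatC :: "nat \<Rightarrow> real mat"
  hatE :: "nat \<Rightarrow> real mat"
  cholF :: "nat \<Rightarrow> real mat"
  cholH :: "nat \<Rightarrow> real mat"
  cholE :: "nat \<Rightarrow> real mat"

definition dimh :: "decomposed_system \<Rightarrow> nat \<Rightarrow> nat" where
  "dimh S i = dimf S i + dimvphi S i"

definition dimg :: "decomposed_system \<Rightarrow> nat \<Rightarrow> nat" where
  "dimg S i = dimf S i + dimvphi S i + dimphi S i"

definition fnh :: "decomposed_system \<Rightarrow> nat \<Rightarrow> real \<Rightarrow> real vec" where
  "fnh S i \<tau> = fnvphi S i \<tau> @\<^sub>v fnf S i \<tau>"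

definition fng :: "decomposed_system \<Rightarrow> nat \<Rightarrow> real \<Rightarrow> real vec" where
  "fng S i \<tau> = fnphi S i \<tau> @\<^sub>v fnh S i \<tau>"

definition cross_gram ::
  "real set \<Rightarrow> nat \<Rightarrow> (real \<Rightarrow> real vec) \<Rightarrow> nat \<Rightarrow> (real \<Rightarrow> real vec) \<Rightarrow> real mat" where
  "cross_gram I k u l v = int_mat I k l (\<lambda>\<tau>. col_mat (u \<tau>) * (col_mat (v \<tau>))\<^sup>T)"

definition gramF :: "decomposed_system \<Rightarrow> nat \<Rightarrow> real mat" where
  "gramF S i = cross_gram (ivl S i) (dimf S i) (fnf S i) (dimf S i) (fnf S i)"

definition gramH :: "decomposed_system \<Rightarrow> nat \<Rightarrow> real mat" where
  "gramH S i = cross_gram (ivl S i) (dimh S i) (fnh S i) (dimh S i) (fnh S i)"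

definition gramG :: "decomposed_system \<Rightarrow> nat \<Rightarrow> real mat" where
  "gramG S i = cross_gram (ivl S i) (dimg S i) (fng S i) (dimg S i) (fng S i)"

definition Gam :: "decomposed_system \<Rightarrow> nat \<Rightarrow> real mat" where
  "Gam S i = cross_gram (ivl S i) (dimphi S i) (fnphi S i) (dimh S i) (fnh S i)"

definition fneps :: "decomposed_system \<Rightarrow> nat \<Rightarrow> real \<Rightarrow> real vec" where
  "fneps S i \<tau> = fnphi S i \<tau> - (Gam S i * mat_inv (gramH S i)) *\<^sub>v fnh S i \<tau>"

definition gramE :: "decomposed_system \<Rightarrow> nat \<Rightarrow> real mat" where
  "gramE S i = cross_gram (ivl S i) (dimphi S i) (fneps S i) (dimphi S i) (fneps S i)"

text \<open>The kernels are elements of $L^2$, so their factorizations are equalities almost everywhere.\<close>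

definition kernel_decomposition :: "decomposed_system \<Rightarrow> bool" where
  "kernel_decomposition S \<longleftrightarrow> (\<forall>i \<in> {1..ndel S}.
     1 \<le> dimf S i \<and>
     fnf S i \<in> W12_vec (- del S i) (- del S (i - 1)) (dimf S i) \<and>
     fnvphi S i \<in> L2_vec (ivl S i) (dimvphi S i) \<and>
     fnphi S i \<in> L2_vec (ivl S i) (dimphi S i) \<and>
     matM S i \<in> carrier_mat (dimf S i) (dimh S i) \<and>
     (\<forall>j < dimf S i. weak_deriv (- del S i) (- del S (i - 1))
        (\<lambda>\<tau>. fnf S i \<tau> $ j) (\<lambda>\<tau>. (matM S i *\<^sub>v fnh S i \<tau>) $ j)) \<and>
     pos_def (gramG S i) \<and>
     hatA S i \<in> carrier_mat (dimx S) (dimg S i * dimx S) \<and>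
     hatB S i \<in> carrier_mat (dimx S) (dimg S i * dimu S) \<and>
     hatC S i \<in> carrier_mat (dimz S) (dimg S i * dimx S) \<and>
     hatE S i \<in> carrier_mat (dimz S) (dimg S i * dimu S) \<and>
     (AE \<tau> in lebesgue_on (ivl S i).
        kerA S i \<tau> = hatA S i * (col_mat (fng S i \<tau>) \<otimes>\<^sub>K 1\<^sub>m (dimx S)) \<and>
        kerB S i \<tau> = hatB S i * (col_mat (fng S i \<tau>) \<otimes>\<^sub>K 1\<^sub>m (dimu S)) \<and>
        kerC S i \<tau> = hatC S i * (col_mat (fng S i \<tau>) \<otimes>\<^sub>K 1\<^sub>m (dimx S)) \<and>
        kerE S i \<tau> = hatE S i * (col_mat (fng S i \<tau>) \<otimes>\<^sub>K 1\<^sub>m (dimu S))))"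

definition cholesky_factors :: "decomposed_system \<Rightarrow> bool" where
  "cholesky_factors S \<longleftrightarrow> (\<forall>i \<in> {1..ndel S}.
     cholesky (gramF S i) (cholF S i) \<and> cholesky (gramH S i) (cholH S i) \<and>
     cholesky (gramE S i) (cholE S i))"

definition delay_idx :: "decomposed_system \<Rightarrow> nat list" where
  "delay_idx S = [1..<Suc (ndel S)]"

definition totf :: "decomposed_system \<Rightarrow> nat" where
  "totf S = (\<Sum>i = 1..ndel S. dimf S i)"

definition toth :: "decomposed_system \<Rightarrow> nat" where
  "toth S = (\<Sum>i = 1..ndel S. dimh S i)"

definition totphi :: "decomposed_system \<Rightarrow> nat" where
  "totphi S = (\<Sum>i = 1..ndel S. dimphi S i)"

definition totg :: "decomposed_system \<Rightarrow> nat" where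
  "totg S = (\<Sum>i = 1..ndel S. dimg S i)"

definition beta :: "decomposed_system \<Rightarrow> nat" where
  "beta S = 1 + ndel S + totg S"

definition matT :: "decomposed_system \<Rightarrow> nat \<Rightarrow> real mat" where
  "matT S i = ((Gam S i * mat_inv (gramH S i)) @\<^sub>r 1\<^sub>m (dimh S i)) * cholH S i"

definition matTt :: "decomposed_system \<Rightarrow> nat \<Rightarrow> real mat" where
  "matTt S i = (1\<^sub>m (dimphi S i) @\<^sub>r 0\<^sub>m (dimh S i) (dimphi S i)) * cholE S i"

definition boldA :: "decomposed_system \<Rightarrow> real mat" where
  "boldA S = hcat (dimx S)
     (map (matA S) [0..<Suc (ndel S)]
      @ map (\<lambda>i. hatA S i * (matT S i \<otimes>\<^sub>K 1\<^sub>m (dimx S))) (delay_idx S)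
      @ map (\<lambda>i. hatA S i * (matTt S i \<otimes>\<^sub>K 1\<^sub>m (dimx S))) (delay_idx S)
      @ [matD1 S])"

definition boldB1 :: "decomposed_system \<Rightarrow> real mat" where
  "boldB1 S = hcat (dimx S)
     (map (matB S) [0..<Suc (ndel S)]
      @ map (\<lambda>i. hatB S i * (matT S i \<otimes>\<^sub>K 1\<^sub>m (dimu S))) (delay_idx S)
      @ map (\<lambda>i. hatB S i * (matTt S i \<otimes>\<^sub>K 1\<^sub>m (dimu S))) (delay_idx S)
      @ [0\<^sub>m (dimx S) (dimw S)])"

definition boldC :: "decomposed_system \<Rightarrow> real mat" where
  "boldC S = hcat (dimz S)
     (map (matC S) [0..<Suc (ndel S)]
      @ map (\<lambda>i. hatC S i * (matT S i \<otimes>\<^sub>K 1\<^sub>m (dimx S))) (delay_idx S)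
      @ map (\<lambda>i. hatC S i * (matTt S i \<otimes>\<^sub>K 1\<^sub>m (dimx S))) (delay_idx S)
      @ [matD2 S])"

definition boldB2 :: "decomposed_system \<Rightarrow> real mat" where
  "boldB2 S = hcat (dimz S)
     (map (matE S) [0..<Suc (ndel S)]
      @ map (\<lambda>i. hatE S i * (matT S i \<otimes>\<^sub>K 1\<^sub>m (dimu S))) (delay_idx S)
      @ map (\<lambda>i. hatE S i * (matTt S i \<otimes>\<^sub>K 1\<^sub>m (dimu S))) (delay_idx S)
      @ [0\<^sub>m (dimz S) (dimw S)])"

definition Omega :: "decomposed_system \<Rightarrow> real mat \<Rightarrow> real mat" where
  "Omega S K = boldA S + boldB1 S * diag_block_mat [1\<^sub>m (beta S) \<otimes>\<^sub>K K, 0\<^sub>m (dimw S) (dimw S)]"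

definition Sigma_cl :: "decomposed_system \<Rightarrow> real mat \<Rightarrow> real mat" where
  "Sigma_cl S K = boldC S + boldB2 S * diag_block_mat [1\<^sub>m (beta S) \<otimes>\<^sub>K K, 0\<^sub>m (dimw S) (dimw S)]"

definition diagQ :: "decomposed_system \<Rightarrow> (nat \<Rightarrow> real mat) \<Rightarrow> real mat" where
  "diagQ S Q = diag_block_mat (map Q (delay_idx S))"

definition Lambda :: "decomposed_system \<Rightarrow> real mat" where
  "Lambda S = diag_block_mat (map (\<lambda>i. (del S i - del S (i - 1)) \<cdot>\<^sub>m 1\<^sub>m (dimx S)) (delay_idx S))"

definition hatI :: "decomposed_system \<Rightarrow> real mat" where
  "hatI S = diag_block_mat
     (map (\<lambda>i. mat_inv (cholF S i) * hcat (dimf S i) [0\<^sub>m (dimf S i) (dimvphi S i), 1\<^sub>m (dimf S i)]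
               * cholH S i) (delay_idx S))
     \<otimes>\<^sub>K 1\<^sub>m (dimx S)"

definition boldM :: "decomposed_system \<Rightarrow> real mat" where
  "boldM S =
     hcat (totf S)
       [diag_block_mat (map (\<lambda>i. mat_inv (cholF S i) * col_mat (fnf S i (- del S (i - 1)))) (delay_idx S)),
        0\<^sub>m (totf S) 1,
        0\<^sub>m (totf S) (toth S)]
     - hcat (totf S)
       [0\<^sub>m (totf S) 1,
        diag_block_mat (map (\<lambda>i. mat_inv (cholF S i) * col_mat (fnf S i (- del S i))) (delay_idx S)),
        diag_block_mat (map (\<lambda>i. mat_inv (cholF S i) * matM S i * cholH S i) (delay_idx S))]"

definition matS :: "decomposed_system \<Rightarrow> real mat" where
  "matS S = (let n = dimx S; q = dimw S; d = totf S in
     hcat n [1\<^sub>m n, 0\<^sub>m n (ndel S * n), 0\<^sub>m n (toth S * n), 0\<^sub>m n (totphi S * n), 0\<^sub>m n q]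
     @\<^sub>r hcat (d * n) [0\<^sub>m (d * n) n, 0\<^sub>m (d * n) (ndel S * n), hatI S, 0\<^sub>m (d * n) (totphi S * n), 0\<^sub>m (d * n) q])"

definition Xi ::
  "decomposed_system \<Rightarrow> supply_data \<Rightarrow> (nat \<Rightarrow> real mat) \<Rightarrow> (nat \<Rightarrow> real mat) \<Rightarrow> real mat" where
  "Xi S J Q R = (let n = dimx S; q = dimw S in
     diag_block_mat [diagQ S Q + diagQ S R * Lambda S, 0\<^sub>m n n, 0\<^sub>m (totg S * n) (totg S * n), 0\<^sub>m q q]
     - diag_block_mat
         [0\<^sub>m n n, diagQ S Q,
          diag_block_mat (map (\<lambda>i. 1\<^sub>m (dimh S i) \<otimes>\<^sub>K R i) (delay_idx S)),
          diag_block_mat (map (\<lambda>i. 1\<^sub>m (dimphi S i) \<otimes>\<^sub>K R i) (delay_idx S)),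
          matJ3 J])"

definition Psi ::
  "decomposed_system \<Rightarrow> supply_data \<Rightarrow> real mat \<Rightarrow> real mat \<Rightarrow> real mat \<Rightarrow> real mat \<Rightarrow>
   (nat \<Rightarrow> real mat) \<Rightarrow> (nat \<Rightarrow> real mat) \<Rightarrow> real mat" where
  "Psi S J K P1 P2 P3 Q R = (let n = dimx S; m = dimz S; q = dimw S; d = totf S in
     Sy ((matS S)\<^sup>T * sym_block P1 P2 P3
           * (Omega S K @\<^sub>r hcat (d * n) [boldM S \<otimes>\<^sub>K 1\<^sub>m n, 0\<^sub>m (d * n) (totphi S * n + q)])
         - (0\<^sub>m (beta S * n) m @\<^sub>r (matJ2 J)\<^sup>T) * Sigma_cl S K)
     + Xi S J Q R)"

definition dissipation_matrix ::
  "decomposed_system \<Rightarrow> supply_data \<Rightarrow> real mat \<Rightarrow> real mat \<Rightarrow> real mat \<Rightarrow> real mat \<Rightarrow>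
   (nat \<Rightarrow> real mat) \<Rightarrow> (nat \<Rightarrow> real mat) \<Rightarrow> real mat" where
  "dissipation_matrix S J K P1 P2 P3 Q R =
     sym_block (Psi S J K P1 P2 P3 Q R) ((Sigma_cl S K)\<^sup>T * (matJt J)\<^sup>T) (matJ1 J)"

definition boldP :: "decomposed_system \<Rightarrow> real mat \<Rightarrow> real mat \<Rightarrow> real mat" where
  "boldP S P1 P2 = (let n = dimx S in
     hcat n [P1, 0\<^sub>m n (ndel S * n), P2 * hatI S, 0\<^sub>m n (totphi S * n + dimw S + dimz S)])"

definition boldPi :: "decomposed_system \<Rightarrow> real mat \<Rightarrow> real mat" where
  "boldPi S K = hcat (dimx S) [Omega S K, 0\<^sub>m (dimx S) (dimz S)]"

definition boldPhi ::
  "decomposed_system \<Rightarrow> supply_data \<Rightarrow> real mat \<Rightarrow> real mat \<Rightarrow> real mat \<Rightarrow>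
   (nat \<Rightarrow> real mat) \<Rightarrow> (nat \<Rightarrow> real mat) \<Rightarrow> real mat" where
  "boldPhi S J K P2 P3 Q R = (let n = dimx S; m = dimz S; q = dimw S; d = totf S in
     Sy (vcat (d * n) [P2, 0\<^sub>m (ndel S * n) (d * n), (hatI S)\<^sup>T * P3, 0\<^sub>m (totphi S * n + q + m) (d * n)]
           * hcat (d * n) [boldM S \<otimes>\<^sub>K 1\<^sub>m n, 0\<^sub>m (d * n) (totphi S * n + q + m)]
         + vcat m [0\<^sub>m (beta S * n) m, - (matJ2 J)\<^sup>T, matJt J]
           * hcat m [Sigma_cl S K, 0\<^sub>m m m])
     + diag_block_mat [Xi S J Q R, matJ1 J])"

definition decision_variables ::
  "nat \<Rightarrow> nat \<Rightarrow> nat \<Rightarrow> nat \<Rightarrow> real mat \<Rightarrow> real mat \<Rightarrow> real mat \<Rightarrow> real mat \<Rightarrow>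
   (nat \<Rightarrow> real mat) \<Rightarrow> (nat \<Rightarrow> real mat) \<Rightarrow> bool" where
  "decision_variables n p nd d K P1 P2 P3 Q R \<longleftrightarrow>
     K \<in> carrier_mat p n \<and> P1 \<in> sym_mats n \<and> P2 \<in> carrier_mat n (d * n) \<and> P3 \<in> sym_mats (d * n) \<and>
     (\<forall>i \<in> {1..nd}. Q i \<in> sym_mats n \<and> R i \<in> sym_mats n)"

text \<open>The number of scalar unknowns is the dimension of the real vector space of all decision
  variables. A tuple of matrices is represented by the function that lists its entries, because
  matrices of variable size do not form a type with a vector space structure.\<close>

datatype position =
  PosK nat nat | PosP1 nat nat | PosP2 nat nat | PosP3 nat nat | PosQ nat nat nat | PosR nat nat nat

definition mat_entry :: "real mat \<Rightarrow> nat \<Rightarrow> nat \<Rightarrow> real" where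
  "mat_entry X j k = (if j < dim_row X \<and> k < dim_col X then X $$ (j, k) else 0)"

fun entries ::
  "nat \<Rightarrow> real mat \<Rightarrow> real mat \<Rightarrow> real mat \<Rightarrow> real mat \<Rightarrow> (nat \<Rightarrow> real mat) \<Rightarrow> (nat \<Rightarrow> real mat) \<Rightarrow>
   position \<Rightarrow> real" where
  "entries nd K P1 P2 P3 Q R (PosK j k) = mat_entry K j k"
| "entries nd K P1 P2 P3 Q R (PosP1 j k) = mat_entry P1 j k"
| "entries nd K P1 P2 P3 Q R (PosP2 j k) = mat_entry P2 j k"
| "entries nd K P1 P2 P3 Q R (PosP3 j k) = mat_entry P3 j k"
| "entries nd K P1 P2 P3 Q R (PosQ i j k) = (if i \<in> {1..nd} then mat_entry (Q i) j k else 0)"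
| "entries nd K P1 P2 P3 Q R (PosR i j k) = (if i \<in> {1..nd} then mat_entry (R i) j k else 0)"

definition num_unknowns :: "nat \<Rightarrow> nat \<Rightarrow> nat \<Rightarrow> nat \<Rightarrow> nat" where
  "num_unknowns n p nd d = vector_space.dim (\<lambda>(c::real) (u :: position \<Rightarrow> real) e. c * u e)
     {entries nd K P1 P2 P3 Q R | K P1 P2 P3 Q R. decision_variables n p nd d K P1 P2 P3 Q R}"

text \<open>Range of the dimensions $(n, p, \nu, d)$ for the growth bound on the number of unknowns:
  $\nu \le d$ holds because every $d_i$ is positive, and $p$ grows at most linearly in $n$,
  which covers a fixed $p$. Landau symbols over the principal filter of this set are uniform on it.\<close>

definition size_range :: "nat \<Rightarrow> (nat \<times> nat \<times> nat \<times> nat) set" where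
  "size_range c = {(n, p, nd, d). 1 \<le> n \<and> p \<le> c * n \<and> 1 \<le> nd \<and> nd \<le> d}"

end

theory Submission
  imports Defs "Jordan_Normal_Form.Determinant"
begin

text \<open>The storage function is $v = \eta^\top P \eta + \sum_i \int_{I_i} x(t+\tau)^\top (Q_i + (\tau + r_i) R_i)
  x(t+\tau) d\tau$, where $\eta$ consists of $x(t)$ and the coordinates of the history with respect to the
  orthonormal functions $L_{f_i}^{-1} f_i$. A kernel in $W^{1,2}$ can be integrated by parts against the
  merely continuous $x$, so $v$ is differentiable wherever $x$ is. Its derivative minus the supply rate is
  the quadratic form of the dissipation matrix at $(\theta, -J_1^{-1} \tilde J z)$, which is the Schur
  complement in disguise, minus the gaps in Bessel's inequality for the orthonormal functions
  $L_{h_i}^{-1} h_i$, $L_{\varepsilon_i}^{-1} \varepsilon_i$ in the metrics $R_i$. The same inequality for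
  $L_{f_i}^{-1} f_i$ in the metrics $Q_i$ bounds $v$ from below. For zero input a strict form of these bounds
  gives $v' \le - c v$ almost everywhere, and absolute continuity of $v$ yields exponential decay. Matrix
  identities are reduced to identities between bilinear forms on block vectors.\<close>

subsection \<open>Absolutely continuous functions\<close>

text \<open>Up to the largest delay after the initial time, segments still contain the initial
  function, which is merely continuous. Hence t can never be differentiated inside x: a window
  integral is first integrated by parts with an antiderivative of x, and the derivative falls on the
  kernel. For this a kernel must be an indefinite integral, whereas its derivative is given by test
  functions only; explicit smooth cutoffs bridge the gap. As the equation for x holds only almost
  everywhere, a monotonicity criterion for absolutely continuous functions is needed as well. The
  vector - J_1^{-1} J~ z is the stationary point of the dissipation form in its last block;
  inserting it turns the inverse in the supply rate into entries of the matrix. The weight \<tau> +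
  r_i has slope 1 and vanishes at the older end of its interval: it yields the boundary term (r_i -
  r_{i-1}) R_i in \<Xi> and the integral of the R_i form with a minus sign, against which the
  moments are balanced. Strictness comes from compactness of unit spheres. If E is the energy of a
  segment, v \<le> C E and E \<le> - A v' give c = 1 / (A C).\<close>

lemma abs_cont_on_dominated:
  assumes u: "abs_cont_on a b u" and v: "abs_cont_on a b v"
    and le: "\<And>s t. a \<le> s \<Longrightarrow> s \<le> t \<Longrightarrow> t \<le> b \<Longrightarrow> \<bar>w t - w s\<bar> \<le> A * \<bar>u t - u s\<bar> + B * \<bar>v t - v s\<bar>"
  shows "abs_cont_on a b w"
  unfolding abs_cont_on_def
proof (intro allI impI)
  fix \<epsilon> :: real assume e: "0 < \<epsilon>"
  \<comment> \<open>C / 2 dominates both coefficients and stays positive when both are zero, so each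
    of the two sums may use up half of \<epsilon>.\<close>
  define C where "C = 2 * (\<bar>A\<bar> + \<bar>B\<bar> + 1)"
  have C: "C > 0" "\<bar>A\<bar> \<le> C / 2" "\<bar>B\<bar> \<le> C / 2" unfolding C_def by auto
  from e C have eC: "0 < \<epsilon> / C" by simp
  obtain d1 where d1: "d1 > 0" and D1: "\<And>D :: (real \<times> real) set. finite D \<and> (\<forall>(s, t) \<in> D. a \<le> s \<and> s \<le> t \<and> t \<le> b) \<and>
     disjoint_family_on (\<lambda>(s, t). {s<..<t}) D \<and> (\<Sum>(s, t)\<in>D. t - s) < d1 \<Longrightarrow> (\<Sum>(s, t)\<in>D. \<bar>u t - u s\<bar>) < \<epsilon> / C"
    using u eC unfolding abs_cont_on_def by meson
  obtain d2 where d2: "d2 > 0" and D2: "\<And>D :: (real \<times> real) set. finite D \<and> (\<forall>(s, t) \<in> D. a \<le> s \<and> s \<le> t \<and> t \<le> b) \<and>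
     disjoint_family_on (\<lambda>(s, t). {s<..<t}) D \<and> (\<Sum>(s, t)\<in>D. t - s) < d2 \<Longrightarrow> (\<Sum>(s, t)\<in>D. \<bar>v t - v s\<bar>) < \<epsilon> / C"
    using v eC unfolding abs_cont_on_def by meson
  show "\<exists>\<delta>>0. \<forall>D :: (real \<times> real) set.
     finite D \<and> (\<forall>(s, t) \<in> D. a \<le> s \<and> s \<le> t \<and> t \<le> b) \<and>
     disjoint_family_on (\<lambda>(s, t). {s<..<t}) D \<and> (\<Sum>(s, t)\<in>D. t - s) < \<delta> \<longrightarrow>
     (\<Sum>(s, t)\<in>D. \<bar>w t - w s\<bar>) < \<epsilon>"
  proof (intro exI conjI allI impI)
    show "0 < min d1 d2" using d1 d2 by simp
    fix D :: "(real \<times> real) set"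
    assume D: "finite D \<and> (\<forall>(s, t) \<in> D. a \<le> s \<and> s \<le> t \<and> t \<le> b) \<and>
     disjoint_family_on (\<lambda>(s, t). {s<..<t}) D \<and> (\<Sum>(s, t)\<in>D. t - s) < min d1 d2"
    have "(\<Sum>(s, t)\<in>D. \<bar>w t - w s\<bar>) \<le> (\<Sum>(s, t)\<in>D. C / 2 * \<bar>u t - u s\<bar> + C / 2 * \<bar>v t - v s\<bar>)"
    proof (rule sum_mono, clarify)
      fix s t assume "(s, t) \<in> D"
      then have st: "a \<le> s" "s \<le> t" "t \<le> b" using D by auto
      have "A * \<bar>u t - u s\<bar> \<le> C / 2 * \<bar>u t - u s\<bar>" "B * \<bar>v t - v s\<bar> \<le> C / 2 * \<bar>v t - v s\<bar>"
        by (intro mult_right_mono; use C in linarith)+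
      then show "\<bar>w t - w s\<bar> \<le> C / 2 * \<bar>u t - u s\<bar> + C / 2 * \<bar>v t - v s\<bar>"
        using le[OF st] by linarith
    qed
    also have "\<dots> = C / 2 * (\<Sum>(s, t)\<in>D. \<bar>u t - u s\<bar>) + C / 2 * (\<Sum>(s, t)\<in>D. \<bar>v t - v s\<bar>)"
      by (simp add: sum.distrib sum_distrib_left case_prod_unfold)
    also have "\<dots> < C / 2 * (\<epsilon> / C) + C / 2 * (\<epsilon> / C)"
      using D1[of D] D2[of D] D C by (intro add_strict_mono mult_strict_left_mono) auto
    also have "\<dots> = \<epsilon>" using C by simp
    finally show "(\<Sum>(s, t)\<in>D. \<bar>w t - w s\<bar>) < \<epsilon>" .
  qed
qed

lemma abs_cont_on_ident: "abs_cont_on a b (\<lambda>t. t)"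
  unfolding abs_cont_on_def
proof (intro allI impI)
  fix \<epsilon> :: real assume e: "0 < \<epsilon>"
  show "\<exists>\<delta>>0. \<forall>D :: (real \<times> real) set.
     finite D \<and> (\<forall>(s, t) \<in> D. a \<le> s \<and> s \<le> t \<and> t \<le> b) \<and>
     disjoint_family_on (\<lambda>(s, t). {s<..<t}) D \<and> (\<Sum>(s, t)\<in>D. t - s) < \<delta> \<longrightarrow>
     (\<Sum>(s, t)\<in>D. \<bar>t - s\<bar>) < \<epsilon>"
  proof (intro exI[of _ \<epsilon>] conjI allI impI e)
    fix D :: "(real \<times> real) set"
    assume D: "finite D \<and> (\<forall>(s, t) \<in> D. a \<le> s \<and> s \<le> t \<and> t \<le> b) \<and>
     disjoint_family_on (\<lambda>(s, t). {s<..<t}) D \<and> (\<Sum>(s, t)\<in>D. t - s) < \<epsilon>"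
    have "(\<Sum>(s, t)\<in>D. \<bar>t - s\<bar>) = (\<Sum>(s, t)\<in>D. t - s)"
      using D by (intro sum.cong) auto
    then show "(\<Sum>(s, t)\<in>D. \<bar>t - s\<bar>) < \<epsilon>" using D by simp
  qed
qed

lemma abs_cont_on_lipschitz:
  assumes "\<And>s t. a \<le> s \<Longrightarrow> s \<le> t \<Longrightarrow> t \<le> b \<Longrightarrow> \<bar>u t - u s\<bar> \<le> L * (t - s)"
  shows "abs_cont_on a b u"
  by (rule abs_cont_on_dominated[OF abs_cont_on_ident abs_cont_on_ident, of _ _ _ L 0]) (use assms in auto)

lemma abs_cont_on_const: "abs_cont_on a b (\<lambda>t. c)"
  by (rule abs_cont_on_lipschitz[of _ _ _ 0]) auto

lemma abs_cont_on_cong: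
  assumes "abs_cont_on a b u" and "\<And>t. a \<le> t \<Longrightarrow> t \<le> b \<Longrightarrow> u t = v t"
  shows "abs_cont_on a b v"
  by (rule abs_cont_on_dominated[OF assms(1,1), of _ 1 0]) (use assms(2) in auto)

lemma abs_cont_on_add:
  assumes "abs_cont_on a b u" "abs_cont_on a b v"
  shows "abs_cont_on a b (\<lambda>t. u t + v t)"
  by (rule abs_cont_on_dominated[OF assms, of _ 1 1]) auto

lemma abs_cont_on_sum:
  assumes "\<And>i. i \<in> I \<Longrightarrow> abs_cont_on a b (u i)"
  shows "abs_cont_on a b (\<lambda>t. \<Sum>i\<in>I. u i t)"
  using assms by (induction I rule: infinite_finite_induct) (auto intro: abs_cont_on_const abs_cont_on_add)

lemma abs_cont_on_continuous:
  assumes u: "abs_cont_on a b u"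
  shows "continuous_on {a..b} u"
  unfolding continuous_on_iff
proof (intro ballI allI impI)
  fix x e :: real assume x: "x \<in> {a..b}" and e: "0 < e"
  obtain d where d: "d > 0" and D: "\<And>D :: (real \<times> real) set. finite D \<and> (\<forall>(s, t) \<in> D. a \<le> s \<and> s \<le> t \<and> t \<le> b) \<and>
     disjoint_family_on (\<lambda>(s, t). {s<..<t}) D \<and> (\<Sum>(s, t)\<in>D. t - s) < d \<Longrightarrow> (\<Sum>(s, t)\<in>D. \<bar>u t - u s\<bar>) < e"
    using u e unfolding abs_cont_on_def by meson
  have st: "\<bar>u t - u s\<bar> < e" if "a \<le> s" "s \<le> t" "t \<le> b" "t - s < d" for s t
    using D[of "{(s, t)}"] that by (auto simp: disjoint_family_on_def)
  show "\<exists>d>0. \<forall>x'\<in>{a..b}. dist x' x < d \<longrightarrow> dist (u x') (u x) < e"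
  proof (intro exI[of _ d] conjI d ballI impI)
    fix y assume y: "y \<in> {a..b}" "dist y x < d"
    show "dist (u y) (u x) < e"
    proof (cases "x \<le> y")
      case True then show ?thesis using st[of x y] x y by (auto simp: dist_real_def)
    next
      case False then show ?thesis using st[of y x] x y by (auto simp: dist_real_def)
    qed
  qed
qed

lemma continuous_on_interval_bound:
  fixes u :: "real \<Rightarrow> real"
  assumes "continuous_on {a..b} u"
  obtains B where "B \<ge> 0" "\<And>t. t \<in> {a..b} \<Longrightarrow> \<bar>u t\<bar> \<le> B"
proof -
  have "bounded (u ` {a..b})" using assms compact_continuous_image compact_imp_bounded by blast
  then obtain B where "\<And>y. y \<in> u ` {a..b} \<Longrightarrow> norm y \<le> B" unfolding bounded_iff by blast
  then show thesis using that[of "max B 0"] by fastforce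
qed

text \<open>Both factors are bounded on the compact interval, so an increment of the product is
  dominated by increments of the factors with these bounds as coefficients.\<close>

lemma abs_cont_on_mult:
  assumes u: "abs_cont_on a b u" and v: "abs_cont_on a b v"
  shows "abs_cont_on a b (\<lambda>t. u t * v t)"
proof -
  obtain U where U: "\<And>t. t \<in> {a..b} \<Longrightarrow> \<bar>u t\<bar> \<le> U"
    using continuous_on_interval_bound[OF abs_cont_on_continuous[OF u]] by metis
  obtain V where V: "\<And>t. t \<in> {a..b} \<Longrightarrow> \<bar>v t\<bar> \<le> V"
    using continuous_on_interval_bound[OF abs_cont_on_continuous[OF v]] by metis
  show ?thesis
  proof (rule abs_cont_on_dominated[OF u v, of _ V U])
    fix s t assume st: "a \<le> s" "s \<le> t" "t \<le> b"
    have "u t * v t - u s * v s = v t * (u t - u s) + u s * (v t - v s)" by (simp add: algebra_simps)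
    also have "\<bar>\<dots>\<bar> \<le> \<bar>v t\<bar> * \<bar>u t - u s\<bar> + \<bar>u s\<bar> * \<bar>v t - v s\<bar>"
      by (metis abs_mult abs_triangle_ineq)
    also have "\<dots> \<le> V * \<bar>u t - u s\<bar> + U * \<bar>v t - v s\<bar>"
      using U[of s] V[of t] st by (intro add_mono mult_right_mono) auto
    finally show "\<bar>u t * v t - u s * v s\<bar> \<le> V * \<bar>u t - u s\<bar> + U * \<bar>v t - v s\<bar>" .
  qed
qed

lemma abs_cont_on_deriv_bounded:
  assumes d: "\<And>t. (u has_real_derivative u' t) (at t)"
    and B: "\<And>t. t \<in> {a..b} \<Longrightarrow> \<bar>u' t\<bar> \<le> B"
  shows "abs_cont_on a b u"
proof (rule abs_cont_on_lipschitz[of _ _ _ B])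
  fix s t assume st: "a \<le> s" "s \<le> t" "t \<le> b"
  show "\<bar>u t - u s\<bar> \<le> B * (t - s)"
  proof (cases "s = t")
    case False
    then have "s < t" using st by simp
    from MVT2[OF this d] obtain z where z: "s < z" "z < t" "u t - u s = (t - s) * u' z" by blast
    then have "\<bar>u t - u s\<bar> = (t - s) * \<bar>u' z\<bar>" by (simp add: abs_mult)
    also have "\<dots> \<le> (t - s) * B" using B[of z] z st by (intro mult_left_mono) auto
    finally show ?thesis by (simp add: mult.commute)
  qed simp
qed

text \<open>The exceptional set is covered by an open set of small measure on which absolute continuity
  controls the increments; a tagged division fine for both alternatives exists.\<close>

lemma abs_cont_on_nonincreasing:
  assumes ab: "a \<le> b" and ac: "abs_cont_on a b u" and N: "negligible N"
    and d: "\<And>t. t \<in> {a..b} - N \<Longrightarrow> \<exists>D\<le>0. (u has_real_derivative D) (at t)"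
  shows "u b \<le> u a"
proof (rule field_le_epsilon)
  fix e0 :: real assume e0: "0 < e0"
  \<comment> \<open>The good tags will cost e (b - a), the exceptional ones e.\<close>
  define e where "e = e0 / (b - a + 1)"
  have e: "0 < e" using e0 ab by (simp add: e_def)
  obtain \<delta> where \<delta>: "\<delta> > 0" and AC: "\<And>D :: (real \<times> real) set. finite D \<and> (\<forall>(s, t) \<in> D. a \<le> s \<and> s \<le> t \<and> t \<le> b) \<and>
     disjoint_family_on (\<lambda>(s, t). {s<..<t}) D \<and> (\<Sum>(s, t)\<in>D. t - s) < \<delta> \<Longrightarrow> (\<Sum>(s, t)\<in>D. \<bar>u t - u s\<bar>) < e"
    using ac e unfolding abs_cont_on_def by meson
  have Nm: "N \<in> lmeasurable" "measure lebesgue N = 0"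
    using N by (auto simp: negligible_imp_measurable negligible_imp_measure0)
  obtain G where G0: "open G" "N \<subseteq> G" "G - N \<in> lmeasurable" "emeasure lebesgue (G - N) < ennreal \<delta>"
    by (rule sets_lebesgue_outer_open[OF fmeasurableD[OF Nm(1)] \<delta>])
  have "G = N \<union> (G - N)" using G0(2) by blast
  then have Gl: "G \<in> lmeasurable" using fmeasurable.Un[OF Nm(1) G0(3)] by simp
  have "measure lebesgue G = measure lebesgue (G - N)"
    using measure_Diff_null_set[of G lebesgue N] N Gl by (simp add: negligible_iff_null_sets fmeasurableD)
  also have "\<dots> < \<delta>" using G0(3,4) \<delta> by (simp add: emeasure_eq_measure2 ennreal_less_iff)
  finally have G: "open G" "N \<subseteq> G" "G \<in> lmeasurable" "measure lebesgue G < \<delta>"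
    using G0 Gl by auto
  \<comment> \<open>As D \<le> 0, difference quotients near t stay below e. The two sides of t are
    bounded separately because a tag splits its interval there.\<close>
  have ex: "\<exists>r>0. \<forall>s. \<bar>s - t\<bar> < r \<longrightarrow> (t \<le> s \<longrightarrow> u s - u t \<le> e * (s - t)) \<and> (s \<le> t \<longrightarrow> u t - u s \<le> e * (t - s))"
    if t: "t \<in> {a..b} - N" for t
  proof -
    obtain D where D: "D \<le> 0" "(u has_real_derivative D) (at t)" using d[OF t] by blast
    then obtain r where r: "r > 0" "\<And>s. s \<noteq> t \<Longrightarrow> \<bar>s - t\<bar> < r \<Longrightarrow> \<bar>(u s - u t) / (s - t) - D\<bar> < e"
      using e unfolding has_field_derivative_iff LIM_def by (fastforce simp: dist_real_def)
    show ?thesis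
    proof (intro exI[of _ r] conjI r allI impI)
      fix s assume s: "\<bar>s - t\<bar> < r" "t \<le> s"
      show "u s - u t \<le> e * (s - t)"
      proof (cases "s = t")
        case False
        then have "(u s - u t) / (s - t) < e" using r(2)[of s] s D by linarith
        then show ?thesis using s False by (simp add: divide_less_eq mult.commute)
      qed simp
    next
      fix s assume s: "\<bar>s - t\<bar> < r" "s \<le> t"
      show "u t - u s \<le> e * (t - s)"
      proof (cases "s = t")
        case False
        then have "(u s - u t) / (s - t) < e" using r(2)[of s] s D by linarith
        then have "(u t - u s) / (t - s) < e" by (metis minus_diff_eq minus_divide_divide)
        then show ?thesis using s False by (simp add: divide_less_eq mult.commute)
      qed simp
    qed
  qed
  then obtain r where r: "\<And>t. t \<in> {a..b} - N \<Longrightarrow> r t > 0"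
    "\<And>t s. t \<in> {a..b} - N \<Longrightarrow> \<bar>s - t\<bar> < r t \<Longrightarrow> (t \<le> s \<longrightarrow> u s - u t \<le> e * (s - t)) \<and> (s \<le> t \<longrightarrow> u t - u s \<le> e * (t - s))"
    by metis
  \<comment> \<open>An interval tagged in N lies inside G, and one tagged elsewhere lies in a ball
    where the slopes are below e; outside [a, b] any open set will do.\<close>
  define \<gamma> where "\<gamma> t = (if t \<in> N then G else if t \<in> {a..b} then ball t (r t) else UNIV)" for t
  have "gauge \<gamma>" unfolding gauge_def \<gamma>_def using G r(1) by auto
  then obtain p where p: "p tagged_division_of {a..b}" "\<gamma> fine p" by (rule fine_division_exists_real)
  note pD = tagged_division_ofD[OF p(1)]
  have pk: "\<exists>c d. K = {c..d} \<and> c \<le> x \<and> x \<le> d \<and> a \<le> c \<and> d \<le> b" if xK: "(x, K) \<in> p" for x K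
  proof -
    obtain c d where cd: "K = {c..d}" using pD(4)[OF xK] by auto
    with pD(2,3)[OF xK] show ?thesis by auto
  qed
  have fine: "K \<subseteq> \<gamma> x" if "(x, K) \<in> p" for x K using p(2) that by (auto simp: fine_def)
  \<comment> \<open>The endpoints are required to differ so that the open intervals are nonempty and
    their disjointness makes I injective. A degenerate interval has no increment and is left to the
    other sum.\<close>
  define p2 where "p2 = {z \<in> p. fst z \<in> N \<and> Inf (snd z) < Sup (snd z)}"
  define I where "I z = (Inf (snd z), Sup (snd z))" for z :: "real \<times> real set"
  define D where "D = I ` p2"
  have fin: "finite p" "finite p2" "finite D" using pD(1) by (auto simp: p2_def D_def)
  have p2: "\<exists>x c d. z = (x, {c..d}) \<and> I z = (c, d) \<and> c < d \<and> a \<le> c \<and> d \<le> b \<and> {c..d} \<subseteq> G" if "z \<in> p2" for z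
  proof -
    obtain x K where z: "z = (x, K)" by (cases z)
    with \<open>z \<in> p2\<close> have z: "z = (x, K)" "(x, K) \<in> p" "x \<in> N" "Inf K < Sup K" by (auto simp: p2_def)
    with pk[OF z(2)] obtain c d where cd: "K = {c..d}" "c \<le> x" "x \<le> d" "a \<le> c" "d \<le> b" by blast
    then have "c \<le> d" by simp
    with cd z fine[OF z(2)] show ?thesis by (auto simp: I_def \<gamma>_def)
  qed
  have disj: "{fst (I z)<..<snd (I z)} \<inter> {fst (I z')<..<snd (I z')} = {}" if zz: "z \<in> p2" "z' \<in> p2" "z \<noteq> z'" for z z'
  proof -
    obtain x c d where z: "z = (x, {c..d})" "I z = (c, d)" using p2[OF zz(1)] by blast
    obtain x' c' d' where z': "z' = (x', {c'..d'})" "I z' = (c', d')" using p2[OF zz(2)] by blast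
    show ?thesis using pD(5)[of x "{c..d}" x' "{c'..d'}"] zz z z' by (auto simp: p2_def)
  qed
  have inj: "inj_on I p2"
  proof (rule inj_onI, rule ccontr)
    fix z z' assume zz: "z \<in> p2" "z' \<in> p2" "I z = I z'" "z \<noteq> z'"
    obtain x c d where "z = (x, {c..d})" "I z = (c, d)" "c < d" using p2[OF zz(1)] by blast
    with disj[OF zz(1,2,4)] zz(3) show False by auto
  qed
  have Dst: "s < t \<and> a \<le> s \<and> t \<le> b \<and> {s<..<t} \<subseteq> G" if "(s, t) \<in> D" for s t
  proof -
    obtain z where z: "z \<in> p2" "I z = (s, t)" using \<open>(s, t) \<in> D\<close> unfolding D_def by (metis imageE)
    obtain x c d where "I z = (c, d)" "c < d" "a \<le> c" "d \<le> b" "{c..d} \<subseteq> G" using p2[OF z(1)] by blast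
    with z(2) show ?thesis by (simp add: subset_iff)
  qed
  have dD: "disjoint_family_on (\<lambda>(s, t). {s<..<t}) D"
    unfolding disjoint_family_on_def
  proof (intro ballI impI)
    fix m m' assume m: "m \<in> D" "m' \<in> D" "m \<noteq> m'"
    then obtain z z' where z: "z \<in> p2" "z' \<in> p2" "m = I z" "m' = I z'" unfolding D_def by blast
    with m(3) have "z \<noteq> z'" by blast
    with disj[OF z(1,2)] z(3,4) show "(case m of (s, t) \<Rightarrow> {s<..<t}) \<inter> (case m' of (s, t) \<Rightarrow> {s<..<t}) = {}"
      by (simp add: case_prod_unfold)
  qed
  have fe: "emeasure lborel {c<..<d} \<noteq> \<infinity>" for c d :: real by (cases "c \<le> d") auto
  have fe': "emeasure lebesgue (case z of (s, t) \<Rightarrow> {s<..<t}) \<noteq> \<infinity>" for z :: "real \<times> real"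
    using fe[of "fst z" "snd z"] by (simp add: case_prod_unfold)
  have Ds: "(case z of (s, t) \<Rightarrow> t - s) = measure lebesgue (case z of (s, t) \<Rightarrow> {s<..<t})" if "z \<in> D" for z
    using Dst[of "fst z" "snd z"] that by (cases z) simp
  \<comment> \<open>The intervals are disjoint subsets of G, so their total length is below
    \<delta>, and absolute continuity applies to them as a single family.\<close>
  have "(\<Sum>(s, t)\<in>D. t - s) = (\<Sum>z\<in>D. measure lebesgue (case z of (s, t) \<Rightarrow> {s<..<t}))"
    by (rule sum.cong[OF refl Ds])
  also have "\<dots> = measure lebesgue (\<Union>z\<in>D. case z of (s, t) \<Rightarrow> {s<..<t})"
  proof (rule measure_finite_Union[symmetric, OF fin(3) _ dD fe'])
    show "(\<lambda>(s, t). {s<..<t}) ` D \<subseteq> sets lebesgue" by (rule image_subsetI) (simp add: case_prod_unfold)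
  qed
  also have "\<dots> \<le> measure lebesgue G"
  proof (rule measure_mono_fmeasurable)
    show "(\<Union>z\<in>D. case z of (s, t) \<Rightarrow> {s<..<t}) \<subseteq> G"
      by (rule UN_least) (use Dst in \<open>simp add: case_prod_unfold\<close>)
    show "(\<Union>z\<in>D. case z of (s, t) \<Rightarrow> {s<..<t}) \<in> sets lebesgue"
      using fin(3) by (intro sets.finite_UN) (auto simp: case_prod_unfold)
  qed (fact G(3))
  finally have "(\<Sum>(s, t)\<in>D. t - s) < \<delta>" using G(4) by simp
  moreover have "\<forall>(s, t)\<in>D. a \<le> s \<and> s \<le> t \<and> t \<le> b"
  proof (rule ballI, rule case_prodI2)
    fix z s t assume "z \<in> D" "z = (s, t)"
    then show "a \<le> s \<and> s \<le> t \<and> t \<le> b" using Dst[of s t] by simp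
  qed
  ultimately have "(\<Sum>(s, t)\<in>D. \<bar>u t - u s\<bar>) < e"
    using dD fin(3) by (intro AC conjI)
  then have S2: "(\<Sum>(x, K)\<in>p2. u (Sup K) - u (Inf K)) \<le> e"
  proof -
    assume *: "(\<Sum>(s, t)\<in>D. \<bar>u t - u s\<bar>) < e"
    have "(\<Sum>(s, t)\<in>D. \<bar>u t - u s\<bar>) = (\<Sum>(x, K)\<in>p2. \<bar>u (Sup K) - u (Inf K)\<bar>)"
      unfolding D_def by (subst sum.reindex[OF inj]) (simp add: I_def case_prod_unfold)
    moreover have "(\<Sum>(x, K)\<in>p2. u (Sup K) - u (Inf K)) \<le> (\<Sum>(x, K)\<in>p2. \<bar>u (Sup K) - u (Inf K)\<bar>)"
      by (rule sum_mono) auto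
    ultimately show ?thesis using * by simp
  qed
  have S1: "(\<Sum>(x, K)\<in>p - p2. u (Sup K) - u (Inf K)) \<le> e * (b - a)"
  proof -
    have "(\<Sum>(x, K)\<in>p - p2. u (Sup K) - u (Inf K)) \<le> (\<Sum>(x, K)\<in>p - p2. e * measure lborel K)"
    proof (rule sum_mono, clarify)
      fix x K assume K: "(x, K) \<in> p" "(x, K) \<notin> p2"
      obtain c d where cd: "K = {c..d}" "c \<le> x" "x \<le> d" "a \<le> c" "d \<le> b" using pk[OF K(1)] by blast
      show "u (Sup K) - u (Inf K) \<le> e * measure lborel K"
      proof (cases "x \<in> N")
        case True
        then have "c = d" using K cd by (auto simp: p2_def)
        then show ?thesis using cd by simp
      next
        case False
        then have x: "x \<in> {a..b} - N" using cd by auto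
        have "K \<subseteq> ball x (r x)" using fine[OF K(1)] x by (auto simp: \<gamma>_def)
        moreover have "c \<in> K" "d \<in> K" using cd by auto
        ultimately have "c \<in> ball x (r x)" "d \<in> ball x (r x)" by blast+
        then have "\<bar>c - x\<bar> < r x" "\<bar>d - x\<bar> < r x" by (auto simp: dist_real_def)
        with r(2)[OF x, of c] r(2)[OF x, of d] cd have "u x - u c \<le> e * (x - c)" "u d - u x \<le> e * (d - x)" by auto
        then have "u d - u c \<le> e * (d - c)" by (simp add: algebra_simps)
        then show ?thesis using cd by simp
      qed
    qed
    also have "\<dots> \<le> (\<Sum>(x, K)\<in>p. e * measure lborel K)"
      using fin e by (intro sum_mono2) auto
    also have "\<dots> = e * (\<Sum>(x, K)\<in>p. measure lborel K)" by (simp add: sum_distrib_left case_prod_unfold)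
    also have "\<dots> = e * (b - a)"
      using additive_content_tagged_division[of p a b] p ab by simp
    finally show ?thesis .
  qed
  have "u b - u a = (\<Sum>(x, K)\<in>p. u (Sup K) - u (Inf K))"
    using additive_tagged_division_1[OF ab p(1)] by metis
  also have "\<dots> = (\<Sum>(x, K)\<in>p - p2. u (Sup K) - u (Inf K)) + (\<Sum>(x, K)\<in>p2. u (Sup K) - u (Inf K))"
    by (rule sum.subset_diff) (use fin in \<open>auto simp: p2_def\<close>)
  also have "\<dots> \<le> e * (b - a) + e" using S1 S2 by simp
  also have "\<dots> = e * (b - a + 1)" by (simp add: algebra_simps)
  also have "\<dots> = e0" using ab by (simp add: e_def)
  finally show "u b \<le> u a + e0" by simp
qed

subsection \<open>Weak derivatives\<close>

text \<open>The classical exp(-1/x), extended by zero, times a polynomial in 1/x: with the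
  polynomial factor the family is closed under differentiation.\<close>

definition flat :: "real poly \<Rightarrow> real \<Rightarrow> real" where
  "flat p x = (if 0 < x then poly p (1 / x) * exp (- 1 / x) else 0)"

lemma poly_exp_tendsto_0: "((\<lambda>y. poly p y * exp (- y)) \<longlongrightarrow> (0::real)) at_top"
proof -
  have "((\<lambda>y. \<Sum>i\<le>degree p. coeff p i * (y ^ i / exp y)) \<longlongrightarrow> (\<Sum>i\<le>degree p. coeff p i * 0)) at_top"
    by (intro tendsto_sum tendsto_mult tendsto_const tendsto_power_div_exp_0)
  then show ?thesis
    by (simp add: poly_altdef sum_distrib_right exp_minus divide_inverse mult.assoc)
qed

text \<open>Differentiating p(1/x) exp(-1/x) multiplies by 1/x^2 and replaces p by p - p', which
  amounts to the polynomial y^2 (p - p') in y = 1/x. At 0 the exponential beats every polynomial, so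
  the derivative there is 0, the value of each \<open>flat\<close> function.\<close>

lemma flat_has_derivative:
  "(flat p has_real_derivative flat ([:0, 0, 1:] * (p - pderiv p)) x) (at x)"
proof -
  consider "x < 0" | "x = 0" | "x > 0" by linarith
  then show ?thesis
  proof cases
    case 1
    have "((\<lambda>x. 0) has_real_derivative 0) (at x)" by simp
    then show ?thesis using 1
      by (subst has_field_derivative_cong_ev[where g = "\<lambda>x. 0"])
        (auto simp: flat_def eventually_nhds intro!: exI[of _ "{..<0}"])
  next
    case 3
    have "((\<lambda>x. poly p (1 / x) * exp (- 1 / x)) has_real_derivative
       (poly (pderiv p) (1 / x) * (- 1 / x^2) * exp (- 1 / x) + (exp (- 1 / x) * (1 / x^2)) * poly p (1 / x))) (at x)"
      using 3 by (auto intro!: derivative_eq_intros simp: power2_eq_square field_simps)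
    moreover have "(poly (pderiv p) (1 / x) * (- 1 / x^2) * exp (- 1 / x) + (exp (- 1 / x) * (1 / x^2)) * poly p (1 / x)) =
       flat ([:0, 0, 1:] * (p - pderiv p)) x"
      using 3 by (simp add: flat_def power2_eq_square field_simps)
    ultimately have "((\<lambda>x. poly p (1 / x) * exp (- 1 / x)) has_real_derivative flat ([:0, 0, 1:] * (p - pderiv p)) x) (at x)"
      by metis
    then show ?thesis using 3
      by (subst has_field_derivative_cong_ev[where g = "\<lambda>x. poly p (1 / x) * exp (- 1 / x)"])
        (auto simp: flat_def eventually_nhds intro!: exI[of _ "{0<..}"])
  next
    case 2
    have r: "((\<lambda>h. (flat p (0 + h) - flat p 0) / h) \<longlongrightarrow> 0) (at_right 0)"
    proof -
      \<comment> \<open>With y = 1 / h the difference quotient at 0 is y p(y) exp(-y).\<close>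
      have "((\<lambda>h. poly ([:0, 1:] * p) (inverse h) * exp (- inverse h)) \<longlongrightarrow> 0) (at_right (0::real))"
        using filterlim_compose[OF poly_exp_tendsto_0 filterlim_inverse_at_top_right] .
      then show ?thesis
        by (rule Lim_transform_eventually)
          (auto simp: flat_def eventually_at_filter field_simps)
    qed
    have l: "((\<lambda>h. (flat p (0 + h) - flat p 0) / h) \<longlongrightarrow> 0) (at_left 0)"
      by (rule Lim_transform_eventually[OF tendsto_const])
        (auto simp: flat_def eventually_at_filter)
    show ?thesis unfolding 2 DERIV_def
      using filterlim_split_at[OF l r] by (simp add: flat_def)
  qed
qed

text \<open>Closure under differentiation is what makes members infinitely differentiable.\<close>

inductive smooth_fun :: "(real \<Rightarrow> real) \<Rightarrow> bool" where
  flat: "smooth_fun (\<lambda>x. flat p (c * x + d))"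
| const: "smooth_fun (\<lambda>x. c)"
| add: "smooth_fun f \<Longrightarrow> smooth_fun g \<Longrightarrow> smooth_fun (\<lambda>x. f x + g x)"
| mult: "smooth_fun f \<Longrightarrow> smooth_fun g \<Longrightarrow> smooth_fun (\<lambda>x. f x * g x)"
| inv: "smooth_fun f \<Longrightarrow> (\<And>x. f x \<noteq> 0) \<Longrightarrow> smooth_fun (\<lambda>x. inverse (f x))"

lemma smooth_fun_derivative:
  "smooth_fun f \<Longrightarrow> \<exists>f'. smooth_fun f' \<and> (\<forall>x. (f has_real_derivative f' x) (at x))"
proof (induction rule: smooth_fun.induct)
  case (flat p c d)
  have "((\<lambda>x. flat p (c * x + d)) has_real_derivative c * flat ([:0, 0, 1:] * (p - pderiv p)) (c * x + d)) (at x)" for x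
    by (rule DERIV_cong[OF DERIV_chain2[OF flat_has_derivative]]) (auto intro!: derivative_eq_intros)
  then show ?case by (blast intro: smooth_fun.intros)
next
  case (const c)
  then show ?case by (intro exI[of _ "\<lambda>x. 0"]) (auto intro: smooth_fun.intros)
next
  case (add f g)
  then obtain f' g' where "smooth_fun f'" "smooth_fun g'" "\<And>x. (f has_real_derivative f' x) (at x)" "\<And>x. (g has_real_derivative g' x) (at x)"
    by blast
  then show ?case by (intro exI[of _ "\<lambda>x. f' x + g' x"]) (auto intro!: smooth_fun.intros derivative_intros)
next
  case (mult f g)
  then obtain f' g' where "smooth_fun f'" "smooth_fun g'" "\<And>x. (f has_real_derivative f' x) (at x)" "\<And>x. (g has_real_derivative g' x) (at x)"
    by blast
  with mult show ?case by (intro exI[of _ "\<lambda>x. f' x * g x + g' x * f x"]) (auto intro!: smooth_fun.intros derivative_eq_intros)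
next
  case (inv f)
  then obtain f' where "smooth_fun f'" "\<And>x. (f has_real_derivative f' x) (at x)"
    by blast
  moreover have "smooth_fun (\<lambda>x. (- 1) * (inverse (f x) * f' x * inverse (f x)))"
    by (intro smooth_fun.intros inv.hyps \<open>smooth_fun f'\<close>)
  ultimately show ?case using inv.hyps
    by (intro exI[of _ "\<lambda>x. (- 1) * (inverse (f x) * f' x * inverse (f x))"])
      (auto intro!: derivative_eq_intros simp: power2_eq_square field_simps)
qed

lemma smooth_fun_iterated_deriv:
  assumes "smooth_fun f"
  shows "(deriv ^^ k) f field_differentiable at x"
proof -
  have d: "smooth_fun (deriv g)" if "smooth_fun g" for g
  proof -
    obtain g' where g': "smooth_fun g'" "\<And>x. (g has_real_derivative g' x) (at x)" using smooth_fun_derivative[OF \<open>smooth_fun g\<close>] by blast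
    then have "deriv g = g'" by (auto intro: DERIV_imp_deriv)
    then show ?thesis using g' by simp
  qed
  have "smooth_fun ((deriv ^^ k) f)" by (induction k) (use assms d in auto)
  then show ?thesis using smooth_fun_derivative unfolding field_differentiable_def by blast
qed

text \<open>The smooth step from 0 to 1: the numerator vanishes for y \<le> 0, the second summand of
  the denominator for y \<ge> 1.\<close>

definition sstep :: "real \<Rightarrow> real" where
  "sstep y = flat 1 y * inverse (flat 1 y + flat 1 (1 - y))"

text \<open>The quotient rule for \<open>sstep\<close> after the products of \<open>flat 1 y\<close>
  with its own derivative have cancelled; in this form every term is visibly nonnegative.\<close>

definition sstep' :: "real \<Rightarrow> real" where
  "sstep' y = (flat [:0, 0, 1:] y * flat 1 (1 - y) + flat 1 y * flat [:0, 0, 1:] (1 - y)) / (flat 1 y + flat 1 (1 - y))^2"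

lemma flat_1_denominator: "0 < flat 1 y + flat 1 (1 - y)"
  by (cases "0 < y"; cases "y < 1") (auto simp: flat_def add_pos_pos)

lemma sstep_simps: "y \<le> 0 \<Longrightarrow> sstep y = 0" "1 \<le> y \<Longrightarrow> sstep y = 1"
  by (auto simp: sstep_def flat_def)

lemma sstep_bounds: "0 \<le> sstep y" "sstep y \<le> 1"
  using flat_1_denominator[of y] by (auto simp: sstep_def flat_def field_simps)

lemma sstep_derivative: "(sstep has_real_derivative sstep' y) (at y)"
proof -
  have p2: "[:0, 0, 1:] * (1 - pderiv 1) = ([:0, 0, 1:] :: real poly)" by simp
  note f = flat_has_derivative[of 1, unfolded p2]
  have g: "((\<lambda>y. flat 1 (1 - y)) has_real_derivative - flat [:0, 0, 1:] (1 - y)) (at y)"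
    by (rule DERIV_cong[OF DERIV_chain2[OF f]]) (auto intro!: derivative_eq_intros)
  have "flat 1 y + flat 1 (1 - y) \<noteq> 0" using flat_1_denominator[of y] by simp
  then show ?thesis unfolding sstep_def[abs_def] sstep'_def
    by (auto intro!: derivative_eq_intros f g simp: power2_eq_square field_simps)
qed

lemma sstep'_nonneg: "0 \<le> sstep' y"
  by (auto simp: sstep'_def flat_def intro!: divide_nonneg_nonneg add_nonneg_nonneg mult_nonneg_nonneg)

lemma sstep'_outside: "y \<le> 0 \<or> 1 \<le> y \<Longrightarrow> sstep' y = 0"
  by (auto simp: sstep'_def flat_def)

lemma sstep'_continuous: "continuous_on A sstep'"
proof -
  have f: "continuous_on A (flat p)" for p A
    using flat_has_derivative by (meson DERIV_isCont continuous_at_imp_continuous_on)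
  have g: "continuous_on A (\<lambda>y. flat p (1 - y))" for p A
    by (rule continuous_on_compose2[OF f[where A = UNIV]]) (auto intro!: continuous_intros)
  have "flat 1 y + flat 1 (1 - y) \<noteq> 0" for y using flat_1_denominator[of y] by simp
  then show ?thesis unfolding sstep'_def[abs_def] by (auto intro!: continuous_intros f g)
qed

lemma smooth_fun_sstep: "smooth_fun (\<lambda>x. sstep (c * x + d))"
proof -
  have "smooth_fun (\<lambda>x. flat 1 (c * x + d) * inverse (flat 1 (c * x + d) + flat 1 ((- c) * x + (1 - d))))"
  proof (intro smooth_fun.intros)
    fix x show "flat 1 (c * x + d) + flat 1 ((- c) * x + (1 - d)) \<noteq> 0"
      using flat_1_denominator[of "c * x + d"] by (simp add: algebra_simps)
  qed
  then show ?thesis by (simp add: sstep_def algebra_simps)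
qed

text \<open>The kernel is nonnegative, has integral one by the fundamental theorem, and vanishes
  outside [r, r + e]: the integral is a weighted mean of values of u to the right of r.\<close>

lemma sstep_kernel:
  assumes u: "continuous_on {a..b} u" and r: "a \<le> r" "0 < e" "r + e \<le> b"
    and c: "\<And>x. x \<in> {r..r + e} \<Longrightarrow> \<bar>u x - u r\<bar> \<le> c"
  shows "\<bar>(LINT x|lebesgue_on {a..b}. u x * (sstep' ((x - r) / e) / e)) - u r\<bar> \<le> c"
proof -
  define k where "k x = sstep' ((x - r) / e) / e" for x
  have kc: "continuous_on A k" for A
    unfolding k_def using r by (intro continuous_intros continuous_on_compose2[OF sstep'_continuous[of UNIV]]) auto
  have k0: "0 \<le> k x" for x using sstep'_nonneg r by (simp add: k_def)
  have "(k has_integral (sstep ((b - r) / e) - sstep ((a - r) / e))) {a..b}"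
  proof (rule fundamental_theorem_of_calculus)
    fix x
    have "((\<lambda>x. sstep ((x - r) / e)) has_real_derivative k x) (at x)"
      unfolding k_def using r
      by (intro DERIV_cong[OF DERIV_chain2[OF sstep_derivative, where Db = "1 / e"]]) (auto intro!: derivative_eq_intros)
    then show "((\<lambda>x. sstep ((x - r) / e)) has_vector_derivative k x) (at x within {a..b})"
      by (simp add: has_real_derivative_iff_has_vector_derivative has_vector_derivative_at_within)
  qed (use r in simp)
  moreover have "sstep ((b - r) / e) = 1" "sstep ((a - r) / e) = 0"
    using r by (auto intro!: sstep_simps simp: field_simps)
  ultimately have "integral {a..b} k = 1" by (simp add: integral_unique)
  then have k1: "integral\<^sup>L (lebesgue_on {a..b}) k = 1"
    by (simp add: lebesgue_integral_eq_integral continuous_imp_integrable_real kc)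
  have i1: "integrable (lebesgue_on {a..b}) (\<lambda>x. u x * k x)"
    by (intro continuous_imp_integrable_real continuous_intros u kc)
  have i2: "integrable (lebesgue_on {a..b}) (\<lambda>x. (u x - u r) * k x)"
    by (intro continuous_imp_integrable_real continuous_intros u kc)
  have i3: "integrable (lebesgue_on {a..b}) k"
    by (intro continuous_imp_integrable_real continuous_intros kc)
  have "(LINT x|lebesgue_on {a..b}. u x * k x) - u r = (LINT x|lebesgue_on {a..b}. u x * k x) - (LINT x|lebesgue_on {a..b}. u r * k x)"
    using k1 by simp
  also have "\<dots> = (LINT x|lebesgue_on {a..b}. (u x - u r) * k x)"
    by (subst Bochner_Integration.integral_diff[symmetric, OF i1 integrable_mult_right[OF i3]]) (simp add: left_diff_distrib)
  also have "\<bar>\<dots>\<bar> \<le> (LINT x|lebesgue_on {a..b}. \<bar>(u x - u r) * k x\<bar>)"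
    using integral_norm_bound[of "lebesgue_on {a..b}" "\<lambda>x. (u x - u r) * k x"] by simp
  also have "\<dots> \<le> (LINT x|lebesgue_on {a..b}. c * k x)"
  proof (rule integral_mono)
    show "integrable (lebesgue_on {a..b}) (\<lambda>x. \<bar>(u x - u r) * k x\<bar>)" using i2 by auto
    show "integrable (lebesgue_on {a..b}) (\<lambda>x. c * k x)" using i3 by auto
    fix x
    show "\<bar>(u x - u r) * k x\<bar> \<le> c * k x"
    proof (cases "x \<in> {r..r + e}")
      case True
      then show ?thesis using c[OF True] k0[of x] by (simp add: abs_mult mult_right_mono)
    next
      case False
      then have "(x - r) / e \<le> 0 \<or> 1 \<le> (x - r) / e" using r by (auto simp: field_simps)
      then have "k x = 0" by (auto simp: k_def sstep'_outside)
      then show ?thesis by simp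
    qed
  qed
  also have "\<dots> = c" using k1 by simp
  finally show ?thesis by (simp add: k_def)
qed

lemma sstep_kernel_tendsto:
  assumes u: "continuous_on {a..b} u" and r: "a \<le> r" "r < b"
    and e: "\<And>k. 0 < e k" "\<And>k. r + e k \<le> b" "e \<longlonglongrightarrow> (0::real)"
  shows "(\<lambda>k. LINT x|lebesgue_on {a..b}. u x * (sstep' ((x - r) / e k) / e k)) \<longlonglongrightarrow> u r"
proof (rule LIMSEQ_I)
  fix c :: real assume c: "0 < c"
  then have "0 < c / 2" by simp
  then obtain d where d: "d > 0" "\<And>x. x \<in> {a..b} \<Longrightarrow> \<bar>x - r\<bar> < d \<Longrightarrow> \<bar>u x - u r\<bar> < c / 2"
    using u r unfolding continuous_on_iff dist_real_def by (metis atLeastAtMost_iff less_imp_le)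
  obtain N where N: "\<And>k. k \<ge> N \<Longrightarrow> e k < d"
    using LIMSEQ_D[OF e(3) d(1)] by fastforce
  show "\<exists>N. \<forall>k\<ge>N. norm ((LINT x|lebesgue_on {a..b}. u x * (sstep' ((x - r) / e k) / e k)) - u r) < c"
  proof (intro exI[of _ N] allI impI)
    fix k assume k: "N \<le> k"
    have "\<bar>(LINT x|lebesgue_on {a..b}. u x * (sstep' ((x - r) / e k) / e k)) - u r\<bar> \<le> c / 2"
    proof (rule sstep_kernel[OF u r(1) e(1) e(2)])
      fix x assume x: "x \<in> {r..r + e k}"
      then have "x \<in> {a..b}" "\<bar>x - r\<bar> < d" using r e(2)[of k] N[OF k] by auto
      then show "\<bar>u x - u r\<bar> \<le> c / 2" using d(2)[of x] by simp
    qed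
    then show "norm ((LINT x|lebesgue_on {a..b}. u x * (sstep' ((x - r) / e k) / e k)) - u r) < c" using c by simp
  qed
qed

text \<open>The test function is a smoothed indicator of the interval from s to t. Its derivative is
  a difference of two averaging kernels, at s and at t, so the left side of the weak identity tends
  to u s - u t, while dominated convergence produces the integral of g on the right.\<close>

lemma weak_deriv_increment:
  assumes u: "continuous_on {a..b} u" and g: "integrable (lebesgue_on {a..b}) g" and w: "weak_deriv a b u g"
    and st: "a < s" "s < t" "t < b"
  shows "u t - u s = integral {s..t} g"
proof -
  \<comment> \<open>At most half of the distance from t to b, so that the support [s, t + e k] stays
    strictly inside the interval.\<close>
  define e where "e k = (b - t) / (2 * real (Suc k))" for k
  have e0: "0 < e k" for k using st by (simp add: e_def)
  have e1: "e k \<le> (b - t) / 2" for k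
    unfolding e_def using st by (intro divide_left_mono) auto
  have eb: "t + e k < b" for k using e1[of k] st by (simp add: field_simps)
  have "(\<lambda>k. (b - t) / 2 * inverse (real (Suc k))) \<longlonglongrightarrow> (b - t) / 2 * 0"
    by (intro tendsto_mult tendsto_const LIMSEQ_inverse_real_of_nat)
  then have e_lim: "e \<longlonglongrightarrow> 0" by (simp add: e_def[abs_def] field_simps)
  \<comment> \<open>Affine arguments and the factor - 1 match the rules that generate
    \<open>smooth_fun\<close>.\<close>
  define \<eta> where "\<eta> k x = sstep (1 / e k * x + (- s / e k)) + (- 1) * sstep (1 / e k * x + (- t / e k))" for k x
  have eta: "\<eta> k x = sstep ((x - s) / e k) - sstep ((x - t) / e k)" for k x
    by (simp add: \<eta>_def diff_divide_distrib)
  have sm: "smooth_fun (\<eta> k)" for k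
    unfolding \<eta>_def[abs_def] by (intro smooth_fun.add smooth_fun.mult smooth_fun.const smooth_fun_sstep)
  have tf: "\<eta> k \<in> test_functions a b" for k
    unfolding test_functions_def
  proof (rule CollectI, rule conjI)
    show "\<forall>j x. (deriv ^^ j) (\<eta> k) field_differentiable at x"
      using smooth_fun_iterated_deriv[OF sm] by blast
    have "\<eta> k x = 0" if "x \<notin> {s..t + e k}" for x
    proof -
    from that consider "x < s" | "x > t + e k" by force
    then show "\<eta> k x = 0"
    proof cases
      case 1
      then have "(x - s) / e k \<le> 0" "(x - t) / e k \<le> 0" using e0[of k] st by (auto simp: field_simps)
      then show ?thesis by (simp add: eta sstep_simps)
    next
      case 2
      then have "(x - s) / e k \<ge> 1" "(x - t) / e k \<ge> 1" using e0[of k] st by (auto simp: field_simps)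
      then show ?thesis by (simp add: eta sstep_simps)
    qed
    qed
    then show "\<exists>c d. a < c \<and> d < b \<and> (\<forall>x. x \<notin> {c..d} \<longrightarrow> \<eta> k x = 0)"
      using st eb[of k] by blast
  qed
  have der: "deriv (\<eta> k) x = sstep' ((x - s) / e k) / e k - sstep' ((x - t) / e k) / e k" for k x
  proof (rule DERIV_imp_deriv)
    have d: "((\<lambda>x. sstep ((x - r) / e k)) has_real_derivative sstep' ((x - r) / e k) / e k) (at x)" for r
      using e0[of k]
      by (intro DERIV_cong[OF DERIV_chain2[OF sstep_derivative, where Db = "1 / e k"]]) (auto intro!: derivative_eq_intros)
    show "(\<eta> k has_real_derivative sstep' ((x - s) / e k) / e k - sstep' ((x - t) / e k) / e k) (at x)"
      unfolding eta[abs_def] by (intro DERIV_diff d)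
  qed
  have eq: "(LINT x|lebesgue_on {a..b}. u x * deriv (\<eta> k) x) = - (LINT x|lebesgue_on {a..b}. g x * \<eta> k x)" for k
    using w tf unfolding weak_deriv_def by blast
  have kint: "integrable (lebesgue_on {a..b}) (\<lambda>x. u x * (sstep' ((x - r) / e k) / e k))" for r k
    using e0[of k] by (intro continuous_imp_integrable_real continuous_intros u continuous_on_compose2[OF sstep'_continuous[of UNIV]]) auto
  have L1: "(\<lambda>k. LINT x|lebesgue_on {a..b}. u x * deriv (\<eta> k) x) \<longlonglongrightarrow> u s - u t"
  proof -
    have eq1: "(LINT x|lebesgue_on {a..b}. u x * deriv (\<eta> k) x) =
      (LINT x|lebesgue_on {a..b}. u x * (sstep' ((x - s) / e k) / e k)) - (LINT x|lebesgue_on {a..b}. u x * (sstep' ((x - t) / e k) / e k))" for k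
      unfolding der by (subst Bochner_Integration.integral_diff[symmetric, OF kint kint]) (simp add: right_diff_distrib)
    have b: "s + e k \<le> b" "t + e k \<le> b" for k using eb[of k] st by auto
    have "a \<le> s" "s < b" "a \<le> t" using st by auto
    then show ?thesis
      unfolding eq1 by (intro tendsto_diff sstep_kernel_tendsto[OF u] e0 e_lim b st(3))
  qed
  have L2: "(\<lambda>k. LINT x|lebesgue_on {a..b}. g x * \<eta> k x) \<longlonglongrightarrow> (LINT x|lebesgue_on {a..b}. g x * indicator {s<..t} x)"
  proof (rule integral_dominated_convergence[where w = "\<lambda>x. \<bar>g x\<bar>"])
    have gm: "g \<in> borel_measurable (lebesgue_on {a..b})" using g by auto
    have sc: "continuous_on A sstep" for A
      using sstep_derivative by (meson DERIV_isCont continuous_at_imp_continuous_on)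
    have "continuous_on {a..b} (\<eta> k)" for k
      unfolding eta[abs_def] using e0[of k] by (intro continuous_intros continuous_on_compose2[OF sc[of UNIV]]) auto
    then have "\<eta> k \<in> borel_measurable (lebesgue_on {a..b})" for k
      by (rule continuous_imp_measurable_on_sets_lebesgue) simp
    then show "(\<lambda>x. g x * \<eta> k x) \<in> borel_measurable (lebesgue_on {a..b})" for k
      using gm by (intro borel_measurable_times) auto
    have "(indicator {s<..t} :: real \<Rightarrow> real) \<in> borel_measurable lebesgue" by (intro borel_measurable_indicator) simp
    then have "(indicator {s<..t} :: real \<Rightarrow> real) \<in> borel_measurable (lebesgue_on {a..b})"
      by (rule measurable_restrict_space1)
    then show "(\<lambda>x. g x * indicator {s<..t} x) \<in> borel_measurable (lebesgue_on {a..b})"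
      using gm by (intro borel_measurable_times) auto
    show "integrable (lebesgue_on {a..b}) (\<lambda>x. \<bar>g x\<bar>)" using g by auto
    show "AE x in lebesgue_on {a..b}. norm (g x * \<eta> k x) \<le> \<bar>g x\<bar>" for k
    proof (rule AE_I2)
      fix x
      have "\<bar>\<eta> k x\<bar> \<le> 1" unfolding eta
        using sstep_bounds[of "(x - s) / e k"] sstep_bounds[of "(x - t) / e k"] by linarith
      then show "norm (g x * \<eta> k x) \<le> \<bar>g x\<bar>" by (simp add: abs_mult mult_left_le)
    qed
    \<comment> \<open>At x = r the limit is 0, since \<open>sstep\<close> vanishes at 0; therefore
      \<eta> tends to the indicator of a half-open interval.\<close>
    have step: "(\<lambda>k. sstep ((x - r) / e k)) \<longlonglongrightarrow> (if r < x then 1 else 0)" for x r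
    proof (cases "r < x")
      case True
      have "eventually (\<lambda>k. e k < x - r) sequentially"
        using e_lim True by (intro order_tendstoD) auto
      then have "eventually (\<lambda>k. sstep ((x - r) / e k) = 1) sequentially"
        by eventually_elim (use e0 in \<open>auto intro!: sstep_simps simp: le_divide_eq less_imp_le\<close>)
      then show ?thesis using True by (simp add: tendsto_eventually)
    next
      case False
      then have "sstep ((x - r) / e k) = 0" for k
        using e0[of k] by (intro sstep_simps) (simp add: divide_le_0_iff)
      then show ?thesis using False by simp
    qed
    show "AE x in lebesgue_on {a..b}. (\<lambda>k. g x * \<eta> k x) \<longlonglongrightarrow> g x * indicator {s<..t} x"
    proof (rule AE_I2)
      fix x
      have "(\<lambda>k. \<eta> k x) \<longlonglongrightarrow> (if s < x then 1 else 0) - (if t < x then 1 else 0)"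
        unfolding eta by (intro tendsto_diff step)
      moreover have "(if s < x then 1 else 0) - (if t < x then 1 else 0) = (indicator {s<..t} x :: real)"
        using st by (auto simp: indicator_def)
      ultimately show "(\<lambda>k. g x * \<eta> k x) \<longlonglongrightarrow> g x * indicator {s<..t} x"
        using tendsto_mult[OF tendsto_const, of "\<lambda>k. \<eta> k x" _ sequentially "g x"] by simp
    qed
  qed
  have "u s - u t = - (LINT x|lebesgue_on {a..b}. g x * indicator {s<..t} x)"
    using LIMSEQ_unique[OF L1] tendsto_minus[OF L2] eq by simp
  moreover have "(LINT x|lebesgue_on {a..b}. g x * indicator {s<..t} x) = integral {s..t} g"
  proof -
    have "integrable (lebesgue_on {a..b}) (\<lambda>x. g x * indicator {s<..t} x)"
    proof (rule Bochner_Integration.integrable_bound[OF g])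
      have "(indicator {s<..t} :: real \<Rightarrow> real) \<in> borel_measurable lebesgue" by (intro borel_measurable_indicator) simp
      then have "(indicator {s<..t} :: real \<Rightarrow> real) \<in> borel_measurable (lebesgue_on {a..b})"
        by (rule measurable_restrict_space1)
      then show "(\<lambda>x. g x * indicator {s<..t} x) \<in> borel_measurable (lebesgue_on {a..b})"
        using g by (intro borel_measurable_times) auto
    qed (auto simp: indicator_def)
    then have "(LINT x|lebesgue_on {a..b}. g x * indicator {s<..t} x) = integral {a..b} (\<lambda>x. g x * indicator {s<..t} x)"
      by (rule lebesgue_integral_eq_integral) simp
    \<comment> \<open>The half-open and the closed interval differ by the null set {s}.\<close>
    also have "\<dots> = integral {a..b} (\<lambda>x. if x \<in> {s..t} then g x else 0)"
      by (rule integral_spike[of "{s}"]) (auto simp: indicator_def)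
    also have "\<dots> = integral {s..t} g"
      unfolding Henstock_Kurzweil_Integration.integral_restrict_Int using st by (simp add: Int_absorb2)
    finally show ?thesis .
  qed
  ultimately show ?thesis by simp
qed

text \<open>On the open interval u minus the indefinite integral of g is constant by the increment
  formula; continuity extends this to the endpoints, which no test function sees.\<close>

lemma weak_deriv_FTC:
  assumes u: "continuous_on {a..b} u" and g: "integrable (lebesgue_on {a..b}) g" and w: "weak_deriv a b u g"
    and ab: "a < b" and t: "t \<in> {a..b}"
  shows "u t = u a + integral {a..t} g"
proof -
  have gi: "g integrable_on {a..b}" using g by (simp add: integrable_on_lebesgue_on)
  define D where "D x = u x - integral {a..x} g" for x
  define m where "m = (a + b) / 2"
  have m: "a < m" "m < b" using ab by (auto simp: m_def)
  have inc: "D x = D y" if "a < x" "x < y" "y < b" for x y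
  proof -
    have "integral {a..x} g + integral {x..y} g = integral {a..y} g"
      by (rule Henstock_Kurzweil_Integration.integral_combine)
        (use that in \<open>auto intro: integrable_on_subinterval[OF gi]\<close>)
    then show ?thesis using weak_deriv_increment[OF u g w that] by (simp add: D_def)
  qed
  have "D x = D m" if x: "x \<in> {a<..<b}" for x
  proof (cases x m rule: linorder_cases)
    case less
    then show ?thesis using inc[of x m] x m by simp
  next
    case greater
    then show ?thesis using inc[of m x] x m by simp
  qed simp
  moreover have "continuous_on (closure {a<..<b}) D"
    unfolding D_def closure_greaterThanLessThan[OF ab]
    by (intro continuous_intros u indefinite_integral_continuous_1 gi)
  ultimately have "D x = D m" if "x \<in> {a..b}" for x
    using continuous_constant_on_closure[of "{a<..<b}" D "D m" x] that ab by auto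
  then have "D t = D a" using t ab by simp
  then show ?thesis by (simp add: D_def)
qed

subsection \<open>Integrals over a sliding window\<close>

text \<open>The interval is cut into pieces of length \<delta> / 2, over which \<Phi> adds up and
  the bounds telescope through m.\<close>

lemma interval_function_local_bound:
  fixes \<Phi> :: "real \<Rightarrow> real \<Rightarrow> real"
  assumes ab: "a \<le> b" and \<delta>: "0 < \<delta>"
    and add: "\<And>s t r. a \<le> s \<Longrightarrow> s \<le> t \<Longrightarrow> t \<le> r \<Longrightarrow> r \<le> b \<Longrightarrow> \<Phi> s r = \<Phi> s t + \<Phi> t r"
    and le: "\<And>s t. a \<le> s \<Longrightarrow> s \<le> t \<Longrightarrow> t \<le> b \<Longrightarrow> t - s < \<delta> \<Longrightarrow> \<bar>\<Phi> s t\<bar> \<le> m t - m s"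
  shows "\<bar>\<Phi> a b\<bar> \<le> m b - m a"
proof -
  have *: "\<bar>\<Phi> s t\<bar> \<le> m t - m s" if "a \<le> s" "s \<le> t" "t \<le> b" "t - s < real n * (\<delta> / 2)" for n s t
    using that
  proof (induction n arbitrary: s)
    case (Suc n)
    show ?case
    proof (cases "t - s < \<delta>")
      case True
      then show ?thesis using le Suc by auto
    next
      case False
      define r where "r = s + \<delta> / 2"
      have r: "s \<le> r" "r \<le> t" "a \<le> r" "r - s < \<delta>" "t - r < real n * (\<delta> / 2)"
        using False Suc.prems \<delta> by (auto simp: r_def algebra_simps)
      have "\<bar>\<Phi> r t\<bar> \<le> m t - m r" using Suc.IH[of r] r Suc.prems by auto
      moreover have "\<bar>\<Phi> s r\<bar> \<le> m r - m s" using le[of s r] r Suc.prems by auto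
      ultimately show ?thesis using add[of s r t] r Suc.prems by auto
    qed
  qed auto
  obtain n where "b - a < real n * (\<delta> / 2)" using \<delta> reals_Archimedean3[of "\<delta> / 2"] by (meson half_gt_zero)
  then show ?thesis using *[of a b n] ab by auto
qed

lemma absolutely_integrable_continuous_mult:
  fixes g X :: "real \<Rightarrow> real"
  assumes "g absolutely_integrable_on {a..b}" "continuous_on {a..b} X"
  shows "(\<lambda>\<tau>. g \<tau> * X \<tau>) absolutely_integrable_on {a..b}"
proof -
  have "(\<lambda>\<tau>. X \<tau> * g \<tau>) absolutely_integrable_on {a..b}"
    using assms by (intro absolutely_integrable_bounded_measurable_product_real continuous_imp_measurable_on_sets_lebesgue
      compact_imp_bounded compact_continuous_image) auto
  then show ?thesis by (simp add: mult.commute)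
qed

text \<open>Since f is only an indefinite integral, f X need not be differentiable at every point.
  Instead, the defect \<Phi> of the formula over an interval is additive and, by uniform continuity
  of f and X, bounded on short intervals by e times the integral of |g| + C; as e is arbitrary, it
  is zero.\<close>

lemma integral_by_parts_indefinite:
  fixes f g X x :: "real \<Rightarrow> real"
  assumes ab: "a \<le> b" and g: "g absolutely_integrable_on {a..b}"
    and f: "\<And>t. t \<in> {a..b} \<Longrightarrow> f t = f a + integral {a..t} g"
    and X: "\<And>t. (X has_real_derivative x t) (at t)" and x: "continuous_on {a..b} x"
  shows "integral {a..b} (\<lambda>\<tau>. f \<tau> * x \<tau>) = f b * X b - f a * X a - integral {a..b} (\<lambda>\<tau>. g \<tau> * X \<tau>)"
proof -
  have gi: "g integrable_on {a..b}" using g by (rule set_lebesgue_integral_eq_integral)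
  have gai: "(\<lambda>\<tau>. \<bar>g \<tau>\<bar>) integrable_on {a..b}" using g unfolding absolutely_integrable_on_def by simp
  have sub: "h integrable_on {s..t}" if "h integrable_on {a..b}" "a \<le> s" "t \<le> b" for h :: "real \<Rightarrow> real" and s t
    using that by (auto intro: integrable_on_subinterval)
  have fc: "continuous_on {a..b} f"
  proof -
    have "continuous_on {a..b} (\<lambda>t. f a + integral {a..t} g)"
      by (intro continuous_intros indefinite_integral_continuous_1 gi)
    then show ?thesis by (rule continuous_on_eq) (rule f[symmetric])
  qed
  have Xc: "continuous_on {a..b} X" using X by (meson DERIV_isCont continuous_at_imp_continuous_on)
  have int1: "(\<lambda>\<tau>. g \<tau> * h \<tau>) integrable_on {a..b}" if "continuous_on {a..b} h" for h
    using absolutely_integrable_continuous_mult[OF g that] by (rule set_lebesgue_integral_eq_integral)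
  have int2: "(\<lambda>\<tau>. h \<tau> * x \<tau>) integrable_on {a..b}" if "continuous_on {a..b} h" for h
    using that x by (intro integrable_continuous_real continuous_intros)
  define I where "I s t = integral {s..t} (\<lambda>\<tau>. g \<tau> * X \<tau> + f \<tau> * x \<tau>)" for s t
  define \<Phi> where "\<Phi> s t = f t * X t - f s * X s - I s t" for s t
  have Iint: "(\<lambda>\<tau>. g \<tau> * X \<tau> + f \<tau> * x \<tau>) integrable_on {a..b}"
    by (intro integrable_add int1 int2 Xc fc)
  obtain C where C: "C \<ge> 0" "\<And>t. t \<in> {a..b} \<Longrightarrow> \<bar>x t\<bar> \<le> C"
  proof -
    have "bounded (x ` {a..b})" using x compact_continuous_image compact_imp_bounded by blast
    then obtain B where "\<And>y. y \<in> x ` {a..b} \<Longrightarrow> norm y \<le> B" unfolding bounded_iff by blast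
    then show thesis using that[of "max B 0"] by fastforce
  qed
  have add: "\<Phi> s r = \<Phi> s t + \<Phi> t r" if "a \<le> s" "s \<le> t" "t \<le> r" "r \<le> b" for s t r
  proof -
    have "I s t + I t r = I s r" unfolding I_def
      by (rule Henstock_Kurzweil_Integration.integral_combine) (use that in \<open>auto intro!: sub Iint\<close>)
    then show ?thesis by (simp add: \<Phi>_def)
  qed
  define G where "G = integral {a..b} (\<lambda>\<tau>. \<bar>g \<tau>\<bar> + C)"
  have small: "\<bar>\<Phi> a b\<bar> \<le> e * G" if e: "0 < e" for e
  proof -
    have "uniformly_continuous_on {a..b} f" "uniformly_continuous_on {a..b} X"
      using fc Xc by (auto intro: compact_uniformly_continuous)
    then obtain d1 d2 where d: "d1 > 0" "d2 > 0"
      "\<And>s t. s \<in> {a..b} \<Longrightarrow> t \<in> {a..b} \<Longrightarrow> \<bar>t - s\<bar> < d1 \<Longrightarrow> \<bar>f t - f s\<bar> < e"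
      "\<And>s t. s \<in> {a..b} \<Longrightarrow> t \<in> {a..b} \<Longrightarrow> \<bar>t - s\<bar> < d2 \<Longrightarrow> \<bar>X t - X s\<bar> < e"
      using e unfolding uniformly_continuous_on_def dist_real_def by metis
    define m where "m t = integral {a..t} (\<lambda>\<tau>. e * (\<bar>g \<tau>\<bar> + C))" for t
    have mint: "(\<lambda>\<tau>. e * (\<bar>g \<tau>\<bar> + C)) integrable_on {a..b}"
      using gai by (intro integrable_on_mult_right integrable_add) auto
    have "\<bar>\<Phi> a b\<bar> \<le> m b - m a"
    proof (rule interval_function_local_bound[OF ab _ add, of "min d1 d2"])
      fix s t assume st: "a \<le> s" "s \<le> t" "t \<le> b" "t - s < min d1 d2"
      have i: "g integrable_on {s..t}" "x integrable_on {s..t}" "(\<lambda>\<tau>. g \<tau> * X \<tau> + f \<tau> * x \<tau>) integrable_on {s..t}"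
        using sub[OF gi st(1,3)] sub[OF integrable_continuous_real[OF x] st(1,3)] sub[OF Iint st(1,3)] by auto
      \<comment> \<open>The increment of f X is split as (f t - f s) X s + f t (X t - X s). Each
        part is an integral over [s, t], which leaves \<Phi> with a small integrand.\<close>
      have "integral {s..t} g = f t - f s"
      proof -
        have "integral {a..s} g + integral {s..t} g = integral {a..t} g"
          by (rule Henstock_Kurzweil_Integration.integral_combine) (use st in \<open>auto intro!: sub gi\<close>)
        then show ?thesis using f[of s] f[of t] st by auto
      qed
      then have hg: "((\<lambda>\<tau>. g \<tau> * X s) has_integral (f t - f s) * X s) {s..t}"
        using i(1) by (metis has_integral_mult_left integrable_integral)
      have "(x has_integral (X t - X s)) {s..t}"
        using st X by (intro fundamental_theorem_of_calculus)
          (auto simp: has_real_derivative_iff_has_vector_derivative[symmetric] intro: has_field_derivative_at_within)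
      then have hx: "((\<lambda>\<tau>. f t * x \<tau>) has_integral f t * (X t - X s)) {s..t}"
        by (rule has_integral_mult_right)
      have "((\<lambda>\<tau>. g \<tau> * X \<tau> + f \<tau> * x \<tau>) has_integral I s t) {s..t}"
        unfolding I_def using i(3) by (rule integrable_integral)
      from has_integral_diff[OF has_integral_add[OF hg hx] this]
      have h: "((\<lambda>\<tau>. g \<tau> * (X s - X \<tau>) + (f t - f \<tau>) * x \<tau>) has_integral \<Phi> s t) {s..t}"
        by (simp add: \<Phi>_def algebra_simps)
      then have "\<Phi> s t = integral {s..t} (\<lambda>\<tau>. g \<tau> * (X s - X \<tau>) + (f t - f \<tau>) * x \<tau>)"
        by (simp add: integral_unique)
      also have "norm \<dots> \<le> integral {s..t} (\<lambda>\<tau>. e * (\<bar>g \<tau>\<bar> + C))"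
      proof (rule integral_norm_bound_integral)
        show "(\<lambda>\<tau>. g \<tau> * (X s - X \<tau>) + (f t - f \<tau>) * x \<tau>) integrable_on {s..t}" using h by blast
        show "(\<lambda>\<tau>. e * (\<bar>g \<tau>\<bar> + C)) integrable_on {s..t}" using mint st sub by blast
        fix \<tau> assume \<tau>: "\<tau> \<in> {s..t}"
        have "\<bar>X s - X \<tau>\<bar> \<le> e" "\<bar>f t - f \<tau>\<bar> \<le> e"
          using d(4)[of \<tau> s] d(3)[of \<tau> t] \<tau> st by auto
        then have "\<bar>g \<tau>\<bar> * \<bar>X s - X \<tau>\<bar> \<le> \<bar>g \<tau>\<bar> * e" "\<bar>f t - f \<tau>\<bar> * \<bar>x \<tau>\<bar> \<le> e * C"
          using C(2)[of \<tau>] C(1) \<tau> st e by (auto intro!: mult_mono mult_left_mono)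
        then show "norm (g \<tau> * (X s - X \<tau>) + (f t - f \<tau>) * x \<tau>) \<le> e * (\<bar>g \<tau>\<bar> + C)"
          using abs_triangle_ineq[of "g \<tau> * (X s - X \<tau>)" "(f t - f \<tau>) * x \<tau>"]
          unfolding abs_mult real_norm_def distrib_left by (simp only: mult.commute[of e])
      qed
      also have "\<dots> = m t - m s"
      proof -
        have "m s + integral {s..t} (\<lambda>\<tau>. e * (\<bar>g \<tau>\<bar> + C)) = m t" unfolding m_def
          by (rule Henstock_Kurzweil_Integration.integral_combine) (use st in \<open>auto intro!: sub mint\<close>)
        then show ?thesis by simp
      qed
      finally show "\<bar>\<Phi> s t\<bar> \<le> m t - m s" by simp
    qed (use d in auto)
    also have "\<dots> = e * G" by (simp add: m_def G_def)
    finally show ?thesis .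
  qed
  have G0: "0 \<le> G" unfolding G_def using C by (intro Henstock_Kurzweil_Integration.integral_nonneg integrable_add gai) auto
  have "\<bar>\<Phi> a b\<bar> \<le> 0 + e" if "0 < e" for e
  proof -
    have "\<bar>\<Phi> a b\<bar> \<le> e / (G + 1) * G" using that G0 by (intro small) auto
    also have "\<dots> \<le> e" using that G0 by (simp add: field_simps)
    finally show ?thesis by simp
  qed
  then have "\<bar>\<Phi> a b\<bar> \<le> 0" by (rule field_le_epsilon)
  then have "f b * X b - f a * X a = I a b" by (simp add: \<Phi>_def)
  also have "\<dots> = integral {a..b} (\<lambda>\<tau>. g \<tau> * X \<tau>) + integral {a..b} (\<lambda>\<tau>. f \<tau> * x \<tau>)"
    unfolding I_def by (intro Henstock_Kurzweil_Integration.integral_add int1 int2 Xc fc)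
  finally show ?thesis by simp
qed

text \<open>X is continuously differentiable, so its difference quotients converge uniformly for t +
  \<tau> in a compact range; integration against |g| keeps the error small.\<close>

lemma has_derivative_integral_translate:
  fixes g X y :: "real \<Rightarrow> real"
  assumes g: "g absolutely_integrable_on {a..b}"
    and X: "\<And>t. (X has_real_derivative y t) (at t)" and y: "continuous_on UNIV y"
  shows "((\<lambda>t. integral {a..b} (\<lambda>\<tau>. g \<tau> * X (t + \<tau>))) has_real_derivative
     integral {a..b} (\<lambda>\<tau>. g \<tau> * y (t + \<tau>))) (at t)"
proof -
  have gai: "(\<lambda>\<tau>. \<bar>g \<tau>\<bar>) integrable_on {a..b}" using g unfolding absolutely_integrable_on_def by simp
  define G where "G = integral {a..b} (\<lambda>\<tau>. \<bar>g \<tau>\<bar>)"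
  have G0: "0 \<le> G" unfolding G_def by (intro Henstock_Kurzweil_Integration.integral_nonneg gai) auto
  have Xc: "continuous_on UNIV X" using X by (meson DERIV_isCont continuous_at_imp_continuous_on)
  have tr: "continuous_on {a..b} (\<lambda>\<tau>. h (s + \<tau>))" if "continuous_on UNIV h" for h :: "real \<Rightarrow> real" and s
    by (rule continuous_on_compose2[OF that]) (auto intro!: continuous_intros)
  have int1: "(\<lambda>\<tau>. g \<tau> * h \<tau>) integrable_on {a..b}" if "continuous_on {a..b} h" for h
    using absolutely_integrable_continuous_mult[OF g that] by (rule set_lebesgue_integral_eq_integral)
  show ?thesis unfolding DERIV_def
  proof (rule LIM_I)
    fix e :: real assume e: "0 < e"
    define e' where "e' = e / (G + 1)"
    have e': "0 < e'" using e G0 by (simp add: e'_def)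
    have "uniformly_continuous_on {t + a - 1..t + b + 1} y"
      using y continuous_on_subset by (intro compact_uniformly_continuous) auto
    then obtain d where d: "d > 0" "\<And>s r. s \<in> {t + a - 1..t + b + 1} \<Longrightarrow> r \<in> {t + a - 1..t + b + 1} \<Longrightarrow> \<bar>s - r\<bar> < d \<Longrightarrow> \<bar>y s - y r\<bar> < e'"
      using e' unfolding uniformly_continuous_on_def dist_real_def by metis
    show "\<exists>s>0. \<forall>h. h \<noteq> 0 \<and> norm (h - 0) < s \<longrightarrow>
      norm ((integral {a..b} (\<lambda>\<tau>. g \<tau> * X (t + h + \<tau>)) - integral {a..b} (\<lambda>\<tau>. g \<tau> * X (t + \<tau>))) / h - integral {a..b} (\<lambda>\<tau>. g \<tau> * y (t + \<tau>))) < e"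
    proof (intro exI[of _ "min d 1"] conjI allI impI)
      fix h :: real assume h: "h \<noteq> 0 \<and> norm (h - 0) < min d 1"
      have q: "\<bar>(X (t + h + \<tau>) - X (t + \<tau>)) / h - y (t + \<tau>)\<bar> \<le> e'" if \<tau>: "\<tau> \<in> {a..b}" for \<tau>
      proof -
        \<comment> \<open>The mean value inequality for the function X z - y (t + \<tau>) z of z,
          whose derivative is at most e' near t + \<tau>.\<close>
        have "norm ((X (t + h + \<tau>) - y (t + \<tau>) * (t + h + \<tau>)) - (X (t + \<tau>) - y (t + \<tau>) * (t + \<tau>))) \<le> e' * norm ((t + h + \<tau>) - (t + \<tau>))"
        proof (rule field_differentiable_bound[where S = "{t + \<tau> - \<bar>h\<bar>..t + \<tau> + \<bar>h\<bar>}" and f' = "\<lambda>z. y z - y (t + \<tau>)"])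
          fix z assume z: "z \<in> {t + \<tau> - \<bar>h\<bar>..t + \<tau> + \<bar>h\<bar>}"
          show "((\<lambda>z. X z - y (t + \<tau>) * z) has_field_derivative y z - y (t + \<tau>)) (at z within {t + \<tau> - \<bar>h\<bar>..t + \<tau> + \<bar>h\<bar>})"
            by (auto intro!: derivative_eq_intros has_field_derivative_at_within[OF X])
          show "norm (y z - y (t + \<tau>)) \<le> e'"
          proof -
            have "\<bar>z - (t + \<tau>)\<bar> \<le> \<bar>h\<bar>" "\<bar>h\<bar> < d" "\<bar>h\<bar> < 1" using z h by (auto simp: abs_le_iff)
            then show ?thesis using d(2)[of z "t + \<tau>"] z \<tau> by auto
          qed
        qed auto
        then have "\<bar>X (t + h + \<tau>) - X (t + \<tau>) - y (t + \<tau>) * h\<bar> \<le> e' * \<bar>h\<bar>" by (simp add: algebra_simps)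
        moreover have "(X (t + h + \<tau>) - X (t + \<tau>)) / h - y (t + \<tau>) = (X (t + h + \<tau>) - X (t + \<tau>) - y (t + \<tau>) * h) / h"
          using h by (simp add: field_simps)
        ultimately show ?thesis using h by (simp add: abs_divide divide_le_eq)
      qed
      have ci: "continuous_on {a..b} (\<lambda>\<tau>. (X (t + h + \<tau>) - X (t + \<tau>)) / h - y (t + \<tau>))"
        using h by (intro continuous_intros tr Xc y) auto
      have "integral {a..b} (\<lambda>\<tau>. g \<tau> * ((X (t + h + \<tau>) - X (t + \<tau>)) / h - y (t + \<tau>))) =
        integral {a..b} (\<lambda>\<tau>. ((g \<tau> * X (t + h + \<tau>)) - g \<tau> * X (t + \<tau>)) / h - g \<tau> * y (t + \<tau>))"
        by (simp add: field_simps)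
      also have "\<dots> = (integral {a..b} (\<lambda>\<tau>. g \<tau> * X (t + h + \<tau>)) - integral {a..b} (\<lambda>\<tau>. g \<tau> * X (t + \<tau>))) / h - integral {a..b} (\<lambda>\<tau>. g \<tau> * y (t + \<tau>))"
      proof -
        have i1: "(\<lambda>\<tau>. g \<tau> * X (t + h + \<tau>)) integrable_on {a..b}" "(\<lambda>\<tau>. g \<tau> * X (t + \<tau>)) integrable_on {a..b}"
          "(\<lambda>\<tau>. g \<tau> * y (t + \<tau>)) integrable_on {a..b}"
          by (intro int1 tr Xc y)+
        show ?thesis
          by (simp add: Henstock_Kurzweil_Integration.integral_diff[OF integrable_on_divide[OF integrable_diff[OF i1(1,2)]] i1(3)]
            Henstock_Kurzweil_Integration.integral_diff[OF i1(1,2)])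
      qed
      finally have eq: "(integral {a..b} (\<lambda>\<tau>. g \<tau> * X (t + h + \<tau>)) - integral {a..b} (\<lambda>\<tau>. g \<tau> * X (t + \<tau>))) / h - integral {a..b} (\<lambda>\<tau>. g \<tau> * y (t + \<tau>))
        = integral {a..b} (\<lambda>\<tau>. g \<tau> * ((X (t + h + \<tau>) - X (t + \<tau>)) / h - y (t + \<tau>)))" by simp
      have "norm (integral {a..b} (\<lambda>\<tau>. g \<tau> * ((X (t + h + \<tau>) - X (t + \<tau>)) / h - y (t + \<tau>)))) \<le> integral {a..b} (\<lambda>\<tau>. e' * \<bar>g \<tau>\<bar>)"
      proof (rule integral_norm_bound_integral)
        show "(\<lambda>\<tau>. e' * \<bar>g \<tau>\<bar>) integrable_on {a..b}" using gai by (rule integrable_on_mult_right)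
        show "norm (g \<tau> * ((X (t + h + \<tau>) - X (t + \<tau>)) / h - y (t + \<tau>))) \<le> e' * \<bar>g \<tau>\<bar>" if "\<tau> \<in> {a..b}" for \<tau>
          using mult_left_mono[OF q[OF that], of "\<bar>g \<tau>\<bar>"] by (simp add: abs_mult mult.commute)
      qed (intro int1 ci)
      also have "\<dots> = e' * G" by (simp add: G_def)
      also have "\<dots> < e" using e G0 by (simp add: e'_def field_simps)
      finally show "norm ((integral {a..b} (\<lambda>\<tau>. g \<tau> * X (t + h + \<tau>)) - integral {a..b} (\<lambda>\<tau>. g \<tau> * X (t + \<tau>))) / h - integral {a..b} (\<lambda>\<tau>. g \<tau> * y (t + \<tau>))) < e"
        unfolding eq .
    qed (use d in auto)
  qed
qed

text \<open>As y is only continuous, the shift by t is first moved into an antiderivative X of y: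
  integration by parts leaves boundary terms and an integral in which X is translated, and all of
  these can be differentiated in t.\<close>

lemma sliding_window_derivative:
  fixes f g y :: "real \<Rightarrow> real"
  assumes ab: "a \<le> b" and g: "g absolutely_integrable_on {a..b}"
    and f: "\<And>t. t \<in> {a..b} \<Longrightarrow> f t = f a + integral {a..t} g" and y: "continuous_on UNIV y"
  shows "((\<lambda>t. integral {a..b} (\<lambda>\<tau>. f \<tau> * y (t + \<tau>))) has_real_derivative
     f b * y (t + b) - f a * y (t + a) - integral {a..b} (\<lambda>\<tau>. g \<tau> * y (t + \<tau>))) (at t)"
proof -
  have "\<exists>F. \<forall>x. -\<infinity> < ereal x \<longrightarrow> ereal x < \<infinity> \<longrightarrow> (F has_vector_derivative y x) (at x)"
    using y by (intro einterval_antiderivative) (auto simp: continuous_on_eq_continuous_at)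
  then obtain X where X: "\<And>t. (X has_real_derivative y t) (at t)"
    by (auto simp: has_real_derivative_iff_has_vector_derivative)
  have eq: "integral {a..b} (\<lambda>\<tau>. f \<tau> * y (t + \<tau>)) = f b * X (t + b) - f a * X (t + a) - integral {a..b} (\<lambda>\<tau>. g \<tau> * X (t + \<tau>))" for t
  proof (rule integral_by_parts_indefinite[OF ab g f])
    show "((\<lambda>\<tau>. X (t + \<tau>)) has_real_derivative y (t + \<tau>)) (at \<tau>)" for \<tau>
      by (rule DERIV_cong[OF DERIV_chain2[OF X, where Db = 1]]) (auto intro!: derivative_eq_intros)
  qed (auto intro!: continuous_on_compose2[OF y] continuous_intros)
  have X': "((\<lambda>t. c * X (t + \<tau>)) has_real_derivative c * y (t + \<tau>)) (at t)" for c \<tau>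
    by (rule DERIV_cong[OF DERIV_cmult[OF DERIV_chain2[OF X, where Db = 1]]]) (auto intro!: derivative_eq_intros)
  show ?thesis unfolding eq
    by (intro DERIV_diff has_derivative_integral_translate g X X' y)
qed

subsection \<open>The number of unknowns\<close>

interpretation fun_space: vector_space "\<lambda>(c::real) (u :: 'p \<Rightarrow> real) e. c * u e"
  by unfold_locales (simp_all add: fun_eq_iff distrib_left distrib_right mult.assoc)

text \<open>The indicator functions of the classes {p \<in> D. rep p = a}, for a \<in> A, form a
  basis; the coordinate of u at a is the value u a.\<close>

lemma dim_functions_constant_on_classes:
  fixes D A :: "'p set" and rep :: "'p \<Rightarrow> 'p"
  assumes fin: "finite A" and A: "A \<subseteq> D" "\<And>p. p \<in> D \<Longrightarrow> rep p \<in> A" "\<And>a. a \<in> A \<Longrightarrow> rep a = a"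
  shows "vector_space.dim (\<lambda>(c::real) (u :: 'p \<Rightarrow> real) e. c * u e)
    {u. (\<forall>p. p \<notin> D \<longrightarrow> u p = 0) \<and> (\<forall>p\<in>D. u p = u (rep p))} = card A" (is "fun_space.dim ?V = _")
proof -
  define b where "b a p = (if p \<in> D \<and> rep p = a then 1 else 0 :: real)" for a p
  have ba: "b a' a = (if a = a' then 1 else 0)" if "a \<in> A" for a a' using A that by (auto simp: b_def)
  have inj: "inj_on b A"
  proof (rule inj_onI)
    fix a a' assume "a \<in> A" "a' \<in> A" "b a = b a'"
    then show "a = a'" using ba[of a a] ba[of a a'] by (metis zero_neq_one)
  qed
  have sumb: "(\<Sum>a\<in>A. (\<lambda>e. c a * b a e)) p = (if p \<in> D then c (rep p) else 0)" for c p
  proof -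
    have "(\<Sum>a\<in>A. (\<lambda>e. c a * b a e)) p = (\<Sum>a\<in>A. c a * b a p)"
      using fin by (induction A rule: finite_induct) auto
    also have "\<dots> = (\<Sum>a\<in>A. if a = rep p \<and> p \<in> D then c a else 0)"
      by (intro sum.cong) (auto simp: b_def)
    also have "\<dots> = (if p \<in> D then c (rep p) else 0)"
      using fin A(2) by (auto simp: sum.delta)
    finally show ?thesis .
  qed
  show ?thesis
  proof (rule fun_space.dim_unique)
    show "b ` A \<subseteq> ?V" using A by (auto simp: b_def)
    show "?V \<subseteq> fun_space.span (b ` A)"
    proof
      fix u assume u: "u \<in> ?V"
      have "u = (\<Sum>a\<in>A. (\<lambda>e. u a * b a e))"
        by (rule ext) (use u sumb in auto)
      also have "\<dots> \<in> fun_space.span (b ` A)"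
        by (intro fun_space.span_sum fun_space.span_scale fun_space.span_base) auto
      finally show "u \<in> fun_space.span (b ` A)" .
    qed
    show "fun_space.independent (b ` A)"
    proof (rule fun_space.independent_if_scalars_zero)
      show "finite (b ` A)" using fin by simp
      fix c x assume 0: "(\<Sum>x\<in>b ` A. (\<lambda>e. c x * x e)) = 0" and x: "x \<in> b ` A"
      obtain a where a: "a \<in> A" "x = b a" using x by blast
      have "(\<Sum>a\<in>A. (\<lambda>e. c (b a) * b a e)) = 0" using 0 by (simp add: sum.reindex[OF inj])
      then have "(\<Sum>a\<in>A. (\<lambda>e. c (b a) * b a e)) a = 0" by simp
      then show "c x = 0" using sumb[of "\<lambda>a. c (b a)" a] a A by auto
    qed
    show "card (b ` A) = card A" using inj by (rule card_image)
  qed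
qed

text \<open>Sends an entry of a symmetric block to its copy on or above the diagonal; the fixed
  points among the valid positions are the free scalars.\<close>

fun mirror_position :: "position \<Rightarrow> position" where
  "mirror_position (PosP1 j k) = PosP1 (min j k) (max j k)"
| "mirror_position (PosP3 j k) = PosP3 (min j k) (max j k)"
| "mirror_position (PosQ i j k) = PosQ i (min j k) (max j k)"
| "mirror_position (PosR i j k) = PosR i (min j k) (max j k)"
| "mirror_position p = p"

fun valid_position :: "nat \<Rightarrow> nat \<Rightarrow> nat \<Rightarrow> nat \<Rightarrow> position \<Rightarrow> bool" where
  "valid_position n p nd d (PosK j k) = (j < p \<and> k < n)"
| "valid_position n p nd d (PosP1 j k) = (j < n \<and> k < n)"
| "valid_position n p nd d (PosP2 j k) = (j < n \<and> k < d * n)"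
| "valid_position n p nd d (PosP3 j k) = (j < d * n \<and> k < d * n)"
| "valid_position n p nd d (PosQ i j k) = (i \<in> {1..nd} \<and> j < n \<and> k < n)"
| "valid_position n p nd d (PosR i j k) = (i \<in> {1..nd} \<and> j < n \<and> k < n)"

lemma sym_mats_entry: "X \<in> sym_mats n \<Longrightarrow> j < n \<Longrightarrow> k < n \<Longrightarrow> X $$ (j, k) = X $$ (k, j)"
  unfolding sym_mats_def by (metis (mono_tags, lifting) carrier_matD index_transpose_mat(1) mem_Collect_eq)

lemma mat_entry_min_max:
  assumes X: "X \<in> sym_mats n" "j < n" "k < n"
  shows "mat_entry X j k = mat_entry X (min j k) (max j k)"
proof (cases "j \<le> k")
  case False
  then have "min j k = k" "max j k = j" by auto
  moreover have "X \<in> carrier_mat n n" using X by (simp add: sym_mats_def)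
  ultimately show ?thesis using X by (simp add: mat_entry_def sym_mats_entry[OF X])
qed (simp add: min_absorb1 max_absorb2)

text \<open>The tuples of matrices become a space of functions cut out by conditions on support and
  symmetry, so that its dimension is the number of symmetry classes of positions. Conversely, a
  function with these properties is read back into matrices.\<close>

lemma entries_range:
  "{entries nd K P1 P2 P3 Q R | K P1 P2 P3 Q R. decision_variables n p nd d K P1 P2 P3 Q R} =
   {u. (\<forall>e. e \<notin> Collect (valid_position n p nd d) \<longrightarrow> u e = 0) \<and> (\<forall>e \<in> Collect (valid_position n p nd d). u e = u (mirror_position e))}"
  (is "?L = ?R")
proof (intro equalityI subsetI)
  fix u assume "u \<in> ?L"
  then obtain K P1 P2 P3 Q R where u: "u = entries nd K P1 P2 P3 Q R" and dv: "decision_variables n p nd d K P1 P2 P3 Q R"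
    by blast
  have c: "K \<in> carrier_mat p n" "P1 \<in> sym_mats n" "P1 \<in> carrier_mat n n" "P2 \<in> carrier_mat n (d * n)" "P3 \<in> sym_mats (d * n)" "P3 \<in> carrier_mat (d * n) (d * n)"
    "\<And>i. i \<in> {1..nd} \<Longrightarrow> Q i \<in> sym_mats n" "\<And>i. i \<in> {1..nd} \<Longrightarrow> Q i \<in> carrier_mat n n"
    "\<And>i. i \<in> {1..nd} \<Longrightarrow> R i \<in> sym_mats n" "\<And>i. i \<in> {1..nd} \<Longrightarrow> R i \<in> carrier_mat n n"
    using dv by (auto simp: decision_variables_def sym_mats_def)
  have "u e = 0" if "\<not> valid_position n p nd d e" for e
    using that c(1,3,4,6) c(8,10)[THEN carrier_matD(1)] c(8,10)[THEN carrier_matD(2)]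
    by (cases e) (auto simp: u mat_entry_def)
  moreover have "u e = u (mirror_position e)" if e: "valid_position n p nd d e" for e
  proof (cases e)
    case (PosP1 j k)
    with e have "j < n" "k < n" by auto
    from mat_entry_min_max[OF c(2) this] show ?thesis by (simp add: u PosP1)
  next
    case (PosP3 j k)
    with e have "j < d * n" "k < d * n" by auto
    from mat_entry_min_max[OF c(5) this] show ?thesis by (simp add: u PosP3)
  next
    case (PosQ i j k)
    with e have i: "i \<in> {1..nd}" and "j < n" "k < n" by auto
    from mat_entry_min_max[OF c(7)[OF i] this(2,3)] i show ?thesis by (simp add: u PosQ)
  next
    case (PosR i j k)
    with e have i: "i \<in> {1..nd}" and "j < n" "k < n" by auto
    from mat_entry_min_max[OF c(9)[OF i] this(2,3)] i show ?thesis by (simp add: u PosR)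
  qed simp_all
  ultimately show "u \<in> ?R" by simp
next
  fix u assume u: "u \<in> ?R"
  have m: "u e = u e'" if "valid_position n p nd d e" "valid_position n p nd d e'" "mirror_position e = mirror_position e'" for e e'
    using u that by (metis (mono_tags, lifting) mem_Collect_eq)
  define K where "K = mat p n (\<lambda>(j, k). u (PosK j k))"
  define P1 where "P1 = mat n n (\<lambda>(j, k). u (PosP1 j k))"
  define P2 where "P2 = mat n (d * n) (\<lambda>(j, k). u (PosP2 j k))"
  define P3 where "P3 = mat (d * n) (d * n) (\<lambda>(j, k). u (PosP3 j k))"
  define Q where "Q i = mat n n (\<lambda>(j, k). u (PosQ i j k))" for i
  define R where "R i = mat n n (\<lambda>(j, k). u (PosR i j k))" for i
  note defs = K_def P1_def P2_def P3_def Q_def R_def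
  have "decision_variables n p nd d K P1 P2 P3 Q R"
    unfolding decision_variables_def sym_mats_def defs
    by (auto intro!: eq_matI m simp: min.commute max.commute)
  moreover have "entries nd K P1 P2 P3 Q R = u"
  proof
    fix e
    show "entries nd K P1 P2 P3 Q R e = u e"
    proof (cases "valid_position n p nd d e")
      case True
      then show ?thesis by (cases e) (auto simp: defs mat_entry_def)
    next
      case False
      then have "u e = 0" using u by auto
      then show ?thesis using False by (cases e) (auto simp: defs mat_entry_def)
    qed
  qed
  ultimately show "u \<in> ?L" by blast
qed

lemma card_triangle: "2 * card (SIGMA k:{..<n}. {..k}) = n * (n + 1)"
  by (induction n) (simp_all add: card_SigmaI algebra_simps)

text \<open>In the symmetric blocks the column k is listed first, so that the row j runs over {..k}.
  Each part is then an injective image of a set with known cardinality.\<close>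

lemma canonical_positions:
  "{e. valid_position n p nd d e \<and> mirror_position e = e} =
     (\<lambda>(j, k). PosK j k) ` ({..<p} \<times> {..<n})
   \<union> ((\<lambda>(k, j). PosP1 j k) ` (SIGMA k:{..<n}. {..k})
   \<union> ((\<lambda>(j, k). PosP2 j k) ` ({..<n} \<times> {..<d * n})
   \<union> ((\<lambda>(k, j). PosP3 j k) ` (SIGMA k:{..<d * n}. {..k})
   \<union> ((\<lambda>(i, k, j). PosQ i j k) ` ({1..nd} \<times> (SIGMA k:{..<n}. {..k}))
   \<union> (\<lambda>(i, k, j). PosR i j k) ` ({1..nd} \<times> (SIGMA k:{..<n}. {..k}))))))"
  (is "?L = ?R")
proof (rule Set.set_eqI)
  fix e
  have mm: "min j k = j \<and> max j k = k \<longleftrightarrow> j \<le> k" for j k :: nat by linarith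
  have ex: "(\<exists>x\<in>A. j = fst x \<and> k = snd x) \<longleftrightarrow> (j, k) \<in> A" "(\<exists>x\<in>A. j = snd x \<and> k = fst x) \<longleftrightarrow> (k, j) \<in> A"
    for A :: "(nat \<times> nat) set" and j k by force+
  have ex3: "(\<exists>x\<in>A. i = fst x \<and> j = snd (snd x) \<and> k = fst (snd x)) \<longleftrightarrow> (i, k, j) \<in> A"
    for A :: "(nat \<times> nat \<times> nat) set" and i j k by force
  show "e \<in> ?L \<longleftrightarrow> e \<in> ?R"
  proof (cases e)
    case (PosK j k)
    then show ?thesis by (simp add: image_iff case_prod_unfold ex)
  next
    case (PosP1 j k)
    then show ?thesis by (simp add: image_iff case_prod_unfold ex mm) linarith
  next
    case (PosP2 j k)
    then show ?thesis by (simp add: image_iff case_prod_unfold ex)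
  next
    case (PosP3 j k)
    then show ?thesis by (simp add: image_iff case_prod_unfold ex mm) linarith
  next
    case (PosQ i j k)
    then show ?thesis by (simp add: image_iff case_prod_unfold ex3 mm) linarith
  next
    case (PosR i j k)
    then show ?thesis by (simp add: image_iff case_prod_unfold ex3 mm) linarith
  qed
qed

lemma card_canonical_positions:
  "finite {e. valid_position n p nd d e \<and> mirror_position e = e} \<and>
   card {e. valid_position n p nd d e \<and> mirror_position e = e} =
    p * n + (card (SIGMA k:{..<n}. {..k}) + (n * (d * n) + (card (SIGMA k:{..<d * n}. {..k})
     + (nd * card (SIGMA k:{..<n}. {..k}) + nd * card (SIGMA k:{..<n}. {..k})))))"
proof -
  define T where "T n = (SIGMA k:{..<n}. {..k})" for n :: nat
  define SK where "SK = (\<lambda>(j, k). PosK j k) ` ({..<p} \<times> {..<n})"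
  define S1 where "S1 = (\<lambda>(k, j). PosP1 j k) ` T n"
  define S2 where "S2 = (\<lambda>(j, k). PosP2 j k) ` ({..<n} \<times> {..<d * n})"
  define S3 where "S3 = (\<lambda>(k, j). PosP3 j k) ` T (d * n)"
  define SQ where "SQ = (\<lambda>(i, k, j). PosQ i j k) ` ({1..nd} \<times> T n)"
  define SR where "SR = (\<lambda>(i, k, j). PosR i j k) ` ({1..nd} \<times> T n)"
  have eq: "{e. valid_position n p nd d e \<and> mirror_position e = e} = SK \<union> (S1 \<union> (S2 \<union> (S3 \<union> (SQ \<union> SR))))"
    unfolding canonical_positions SK_def S1_def S2_def S3_def SQ_def SR_def T_def ..
  have fT: "finite (T n)" for n by (simp add: T_def)
  have fin: "finite SK" "finite S1" "finite S2" "finite S3" "finite SQ" "finite SR"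
    by (simp_all add: SK_def S1_def S2_def S3_def SQ_def SR_def fT)
  have disj: "SQ \<inter> SR = {}" "S3 \<inter> (SQ \<union> SR) = {}" "S2 \<inter> (S3 \<union> (SQ \<union> SR)) = {}"
    "S1 \<inter> (S2 \<union> (S3 \<union> (SQ \<union> SR))) = {}" "SK \<inter> (S1 \<union> (S2 \<union> (S3 \<union> (SQ \<union> SR)))) = {}"
    by (auto simp: SK_def S1_def S2_def S3_def SQ_def SR_def)
  have card: "card SK = p * n" "card S1 = card (T n)" "card S2 = n * (d * n)" "card S3 = card (T (d * n))"
    "card SQ = nd * card (T n)" "card SR = nd * card (T n)"
    unfolding SK_def S1_def S2_def S3_def SQ_def SR_def
    by (simp_all add: card_image inj_on_def card_cartesian_product case_prod_unfold prod_eq_iff)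
  show ?thesis unfolding eq T_def[symmetric] using fin disj by (simp add: card_Un_disjoint card)
qed

lemma mirror_position_idem: "mirror_position (mirror_position e) = mirror_position e"
  by (cases e) (auto simp: min_def max_def)

lemma valid_mirror_position: "valid_position n p nd d e \<Longrightarrow> valid_position n p nd d (mirror_position e)"
  by (cases e) (auto simp: min_def max_def)

text \<open>The count is p n for K, n (n + 1) / 2 for P1, d n^2 for P2, d n (d n + 1) / 2 for P3 and
  \<nu> n (n + 1) / 2 for each of the families Q and R.\<close>

lemma num_unknowns_eq:
  "real (num_unknowns n p nd d) =
     (0.5 * (real d)\<^sup>2 + real d + real nd + 0.5) * (real n)\<^sup>2 + (0.5 * real d + 0.5 + real nd + real p) * real n"
proof -
  have N: "num_unknowns n p nd d = card {e. valid_position n p nd d e \<and> mirror_position e = e}"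
    unfolding num_unknowns_def entries_range
    by (rule dim_functions_constant_on_classes)
      (auto simp: card_canonical_positions mirror_position_idem valid_mirror_position)
  have tri: "real (card (SIGMA k:{..<n}. {..k})) = real n * (real n + 1) / 2" for n
  proof -
    define c where "c = card (SIGMA k:{..<n}. {..k})"
    have "real (2 * c) = real (n * (n + 1))" unfolding c_def card_triangle ..
    then show ?thesis unfolding c_def[symmetric] by (simp add: field_simps)
  qed
  show ?thesis
    unfolding N card_canonical_positions[THEN conjunct2] of_nat_add of_nat_mult tri
    by (simp add: power2_eq_square field_simps)
qed

lemma num_unknowns_bigo:
  "(\<lambda>(n, p, nd, d). real (num_unknowns n p nd d)) \<in> O[principal (size_range c)](\<lambda>(n, p, nd, d). (real d)\<^sup>2 * (real n)\<^sup>2)"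
\<comment> \<open>Relative to d^2, the coefficient of n^2 is at most 3 and the coefficient of n
  without p at most 2; the rest comes from p \<le> c n.\<close>
proof (rule bigoI[where c = "5 + real c"], unfold eventually_principal, rule ballI)
  fix q :: "nat \<times> nat \<times> nat \<times> nat" assume q: "q \<in> size_range c"
  obtain n p nd d where q_eq: "q = (n, p, nd, d)" by (cases q)
  from q have h: "1 \<le> n" "p \<le> c * n" "1 \<le> nd" "nd \<le> d" by (auto simp: size_range_def q_eq)
  define x y where "x = real n" and "y = real d"
  have x: "1 \<le> x" "1 \<le> y" "real nd \<le> y" using h by (auto simp: x_def y_def)
  have px: "real p \<le> real c * x" using h(2) unfolding x_def of_nat_mult[symmetric] of_nat_le_iff .
  have y2: "y \<le> y\<^sup>2" using mult_left_mono[of 1 y y] x by (simp add: power2_eq_square)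
  with x have y2: "y \<le> y\<^sup>2" "1 \<le> y\<^sup>2" by linarith+
  have x2: "x \<le> x\<^sup>2" using mult_left_mono[of 1 x x] x by (simp add: power2_eq_square)
  have "real c * (1 * x\<^sup>2) \<le> real c * (y\<^sup>2 * x\<^sup>2)"
    using y2 by (intro mult_left_mono mult_right_mono) auto
  then have cx: "real c * x * x \<le> real c * (y\<^sup>2 * x\<^sup>2)" by (simp add: power2_eq_square mult.assoc)
  have "(0.5 * y\<^sup>2 + y + real nd + 0.5) * x\<^sup>2 \<le> (3 * y\<^sup>2) * x\<^sup>2"
    using y2 x by (intro mult_right_mono) auto
  moreover have "(0.5 * y + 0.5 + real nd) * x \<le> (2 * y\<^sup>2) * x\<^sup>2"
    using y2 x x2 by (intro mult_mono) auto
  moreover have "real p * x \<le> real c * x * x" using px x by (intro mult_right_mono) auto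
  moreover note cx
  ultimately have "(0.5 * y\<^sup>2 + y + real nd + 0.5) * x\<^sup>2 + (0.5 * y + 0.5 + real nd + real p) * x \<le> (5 + real c) * (y\<^sup>2 * x\<^sup>2)"
    by (simp add: algebra_simps)
  then show "norm (case q of (n, p, nd, d) \<Rightarrow> real (num_unknowns n p nd d)) \<le> (5 + real c) * norm (case q of (n, p, nd, d) \<Rightarrow> (real d)\<^sup>2 * (real n)\<^sup>2)"
    unfolding q_eq prod.case num_unknowns_eq x_def y_def by simp
qed

subsection \<open>Block matrices\<close>

lemma sp_add_right: "dim_vec v = dim_vec w \<Longrightarrow> u \<bullet> (v + w) = u \<bullet> v + u \<bullet> (w :: real vec)"
  by (simp add: scalar_prod_def sum.distrib distrib_left)

lemma sp_minus_right: "dim_vec v = dim_vec w \<Longrightarrow> u \<bullet> (v - w) = u \<bullet> v - u \<bullet> (w :: real vec)"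
  by (simp add: scalar_prod_def sum_subtractf right_diff_distrib)

lemma sp_uminus_right: "u \<bullet> (- v) = - (u \<bullet> (v :: real vec))"
  by (simp add: scalar_prod_def sum_negf)

lemma sp_zero_right: "u \<bullet> 0\<^sub>v k = (0 :: real)"
  by (simp add: scalar_prod_def)

lemma sp_zero_left: "dim_vec v = k \<Longrightarrow> 0\<^sub>v k \<bullet> v = (0 :: real)"
  by (simp add: scalar_prod_def)

lemma sp_add_left: "dim_vec v = dim_vec u \<Longrightarrow> dim_vec w = dim_vec u \<Longrightarrow> (v + w) \<bullet> u = v \<bullet> u + w \<bullet> (u :: real vec)"
  by (simp add: scalar_prod_def sum.distrib distrib_right)

lemma sp_comm: "dim_vec u = dim_vec v \<Longrightarrow> u \<bullet> v = v \<bullet> (u :: real vec)"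
  by (simp add: scalar_prod_def mult.commute)

lemma sp_append: "dim_vec u = dim_vec u' \<Longrightarrow> dim_vec v = dim_vec v' \<Longrightarrow>
  (u @\<^sub>v v) \<bullet> (u' @\<^sub>v v') = u \<bullet> u' + v \<bullet> (v' :: real vec)"
  by (rule scalar_prod_append) (auto intro: carrier_vecI)

lemma sp_transpose: "dim_vec u = dim_row A \<Longrightarrow> dim_vec v = dim_col A \<Longrightarrow> v \<bullet> (A\<^sup>T *\<^sub>v u) = u \<bullet> (A *\<^sub>v (v :: real vec))"
  by (metis carrier_matI carrier_vec_dim_vec comm_scalar_prod dim_mult_mat_vec index_transpose_mat(2) transpose_vec_mult_scalar carrier_vecI)

lemma sp_nonneg: "0 \<le> v \<bullet> (v :: real vec)"
  by (simp add: scalar_prod_def sum_nonneg)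

lemma mmv_add: "dim_row A = dim_row B \<Longrightarrow> dim_col A = dim_col B \<Longrightarrow> dim_vec v = dim_col A \<Longrightarrow> (A + B) *\<^sub>v v = A *\<^sub>v v + B *\<^sub>v (v :: real vec)"
  by (rule add_mult_distrib_mat_vec) (auto intro: carrier_vecI carrier_matI)

lemma mmv_minus: "dim_row A = dim_row B \<Longrightarrow> dim_col A = dim_col B \<Longrightarrow> dim_vec v = dim_col A \<Longrightarrow> (A - B) *\<^sub>v v = A *\<^sub>v v - B *\<^sub>v (v :: real vec)"
  by (rule minus_mult_distrib_mat_vec) (auto intro: carrier_vecI carrier_matI)

lemma mmv_mult: "dim_col A = dim_row B \<Longrightarrow> dim_vec v = dim_col B \<Longrightarrow> (A * B) *\<^sub>v v = A *\<^sub>v (B *\<^sub>v (v :: real vec))"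
  by (rule assoc_mult_mat_vec) (auto intro: carrier_vecI carrier_matI)

lemma mmv_vec_add: "dim_vec v = dim_col A \<Longrightarrow> dim_vec w = dim_col A \<Longrightarrow> A *\<^sub>v (v + w) = A *\<^sub>v v + A *\<^sub>v (w :: real vec)"
  by (rule mult_add_distrib_mat_vec) (auto intro: carrier_vecI carrier_matI)

lemma mmv_zero_mat: "dim_vec v = c \<Longrightarrow> 0\<^sub>m r c *\<^sub>v v = (0\<^sub>v r :: real vec)"
  by (intro eq_vecI) (auto simp: scalar_prod_def row_def)

lemma mmv_one: "dim_vec v = n \<Longrightarrow> 1\<^sub>m n *\<^sub>v v = (v :: real vec)"
  by (rule one_mult_mat_vec) (auto intro: carrier_vecI)

text \<open>Pairs of unit vectors recover the entries.\<close>

lemma mat_eq_by_forms: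
  assumes "dim_row A = dim_row B" "dim_col A = dim_col B"
    and "\<And>u v. dim_vec u = dim_row B \<Longrightarrow> dim_vec v = dim_col B \<Longrightarrow> u \<bullet> (A *\<^sub>v v) = u \<bullet> (B *\<^sub>v (v :: real vec))"
  shows "A = B"
proof (rule eq_matI)
  fix i j assume ij: "i < dim_row B" "j < dim_col B"
  have e: "unit_vec (dim_row B) i \<bullet> (C *\<^sub>v unit_vec (dim_col B) j) = C $$ (i, j)"
    if "dim_row C = dim_row B" "dim_col C = dim_col B" for C :: "real mat"
    using that ij by (simp add: scalar_prod_left_unit carrier_vecI scalar_prod_right_unit)
  show "A $$ (i, j) = B $$ (i, j)"
    using assms(3)[of "unit_vec (dim_row B) i" "unit_vec (dim_col B) j"] e[of A] e[of B] assms(1,2) by simp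
qed (use assms in auto)

lemma vec_eq_by_forms:
  assumes "dim_vec v = dim_vec w" "\<And>u. dim_vec u = dim_vec w \<Longrightarrow> u \<bullet> v = u \<bullet> (w :: real vec)"
  shows "v = w"
proof (rule eq_vecI)
  fix i assume i: "i < dim_vec w"
  have e: "unit_vec (dim_vec w) i \<bullet> x = x $ i" if "dim_vec x = dim_vec w" for x :: "real vec"
    using that i by (intro scalar_prod_left_unit carrier_vecI)
  show "v $ i = w $ i"
    using assms(2)[of "unit_vec (dim_vec w) i"] unfolding e[OF assms(1)] e[OF refl] by simp
qed (use assms in auto)

lemma Sy_form: "dim_row X = dim_col X \<Longrightarrow> dim_vec u = dim_row X \<Longrightarrow> dim_vec v = dim_row X \<Longrightarrow>
  u \<bullet> (Sy X *\<^sub>v v) = u \<bullet> (X *\<^sub>v v) + v \<bullet> (X *\<^sub>v u)"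
  unfolding Sy_def by (simp add: mmv_add sp_add_right sp_transpose)

lemma dim_Sy[simp]: "dim_row (Sy X) = dim_col X" "dim_col (Sy X) = dim_row X"
  by (auto simp: Sy_def)

lemma four_block_form:
  assumes "dim_row B = dim_row A" "dim_col C = dim_col A" "dim_row D = dim_row C" "dim_col D = dim_col B"
    "dim_vec a = dim_col A" "dim_vec b = dim_col D"
  shows "four_block_mat A B C D *\<^sub>v (a @\<^sub>v b) = (A *\<^sub>v a + B *\<^sub>v b) @\<^sub>v (C *\<^sub>v a + D *\<^sub>v (b :: real vec))"
  by (rule four_block_mat_mult_vec) (use assms in \<open>auto intro: carrier_vecI carrier_matI\<close>)

lemma dim_sym_block[simp]: "dim_row (sym_block A B C) = dim_row A + dim_row C" "dim_col (sym_block A B C) = dim_col A + dim_col C"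
  by (auto simp: sym_block_def)

lemma sym_block_form:
  assumes "A \<in> carrier_mat k k" "B \<in> carrier_mat k l" "C \<in> carrier_mat l l"
    "dim_vec a = k" "dim_vec b = l" "dim_vec a' = k" "dim_vec b' = l"
  shows "(a' @\<^sub>v b') \<bullet> (sym_block A B C *\<^sub>v (a @\<^sub>v b)) =
    a' \<bullet> (A *\<^sub>v a) + a' \<bullet> (B *\<^sub>v b) + a \<bullet> (B *\<^sub>v b') + b' \<bullet> (C *\<^sub>v (b :: real vec))"
proof -
  have "sym_block A B C *\<^sub>v (a @\<^sub>v b) = (A *\<^sub>v a + B *\<^sub>v b) @\<^sub>v (B\<^sup>T *\<^sub>v a + C *\<^sub>v b)"
    unfolding sym_block_def using assms by (intro four_block_form) auto
  then show ?thesis using assms by (simp add: sp_append sp_add_right sp_transpose)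
qed

lemma append_rows_form: "dim_col A = dim_col B \<Longrightarrow> dim_vec v = dim_col A \<Longrightarrow> (A @\<^sub>r B) *\<^sub>v v = (A *\<^sub>v v) @\<^sub>v (B *\<^sub>v (v :: real vec))"
  by (rule mat_mult_append) (auto intro: carrier_vecI carrier_matI)

lemma dim_append_rows[simp]: "dim_row (A @\<^sub>r B) = dim_row A + dim_row B" "dim_col (A @\<^sub>r B) = dim_col A"
  by (auto simp: append_rows_def)

lemma append_vNil: "(v :: real vec) @\<^sub>v vNil = v"
  by (intro eq_vecI) auto

lemma append_vec_assoc: "(a @\<^sub>v b) @\<^sub>v c = a @\<^sub>v b @\<^sub>v (c :: real vec)"
  by (intro eq_vecI) auto

lemma hcat_Nil: "hcat nr [] = 0\<^sub>m nr 0" by (simp add: hcat_def)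

lemma hcat_Cons: "hcat nr (A # As) = four_block_mat A (hcat nr As) (0\<^sub>m 0 (dim_col A)) (0\<^sub>m 0 (dim_col (hcat nr As)))"
  by (simp add: hcat_def)

lemma dim_col_hcat: "dim_col (hcat nr As) = sum_list (map dim_col As)"
  by (induction As) (auto simp: hcat_Nil hcat_Cons)

lemma dim_row_hcat: "(\<And>A. A \<in> set As \<Longrightarrow> dim_row A = nr) \<Longrightarrow> dim_row (hcat nr As) = nr"
  by (induction As) (auto simp: hcat_Nil hcat_Cons)

lemma hcat_Cons_form:
  assumes "dim_row A = nr" "\<And>B. B \<in> set As \<Longrightarrow> dim_row B = nr" "dim_vec a = dim_col A" "dim_vec b = sum_list (map dim_col As)"
  shows "hcat nr (A # As) *\<^sub>v (a @\<^sub>v b) = A *\<^sub>v a + hcat nr As *\<^sub>v (b :: real vec)"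
proof -
  have d: "dim_row (hcat nr As) = nr" "dim_col (hcat nr As) = sum_list (map dim_col As)"
    using assms by (auto intro: dim_row_hcat simp: dim_col_hcat)
  have "hcat nr (A # As) *\<^sub>v (a @\<^sub>v b) = (A *\<^sub>v a + hcat nr As *\<^sub>v b) @\<^sub>v (0\<^sub>m 0 (dim_col A) *\<^sub>v a + 0\<^sub>m 0 (dim_col (hcat nr As)) *\<^sub>v b)"
    unfolding hcat_Cons using assms d by (intro four_block_form) auto
  then show ?thesis using assms d by (intro eq_vecI) auto
qed

lemma hcat_single_form: "dim_row A = nr \<Longrightarrow> dim_vec a = dim_col A \<Longrightarrow> hcat nr [A] *\<^sub>v a = A *\<^sub>v (a :: real vec)"
  using hcat_Cons_form[of A nr "[]" a vNil] by (simp add: append_vNil hcat_Nil) (intro eq_vecI; auto)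

lemma hcat_append_form:
  assumes "\<And>A. A \<in> set As \<union> set Bs \<Longrightarrow> dim_row A = nr" "dim_vec a = sum_list (map dim_col As)" "dim_vec b = sum_list (map dim_col Bs)"
  shows "hcat nr (As @ Bs) *\<^sub>v (a @\<^sub>v b) = hcat nr As *\<^sub>v a + hcat nr Bs *\<^sub>v (b :: real vec)"
  using assms
proof (induction As arbitrary: a)
  case Nil
  then have "a = vNil" by (intro eq_vecI) auto
  moreover have "dim_row (hcat nr Bs) = nr" by (rule dim_row_hcat) (use Nil in auto)
  ultimately show ?case by (simp add: hcat_Nil) (intro eq_vecI; auto)
next
  case (Cons A As)
  define a1 a2 where "a1 = vec_first a (dim_col A)" and "a2 = vec_last a (sum_list (map dim_col As))"
  have a: "dim_vec a1 = dim_col A" "dim_vec a2 = sum_list (map dim_col As)"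
    unfolding a1_def a2_def by simp_all
  have a1: "a = a1 @\<^sub>v a2"
    unfolding a1_def a2_def by (rule vec_first_last_append[symmetric]) (use Cons.prems(2) in \<open>auto intro: carrier_vecI\<close>)
  have "hcat nr ((A # As) @ Bs) *\<^sub>v (a @\<^sub>v b) = A *\<^sub>v a1 + hcat nr (As @ Bs) *\<^sub>v (a2 @\<^sub>v b)"
    unfolding a1 append_vec_assoc append_Cons using Cons.prems a by (intro hcat_Cons_form) auto
  also have "hcat nr (As @ Bs) *\<^sub>v (a2 @\<^sub>v b) = hcat nr As *\<^sub>v a2 + hcat nr Bs *\<^sub>v b"
    using Cons.prems a by (intro Cons.IH) auto
  also have "A *\<^sub>v a1 + \<dots> = (A *\<^sub>v a1 + hcat nr As *\<^sub>v a2) + hcat nr Bs *\<^sub>v b"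
    using Cons.prems by (intro eq_vecI) (auto simp: dim_row_hcat)
  also have "A *\<^sub>v a1 + hcat nr As *\<^sub>v a2 = hcat nr (A # As) *\<^sub>v a"
    unfolding a1 using Cons.prems a by (intro hcat_Cons_form[symmetric]) auto
  finally show ?case .
qed

section \<open>Stacked families of vectors and block-diagonal matrices\<close>

definition cv :: "real vec list \<Rightarrow> real vec" where
  "cv vs = foldr (@\<^sub>v) vs vNil"

lemma cv_Nil[simp]: "cv [] = vNil" by (simp add: cv_def)
lemma cv_Cons[simp]: "cv (v # vs) = v @\<^sub>v cv vs" by (simp add: cv_def)
lemma dim_cv: "dim_vec (cv vs) = sum_list (map dim_vec vs)" by (induction vs) auto
lemma cv_append: "cv (us @ vs) = cv us @\<^sub>v cv vs" by (induction us) (auto simp: append_vec_assoc)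

lemma hcat_map_form:
  assumes "\<And>i. i \<in> set is \<Longrightarrow> dim_row (A i) = nr" "\<And>i. i \<in> set is \<Longrightarrow> dim_vec (v i) = dim_col (A i)"
  shows "u \<bullet> (hcat nr (map A is) *\<^sub>v cv (map v is)) = (\<Sum>i\<leftarrow>is. u \<bullet> (A i *\<^sub>v v i))"
  using assms
proof (induction "is")
  case Nil
  then show ?case by (simp add: hcat_Nil scalar_prod_def)
next
  case (Cons i "is")
  have s: "sum_list (map (dim_vec \<circ> v) is) = sum_list (map (dim_col \<circ> A) is)"
    using Cons.prems(2) by (intro arg_cong[of _ _ sum_list] map_cong) auto
  have "hcat nr (map A (i # is)) *\<^sub>v cv (map v (i # is)) = A i *\<^sub>v v i + hcat nr (map A is) *\<^sub>v cv (map v is)"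
    unfolding list.map cv_Cons by (rule hcat_Cons_form) (use Cons.prems s in \<open>auto simp: dim_cv\<close>)
  moreover have "dim_row (hcat nr (map A is)) = nr" by (rule dim_row_hcat) (use Cons.prems in auto)
  ultimately show ?case using Cons by (simp add: sp_add_right)
qed

lemma diag_block_Cons_form:
  assumes "dim_vec a = dim_col A" "dim_vec b = dim_col (diag_block_mat As)"
  shows "diag_block_mat (A # As) *\<^sub>v (a @\<^sub>v b) = (A *\<^sub>v a) @\<^sub>v (diag_block_mat As *\<^sub>v (b :: real vec))"
proof -
  have "diag_block_mat (A # As) *\<^sub>v (a @\<^sub>v b) = (A *\<^sub>v a + 0\<^sub>m (dim_row A) (dim_col (diag_block_mat As)) *\<^sub>v b)
      @\<^sub>v (0\<^sub>m (dim_row (diag_block_mat As)) (dim_col A) *\<^sub>v a + diag_block_mat As *\<^sub>v b)"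
    unfolding diag_block_mat.simps Let_def using assms by (intro four_block_form) auto
  moreover have "A *\<^sub>v a + 0\<^sub>m (dim_row A) (dim_col (diag_block_mat As)) *\<^sub>v b = A *\<^sub>v a"
    "0\<^sub>m (dim_row (diag_block_mat As)) (dim_col A) *\<^sub>v a + diag_block_mat As *\<^sub>v b = diag_block_mat As *\<^sub>v b"
    by (intro eq_vecI; simp add: mmv_zero_mat assms)+
  ultimately show ?thesis by simp
qed

lemma hcat3_form:
  assumes "dim_row A = r" "dim_row B = r" "dim_row C = r" "dim_vec a = dim_col A" "dim_vec b = dim_col B" "dim_vec c = dim_col C"
  shows "hcat r [A, B, C] *\<^sub>v (a @\<^sub>v b @\<^sub>v c) = A *\<^sub>v a + (B *\<^sub>v b + C *\<^sub>v (c :: real vec))"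
proof -
  have "hcat r [A, B, C] *\<^sub>v (a @\<^sub>v b @\<^sub>v c) = A *\<^sub>v a + hcat r [B, C] *\<^sub>v (b @\<^sub>v c)"
    by (rule hcat_Cons_form) (use assms in auto)
  also have "hcat r [B, C] *\<^sub>v (b @\<^sub>v c) = B *\<^sub>v b + hcat r [C] *\<^sub>v c"
    by (rule hcat_Cons_form) (use assms in auto)
  also have "hcat r [C] *\<^sub>v c = C *\<^sub>v c" by (rule hcat_single_form) (use assms in auto)
  finally show ?thesis .
qed

lemma diag_block4_form:
  assumes "dim_vec a = dim_col A" "dim_vec b = dim_col B" "dim_vec c = dim_col C" "dim_vec d = dim_col D"
  shows "diag_block_mat [A, B, C, D] *\<^sub>v (a @\<^sub>v b @\<^sub>v c @\<^sub>v d) = (A *\<^sub>v a) @\<^sub>v (B *\<^sub>v b) @\<^sub>v (C *\<^sub>v c) @\<^sub>v (D *\<^sub>v (d :: real vec))"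
proof -
  have "diag_block_mat [A, B, C, D] *\<^sub>v (a @\<^sub>v b @\<^sub>v c @\<^sub>v d) = (A *\<^sub>v a) @\<^sub>v (diag_block_mat [B, C, D] *\<^sub>v (b @\<^sub>v c @\<^sub>v d))"
    by (rule diag_block_Cons_form) (use assms in \<open>auto simp: Let_def\<close>)
  also have "diag_block_mat [B, C, D] *\<^sub>v (b @\<^sub>v c @\<^sub>v d) = (B *\<^sub>v b) @\<^sub>v (diag_block_mat [C, D] *\<^sub>v (c @\<^sub>v d))"
    by (rule diag_block_Cons_form) (use assms in \<open>auto simp: Let_def\<close>)
  also have "diag_block_mat [C, D] *\<^sub>v (c @\<^sub>v d) = (C *\<^sub>v c) @\<^sub>v (diag_block_mat [D] *\<^sub>v d)"
    by (rule diag_block_Cons_form) (use assms in \<open>auto simp: Let_def\<close>)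
  finally show ?thesis unfolding diag_block_mat_singleton .
qed

lemma mmv_smult: "dim_vec v = dim_col A \<Longrightarrow> (k \<cdot>\<^sub>m A) *\<^sub>v v = k \<cdot>\<^sub>v (A *\<^sub>v (v :: real vec))"
  by (intro eq_vecI) (auto simp: scalar_prod_def sum_distrib_left mult.assoc row_def)

lemma diag_block_map_form:
  assumes "\<And>i. i \<in> set is \<Longrightarrow> dim_vec (v i) = dim_col (A i)"
  shows "diag_block_mat (map A is) *\<^sub>v cv (map v is) = cv (map (\<lambda>i. A i *\<^sub>v v i) is)"
  using assms
proof (induction "is")
  case Nil
  then show ?case by (intro eq_vecI) auto
next
  case (Cons i "is")
  have s: "sum_list (map (dim_vec \<circ> v) is) = sum_list (map (dim_col \<circ> A) is)"
    using Cons.prems by (intro arg_cong[of _ _ sum_list] map_cong) auto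
  have "diag_block_mat (map A (i # is)) *\<^sub>v cv (map v (i # is)) = (A i *\<^sub>v v i) @\<^sub>v (diag_block_mat (map A is) *\<^sub>v cv (map v is))"
    unfolding list.map cv_Cons by (rule diag_block_Cons_form) (use Cons.prems s in \<open>auto simp: dim_cv dim_diag_block_mat\<close>)
  then show ?case using Cons by simp
qed

lemma cv_map_scalar_prod:
  assumes "\<And>i. i \<in> set is \<Longrightarrow> dim_vec (u i) = dim_vec (v i)"
  shows "cv (map u is) \<bullet> cv (map v is) = (\<Sum>i\<leftarrow>is. u i \<bullet> v i)"
  using assms
proof (induction "is")
  case (Cons i "is")
  have s: "sum_list (map (dim_vec \<circ> u) is) = sum_list (map (dim_vec \<circ> v) is)"
    using Cons.prems by (intro arg_cong[of _ _ sum_list] map_cong) auto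
  show ?case using Cons s by (simp add: sp_append dim_cv)
qed (simp add: scalar_prod_def)

lemma cv_map_add:
  assumes "\<And>i. i \<in> set is \<Longrightarrow> dim_vec (u i) = dim_vec (v i)"
  shows "cv (map u is) + cv (map v is) = cv (map (\<lambda>i. u i + v i) is)"
  using assms
proof (induction "is")
  case (Cons i "is")
  have s: "sum_list (map (dim_vec \<circ> u) is) = sum_list (map (dim_vec \<circ> v) is)"
    using Cons.prems by (intro arg_cong[of _ _ sum_list] map_cong) auto
  have "(u i @\<^sub>v cv (map u is)) + (v i @\<^sub>v cv (map v is)) = (u i + v i) @\<^sub>v (cv (map u is) + cv (map v is))"
    by (rule append_vec_add) (use Cons.prems s in \<open>auto simp: dim_cv intro: carrier_vecI\<close>)
  then show ?case using Cons by simp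
qed (auto intro: eq_vecI)

lemma cv_map_minus:
  assumes "\<And>i. i \<in> set is \<Longrightarrow> dim_vec (u i) = dim_vec (v i)"
  shows "cv (map u is) - cv (map v is) = cv (map (\<lambda>i. u i - v i) is)"
  using assms
proof (induction "is")
  case (Cons i "is")
  have s: "sum_list (map (dim_vec \<circ> u) is) = sum_list (map (dim_vec \<circ> v) is)"
    using Cons.prems by (intro arg_cong[of _ _ sum_list] map_cong) auto
  have "(u i @\<^sub>v cv (map u is)) - (v i @\<^sub>v cv (map v is)) = (u i - v i) @\<^sub>v (cv (map u is) - cv (map v is))"
    using Cons.prems s by (intro eq_vecI) (auto simp: dim_cv)
  then show ?case using Cons by simp
qed (auto intro: eq_vecI)

lemma cv_map_cong: "(\<And>i. i \<in> set is \<Longrightarrow> u i = v i) \<Longrightarrow> cv (map u is) = cv (map v is)"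
  by (metis map_cong)

subsection \<open>Kronecker products\<close>

lemma dim_kronecker[simp]: "dim_row (A \<otimes>\<^sub>K B) = dim_row A * dim_row B" "dim_col (A \<otimes>\<^sub>K B) = dim_col A * dim_col B"
  by (auto simp: kronecker_def)

text \<open>The Kronecker product of two column vectors: with l the length of x, entry a l + j is
  entry a of u times entry j of x.\<close>

definition kv :: "real vec \<Rightarrow> real vec \<Rightarrow> real vec" where
  "kv u x = vec (dim_vec u * dim_vec x) (\<lambda>k. u $ (k div dim_vec x) * x $ (k mod dim_vec x))"

lemma dim_kv[simp]: "dim_vec (kv u x) = dim_vec u * dim_vec x" by (simp add: kv_def)

lemma div_mod_less: "k < a * b \<Longrightarrow> k div b < a \<and> k mod b < (b :: nat)"
  by (metis less_mult_imp_div_less mod_less_divisor mult_0_right neq0_conv not_less_zero)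

lemma pair_index_less: "i < a \<Longrightarrow> j < b \<Longrightarrow> i * b + j < a * (b :: nat)"
  using mult_le_mono1[of "Suc i" a b] by simp

lemma sum_div_mod:
  fixes a b :: nat
  shows "(\<Sum>k = 0..<a * b. f (k div b) * g (k mod b)) = (\<Sum>i = 0..<a. f i) * (\<Sum>j = 0..<b. g j :: real)"
proof -
  have "(\<Sum>k = 0..<a * b. f (k div b) * g (k mod b)) = (\<Sum>(i, j)\<in>{0..<a} \<times> {0..<b}. f i * g j)"
    by (rule sum.reindex_bij_witness[of _ "\<lambda>(i, j). i * b + j" "\<lambda>k. (k div b, k mod b)"])
      (auto simp: div_mod_less pair_index_less)
  then show ?thesis by (simp add: sum_product sum.cartesian_product)
qed

text \<open>The mixed product rule. The sum over the joint index factors into two sums along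
  division with remainder.\<close>

lemma kronecker_mult_kv:
  assumes "dim_vec u = dim_col A" "dim_vec x = dim_col B"
  shows "(A \<otimes>\<^sub>K B) *\<^sub>v kv u x = kv (A *\<^sub>v u) (B *\<^sub>v x)"
proof (rule eq_vecI)
  fix i assume "i < dim_vec (kv (A *\<^sub>v u) (B *\<^sub>v x))"
  then have i: "i < dim_row A * dim_row B" by simp
  have "((A \<otimes>\<^sub>K B) *\<^sub>v kv u x) $ i = (\<Sum>k = 0..<dim_vec u * dim_vec x.
     (A $$ (i div dim_row B, k div dim_vec x) * u $ (k div dim_vec x)) * (B $$ (i mod dim_row B, k mod dim_vec x) * x $ (k mod dim_vec x)))"
    using i assms by (simp add: scalar_prod_def kronecker_def kv_def row_def mult_ac)
  also have "\<dots> = (A *\<^sub>v u) $ (i div dim_row B) * (B *\<^sub>v x) $ (i mod dim_row B)"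
    using div_mod_less[OF i] assms
      sum_div_mod[of "\<lambda>k. A $$ (i div dim_row B, k) * u $ k" "dim_vec x" "\<lambda>k. B $$ (i mod dim_row B, k) * x $ k" "dim_vec u"]
    by (simp add: scalar_prod_def)
  finally show "((A \<otimes>\<^sub>K B) *\<^sub>v kv u x) $ i = kv (A *\<^sub>v u) (B *\<^sub>v x) $ i"
    using i by (simp add: kv_def)
qed simp

lemma kv_single: "kv (vec 1 (\<lambda>_. 1)) x = x"
  by (intro eq_vecI) (auto simp: kv_def)

lemma kv_add_left: "dim_vec u = dim_vec v \<Longrightarrow> kv (u + v) x = kv u x + kv v x"
  by (intro eq_vecI) (auto simp: kv_def distrib_right dest: div_mod_less)

lemma kronecker_minus: "dim_row A = dim_row B \<Longrightarrow> dim_col A = dim_col B \<Longrightarrow> (A - B) \<otimes>\<^sub>K C = A \<otimes>\<^sub>K C - B \<otimes>\<^sub>K C"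
proof (intro eq_matI)
  fix i j
  assume *: "dim_row A = dim_row B" "dim_col A = dim_col B" "i < dim_row (A \<otimes>\<^sub>K C - B \<otimes>\<^sub>K C)" "j < dim_col (A \<otimes>\<^sub>K C - B \<otimes>\<^sub>K C)"
  then show "((A - B) \<otimes>\<^sub>K C) $$ (i, j) = (A \<otimes>\<^sub>K C - B \<otimes>\<^sub>K C) $$ (i, j)"
    using div_mod_less[of i "dim_row B" "dim_row C"] div_mod_less[of j "dim_col B" "dim_col C"]
    by (simp add: kronecker_def left_diff_distrib)
qed auto

lemma kronecker_zero: "0\<^sub>m a b \<otimes>\<^sub>K C = 0\<^sub>m (a * dim_row C) (b * dim_col C)"
proof (intro eq_matI)
  fix i j
  assume "i < dim_row (0\<^sub>m (a * dim_row C) (b * dim_col C))" "j < dim_col (0\<^sub>m (a * dim_row C) (b * dim_col C))"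
  then show "(0\<^sub>m a b \<otimes>\<^sub>K C) $$ (i, j) = 0\<^sub>m (a * dim_row C) (b * dim_col C) $$ (i, j)"
    using div_mod_less[of i a "dim_row C"] div_mod_less[of j b "dim_col C"] by (simp add: kronecker_def)
qed auto

text \<open>Quotient and remainder by the size of E separate the position in the block matrix from
  the position in E. An index lies below a e exactly when its quotient by e lies below a, so the
  block boundaries on both sides agree.\<close>

lemma kronecker_four_block:
  assumes "dim_row B = dim_row A" "dim_col C = dim_col A" "dim_row C = dim_row D" "dim_col D = dim_col B"
  shows "four_block_mat A B C D \<otimes>\<^sub>K E = four_block_mat (A \<otimes>\<^sub>K E) (B \<otimes>\<^sub>K E) (C \<otimes>\<^sub>K E) (D \<otimes>\<^sub>K E)"
proof (rule eq_matI)
  fix i j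
  assume "i < dim_row (four_block_mat (A \<otimes>\<^sub>K E) (B \<otimes>\<^sub>K E) (C \<otimes>\<^sub>K E) (D \<otimes>\<^sub>K E))"
    "j < dim_col (four_block_mat (A \<otimes>\<^sub>K E) (B \<otimes>\<^sub>K E) (C \<otimes>\<^sub>K E) (D \<otimes>\<^sub>K E))"
  then have ij: "i < (dim_row A + dim_row D) * dim_row E" "j < (dim_col A + dim_col D) * dim_col E"
    by (auto simp: distrib_right)
  have split: "(i < a * e \<longleftrightarrow> i div e < a) \<and> (a \<le> i div e \<longrightarrow> (i - a * e) div e = i div e - a \<and> (i - a * e) mod e = i mod e)
     \<and> (i div e < a \<longrightarrow> i div e < a + d) \<and> (i < a * e + d * e)"
    if "i < (a + d) * e" for i a d e :: nat
  proof -
    have e: "e > 0" using that by (cases e) auto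
    have 1: "i < a * e \<longleftrightarrow> i div e < a" using e by (simp add: div_less_iff_less_mult)
    moreover have "(i - a * e) div e = i div e - a \<and> (i - a * e) mod e = i mod e" if "a \<le> i div e"
    proof -
      from that 1 have "i = (i - a * e) + a * e" by auto
      then obtain k where k: "i = k + a * e" by blast
      then show ?thesis using e by simp
    qed
    ultimately show ?thesis using that by (auto simp: distrib_right)
  qed
  have idx: "(X \<otimes>\<^sub>K E) $$ (i', j') = X $$ (i' div dim_row E, j' div dim_col E) * E $$ (i' mod dim_row E, j' mod dim_col E)"
    if "i' < dim_row X * dim_row E" "j' < dim_col X * dim_col E" for X i' j'
    using that by (simp add: kronecker_def)
  note si = split[OF ij(1)] and sj = split[OF ij(2)]
  have L: "(four_block_mat A B C D \<otimes>\<^sub>K E) $$ (i, j) = four_block_mat A B C D $$ (i div dim_row E, j div dim_col E) * E $$ (i mod dim_row E, j mod dim_col E)"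
    by (rule idx) (use ij in auto)
  have F: "four_block_mat A' B' C' D' $$ (k, l) = (if k < dim_row A' then if l < dim_col A' then A' $$ (k, l) else B' $$ (k, l - dim_col A')
      else if l < dim_col A' then C' $$ (k - dim_row A', l) else D' $$ (k - dim_row A', l - dim_col A'))"
    if "k < dim_row A' + dim_row D'" "l < dim_col A' + dim_col D'" for A' B' C' D' :: "real mat" and k l
    using that by (rule index_mat_four_block)
  have F1: "four_block_mat A B C D $$ (i div dim_row E, j div dim_col E) =
     (if i div dim_row E < dim_row A then if j div dim_col E < dim_col A then A $$ (i div dim_row E, j div dim_col E) else B $$ (i div dim_row E, j div dim_col E - dim_col A)
      else if j div dim_col E < dim_col A then C $$ (i div dim_row E - dim_row A, j div dim_col E) else D $$ (i div dim_row E - dim_row A, j div dim_col E - dim_col A))"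
    by (rule F) (use div_mod_less[OF ij(1)] div_mod_less[OF ij(2)] in auto)
  have F2: "four_block_mat (A \<otimes>\<^sub>K E) (B \<otimes>\<^sub>K E) (C \<otimes>\<^sub>K E) (D \<otimes>\<^sub>K E) $$ (i, j) =
     (if i < dim_row A * dim_row E then if j < dim_col A * dim_col E then (A \<otimes>\<^sub>K E) $$ (i, j) else (B \<otimes>\<^sub>K E) $$ (i, j - dim_col A * dim_col E)
      else if j < dim_col A * dim_col E then (C \<otimes>\<^sub>K E) $$ (i - dim_row A * dim_row E, j) else (D \<otimes>\<^sub>K E) $$ (i - dim_row A * dim_row E, j - dim_col A * dim_col E))"
    by (subst F) (use ij in \<open>auto simp: distrib_right\<close>)
  have lt: "i - dim_row A * dim_row E < dim_row D * dim_row E" if "\<not> i < dim_row A * dim_row E" using si that by linarith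
  have lt': "j - dim_col A * dim_col E < dim_col D * dim_col E" if "\<not> j < dim_col A * dim_col E" using sj that by linarith
  show "(four_block_mat A B C D \<otimes>\<^sub>K E) $$ (i, j) = four_block_mat (A \<otimes>\<^sub>K E) (B \<otimes>\<^sub>K E) (C \<otimes>\<^sub>K E) (D \<otimes>\<^sub>K E) $$ (i, j)"
  proof (cases "i < dim_row A * dim_row E"; cases "j < dim_col A * dim_col E")
    assume c: "i < dim_row A * dim_row E" "j < dim_col A * dim_col E"
    show ?thesis unfolding L F1 F2 using c si sj by (simp only: idx if_True)
  next
    assume c: "i < dim_row A * dim_row E" "\<not> j < dim_col A * dim_col E"
    have "(B \<otimes>\<^sub>K E) $$ (i, j - dim_col A * dim_col E) = B $$ (i div dim_row E, j div dim_col E - dim_col A) * E $$ (i mod dim_row E, j mod dim_col E)"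
      using idx[of i B "j - dim_col A * dim_col E"] c lt' assms sj by (metis linorder_not_less)
    then show ?thesis unfolding L F1 F2 using c si sj by (simp only: if_True if_False simp_thms)
  next
    assume c: "\<not> i < dim_row A * dim_row E" "j < dim_col A * dim_col E"
    have "(C \<otimes>\<^sub>K E) $$ (i - dim_row A * dim_row E, j) = C $$ (i div dim_row E - dim_row A, j div dim_col E) * E $$ (i mod dim_row E, j mod dim_col E)"
      using idx[of "i - dim_row A * dim_row E" C j] c lt assms si by (metis linorder_not_less)
    then show ?thesis unfolding L F1 F2 using c si sj by (simp only: if_True if_False simp_thms)
  next
    assume c: "\<not> i < dim_row A * dim_row E" "\<not> j < dim_col A * dim_col E"
    have "(D \<otimes>\<^sub>K E) $$ (i - dim_row A * dim_row E, j - dim_col A * dim_col E) = D $$ (i div dim_row E - dim_row A, j div dim_col E - dim_col A) * E $$ (i mod dim_row E, j mod dim_col E)"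
      using idx[of "i - dim_row A * dim_row E" D "j - dim_col A * dim_col E"] c lt lt' si sj by (metis linorder_not_less)
    then show ?thesis unfolding L F1 F2 using c si sj by (simp only: if_True if_False simp_thms)
  qed
qed (use assms in \<open>auto simp: distrib_right\<close>)

lemma kronecker_hcat:
  assumes "\<And>A. A \<in> set As \<Longrightarrow> dim_row A = nr"
  shows "hcat nr As \<otimes>\<^sub>K E = hcat (nr * dim_row E) (map (\<lambda>A. A \<otimes>\<^sub>K E) As)"
  using assms
proof (induction As)
  case Nil
  show ?case by (simp add: hcat_Nil kronecker_zero)
next
  case (Cons A As)
  have "hcat nr (A # As) \<otimes>\<^sub>K E = four_block_mat (A \<otimes>\<^sub>K E) (hcat nr As \<otimes>\<^sub>K E) (0\<^sub>m 0 (dim_col A) \<otimes>\<^sub>K E) (0\<^sub>m 0 (dim_col (hcat nr As)) \<otimes>\<^sub>K E)"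
    unfolding hcat_Cons using Cons.prems by (intro kronecker_four_block) (auto simp: dim_row_hcat)
  then show ?case using Cons by (simp add: hcat_Cons kronecker_zero dim_col_hcat comp_def sum_list_mult_const)
qed

lemma kronecker_diag_block: "diag_block_mat As \<otimes>\<^sub>K E = diag_block_mat (map (\<lambda>A. A \<otimes>\<^sub>K E) As)"
proof (induction As)
  case Nil
  show ?case by (simp add: kronecker_zero)
next
  case (Cons A As)
  have "diag_block_mat (A # As) \<otimes>\<^sub>K E = four_block_mat (A \<otimes>\<^sub>K E) (0\<^sub>m (dim_row A) (dim_col (diag_block_mat As)) \<otimes>\<^sub>K E)
     (0\<^sub>m (dim_row (diag_block_mat As)) (dim_col A) \<otimes>\<^sub>K E) (diag_block_mat As \<otimes>\<^sub>K E)"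
    unfolding diag_block_mat.simps Let_def by (intro kronecker_four_block) auto
  then show ?case using Cons.IH[symmetric] by (simp add: Let_def kronecker_zero)
qed

lemma one_mat_diag_blocks: "(1\<^sub>m (sum_list ks) :: real mat) = diag_block_mat (map 1\<^sub>m ks)"
proof (induction ks)
  case (Cons k ks)
  then show ?case by (simp add: Let_def dim_diag_block_mat comp_def Cons.IH[symmetric])
qed (auto intro: eq_matI)

lemma one_kronecker_one: "1\<^sub>m 1 \<otimes>\<^sub>K A = A"
  by (intro eq_matI) (auto simp: kronecker_def)

text \<open>Lets one factor I \<otimes> A act blockwise on a vector whose blocks have different
  sizes.\<close>

lemma one_kronecker_blocks: "1\<^sub>m (sum_list ks) \<otimes>\<^sub>K A = diag_block_mat (map (\<lambda>k. 1\<^sub>m k \<otimes>\<^sub>K A) ks)"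
  unfolding one_mat_diag_blocks kronecker_diag_block by (simp add: comp_def)

lemma col_mat_mult: "col_mat g *\<^sub>v vec 1 (\<lambda>_. 1) = g"
  by (intro eq_vecI) (auto simp: col_mat_def scalar_prod_def mat_of_cols_def row_def)

lemma dim_col_mat[simp]: "dim_row (col_mat v) = dim_vec v" "dim_col (col_mat v) = 1"
  by (auto simp: col_mat_def)

lemma col_mat_kronecker_one: "dim_vec x = n \<Longrightarrow> (col_mat g \<otimes>\<^sub>K 1\<^sub>m n) *\<^sub>v x = kv g x"
  using kronecker_mult_kv[of "vec 1 (\<lambda>_. 1)" "col_mat g" x "1\<^sub>m n"]
  by (simp add: kv_single col_mat_mult mmv_one del: One_nat_def)

subsection \<open>The closed loop and its dissipation matrix\<close>

lemma vcat_form: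
  assumes "list_all (\<lambda>A. dim_col A = nc) (A # As)" "dim_vec v = nc"
  shows "vcat nc (A # As) *\<^sub>v v = (A *\<^sub>v v) @\<^sub>v (vcat nc As *\<^sub>v (v :: real vec))"
proof -
  have "dim_col (vcat nc As) = nc" using assms by (cases As) (auto simp: vcat_def)
  then have "(A @\<^sub>r vcat nc As) *\<^sub>v v = (A *\<^sub>v v) @\<^sub>v (vcat nc As *\<^sub>v v)"
    using assms by (intro append_rows_form) auto
  then show ?thesis by (simp add: vcat_def)
qed

lemma vcat_Nil_form: "vcat nc [] *\<^sub>v v = (vNil :: real vec)"
  by (intro eq_vecI) (auto simp: vcat_def)

lemma dim_vcat: "dim_row (vcat nc As) = sum_list (map dim_row As)"
  "(\<And>A. A \<in> set As \<Longrightarrow> dim_col A = nc) \<Longrightarrow> dim_col (vcat nc As) = nc"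
   by (induction As) (auto simp: vcat_def)

lemma vec_split:
  assumes "dim_vec v = a + b"
  obtains x y where "v = x @\<^sub>v y" "dim_vec x = a" "dim_vec y = (b :: nat)"
proof
  show "v = vec_first v a @\<^sub>v vec_last v b"
    by (rule vec_first_last_append[symmetric]) (use assms in \<open>auto intro: carrier_vecI\<close>)
qed auto

text \<open>\<open>mat_inv\<close> is a definite description, so uniqueness of the inverse has to
  come before any of its properties.\<close>

lemma mat_inv_inverse:
  assumes A: "A \<in> carrier_mat n n" and inv: "invertible_mat A"
  shows "mat_inv A \<in> carrier_mat n n" "A * mat_inv A = 1\<^sub>m n" "mat_inv A * A = 1\<^sub>m n"
proof -
  obtain B where B: "inverts_mat A B" "inverts_mat B A" using inv by (auto simp: invertible_mat_def)
  have AB: "A * B = 1\<^sub>m n" using B A by (simp add: inverts_mat_def)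
  have BA: "B * A = 1\<^sub>m (dim_row B)" using B by (simp add: inverts_mat_def)
  have "dim_col B = n" using arg_cong[OF AB, of dim_col] by simp
  moreover have "dim_row B = n" using arg_cong[OF BA, of dim_col] A by simp
  ultimately have Bc: "B \<in> carrier_mat n n" by auto
  have "mat_inv A = B" unfolding mat_inv_def
  proof (rule the_equality)
    show "B \<in> carrier_mat (dim_row A) (dim_row A) \<and> inverts_mat A B \<and> inverts_mat B A" using Bc B A by auto
    fix C assume C: "C \<in> carrier_mat (dim_row A) (dim_row A) \<and> inverts_mat A C \<and> inverts_mat C A"
    then have Cc: "C \<in> carrier_mat n n" and CA: "C * A = 1\<^sub>m n" using A by (auto simp: inverts_mat_def)
    have "C = C * (A * B)" using Cc AB by simp
    also have "\<dots> = (C * A) * B" using Cc A Bc by simp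
    also have "\<dots> = B" using CA Bc by simp
    finally show "C = B" .
  qed
  then show "mat_inv A \<in> carrier_mat n n" "A * mat_inv A = 1\<^sub>m n" "mat_inv A * A = 1\<^sub>m n"
    using Bc AB BA by auto
qed

lemma invertible_mat_det:
  fixes A :: "real mat"
  assumes A: "A \<in> carrier_mat n n" and d: "Determinant.det A \<noteq> 0"
  shows "invertible_mat A"
proof -
  have "A \<in> Units (ring_mat TYPE(real) n ())" by (rule det_non_zero_imp_unit[OF A d])
  then obtain B where "B \<in> carrier_mat n n" "B * A = 1\<^sub>m n" "A * B = 1\<^sub>m n"
    by (auto simp: Units_def ring_mat_def)
  then show ?thesis using A by (auto simp: invertible_mat_def inverts_mat_def)
qed

text \<open>The determinant of the triangular factor is the product of its positive diagonal
  entries, and that of A is its square.\<close>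

lemma cholesky_invertible:
  assumes "cholesky A L" "A \<in> carrier_mat n n"
  shows "L \<in> carrier_mat n n" "invertible_mat L" "invertible_mat A"
proof -
  have L: "L \<in> carrier_mat n n" and ut: "upper_triangular (L\<^sup>T)" and pos: "\<And>i. i < n \<Longrightarrow> 0 < L $$ (i, i)" and A: "A = L * L\<^sup>T"
    using assms by (auto simp: cholesky_def)
  show "L \<in> carrier_mat n n" by fact
  have "Determinant.det (L\<^sup>T) = prod_list (diag_mat (L\<^sup>T))" using ut L by (intro det_upper_triangular) auto
  moreover have "0 \<notin> set (diag_mat (L\<^sup>T))" using pos L by (fastforce simp: diag_mat_def)
  ultimately have "Determinant.det (L\<^sup>T) \<noteq> 0" by (simp add: prod_list_zero_iff)
  then have d: "Determinant.det L \<noteq> 0" using det_transpose[OF L] by simp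
  then show "invertible_mat L" by (rule invertible_mat_det[OF L])
  have "Determinant.det A \<noteq> 0" unfolding A using d det_mult[OF L, of "L\<^sup>T"] L det_transpose[OF L] by simp
  then show "invertible_mat A" by (rule invertible_mat_det[OF assms(2)])
qed

lemma cross_gram_carrier: "cross_gram I k u l v \<in> carrier_mat k l"
  by (simp add: cross_gram_def int_mat_def)

lemma set_delay_idx: "set (delay_idx S) = {1..ndel S}"
  by (auto simp: delay_idx_def)

lemma sum_delay_idx: "(\<Sum>i\<leftarrow>delay_idx S. f i) = (\<Sum>i = 1..ndel S. f i :: 'a :: comm_monoid_add)"
  unfolding delay_idx_def by (simp add: sum_list_distinct_conv_sum_set atLeastLessThanSuc_atLeastAtMost del: upt_Suc)

lemma length_delay_idx: "length (delay_idx S) = ndel S"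
  by (simp add: delay_idx_def)

lemma sum_list_cong: "(\<And>x. x \<in> set xs \<Longrightarrow> f x = g x) \<Longrightarrow> sum_list (map f xs) = sum_list (map g xs)"
  by (metis map_cong)

lemma vec_last_append: "dim_vec b = k \<Longrightarrow> vec_last (a @\<^sub>v b) k = (b :: real vec)"
  by (intro eq_vecI) (auto simp: vec_last_def)

lemma hcat_zero_form:
  assumes "dim_row A = r" "dim_vec a = dim_col A" "dim_vec b = k"
  shows "hcat r [A, 0\<^sub>m r k] *\<^sub>v (a @\<^sub>v b) = A *\<^sub>v (a :: real vec)"
proof -
  have "hcat r [A, 0\<^sub>m r k] *\<^sub>v (a @\<^sub>v b) = A *\<^sub>v a + 0\<^sub>m r k *\<^sub>v b"
    using assms by (subst hcat_Cons_form; (auto; fail)?) (subst hcat_single_form; auto)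
  then show ?thesis using assms by (intro eq_vecI) (auto simp: mmv_zero_mat)
qed

lemma int_vec_cong: "(\<And>\<tau>. \<tau> \<in> I \<Longrightarrow> u \<tau> = v \<tau>) \<Longrightarrow> int_vec I k u = int_vec I k v"
  unfolding int_vec_def by (intro eq_vecI) (auto intro!: Bochner_Integration.integral_cong)

lemma sp_finsum_vec:
  assumes "finite F" "\<And>i. i \<in> F \<Longrightarrow> dim_vec (f i) = k"
  shows "u \<bullet> finsum_vec TYPE(real) k f F = (\<Sum>i\<in>F. u \<bullet> f i)" "dim_vec (finsum_vec TYPE(real) k f F) = k"
proof -
  have f: "f \<in> F \<rightarrow> carrier_vec k" using assms(2) by (auto intro: carrier_vecI)
  then have "finsum_vec TYPE(real) k f F \<in> carrier_vec k" by (rule finsum_vec_closed)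
  then show d: "dim_vec (finsum_vec TYPE(real) k f F) = k" by auto
  have "u \<bullet> finsum_vec TYPE(real) k f F = (\<Sum>j = 0..<k. u $ j * (\<Sum>i\<in>F. f i $ j))"
    using d index_finsum_vec[OF assms(1) _ f] by (simp add: scalar_prod_def)
  also have "\<dots> = (\<Sum>i\<in>F. \<Sum>j = 0..<k. u $ j * f i $ j)"
    unfolding sum_distrib_left by (rule sum.swap)
  also have "\<dots> = (\<Sum>i\<in>F. u \<bullet> f i)"
    using assms(2) by (intro sum.cong) (auto simp: scalar_prod_def)
  finally show "u \<bullet> finsum_vec TYPE(real) k f F = (\<Sum>i\<in>F. u \<bullet> f i)" .
qed

lemma finsum_vec_cong_dim:
  assumes "finite F" "\<And>i. i \<in> F \<Longrightarrow> f i = g i" "\<And>i. i \<in> F \<Longrightarrow> dim_vec (f i) = k"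
  shows "finsum_vec TYPE(real) k f F = finsum_vec TYPE(real) k g F"
proof (rule vec_eq_by_forms)
  have g: "dim_vec (g i) = k" if "i \<in> F" for i using assms(2,3) that by simp
  note F = sp_finsum_vec[OF assms(1,3)] and G = sp_finsum_vec[OF assms(1) g]
  show "dim_vec (finsum_vec TYPE(real) k f F) = dim_vec (finsum_vec TYPE(real) k g F)" using F(2) G(2) by simp
  show "u \<bullet> finsum_vec TYPE(real) k f F = u \<bullet> finsum_vec TYPE(real) k g F" for u
    using F(1)[of _ u] G(1)[of _ u] assms(2) by simp
qed

lemma pos_def_quadratic:
  assumes "pos_def A" "A \<in> carrier_mat k k" "dim_vec v = k"
  shows "0 \<le> v \<bullet> (A *\<^sub>v v)"
proof (cases "v = 0\<^sub>v k")
  case True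
  then show ?thesis using assms by (simp add: sp_zero_left)
next
  case False
  then show ?thesis using assms unfolding pos_def_def by (auto intro: carrier_vecI less_imp_le)
qed

text \<open>Collects what is needed for identities between the matrices and the system; definiteness
  enters in \<open>closed_loop_lmi\<close>.\<close>

locale closed_loop =
  fixes S :: decomposed_system and J :: supply_data
    and K P1 P2 P3 :: "real mat" and Q R :: "nat \<Rightarrow> real mat"
  assumes vs: "valid_system S" and kd: "kernel_decomposition S" and ch: "cholesky_factors S"
    and vsup: "valid_supply (dimz S) (dimw S) J"
    and dv: "decision_variables (dimx S) (dimu S) (ndel S) (totf S) K P1 P2 P3 Q R"
begin

abbreviation "n \<equiv> dimx S"
abbreviation "m \<equiv> dimz S"
abbreviation "p \<equiv> dimu S"
abbreviation "q \<equiv> dimw S"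
abbreviation "\<nu> \<equiv> ndel S"
abbreviation "dl \<equiv> delay_idx S"
abbreviation "ds \<equiv> [0..<Suc \<nu>]"
abbreviation "idx \<equiv> {1..\<nu>}"

section \<open>Shapes of the matrices of the closed loop\<close>

lemma dims_pos: "1 \<le> n" "1 \<le> m" "1 \<le> \<nu>" "1 \<le> q" using vs by (auto simp: valid_system_def)

lemma dims_AB:
  assumes "i \<le> \<nu>"
  shows "matA S i \<in> carrier_mat n n" "matB S i \<in> carrier_mat n p" "matC S i \<in> carrier_mat m n" "matE S i \<in> carrier_mat m p"
  using vs assms by (auto simp: valid_system_def)

lemma dims_D: "matD1 S \<in> carrier_mat n q" "matD2 S \<in> carrier_mat m q"
  using vs by (auto simp: valid_system_def)

lemma dims_hat:
  assumes "i \<in> idx"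
  shows "hatA S i \<in> carrier_mat n (dimg S i * n)" "hatB S i \<in> carrier_mat n (dimg S i * p)"
    "hatC S i \<in> carrier_mat m (dimg S i * n)" "hatE S i \<in> carrier_mat m (dimg S i * p)"
    "matM S i \<in> carrier_mat (dimf S i) (dimh S i)" "1 \<le> dimf S i"
  using kd assms unfolding kernel_decomposition_def by auto

lemma dims_vars:
  "K \<in> carrier_mat p n" "P1 \<in> carrier_mat n n" "P1\<^sup>T = P1" "P2 \<in> carrier_mat n (totf S * n)"
  "P3 \<in> carrier_mat (totf S * n) (totf S * n)" "P3\<^sup>T = P3"
  "\<And>i. i \<in> idx \<Longrightarrow> Q i \<in> carrier_mat n n" "\<And>i. i \<in> idx \<Longrightarrow> R i \<in> carrier_mat n n"
  "\<And>i. i \<in> idx \<Longrightarrow> (Q i)\<^sup>T = Q i" "\<And>i. i \<in> idx \<Longrightarrow> (R i)\<^sup>T = R i"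
  using dv by (auto simp: decision_variables_def sym_mats_def)

lemma dims_supply:
  "matJt J \<in> carrier_mat m m" "matJ1 J \<in> carrier_mat m m" "(matJ1 J)\<^sup>T = matJ1 J" "matJ2 J \<in> carrier_mat m q"
  "matJ3 J \<in> carrier_mat q q" "(matJ3 J)\<^sup>T = matJ3 J" "invertible_mat (matJ1 J)"
  using vsup by (auto simp: valid_supply_def sym_mats_def)

lemma dims_gram:
  "gramF S i \<in> carrier_mat (dimf S i) (dimf S i)" "gramH S i \<in> carrier_mat (dimh S i) (dimh S i)"
  "gramE S i \<in> carrier_mat (dimphi S i) (dimphi S i)" "Gam S i \<in> carrier_mat (dimphi S i) (dimh S i)"
  by (auto simp: gramF_def gramH_def gramE_def Gam_def cross_gram_carrier)

lemma chol:
  assumes "i \<in> idx"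
  shows "cholesky (gramF S i) (cholF S i)" "cholesky (gramH S i) (cholH S i)" "cholesky (gramE S i) (cholE S i)"
  using ch assms unfolding cholesky_factors_def by auto

lemma cholF:
  assumes "i \<in> idx"
  shows "cholF S i \<in> carrier_mat (dimf S i) (dimf S i)" "invertible_mat (cholF S i)" "invertible_mat (gramF S i)"
    "mat_inv (cholF S i) \<in> carrier_mat (dimf S i) (dimf S i)" "cholF S i * mat_inv (cholF S i) = 1\<^sub>m (dimf S i)"
    "mat_inv (cholF S i) * cholF S i = 1\<^sub>m (dimf S i)"
proof -
  note c = cholesky_invertible[OF chol(1)[OF assms] dims_gram(1)]
  show "cholF S i \<in> carrier_mat (dimf S i) (dimf S i)" "invertible_mat (cholF S i)" "invertible_mat (gramF S i)"
    "mat_inv (cholF S i) \<in> carrier_mat (dimf S i) (dimf S i)" "cholF S i * mat_inv (cholF S i) = 1\<^sub>m (dimf S i)"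
    "mat_inv (cholF S i) * cholF S i = 1\<^sub>m (dimf S i)"
    by (fact c mat_inv_inverse[OF c(1,2)])+
qed

lemma cholH:
  assumes "i \<in> idx"
  shows "cholH S i \<in> carrier_mat (dimh S i) (dimh S i)" "invertible_mat (cholH S i)" "invertible_mat (gramH S i)"
    "mat_inv (cholH S i) \<in> carrier_mat (dimh S i) (dimh S i)" "cholH S i * mat_inv (cholH S i) = 1\<^sub>m (dimh S i)"
    "mat_inv (cholH S i) * cholH S i = 1\<^sub>m (dimh S i)"
proof -
  note c = cholesky_invertible[OF chol(2)[OF assms] dims_gram(2)]
  show "cholH S i \<in> carrier_mat (dimh S i) (dimh S i)" "invertible_mat (cholH S i)" "invertible_mat (gramH S i)"
    "mat_inv (cholH S i) \<in> carrier_mat (dimh S i) (dimh S i)" "cholH S i * mat_inv (cholH S i) = 1\<^sub>m (dimh S i)"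
    "mat_inv (cholH S i) * cholH S i = 1\<^sub>m (dimh S i)"
    by (fact c mat_inv_inverse[OF c(1,2)])+
qed

lemma cholE:
  assumes "i \<in> idx"
  shows "cholE S i \<in> carrier_mat (dimphi S i) (dimphi S i)" "invertible_mat (cholE S i)" "invertible_mat (gramE S i)"
    "mat_inv (cholE S i) \<in> carrier_mat (dimphi S i) (dimphi S i)" "cholE S i * mat_inv (cholE S i) = 1\<^sub>m (dimphi S i)"
    "mat_inv (cholE S i) * cholE S i = 1\<^sub>m (dimphi S i)"
proof -
  note c = cholesky_invertible[OF chol(3)[OF assms] dims_gram(3)]
  show "cholE S i \<in> carrier_mat (dimphi S i) (dimphi S i)" "invertible_mat (cholE S i)" "invertible_mat (gramE S i)"
    "mat_inv (cholE S i) \<in> carrier_mat (dimphi S i) (dimphi S i)" "cholE S i * mat_inv (cholE S i) = 1\<^sub>m (dimphi S i)"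
    "mat_inv (cholE S i) * cholE S i = 1\<^sub>m (dimphi S i)"
    by (fact c mat_inv_inverse[OF c(1,2)])+
qed

lemma dim_matT:
  assumes "i \<in> idx"
  shows "matT S i \<in> carrier_mat (dimg S i) (dimh S i)" "matTt S i \<in> carrier_mat (dimg S i) (dimphi S i)"
  using cholH(1)[OF assms] cholE(1)[OF assms] dims_gram(4)[of i]
  by (auto simp: matT_def matTt_def dimg_def dimh_def intro!: carrier_matI)

lemma totg_eq: "totg S = toth S + totphi S"
  unfolding totg_def toth_def totphi_def sum.distrib[symmetric] by (simp add: dimg_def dimh_def)

lemma beta_mult: "beta S * k = k + \<nu> * k + toth S * k + totphi S * k"
  by (simp add: beta_def totg_eq algebra_simps)

abbreviation "NN \<equiv> beta S * n + q"

text \<open>The common shape of the four coefficient rows, so that one computation serves them all: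
  r is the number of rows (n or m), k the width of a block (n or p).\<close>

definition rowmat :: "nat \<Rightarrow> (nat \<Rightarrow> real mat) \<Rightarrow> (nat \<Rightarrow> real mat) \<Rightarrow> nat \<Rightarrow> real mat \<Rightarrow> real mat" where
  "rowmat r MA HA k D = hcat r (map MA ds @ map (\<lambda>i. HA i * (matT S i \<otimes>\<^sub>K 1\<^sub>m k)) dl
      @ map (\<lambda>i. HA i * (matTt S i \<otimes>\<^sub>K 1\<^sub>m k)) dl @ [D])"

lemma sum_list_idx_mult: "(\<Sum>i\<leftarrow>dl. f i * k) = (\<Sum>i = 1..\<nu>. f i) * k" for f :: "nat \<Rightarrow> nat"
  unfolding sum_delay_idx by (simp add: sum_distrib_right)

lemma sum_list_ds_const: "(\<Sum>i\<leftarrow>ds. k) = k + \<nu> * (k :: nat)"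
  by (simp add: sum_list_triv)

lemma dim_rowmat:
  assumes "\<And>i. i \<le> \<nu> \<Longrightarrow> MA i \<in> carrier_mat r k" "\<And>i. i \<in> idx \<Longrightarrow> HA i \<in> carrier_mat r (dimg S i * k)" "D \<in> carrier_mat r q"
  shows "rowmat r MA HA k D \<in> carrier_mat r (beta S * k + q)"
proof (rule carrier_matI)
  have a: "dim_row (MA i) = r" "dim_col (MA i) = k" if "i \<le> \<nu>" for i using assms(1)[OF that] by auto
  have b: "dim_row (HA i) = r" if "i \<in> idx" for i using assms(2)[OF that] by auto
  have dD: "dim_row D = r" using assms(3) by auto
  show "dim_row (rowmat r MA HA k D) = r" unfolding rowmat_def
    by (rule dim_row_hcat) (use a b dD in \<open>auto simp: set_delay_idx simp del: upt_Suc\<close>)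
  have 1: "(\<Sum>i\<leftarrow>ds. dim_col (MA i)) = k + \<nu> * k"
    unfolding sum_list_ds_const[symmetric] by (rule sum_list_cong) (use a in \<open>auto simp del: upt_Suc\<close>)
  have 2: "(\<Sum>i\<leftarrow>dl. dim_col (matT S i) * k) = toth S * k"
    unfolding toth_def sum_list_idx_mult[symmetric] by (rule sum_list_cong) (use dim_matT in \<open>force simp: set_delay_idx\<close>)
  have 3: "(\<Sum>i\<leftarrow>dl. dim_col (matTt S i) * k) = totphi S * k"
    unfolding totphi_def sum_list_idx_mult[symmetric] by (rule sum_list_cong) (use dim_matT in \<open>force simp: set_delay_idx\<close>)
  show "dim_col (rowmat r MA HA k D) = beta S * k + q"
    unfolding rowmat_def dim_col_hcat map_append sum_list_append list.map map_map comp_def index_mult_mat dim_kronecker index_one_mat beta_mult 1 2 3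
    using assms(3) by simp
qed

lemma bold_eq_rowmat:
  "boldA S = rowmat n (matA S) (hatA S) n (matD1 S)" "boldB1 S = rowmat n (matB S) (hatB S) p (0\<^sub>m n q)"
  "boldC S = rowmat m (matC S) (hatC S) n (matD2 S)" "boldB2 S = rowmat m (matE S) (hatE S) p (0\<^sub>m m q)"
  by (simp_all only: boldA_def boldB1_def boldC_def boldB2_def rowmat_def)

lemma dim_gain: "diag_block_mat [1\<^sub>m (beta S) \<otimes>\<^sub>K K, 0\<^sub>m q q] \<in> carrier_mat (beta S * p + q) NN"
  using dims_vars(1) by (auto simp: dim_diag_block_mat intro!: carrier_matI)

lemma dim_bold:
  "boldA S \<in> carrier_mat n NN" "boldB1 S \<in> carrier_mat n (beta S * p + q)"
  "boldC S \<in> carrier_mat m NN" "boldB2 S \<in> carrier_mat m (beta S * p + q)"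
  unfolding bold_eq_rowmat by (rule dim_rowmat; use dims_AB dims_hat dims_D in auto)+

lemma dim_Omega: "Omega S K \<in> carrier_mat n NN" "Sigma_cl S K \<in> carrier_mat m NN"
  unfolding Omega_def Sigma_cl_def using dim_bold dim_gain by auto

lemma dim_hatI: "hatI S \<in> carrier_mat (totf S * n) (toth S * n)"
proof -
  have "(\<Sum>i\<leftarrow>dl. dim_row (mat_inv (cholF S i))) = totf S"
    unfolding totf_def sum_delay_idx[symmetric] by (rule sum_list_cong) (use cholF(4) in \<open>force simp: set_delay_idx\<close>)
  moreover have "(\<Sum>i\<leftarrow>dl. dim_col (cholH S i)) = toth S"
    unfolding toth_def sum_delay_idx[symmetric] by (rule sum_list_cong) (use cholH(1) in \<open>force simp: set_delay_idx\<close>)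
  ultimately show ?thesis by (intro carrier_matI) (simp_all add: hatI_def dim_diag_block_mat comp_def)
qed

abbreviation "Ma i \<equiv> mat_inv (cholF S i) * col_mat (fnf S i (- del S (i - 1)))"
abbreviation "Mb i \<equiv> mat_inv (cholF S i) * col_mat (fnf S i (- del S i))"
abbreviation "Mc i \<equiv> mat_inv (cholF S i) * matM S i * cholH S i"

lemma dim_diagM:
  "diag_block_mat (map Ma dl) \<in> carrier_mat (totf S) \<nu>"
  "diag_block_mat (map Mb dl) \<in> carrier_mat (totf S) \<nu>"
  "diag_block_mat (map Mc dl) \<in> carrier_mat (totf S) (toth S)"
proof -
  have 1: "(\<Sum>i\<leftarrow>dl. dim_row (mat_inv (cholF S i))) = totf S"
    unfolding totf_def sum_delay_idx[symmetric] by (rule sum_list_cong) (use cholF(4) in \<open>force simp: set_delay_idx\<close>)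
  have 2: "(\<Sum>i\<leftarrow>dl. dim_col (cholH S i)) = toth S"
    unfolding toth_def sum_delay_idx[symmetric] by (rule sum_list_cong) (use cholH(1) in \<open>force simp: set_delay_idx\<close>)
  have 3: "(\<Sum>i\<leftarrow>dl. 1) = \<nu>" by (simp add: sum_list_triv length_delay_idx)
  show "diag_block_mat (map Ma dl) \<in> carrier_mat (totf S) \<nu>"
    "diag_block_mat (map Mb dl) \<in> carrier_mat (totf S) \<nu>"
    "diag_block_mat (map Mc dl) \<in> carrier_mat (totf S) (toth S)"
    using 1 2 3 by (auto simp: dim_diag_block_mat comp_def intro!: carrier_matI)
qed

lemma boldM_eq: "boldM S = hcat (totf S) [diag_block_mat (map Ma dl), 0\<^sub>m (totf S) 1, 0\<^sub>m (totf S) (toth S)]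
   - hcat (totf S) [0\<^sub>m (totf S) 1, diag_block_mat (map Mb dl), diag_block_mat (map Mc dl)]"
  by (simp add: boldM_def)

lemma dim_boldM: "boldM S \<in> carrier_mat (totf S) (1 + \<nu> + toth S)"
proof -
  have "dim_row (hcat (totf S) [0\<^sub>m (totf S) 1, diag_block_mat (map Mb dl), diag_block_mat (map Mc dl)]) = totf S"
    by (rule dim_row_hcat) (use dim_diagM in auto)
  then show ?thesis using dim_diagM unfolding boldM_eq by (intro carrier_matI) (auto simp: dim_col_hcat)
qed

definition "Mhat = hcat (totf S * n) [boldM S \<otimes>\<^sub>K 1\<^sub>m n, 0\<^sub>m (totf S * n) (totphi S * n + q)]"

lemma dim_Mhat: "Mhat \<in> carrier_mat (totf S * n) NN"
proof (rule carrier_matI)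
  show "dim_row Mhat = totf S * n" unfolding Mhat_def by (rule dim_row_hcat) (use dim_boldM in auto)
  show "dim_col Mhat = NN" unfolding Mhat_def dim_col_hcat using dim_boldM by (simp add: beta_mult algebra_simps)
qed

lemma dim_diagQ: "(\<And>i. i \<in> idx \<Longrightarrow> X i \<in> carrier_mat n n) \<Longrightarrow> diagQ S X \<in> carrier_mat (\<nu> * n) (\<nu> * n)"
proof -
  assume X: "\<And>i. i \<in> idx \<Longrightarrow> X i \<in> carrier_mat n n"
  have "(\<Sum>i\<leftarrow>dl. dim_row (X i)) = \<nu> * n" "(\<Sum>i\<leftarrow>dl. dim_col (X i)) = \<nu> * n"
    using X sum_list_cong[of dl "\<lambda>i. dim_row (X i)" "\<lambda>i. n"] sum_list_cong[of dl "\<lambda>i. dim_col (X i)" "\<lambda>i. n"]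
    by (force simp: set_delay_idx sum_list_triv length_delay_idx)+
  then show ?thesis by (intro carrier_matI) (auto simp: diagQ_def dim_diag_block_mat comp_def)
qed

lemma dim_Lambda: "Lambda S \<in> carrier_mat (\<nu> * n) (\<nu> * n)"
  by (intro carrier_matI) (auto simp: Lambda_def dim_diag_block_mat comp_def sum_list_triv length_delay_idx)

lemma dim_diagR:
  "diag_block_mat (map (\<lambda>i. 1\<^sub>m (dimh S i) \<otimes>\<^sub>K R i) dl) \<in> carrier_mat (toth S * n) (toth S * n)"
  "diag_block_mat (map (\<lambda>i. 1\<^sub>m (dimphi S i) \<otimes>\<^sub>K R i) dl) \<in> carrier_mat (totphi S * n) (totphi S * n)"
proof -
  have "(\<Sum>i\<leftarrow>dl. dimh S i * dim_row (R i)) = toth S * n" "(\<Sum>i\<leftarrow>dl. dimh S i * dim_col (R i)) = toth S * n"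
    "(\<Sum>i\<leftarrow>dl. dimphi S i * dim_row (R i)) = totphi S * n" "(\<Sum>i\<leftarrow>dl. dimphi S i * dim_col (R i)) = totphi S * n"
    unfolding toth_def totphi_def sum_list_idx_mult[symmetric]
    by (rule sum_list_cong; use dims_vars(8) in \<open>force simp: set_delay_idx\<close>)+
  then show "diag_block_mat (map (\<lambda>i. 1\<^sub>m (dimh S i) \<otimes>\<^sub>K R i) dl) \<in> carrier_mat (toth S * n) (toth S * n)"
    "diag_block_mat (map (\<lambda>i. 1\<^sub>m (dimphi S i) \<otimes>\<^sub>K R i) dl) \<in> carrier_mat (totphi S * n) (totphi S * n)"
    by (auto simp: dim_diag_block_mat comp_def intro!: carrier_matI)
qed

lemma dim_Xi: "Xi S J Q R \<in> carrier_mat NN NN"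
  using dim_diagQ[of Q, OF dims_vars(7)] dim_diagR dims_supply(5)
  by (intro carrier_matI) (auto simp: Xi_def Let_def beta_mult)

lemma matS_form:
  assumes "dim_vec x0 = n" "dim_vec x1 = \<nu> * n" "dim_vec x2 = toth S * n" "dim_vec x3 = totphi S * n" "dim_vec w = q"
  shows "matS S *\<^sub>v (x0 @\<^sub>v x1 @\<^sub>v x2 @\<^sub>v x3 @\<^sub>v w) = x0 @\<^sub>v (hatI S *\<^sub>v x2)"
proof -
  note d = dim_hatI
  have 1: "hcat n [1\<^sub>m n, 0\<^sub>m n (\<nu> * n), 0\<^sub>m n (toth S * n), 0\<^sub>m n (totphi S * n), 0\<^sub>m n q] *\<^sub>v (x0 @\<^sub>v x1 @\<^sub>v x2 @\<^sub>v x3 @\<^sub>v w) = x0"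
    using assms by (subst hcat_Cons_form; (auto; fail)?)+ (subst hcat_single_form; auto simp: mmv_zero_mat mmv_one intro!: eq_vecI)
  have 2: "hcat (totf S * n) [0\<^sub>m (totf S * n) n, 0\<^sub>m (totf S * n) (\<nu> * n), hatI S, 0\<^sub>m (totf S * n) (totphi S * n), 0\<^sub>m (totf S * n) q]
    *\<^sub>v (x0 @\<^sub>v x1 @\<^sub>v x2 @\<^sub>v x3 @\<^sub>v w) = hatI S *\<^sub>v x2"
    using assms d by (subst hcat_Cons_form; (auto; fail)?)+ (subst hcat_single_form; auto simp: mmv_zero_mat intro!: eq_vecI)
  have "matS S *\<^sub>v (x0 @\<^sub>v x1 @\<^sub>v x2 @\<^sub>v x3 @\<^sub>v w) =
    (hcat n [1\<^sub>m n, 0\<^sub>m n (\<nu> * n), 0\<^sub>m n (toth S * n), 0\<^sub>m n (totphi S * n), 0\<^sub>m n q] *\<^sub>v (x0 @\<^sub>v x1 @\<^sub>v x2 @\<^sub>v x3 @\<^sub>v w)) @\<^sub>v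
    (hcat (totf S * n) [0\<^sub>m (totf S * n) n, 0\<^sub>m (totf S * n) (\<nu> * n), hatI S, 0\<^sub>m (totf S * n) (totphi S * n), 0\<^sub>m (totf S * n) q]
    *\<^sub>v (x0 @\<^sub>v x1 @\<^sub>v x2 @\<^sub>v x3 @\<^sub>v w))"
    unfolding matS_def Let_def using assms d by (intro append_rows_form) (auto simp: dim_col_hcat)
  then show ?thesis unfolding 1 2 .
qed

lemma dim_matS: "matS S \<in> carrier_mat (n + totf S * n) NN"
proof (rule carrier_matI)
  show "dim_row (matS S) = n + totf S * n" unfolding matS_def Let_def dim_append_rows
    by (intro arg_cong2[of _ _ _ _ "(+)"] dim_row_hcat) (use dim_hatI in auto)
  show "dim_col (matS S) = NN" unfolding matS_def Let_def dim_append_rows dim_col_hcat using dim_hatI by (simp add: beta_mult)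
qed

section \<open>The dissipation matrix as a bilinear form\<close>

abbreviation "PP \<equiv> sym_block P1 P2 P3"

text \<open>The bilinear form of the matrix inside \<open>Sy\<close> in \<open>Psi\<close>. Only the
  last q coordinates of \<xi>', those of the disturbance, meet J2, because the rows above it are
  zero.\<close>

definition half_Psi :: "real vec \<Rightarrow> real vec \<Rightarrow> real" where
  "half_Psi \<xi>' \<xi> = (matS S *\<^sub>v \<xi>') \<bullet> (PP *\<^sub>v ((Omega S K *\<^sub>v \<xi>) @\<^sub>v (Mhat *\<^sub>v \<xi>)))
     - vec_last \<xi>' q \<bullet> ((matJ2 J)\<^sup>T *\<^sub>v (Sigma_cl S K *\<^sub>v \<xi>))"

lemma Psi_form:
  assumes "dim_vec \<xi> = NN" "dim_vec \<xi>' = NN"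
  shows "\<xi>' \<bullet> (Psi S J K P1 P2 P3 Q R *\<^sub>v \<xi>) = half_Psi \<xi>' \<xi> + half_Psi \<xi> \<xi>' + \<xi>' \<bullet> (Xi S J Q R *\<^sub>v \<xi>)"
proof -
  note d = dim_matS dim_Omega dim_Mhat dim_Xi dims_supply dims_vars
  define X where "X = (matS S)\<^sup>T * PP * (Omega S K @\<^sub>r Mhat) - (0\<^sub>m (beta S * n) m @\<^sub>r (matJ2 J)\<^sup>T) * Sigma_cl S K"
  have dX: "dim_row X = NN" "dim_col X = NN" using d by (auto simp: X_def)
  have P: "Psi S J K P1 P2 P3 Q R = Sy X + Xi S J Q R"
    by (simp add: Psi_def X_def Let_def Mhat_def)
  have X: "\<eta>' \<bullet> (X *\<^sub>v \<eta>) = half_Psi \<eta>' \<eta>" if e: "dim_vec \<eta> = NN" "dim_vec \<eta>' = NN" for \<eta> \<eta>'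
  proof -
    obtain a b where ab: "\<eta>' = a @\<^sub>v b" "dim_vec a = beta S * n" "dim_vec b = q" using e(2) by (rule vec_split)
    have "X *\<^sub>v \<eta> = ((matS S)\<^sup>T * PP * (Omega S K @\<^sub>r Mhat)) *\<^sub>v \<eta> - ((0\<^sub>m (beta S * n) m @\<^sub>r (matJ2 J)\<^sup>T) * Sigma_cl S K) *\<^sub>v \<eta>"
      unfolding X_def using d e by (intro mmv_minus) auto
    also have "((matS S)\<^sup>T * PP * (Omega S K @\<^sub>r Mhat)) *\<^sub>v \<eta> = (matS S)\<^sup>T *\<^sub>v (PP *\<^sub>v ((Omega S K *\<^sub>v \<eta>) @\<^sub>v (Mhat *\<^sub>v \<eta>)))"
      using d e by (simp add: mmv_mult append_rows_form)
    also have "((0\<^sub>m (beta S * n) m @\<^sub>r (matJ2 J)\<^sup>T) * Sigma_cl S K) *\<^sub>v \<eta> = 0\<^sub>v (beta S * n) @\<^sub>v ((matJ2 J)\<^sup>T *\<^sub>v (Sigma_cl S K *\<^sub>v \<eta>))"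
      using d e by (simp add: mmv_mult append_rows_form mmv_zero_mat)
    finally have "\<eta>' \<bullet> (X *\<^sub>v \<eta>) = \<eta>' \<bullet> ((matS S)\<^sup>T *\<^sub>v (PP *\<^sub>v ((Omega S K *\<^sub>v \<eta>) @\<^sub>v (Mhat *\<^sub>v \<eta>))))
       - \<eta>' \<bullet> (0\<^sub>v (beta S * n) @\<^sub>v ((matJ2 J)\<^sup>T *\<^sub>v (Sigma_cl S K *\<^sub>v \<eta>)))"
      using d by (simp add: sp_minus_right)
    also have "\<eta>' \<bullet> (0\<^sub>v (beta S * n) @\<^sub>v ((matJ2 J)\<^sup>T *\<^sub>v (Sigma_cl S K *\<^sub>v \<eta>))) = b \<bullet> ((matJ2 J)\<^sup>T *\<^sub>v (Sigma_cl S K *\<^sub>v \<eta>))"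
      unfolding ab(1) using ab d by (simp add: sp_append sp_zero_right)
    also have "\<eta>' \<bullet> ((matS S)\<^sup>T *\<^sub>v (PP *\<^sub>v ((Omega S K *\<^sub>v \<eta>) @\<^sub>v (Mhat *\<^sub>v \<eta>)))) =
       (PP *\<^sub>v ((Omega S K *\<^sub>v \<eta>) @\<^sub>v (Mhat *\<^sub>v \<eta>))) \<bullet> (matS S *\<^sub>v \<eta>')"
      using d e by (intro sp_transpose) auto
    also have "\<dots> = (matS S *\<^sub>v \<eta>') \<bullet> (PP *\<^sub>v ((Omega S K *\<^sub>v \<eta>) @\<^sub>v (Mhat *\<^sub>v \<eta>)))"
      using d by (intro sp_comm) auto
    finally show ?thesis unfolding half_Psi_def ab(1) using ab by (simp add: vec_last_append)
  qed
  have "Psi S J K P1 P2 P3 Q R *\<^sub>v \<xi> = Sy X *\<^sub>v \<xi> + Xi S J Q R *\<^sub>v \<xi>"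
    unfolding P using d dX assms by (intro mmv_add) auto
  then show ?thesis using d dX assms by (simp add: sp_add_right Sy_form X)
qed

lemma dim_Psi: "Psi S J K P1 P2 P3 Q R \<in> carrier_mat NN NN"
  using dim_Xi by (auto simp: Psi_def Let_def)

lemma dissipation_matrix_form:
  assumes "dim_vec \<xi> = NN" "dim_vec \<xi>' = NN" "dim_vec y = m" "dim_vec y' = m"
  shows "(\<xi>' @\<^sub>v y') \<bullet> (dissipation_matrix S J K P1 P2 P3 Q R *\<^sub>v (\<xi> @\<^sub>v y)) =
    half_Psi \<xi>' \<xi> + half_Psi \<xi> \<xi>' + \<xi>' \<bullet> (Xi S J Q R *\<^sub>v \<xi>) + y \<bullet> (matJt J *\<^sub>v (Sigma_cl S K *\<^sub>v \<xi>'))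
     + y' \<bullet> (matJt J *\<^sub>v (Sigma_cl S K *\<^sub>v \<xi>)) + y' \<bullet> (matJ1 J *\<^sub>v y)"
proof -
  note d = dim_Omega dims_supply dim_Psi
  have t: "\<eta> \<bullet> (((Sigma_cl S K)\<^sup>T * (matJt J)\<^sup>T) *\<^sub>v z) = z \<bullet> (matJt J *\<^sub>v (Sigma_cl S K *\<^sub>v \<eta>))" if "dim_vec \<eta> = NN" "dim_vec z = m" for \<eta> z
    using d that by (simp add: mmv_mult sp_transpose sp_comm[of _ "Sigma_cl S K *\<^sub>v \<eta>"])
  have "(\<xi>' @\<^sub>v y') \<bullet> (dissipation_matrix S J K P1 P2 P3 Q R *\<^sub>v (\<xi> @\<^sub>v y)) =
     \<xi>' \<bullet> (Psi S J K P1 P2 P3 Q R *\<^sub>v \<xi>) + \<xi>' \<bullet> (((Sigma_cl S K)\<^sup>T * (matJt J)\<^sup>T) *\<^sub>v y)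
     + \<xi> \<bullet> (((Sigma_cl S K)\<^sup>T * (matJt J)\<^sup>T) *\<^sub>v y') + y' \<bullet> (matJ1 J *\<^sub>v y)"
    unfolding dissipation_matrix_def by (rule sym_block_form) (use d assms in auto)
  then show ?thesis using assms by (simp add: t Psi_form)
qed

lemma boldP_form:
  assumes "dim_vec x0 = n" "dim_vec x1 = \<nu> * n" "dim_vec x2 = toth S * n" "dim_vec x3 = totphi S * n + q + m"
  shows "boldP S P1 P2 *\<^sub>v (x0 @\<^sub>v x1 @\<^sub>v x2 @\<^sub>v x3) = P1 *\<^sub>v x0 + P2 *\<^sub>v (hatI S *\<^sub>v x2)"
proof -
  note d = dim_hatI dims_vars(2,4)
  have "boldP S P1 P2 *\<^sub>v (x0 @\<^sub>v x1 @\<^sub>v x2 @\<^sub>v x3) =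
    P1 *\<^sub>v x0 + (0\<^sub>m n (\<nu> * n) *\<^sub>v x1 + ((P2 * hatI S) *\<^sub>v x2 + 0\<^sub>m n (totphi S * n + q + m) *\<^sub>v x3))"
    unfolding boldP_def Let_def
    using assms d by (subst hcat_Cons_form; (auto; fail)?)+ (subst hcat_single_form; auto)
  also have "\<dots> = P1 *\<^sub>v x0 + P2 *\<^sub>v (hatI S *\<^sub>v x2)"
    using assms d by (intro eq_vecI) (auto simp: mmv_zero_mat mmv_mult)
  finally show ?thesis .
qed

text \<open>The term with S, P and the stacked rows \<Omega> and M consists of four products: the
  two with \<Omega> make up P^T \<Pi>, the two with M the first product in \<Phi>. The J2 terms and
  the coupling by J~ are collected in the second product.\<close>

lemma dissipation_matrix_eq:
  "dissipation_matrix S J K P1 P2 P3 Q R = Sy ((boldP S P1 P2)\<^sup>T * boldPi S K) + boldPhi S J K P2 P3 Q R"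
proof -
  note d = dim_Omega dims_supply dim_Psi dim_hatI dims_vars dim_Xi dim_boldM
  define Z1 where "Z1 = hcat (totf S * n) [boldM S \<otimes>\<^sub>K 1\<^sub>m n, 0\<^sub>m (totf S * n) (totphi S * n + q + m)]"
  define Z2 where "Z2 = hcat m [Sigma_cl S K, 0\<^sub>m m m]"
  define Y1 where "Y1 = vcat (totf S * n) [P2, 0\<^sub>m (\<nu> * n) (totf S * n), (hatI S)\<^sup>T * P3, 0\<^sub>m (totphi S * n + q + m) (totf S * n)]"
  define Y2 where "Y2 = vcat m [0\<^sub>m (beta S * n) m, - (matJ2 J)\<^sup>T, matJt J]"
  define B where "B = diag_block_mat [Xi S J Q R, matJ1 J]"
  have Phi: "boldPhi S J K P2 P3 Q R = Sy (Y1 * Z1 + Y2 * Z2) + B"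
    by (simp add: boldPhi_def Let_def Y1_def Y2_def Z1_def Z2_def B_def)
  have dP: "dim_row (boldP S P1 P2) = n" "dim_col (boldP S P1 P2) = NN + m"
    unfolding boldP_def Let_def by ((rule dim_row_hcat, use d in auto)[1], use d in \<open>auto simp: dim_col_hcat beta_mult\<close>)
  have dPi: "dim_row (boldPi S K) = n" "dim_col (boldPi S K) = NN + m"
    unfolding boldPi_def by ((rule dim_row_hcat, use d in auto)[1], use d in \<open>auto simp: dim_col_hcat\<close>)
  have dZ1: "dim_row Z1 = totf S * n" "dim_col Z1 = NN + m"
    unfolding Z1_def by ((rule dim_row_hcat, use d in auto)[1], use d in \<open>auto simp: dim_col_hcat beta_mult algebra_simps\<close>)
  have dZ2: "dim_row Z2 = m" "dim_col Z2 = NN + m"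
    unfolding Z2_def by ((rule dim_row_hcat, use d in auto)[1], use d in \<open>auto simp: dim_col_hcat\<close>)
  have dY1: "dim_row Y1 = NN + m" "dim_col Y1 = totf S * n"
    unfolding Y1_def by (use d in \<open>auto simp: dim_vcat(1) beta_mult\<close>)[1] (rule dim_vcat(2), use d in auto)
  have dY2: "dim_row Y2 = NN + m" "dim_col Y2 = m"
    unfolding Y2_def by (use d in \<open>auto simp: dim_vcat(1)\<close>)[1] (rule dim_vcat(2), use d in auto)
  have dB: "dim_row B = NN + m" "dim_col B = NN + m" using d by (auto simp: B_def)
  note dd = dP dPi dZ1 dZ2 dY1 dY2 dB
  have dL: "dim_row (dissipation_matrix S J K P1 P2 P3 Q R) = NN + m" "dim_col (dissipation_matrix S J K P1 P2 P3 Q R) = NN + m"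
    using d by (auto simp: dissipation_matrix_def)
  show ?thesis
  proof (rule mat_eq_by_forms)
    fix u v :: "real vec"
    assume "dim_vec u = dim_row (Sy ((boldP S P1 P2)\<^sup>T * boldPi S K) + boldPhi S J K P2 P3 Q R)"
      "dim_vec v = dim_col (Sy ((boldP S P1 P2)\<^sup>T * boldPi S K) + boldPhi S J K P2 P3 Q R)"
    then have du: "dim_vec u = NN + m" "dim_vec v = NN + m" unfolding Phi using dd by auto
    \<comment> \<open>The identity before symmetrisation. It is proved for arbitrary splittings
      because \<open>Sy\<close> also uses it with u and v exchanged.\<close>
    have key: "u \<bullet> (((boldP S P1 P2)\<^sup>T * boldPi S K) *\<^sub>v v) + u \<bullet> ((Y1 * Z1 + Y2 * Z2) *\<^sub>v v) =
       half_Psi \<xi>' \<xi> + y' \<bullet> (matJt J *\<^sub>v (Sigma_cl S K *\<^sub>v \<xi>))"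
      if uv: "u = \<xi>' @\<^sub>v y'" "v = \<xi> @\<^sub>v y" and dx: "dim_vec \<xi>' = NN" "dim_vec \<xi> = NN" "dim_vec y' = m" "dim_vec y = m" for u v \<xi> \<xi>' y y'
    proof -
      have du: "dim_vec u = NN + m" "dim_vec v = NN + m" using uv dx by auto
      obtain x0 r1 where r1: "\<xi>' = x0 @\<^sub>v r1" "dim_vec x0 = n" "dim_vec r1 = \<nu> * n + (toth S * n + (totphi S * n + q))"
        using vec_split[of \<xi>' n "\<nu> * n + (toth S * n + (totphi S * n + q))"] dx by (auto simp: beta_mult)
      obtain x1 r2 where r2: "r1 = x1 @\<^sub>v r2" "dim_vec x1 = \<nu> * n" "dim_vec r2 = toth S * n + (totphi S * n + q)" using r1(3) by (rule vec_split)
      obtain x2 r3 where r3: "r2 = x2 @\<^sub>v r3" "dim_vec x2 = toth S * n" "dim_vec r3 = totphi S * n + q" using r2(3) by (rule vec_split)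
      obtain x3 w where r4: "r3 = x3 @\<^sub>v w" "dim_vec x3 = totphi S * n" "dim_vec w = q" using r3(3) by (rule vec_split)
      have xi': "\<xi>' = x0 @\<^sub>v x1 @\<^sub>v x2 @\<^sub>v x3 @\<^sub>v w" unfolding r1 r2 r3 r4 ..
      \<comment> \<open>Two bracketings of the same vector, one for the row blocks of Y1 and one for
        those of Y2.\<close>
      have u1: "u = x0 @\<^sub>v x1 @\<^sub>v x2 @\<^sub>v (x3 @\<^sub>v w @\<^sub>v y')" unfolding uv xi' append_vec_assoc ..
      have u2: "u = (x0 @\<^sub>v x1 @\<^sub>v x2 @\<^sub>v x3) @\<^sub>v w @\<^sub>v y'" unfolding uv xi' append_vec_assoc ..
      have w: "vec_last \<xi>' q = w" unfolding xi' append_vec_assoc[symmetric] by (rule vec_last_append[OF r4(3)])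
      obtain a b where ab: "\<xi> = a @\<^sub>v b" "dim_vec a = (1 + \<nu> + toth S) * n" "dim_vec b = totphi S * n + q"
        using vec_split[of \<xi> "(1 + \<nu> + toth S) * n" "totphi S * n + q"] dx by (auto simp: beta_mult algebra_simps)
      have v2: "v = a @\<^sub>v (b @\<^sub>v y)" unfolding uv ab append_vec_assoc ..
      have Mx: "Mhat *\<^sub>v \<xi> = (boldM S \<otimes>\<^sub>K 1\<^sub>m n) *\<^sub>v a"
        unfolding Mhat_def ab(1) using ab d by (intro hcat_zero_form) auto
      have Z1v: "Z1 *\<^sub>v v = Mhat *\<^sub>v \<xi>"
        unfolding Mx Z1_def v2 using ab dx d by (intro hcat_zero_form) auto
      have Z2v: "Z2 *\<^sub>v v = Sigma_cl S K *\<^sub>v \<xi>"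
        unfolding Z2_def uv(2) using dx d by (intro hcat_zero_form) auto
      have Piv: "boldPi S K *\<^sub>v v = Omega S K *\<^sub>v \<xi>"
        unfolding boldPi_def uv(2) using dx d by (intro hcat_zero_form) auto
      define mx where "mx = Mhat *\<^sub>v \<xi>"
      define ox where "ox = Omega S K *\<^sub>v \<xi>"
      define sx where "sx = Sigma_cl S K *\<^sub>v \<xi>"
      define hx where "hx = hatI S *\<^sub>v x2"
      have dm: "dim_vec mx = totf S * n" "dim_vec ox = n" "dim_vec sx = m" "dim_vec hx = totf S * n"
        using dim_Mhat d by (auto simp: mx_def ox_def sx_def hx_def)
      have Pu: "boldP S P1 P2 *\<^sub>v u = P1 *\<^sub>v x0 + P2 *\<^sub>v hx"
        unfolding u1 hx_def using r2 r3 r4 r1(2) dx by (intro boldP_form) auto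
      have t1: "u \<bullet> (((boldP S P1 P2)\<^sup>T * boldPi S K) *\<^sub>v v) = ox \<bullet> (P1 *\<^sub>v x0) + ox \<bullet> (P2 *\<^sub>v hx)"
      proof -
        have "((boldP S P1 P2)\<^sup>T * boldPi S K) *\<^sub>v v = (boldP S P1 P2)\<^sup>T *\<^sub>v ox"
          using dd du by (simp add: mmv_mult Piv ox_def)
        then have "u \<bullet> (((boldP S P1 P2)\<^sup>T * boldPi S K) *\<^sub>v v) = ox \<bullet> (boldP S P1 P2 *\<^sub>v u)"
          using dd du dm by (simp add: sp_transpose)
        then show ?thesis unfolding Pu using d by (simp add: sp_add_right)
      qed
      have Y1m: "Y1 *\<^sub>v mx = (P2 *\<^sub>v mx) @\<^sub>v 0\<^sub>v (\<nu> * n) @\<^sub>v ((hatI S)\<^sup>T *\<^sub>v (P3 *\<^sub>v mx)) @\<^sub>v 0\<^sub>v (totphi S * n + q + m)"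
        unfolding Y1_def using dm d by (simp add: vcat_form vcat_Nil_form append_vNil mmv_zero_mat mmv_mult)
      have Y2s: "Y2 *\<^sub>v sx = 0\<^sub>v (beta S * n) @\<^sub>v (- ((matJ2 J)\<^sup>T *\<^sub>v sx)) @\<^sub>v (matJt J *\<^sub>v sx)"
        unfolding Y2_def using dm d by (simp add: vcat_form vcat_Nil_form append_vNil mmv_zero_mat)
      have t2: "u \<bullet> ((Y1 * Z1 + Y2 * Z2) *\<^sub>v v) = u \<bullet> (Y1 *\<^sub>v mx) + u \<bullet> (Y2 *\<^sub>v sx)"
      proof -
        have "(Y1 * Z1 + Y2 * Z2) *\<^sub>v v = (Y1 * Z1) *\<^sub>v v + (Y2 * Z2) *\<^sub>v v" using dd du by (intro mmv_add) auto
        then show ?thesis using dd du by (simp add: mmv_mult sp_add_right Z1v Z2v mx_def sx_def)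
      qed
      have t3: "u \<bullet> (Y1 *\<^sub>v mx) = x0 \<bullet> (P2 *\<^sub>v mx) + x2 \<bullet> ((hatI S)\<^sup>T *\<^sub>v (P3 *\<^sub>v mx))"
        unfolding Y1m u1 using r1 r2 r3 r4 d dm dx by (simp add: sp_append sp_zero_right)
      have t4: "x2 \<bullet> ((hatI S)\<^sup>T *\<^sub>v (P3 *\<^sub>v mx)) = hx \<bullet> (P3 *\<^sub>v mx)"
        using r3 d dm by (simp add: sp_transpose hx_def sp_comm)
      have t5: "u \<bullet> (Y2 *\<^sub>v sx) = - (w \<bullet> ((matJ2 J)\<^sup>T *\<^sub>v sx)) + y' \<bullet> (matJt J *\<^sub>v sx)"
        unfolding Y2s u2 using r1 r2 r3 r4 d dm dx by (simp add: sp_append sp_zero_right sp_uminus_right beta_mult)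
      have Sx: "matS S *\<^sub>v \<xi>' = x0 @\<^sub>v hx"
        unfolding xi' hx_def using r1 r2 r3 r4 by (intro matS_form) auto
      have t6: "(x0 @\<^sub>v hx) \<bullet> (PP *\<^sub>v (ox @\<^sub>v mx)) = x0 \<bullet> (P1 *\<^sub>v ox) + x0 \<bullet> (P2 *\<^sub>v mx) + ox \<bullet> (P2 *\<^sub>v hx) + hx \<bullet> (P3 *\<^sub>v mx)"
        by (rule sym_block_form[of _ n _ "totf S * n"]) (use dm r1 dims_vars(2,4,5) in auto)
      \<comment> \<open>The symmetry of P1 enters here: P^T \<Pi> produces the form with its
        arguments in the other order.\<close>
      have t7: "x0 \<bullet> (P1 *\<^sub>v ox) = ox \<bullet> (P1 *\<^sub>v x0)"
        using sp_transpose[of ox P1 x0] dims_vars(2,3) dm r1 by simp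
      show ?thesis
        unfolding half_Psi_def Sx w t1 t2 t3 t4 t5 ox_def[symmetric] mx_def[symmetric] sx_def[symmetric] t6 t7 by simp
    qed
    obtain \<xi>' y' where uu: "u = \<xi>' @\<^sub>v y'" "dim_vec \<xi>' = NN" "dim_vec y' = m" using du(1) by (rule vec_split)
    obtain \<xi> y where vv: "v = \<xi> @\<^sub>v y" "dim_vec \<xi> = NN" "dim_vec y = m" using du(2) by (rule vec_split)
    have Bv: "u \<bullet> (B *\<^sub>v v) = \<xi>' \<bullet> (Xi S J Q R *\<^sub>v \<xi>) + y' \<bullet> (matJ1 J *\<^sub>v y)"
    proof -
      have "B *\<^sub>v v = (Xi S J Q R *\<^sub>v \<xi>) @\<^sub>v (diag_block_mat [matJ1 J] *\<^sub>v y)"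
        unfolding B_def vv using vv d by (intro diag_block_Cons_form) auto
      then show ?thesis unfolding uu(1) using uu d by (simp add: sp_append del: diag_block_mat.simps)
    qed
    have "(Sy ((boldP S P1 P2)\<^sup>T * boldPi S K) + boldPhi S J K P2 P3 Q R) *\<^sub>v v =
       Sy ((boldP S P1 P2)\<^sup>T * boldPi S K) *\<^sub>v v + (Sy (Y1 * Z1 + Y2 * Z2) *\<^sub>v v + B *\<^sub>v v)"
      unfolding Phi using dd du by (simp add: mmv_add)
    then have "u \<bullet> ((Sy ((boldP S P1 P2)\<^sup>T * boldPi S K) + boldPhi S J K P2 P3 Q R) *\<^sub>v v) =
       u \<bullet> (Sy ((boldP S P1 P2)\<^sup>T * boldPi S K) *\<^sub>v v) + (u \<bullet> (Sy (Y1 * Z1 + Y2 * Z2) *\<^sub>v v) + u \<bullet> (B *\<^sub>v v))"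
      using dd by (simp add: sp_add_right)
    also have "\<dots> = (u \<bullet> (((boldP S P1 P2)\<^sup>T * boldPi S K) *\<^sub>v v) + u \<bullet> ((Y1 * Z1 + Y2 * Z2) *\<^sub>v v))
       + (v \<bullet> (((boldP S P1 P2)\<^sup>T * boldPi S K) *\<^sub>v u) + v \<bullet> ((Y1 * Z1 + Y2 * Z2) *\<^sub>v u)) + u \<bullet> (B *\<^sub>v v)"
      using dd du by (simp add: Sy_form)
    also have "\<dots> = u \<bullet> (dissipation_matrix S J K P1 P2 P3 Q R *\<^sub>v v)"
      unfolding key[OF uu(1) vv(1) uu(2) vv(2) uu(3) vv(3)] key[OF vv(1) uu(1) vv(2) uu(2) vv(3) uu(3)] Bv
      unfolding uu(1) vv(1) dissipation_matrix_form[OF vv(2) uu(2) vv(3) uu(3)] by simp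
    finally show "u \<bullet> (dissipation_matrix S J K P1 P2 P3 Q R *\<^sub>v v) = u \<bullet> ((Sy ((boldP S P1 P2)\<^sup>T * boldPi S K) + boldPhi S J K P2 P3 Q R) *\<^sub>v v)" by simp
  qed (use dL dd Phi in auto)
qed

section \<open>Delay intervals and vectors with the block structure of the system\<close>

lemma delay_mono: "i \<le> j \<Longrightarrow> j \<le> \<nu> \<Longrightarrow> del S i \<le> del S j"
proof (induction j rule: dec_induct)
  case (step k)
  then have "del S k < del S (Suc k)" using vs by (auto simp: valid_system_def Suc_le_eq)
  then show ?case using step by simp
qed simp

lemma delay_less: "i \<in> idx \<Longrightarrow> del S (i - 1) < del S i"
proof -
  assume i: "i \<in> idx"
  then obtain k where k: "i = Suc k" by (cases i) auto
  then show ?thesis using vs i by (auto simp: valid_system_def)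
qed

lemma delay_0: "del S 0 = 0" using vs by (simp add: valid_system_def)

lemma ivl_endpoints:
  assumes "i \<in> idx"
  shows "- del S i \<in> ivl S i" "- del S (i - 1) \<in> ivl S i" "ivl S i \<subseteq> hist S"
  using delay_less[OF assms] delay_mono[of i \<nu>] delay_mono[of 0 "i - 1"] assms by (auto simp: ivl_def hist_def delay_0)

lemma dim_fn:
  assumes "i \<in> idx" "\<tau> \<in> ivl S i"
  shows "dim_vec (fnf S i \<tau>) = dimf S i" "dim_vec (fnvphi S i \<tau>) = dimvphi S i" "dim_vec (fnphi S i \<tau>) = dimphi S i"
    "dim_vec (fnh S i \<tau>) = dimh S i" "dim_vec (fng S i \<tau>) = dimg S i"
proof -
  have k: "fnf S i \<in> W12_vec (- del S i) (- del S (i - 1)) (dimf S i)" "fnvphi S i \<in> L2_vec (ivl S i) (dimvphi S i)"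
     "fnphi S i \<in> L2_vec (ivl S i) (dimphi S i)"
    using kd assms(1) unfolding kernel_decomposition_def by auto
  show a: "dim_vec (fnf S i \<tau>) = dimf S i" "dim_vec (fnvphi S i \<tau>) = dimvphi S i" "dim_vec (fnphi S i \<tau>) = dimphi S i"
    using k assms(2) unfolding W12_vec_def L2_vec_def ivl_def by auto
  then show "dim_vec (fnh S i \<tau>) = dimh S i" "dim_vec (fng S i \<tau>) = dimg S i"
    by (auto simp: fnh_def fng_def dimh_def dimg_def)
qed

text \<open>Vectors with the block structure of $\vartheta(t)$: \<open>X i\<close> and \<open>Y i\<close> are the moments against $h_i$ and $\varepsilon_i$.\<close>

definition blk :: "(nat \<Rightarrow> real vec) \<Rightarrow> (nat \<Rightarrow> real vec) \<Rightarrow> (nat \<Rightarrow> real vec) \<Rightarrow> real vec \<Rightarrow> real vec" where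
  "blk x X Y w = cv (map x ds) @\<^sub>v cv (map X dl) @\<^sub>v cv (map Y dl) @\<^sub>v w"

definition bdims :: "nat \<Rightarrow> (nat \<Rightarrow> real vec) \<Rightarrow> (nat \<Rightarrow> real vec) \<Rightarrow> (nat \<Rightarrow> real vec) \<Rightarrow> real vec \<Rightarrow> bool" where
  "bdims k x X Y w \<longleftrightarrow> (\<forall>i\<le>\<nu>. dim_vec (x i) = k) \<and> (\<forall>i\<in>idx. dim_vec (X i) = dimh S i * k \<and> dim_vec (Y i) = dimphi S i * k) \<and> dim_vec w = q"

lemma bdimsD:
  assumes "bdims k x X Y w"
  shows "i \<le> \<nu> \<Longrightarrow> dim_vec (x i) = k" "i \<in> idx \<Longrightarrow> dim_vec (X i) = dimh S i * k" "i \<in> idx \<Longrightarrow> dim_vec (Y i) = dimphi S i * k" "dim_vec w = q"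
  using assms by (auto simp: bdims_def)

lemma dim_cv_blocks:
  assumes "bdims k x X Y w"
  shows "dim_vec (cv (map x ds)) = k + \<nu> * k" "dim_vec (cv (map X dl)) = toth S * k" "dim_vec (cv (map Y dl)) = totphi S * k"
    "dim_vec (cv (map x dl)) = \<nu> * k" "dim_vec (cv (map (\<lambda>i. x (i - 1)) dl)) = \<nu> * k"
proof -
  have sn: "(\<Sum>i\<leftarrow>dl. k) = \<nu> * k" by (simp add: sum_list_triv length_delay_idx)
  show "dim_vec (cv (map x ds)) = k + \<nu> * k"
    unfolding dim_cv map_map comp_def sum_list_ds_const[symmetric] by (rule sum_list_cong) (use bdimsD[OF assms] in \<open>auto simp del: upt_Suc\<close>)
  show "dim_vec (cv (map X dl)) = toth S * k" "dim_vec (cv (map Y dl)) = totphi S * k"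
    unfolding dim_cv map_map comp_def toth_def totphi_def sum_list_idx_mult[symmetric]
    by (rule sum_list_cong; use bdimsD[OF assms] in \<open>auto simp: set_delay_idx\<close>)+
  show "dim_vec (cv (map x dl)) = \<nu> * k" "dim_vec (cv (map (\<lambda>i. x (i - 1)) dl)) = \<nu> * k"
    unfolding dim_cv map_map comp_def sn[symmetric]
    by (rule sum_list_cong; use bdimsD[OF assms] in \<open>auto simp: set_delay_idx\<close>)+
qed

lemma dim_blk: "bdims k x X Y w \<Longrightarrow> dim_vec (blk x X Y w) = beta S * k + q"
  using dim_cv_blocks[of k x X Y w] bdimsD(4)[of k x X Y w] by (simp add: blk_def beta_mult)

text \<open>Two readings of the \<nu> + 1 current and delayed states: the first pairs interval i
  with its newer endpoint r_{i-1}, the second with its older endpoint r_i.\<close>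

lemma cv_ds_split: "cv (map x ds) = cv (map (\<lambda>i. x (i - 1)) dl) @\<^sub>v x \<nu>" "cv (map x ds) = x 0 @\<^sub>v cv (map x dl)"
proof -
  have 1: "map (\<lambda>i. x (i - 1)) dl = map x [0..<\<nu>]"
    unfolding delay_idx_def One_nat_def map_Suc_upt[symmetric] by simp
  show "cv (map x ds) = cv (map (\<lambda>i. x (i - 1)) dl) @\<^sub>v x \<nu>"
    unfolding 1 by (simp add: cv_append append_vNil)
  have "ds = 0 # dl" unfolding delay_idx_def by (subst upt_conv_Cons) auto
  then show "cv (map x ds) = x 0 @\<^sub>v cv (map x dl)" by (simp del: upt_Suc)
qed

lemma blk_split:
  "blk x X Y w = x 0 @\<^sub>v cv (map x dl) @\<^sub>v cv (map X dl) @\<^sub>v cv (map Y dl) @\<^sub>v w"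
  "blk x X Y w = cv (map (\<lambda>i. x (i - 1)) dl) @\<^sub>v x \<nu> @\<^sub>v cv (map X dl) @\<^sub>v cv (map Y dl) @\<^sub>v w"
  by (simp_all only: blk_def cv_ds_split append_vec_assoc) (simp only: cv_ds_split(1)[symmetric] cv_ds_split(2) append_vec_assoc[symmetric])

lemma rowmat_form:
  assumes "\<And>i. i \<le> \<nu> \<Longrightarrow> MA i \<in> carrier_mat r k" "\<And>i. i \<in> idx \<Longrightarrow> HA i \<in> carrier_mat r (dimg S i * k)" "D \<in> carrier_mat r q"
    and b: "bdims k x X Y w"
  shows "u \<bullet> (rowmat r MA HA k D *\<^sub>v blk x X Y w) = (\<Sum>i = 0..\<nu>. u \<bullet> (MA i *\<^sub>v x i))
    + (\<Sum>i\<in>idx. u \<bullet> (HA i *\<^sub>v ((matT S i \<otimes>\<^sub>K 1\<^sub>m k) *\<^sub>v X i)))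
    + (\<Sum>i\<in>idx. u \<bullet> (HA i *\<^sub>v ((matTt S i \<otimes>\<^sub>K 1\<^sub>m k) *\<^sub>v Y i))) + u \<bullet> (D *\<^sub>v w)"
proof -
  define L1 L2 L3 where "L1 = map MA ds" and "L2 = map (\<lambda>i. HA i * (matT S i \<otimes>\<^sub>K 1\<^sub>m k)) dl"
    and "L3 = map (\<lambda>i. HA i * (matTt S i \<otimes>\<^sub>K 1\<^sub>m k)) dl"
  note bd = bdimsD[OF b]
  have a: "dim_row (MA i) = r" "dim_col (MA i) = k" if "i \<le> \<nu>" for i using assms(1)[OF that] by auto
  have h: "dim_row (HA i) = r" "dim_col (HA i) = dimg S i * k" if "i \<in> idx" for i using assms(2)[OF that] by auto
  have T: "dim_row (matT S i) = dimg S i" "dim_col (matT S i) = dimh S i" "dim_row (matTt S i) = dimg S i" "dim_col (matTt S i) = dimphi S i"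
    if "i \<in> idx" for i using dim_matT[OF that] by auto
  have rows: "\<And>A. A \<in> set L1 \<union> (set L2 \<union> (set L3 \<union> {D})) \<Longrightarrow> dim_row A = r"
    using a h assms(3) by (auto simp: L1_def L2_def L3_def set_delay_idx simp del: upt_Suc)
  have c1: "dim_vec (cv (map x ds)) = sum_list (map dim_col L1)"
    unfolding L1_def dim_cv map_map comp_def by (rule sum_list_cong) (use a bd in \<open>auto simp del: upt_Suc\<close>)
  have c2: "dim_vec (cv (map X dl)) = sum_list (map dim_col L2)"
    unfolding L2_def dim_cv map_map comp_def by (rule sum_list_cong) (use T bd in \<open>auto simp: set_delay_idx\<close>)
  have c3: "dim_vec (cv (map Y dl)) = sum_list (map dim_col L3)"
    unfolding L3_def dim_cv map_map comp_def by (rule sum_list_cong) (use T bd in \<open>auto simp: set_delay_idx\<close>)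
  have "rowmat r MA HA k D *\<^sub>v blk x X Y w = hcat r (L1 @ (L2 @ (L3 @ [D]))) *\<^sub>v (cv (map x ds) @\<^sub>v (cv (map X dl) @\<^sub>v (cv (map Y dl) @\<^sub>v w)))"
    by (simp add: rowmat_def L1_def L2_def L3_def blk_def)
  also have "\<dots> = hcat r L1 *\<^sub>v cv (map x ds) + hcat r (L2 @ (L3 @ [D])) *\<^sub>v (cv (map X dl) @\<^sub>v (cv (map Y dl) @\<^sub>v w))"
    by (rule hcat_append_form) (use rows c1 c2 c3 bd assms(3) in auto)
  also have "hcat r (L2 @ (L3 @ [D])) *\<^sub>v (cv (map X dl) @\<^sub>v (cv (map Y dl) @\<^sub>v w)) = hcat r L2 *\<^sub>v cv (map X dl) + hcat r (L3 @ [D]) *\<^sub>v (cv (map Y dl) @\<^sub>v w)"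
    by (rule hcat_append_form) (use rows c1 c2 c3 bd assms(3) in auto)
  also have "hcat r (L3 @ [D]) *\<^sub>v (cv (map Y dl) @\<^sub>v w) = hcat r L3 *\<^sub>v cv (map Y dl) + hcat r [D] *\<^sub>v w"
    by (rule hcat_append_form) (use rows c1 c2 c3 bd assms(3) in auto)
  also have "hcat r [D] *\<^sub>v w = D *\<^sub>v w"
    by (rule hcat_single_form) (use bd assms(3) in auto)
  finally have e: "rowmat r MA HA k D *\<^sub>v blk x X Y w =
    hcat r L1 *\<^sub>v cv (map x ds) + (hcat r L2 *\<^sub>v cv (map X dl) + (hcat r L3 *\<^sub>v cv (map Y dl) + D *\<^sub>v w))" .
  have dr: "dim_row (hcat r L1) = r" "dim_row (hcat r L2) = r" "dim_row (hcat r L3) = r" "dim_row D = r"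
    by (rule dim_row_hcat; use rows in auto)+ (use assms in auto)
  have "u \<bullet> (hcat r L1 *\<^sub>v cv (map x ds)) = (\<Sum>i\<leftarrow>ds. u \<bullet> (MA i *\<^sub>v x i))"
    unfolding L1_def by (rule hcat_map_form) (use a bd in \<open>auto simp del: upt_Suc\<close>)
  also have "\<dots> = (\<Sum>i = 0..\<nu>. u \<bullet> (MA i *\<^sub>v x i))"
    by (simp add: sum_list_distinct_conv_sum_set atLeastLessThanSuc_atLeastAtMost del: upt_Suc)
  finally have s1: "u \<bullet> (hcat r L1 *\<^sub>v cv (map x ds)) = (\<Sum>i = 0..\<nu>. u \<bullet> (MA i *\<^sub>v x i))" .
  have "u \<bullet> (hcat r L2 *\<^sub>v cv (map X dl)) = (\<Sum>i\<leftarrow>dl. u \<bullet> ((HA i * (matT S i \<otimes>\<^sub>K 1\<^sub>m k)) *\<^sub>v X i))"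
    unfolding L2_def by (rule hcat_map_form) (use h T bd in \<open>auto simp: set_delay_idx\<close>)
  also have "\<dots> = (\<Sum>i\<in>idx. u \<bullet> (HA i *\<^sub>v ((matT S i \<otimes>\<^sub>K 1\<^sub>m k) *\<^sub>v X i)))"
    unfolding sum_delay_idx by (rule sum.cong) (use h T bd in \<open>auto simp: mmv_mult\<close>)
  finally have s2: "u \<bullet> (hcat r L2 *\<^sub>v cv (map X dl)) = (\<Sum>i\<in>idx. u \<bullet> (HA i *\<^sub>v ((matT S i \<otimes>\<^sub>K 1\<^sub>m k) *\<^sub>v X i)))" .
  have "u \<bullet> (hcat r L3 *\<^sub>v cv (map Y dl)) = (\<Sum>i\<leftarrow>dl. u \<bullet> ((HA i * (matTt S i \<otimes>\<^sub>K 1\<^sub>m k)) *\<^sub>v Y i))"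
    unfolding L3_def by (rule hcat_map_form) (use h T bd in \<open>auto simp: set_delay_idx\<close>)
  also have "\<dots> = (\<Sum>i\<in>idx. u \<bullet> (HA i *\<^sub>v ((matTt S i \<otimes>\<^sub>K 1\<^sub>m k) *\<^sub>v Y i)))"
    unfolding sum_delay_idx by (rule sum.cong) (use h T bd in \<open>auto simp: mmv_mult\<close>)
  finally have s3: "u \<bullet> (hcat r L3 *\<^sub>v cv (map Y dl)) = (\<Sum>i\<in>idx. u \<bullet> (HA i *\<^sub>v ((matTt S i \<otimes>\<^sub>K 1\<^sub>m k) *\<^sub>v Y i)))" .
  show ?thesis unfolding e using dr by (simp add: sp_add_right s1 s2 s3 del: upt_Suc)
qed

lemma gain_form:
  assumes b: "bdims n x X Y w"
  shows "diag_block_mat [1\<^sub>m (beta S) \<otimes>\<^sub>K K, 0\<^sub>m q q] *\<^sub>v blk x X Y w =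
    blk (\<lambda>i. K *\<^sub>v x i) (\<lambda>i. (1\<^sub>m (dimh S i) \<otimes>\<^sub>K K) *\<^sub>v X i) (\<lambda>i. (1\<^sub>m (dimphi S i) \<otimes>\<^sub>K K) *\<^sub>v Y i) (0\<^sub>v q)"
    and "bdims p (\<lambda>i. K *\<^sub>v x i) (\<lambda>i. (1\<^sub>m (dimh S i) \<otimes>\<^sub>K K) *\<^sub>v X i) (\<lambda>i. (1\<^sub>m (dimphi S i) \<otimes>\<^sub>K K) *\<^sub>v Y i) (0\<^sub>v q)"
proof -
  note bd = bdimsD[OF b] and Kc = dims_vars(1)
  \<comment> \<open>Each block is paired with its number of subblocks; these numbers add up to
    \<beta>, which cuts the factor I \<otimes> K along the blocks.\<close>
  define L where "L = map (\<lambda>i. (1 :: nat, x i)) ds @ map (\<lambda>i. (dimh S i, X i)) dl @ map (\<lambda>i. (dimphi S i, Y i)) dl"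
  have ks: "sum_list (map fst L) = beta S"
    unfolding L_def beta_def totg_eq toth_def totphi_def
    by (simp add: comp_def sum_list_triv sum_delay_idx del: upt_Suc)
  have "1\<^sub>m (beta S) \<otimes>\<^sub>K K = diag_block_mat (map (\<lambda>z. 1\<^sub>m (fst z) \<otimes>\<^sub>K K) L)"
    unfolding ks[symmetric] one_kronecker_blocks by (simp add: comp_def)
  then have "(1\<^sub>m (beta S) \<otimes>\<^sub>K K) *\<^sub>v cv (map snd L) = cv (map (\<lambda>z. (1\<^sub>m (fst z) \<otimes>\<^sub>K K) *\<^sub>v snd z) L)"
    by (simp only:) (rule diag_block_map_form, use bd Kc in \<open>auto simp: L_def set_delay_idx simp del: upt_Suc\<close>)
  moreover have "cv (map snd L) = cv (map x ds) @\<^sub>v cv (map X dl) @\<^sub>v cv (map Y dl)"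
    by (simp add: L_def comp_def cv_append del: upt_Suc)
  moreover have "cv (map (\<lambda>z. (1\<^sub>m (fst z) \<otimes>\<^sub>K K) *\<^sub>v snd z) L) =
    cv (map (\<lambda>i. K *\<^sub>v x i) ds) @\<^sub>v cv (map (\<lambda>i. (1\<^sub>m (dimh S i) \<otimes>\<^sub>K K) *\<^sub>v X i) dl) @\<^sub>v cv (map (\<lambda>i. (1\<^sub>m (dimphi S i) \<otimes>\<^sub>K K) *\<^sub>v Y i) dl)"
    by (simp add: L_def comp_def cv_append one_kronecker_one del: upt_Suc One_nat_def)
  ultimately have e: "(1\<^sub>m (beta S) \<otimes>\<^sub>K K) *\<^sub>v (cv (map x ds) @\<^sub>v cv (map X dl) @\<^sub>v cv (map Y dl)) =
    cv (map (\<lambda>i. K *\<^sub>v x i) ds) @\<^sub>v cv (map (\<lambda>i. (1\<^sub>m (dimh S i) \<otimes>\<^sub>K K) *\<^sub>v X i) dl) @\<^sub>v cv (map (\<lambda>i. (1\<^sub>m (dimphi S i) \<otimes>\<^sub>K K) *\<^sub>v Y i) dl)" by simp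
  have "diag_block_mat [1\<^sub>m (beta S) \<otimes>\<^sub>K K, 0\<^sub>m q q] *\<^sub>v ((cv (map x ds) @\<^sub>v cv (map X dl) @\<^sub>v cv (map Y dl)) @\<^sub>v w) =
    (1\<^sub>m (beta S) \<otimes>\<^sub>K K) *\<^sub>v (cv (map x ds) @\<^sub>v cv (map X dl) @\<^sub>v cv (map Y dl)) @\<^sub>v (diag_block_mat [0\<^sub>m q q] *\<^sub>v w)"
    by (rule diag_block_Cons_form) (use dim_cv_blocks[OF b] bd Kc in \<open>auto simp: beta_mult\<close>)
  then show "diag_block_mat [1\<^sub>m (beta S) \<otimes>\<^sub>K K, 0\<^sub>m q q] *\<^sub>v blk x X Y w =
    blk (\<lambda>i. K *\<^sub>v x i) (\<lambda>i. (1\<^sub>m (dimh S i) \<otimes>\<^sub>K K) *\<^sub>v X i) (\<lambda>i. (1\<^sub>m (dimphi S i) \<otimes>\<^sub>K K) *\<^sub>v Y i) (0\<^sub>v q)"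
    unfolding e using bd(4) by (simp add: blk_def append_vec_assoc mmv_zero_mat del: upt_Suc diag_block_mat.simps)
  show "bdims p (\<lambda>i. K *\<^sub>v x i) (\<lambda>i. (1\<^sub>m (dimh S i) \<otimes>\<^sub>K K) *\<^sub>v X i) (\<lambda>i. (1\<^sub>m (dimphi S i) \<otimes>\<^sub>K K) *\<^sub>v Y i) (0\<^sub>v q)"
    using Kc by (auto simp: bdims_def)
qed

lemma closed_loop_row_form:
  assumes MA: "\<And>i. i \<le> \<nu> \<Longrightarrow> MA i \<in> carrier_mat r n" "\<And>i. i \<in> idx \<Longrightarrow> HA i \<in> carrier_mat r (dimg S i * n)" "D \<in> carrier_mat r q"
    and MB: "\<And>i. i \<le> \<nu> \<Longrightarrow> MB i \<in> carrier_mat r p" "\<And>i. i \<in> idx \<Longrightarrow> HB i \<in> carrier_mat r (dimg S i * p)"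
    and b: "bdims n x X Y w"
  shows "u \<bullet> ((rowmat r MA HA n D + rowmat r MB HB p (0\<^sub>m r q) * diag_block_mat [1\<^sub>m (beta S) \<otimes>\<^sub>K K, 0\<^sub>m q q]) *\<^sub>v blk x X Y w) =
    (\<Sum>i = 0..\<nu>. u \<bullet> (MA i *\<^sub>v x i) + u \<bullet> (MB i *\<^sub>v (K *\<^sub>v x i)))
    + (\<Sum>i\<in>idx. u \<bullet> (HA i *\<^sub>v ((matT S i \<otimes>\<^sub>K 1\<^sub>m n) *\<^sub>v X i)) + u \<bullet> (HA i *\<^sub>v ((matTt S i \<otimes>\<^sub>K 1\<^sub>m n) *\<^sub>v Y i))
       + u \<bullet> (HB i *\<^sub>v ((matT S i \<otimes>\<^sub>K 1\<^sub>m p) *\<^sub>v ((1\<^sub>m (dimh S i) \<otimes>\<^sub>K K) *\<^sub>v X i)))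
       + u \<bullet> (HB i *\<^sub>v ((matTt S i \<otimes>\<^sub>K 1\<^sub>m p) *\<^sub>v ((1\<^sub>m (dimphi S i) \<otimes>\<^sub>K K) *\<^sub>v Y i))))
    + u \<bullet> (D *\<^sub>v w)"
proof -
  have d1: "rowmat r MA HA n D \<in> carrier_mat r NN" by (rule dim_rowmat) (use MA in auto)
  have d2: "rowmat r MB HB p (0\<^sub>m r q) \<in> carrier_mat r (beta S * p + q)" by (rule dim_rowmat) (use MB in auto)
  note d = d1 d2 dim_gain dim_blk[OF b]
  have "(rowmat r MA HA n D + rowmat r MB HB p (0\<^sub>m r q) * diag_block_mat [1\<^sub>m (beta S) \<otimes>\<^sub>K K, 0\<^sub>m q q]) *\<^sub>v blk x X Y w
    = rowmat r MA HA n D *\<^sub>v blk x X Y w + (rowmat r MB HB p (0\<^sub>m r q) * diag_block_mat [1\<^sub>m (beta S) \<otimes>\<^sub>K K, 0\<^sub>m q q]) *\<^sub>v blk x X Y w"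
    using d by (intro mmv_add) (auto simp del: diag_block_mat.simps)
  also have "(rowmat r MB HB p (0\<^sub>m r q) * diag_block_mat [1\<^sub>m (beta S) \<otimes>\<^sub>K K, 0\<^sub>m q q]) *\<^sub>v blk x X Y w =
     rowmat r MB HB p (0\<^sub>m r q) *\<^sub>v (diag_block_mat [1\<^sub>m (beta S) \<otimes>\<^sub>K K, 0\<^sub>m q q] *\<^sub>v blk x X Y w)"
    using d by (intro mmv_mult) (auto simp del: diag_block_mat.simps)
  finally have "u \<bullet> ((rowmat r MA HA n D + rowmat r MB HB p (0\<^sub>m r q) * diag_block_mat [1\<^sub>m (beta S) \<otimes>\<^sub>K K, 0\<^sub>m q q]) *\<^sub>v blk x X Y w) =
     u \<bullet> (rowmat r MA HA n D *\<^sub>v blk x X Y w) + u \<bullet> (rowmat r MB HB p (0\<^sub>m r q) *\<^sub>v (diag_block_mat [1\<^sub>m (beta S) \<otimes>\<^sub>K K, 0\<^sub>m q q] *\<^sub>v blk x X Y w))"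
    using d by (simp add: sp_add_right del: diag_block_mat.simps)
  also have "\<dots> = ((\<Sum>i = 0..\<nu>. u \<bullet> (MA i *\<^sub>v x i))
    + (\<Sum>i\<in>idx. u \<bullet> (HA i *\<^sub>v ((matT S i \<otimes>\<^sub>K 1\<^sub>m n) *\<^sub>v X i)))
    + (\<Sum>i\<in>idx. u \<bullet> (HA i *\<^sub>v ((matTt S i \<otimes>\<^sub>K 1\<^sub>m n) *\<^sub>v Y i))) + u \<bullet> (D *\<^sub>v w)) +
    ((\<Sum>i = 0..\<nu>. u \<bullet> (MB i *\<^sub>v (K *\<^sub>v x i)))
    + (\<Sum>i\<in>idx. u \<bullet> (HB i *\<^sub>v ((matT S i \<otimes>\<^sub>K 1\<^sub>m p) *\<^sub>v ((1\<^sub>m (dimh S i) \<otimes>\<^sub>K K) *\<^sub>v X i))))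
    + (\<Sum>i\<in>idx. u \<bullet> (HB i *\<^sub>v ((matTt S i \<otimes>\<^sub>K 1\<^sub>m p) *\<^sub>v ((1\<^sub>m (dimphi S i) \<otimes>\<^sub>K K) *\<^sub>v Y i)))) + u \<bullet> (0\<^sub>m r q *\<^sub>v 0\<^sub>v q))"
    unfolding gain_form(1)[OF b]
    by (intro arg_cong2[of _ _ _ _ "(+)"] rowmat_form MA b MB gain_form(2)[OF b]) auto
  finally show ?thesis by (simp add: sum.distrib mmv_zero_mat sp_zero_right)
qed

section \<open>Action of the matrices M, I-hat and \<Xi> on block vectors\<close>

definition lf :: "nat \<Rightarrow> real \<Rightarrow> real vec" where "lf i \<tau> = mat_inv (cholF S i) *\<^sub>v fnf S i \<tau>"

lemma dim_lf: "i \<in> idx \<Longrightarrow> dim_vec (lf i \<tau>) = dimf S i"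
  using cholF(4) by (force simp: lf_def)

lemma Mab_form:
  assumes i: "i \<in> idx" and x: "dim_vec x = n"
  shows "(Ma i \<otimes>\<^sub>K 1\<^sub>m n) *\<^sub>v x = kv (lf i (- del S (i - 1))) x" "(Mb i \<otimes>\<^sub>K 1\<^sub>m n) *\<^sub>v x = kv (lf i (- del S i)) x"
proof -
  have *: "((mat_inv (cholF S i) * col_mat (fnf S i \<tau>)) \<otimes>\<^sub>K 1\<^sub>m n) *\<^sub>v x = kv (lf i \<tau>) x" if t: "\<tau> \<in> ivl S i" for \<tau>
  proof -
    have "((mat_inv (cholF S i) * col_mat (fnf S i \<tau>)) \<otimes>\<^sub>K 1\<^sub>m n) *\<^sub>v kv (vec 1 (\<lambda>_. 1)) x =
      kv ((mat_inv (cholF S i) * col_mat (fnf S i \<tau>)) *\<^sub>v vec 1 (\<lambda>_. 1)) (1\<^sub>m n *\<^sub>v x)"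
      using x by (intro kronecker_mult_kv) auto
    also have "(mat_inv (cholF S i) * col_mat (fnf S i \<tau>)) *\<^sub>v vec 1 (\<lambda>_. 1) = lf i \<tau>"
      using cholF(4)[OF i] dim_fn(1)[OF i t] by (simp add: mmv_mult col_mat_mult lf_def del: One_nat_def)
    finally show ?thesis using x by (simp add: kv_single mmv_one del: One_nat_def)
  qed
  show "(Ma i \<otimes>\<^sub>K 1\<^sub>m n) *\<^sub>v x = kv (lf i (- del S (i - 1))) x" "(Mb i \<otimes>\<^sub>K 1\<^sub>m n) *\<^sub>v x = kv (lf i (- del S i)) x"
    using * ivl_endpoints[OF i] by auto
qed

text \<open>The right side is shaped like the derivative of the moments against \<open>lf i\<close>
  over a sliding window: the boundary term at the newer end, minus the one at the older end, minus
  the moment against the derivative of \<open>lf i\<close>.\<close>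

lemma Mhat_form:
  assumes b: "bdims n x X Y w"
  shows "Mhat *\<^sub>v blk x X Y w = cv (map (\<lambda>i. kv (lf i (- del S (i - 1))) (x (i - 1)) - (kv (lf i (- del S i)) (x i) + (Mc i \<otimes>\<^sub>K 1\<^sub>m n) *\<^sub>v X i)) dl)"
proof -
  note bd = bdimsD[OF b] and cb = dim_cv_blocks[OF b]
  note dM = dim_diagM
  define x1 where "x1 = cv (map (\<lambda>i. x (i - 1)) dl)"
  define x2 where "x2 = cv (map x dl)"
  define cX where "cX = cv (map X dl)"
  define cY where "cY = cv (map Y dl)"
  define x3 where "x3 = cv (map x ds)"
  note cd = cb[folded x1_def x2_def cX_def cY_def x3_def]
  define DA where "DA = diag_block_mat (map Ma dl) \<otimes>\<^sub>K 1\<^sub>m n"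
  define DB where "DB = diag_block_mat (map Mb dl) \<otimes>\<^sub>K 1\<^sub>m n"
  define DC where "DC = diag_block_mat (map Mc dl) \<otimes>\<^sub>K 1\<^sub>m n"
  have dD: "dim_row DA = totf S * n" "dim_col DA = \<nu> * n" "dim_row DB = totf S * n" "dim_col DB = \<nu> * n" "dim_row DC = totf S * n" "dim_col DC = toth S * n"
    using dM by (auto simp: DA_def DB_def DC_def)
  have "boldM S \<otimes>\<^sub>K 1\<^sub>m n = hcat (totf S * n) [DA, 0\<^sub>m (totf S * n) n, 0\<^sub>m (totf S * n) (toth S * n)]
     - hcat (totf S * n) [0\<^sub>m (totf S * n) n, DB, DC]"
  proof -
    have r: "dim_row (hcat (totf S) [diag_block_mat (map Ma dl), 0\<^sub>m (totf S) 1, 0\<^sub>m (totf S) (toth S)]) = totf S"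
      "dim_row (hcat (totf S) [0\<^sub>m (totf S) 1, diag_block_mat (map Mb dl), diag_block_mat (map Mc dl)]) = totf S"
      by (rule dim_row_hcat; use dM in auto)+
    have "boldM S \<otimes>\<^sub>K 1\<^sub>m n = hcat (totf S) [diag_block_mat (map Ma dl), 0\<^sub>m (totf S) 1, 0\<^sub>m (totf S) (toth S)] \<otimes>\<^sub>K 1\<^sub>m n
      - hcat (totf S) [0\<^sub>m (totf S) 1, diag_block_mat (map Mb dl), diag_block_mat (map Mc dl)] \<otimes>\<^sub>K 1\<^sub>m n"
      unfolding boldM_eq by (rule kronecker_minus) (use r dM in \<open>auto simp: dim_col_hcat\<close>)
    also have "hcat (totf S) [diag_block_mat (map Ma dl), 0\<^sub>m (totf S) 1, 0\<^sub>m (totf S) (toth S)] \<otimes>\<^sub>K 1\<^sub>m n =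
       hcat (totf S * n) [DA, 0\<^sub>m (totf S * n) n, 0\<^sub>m (totf S * n) (toth S * n)]"
      by (subst kronecker_hcat) (use dM in \<open>auto simp: DA_def kronecker_zero\<close>)
    also have "hcat (totf S) [0\<^sub>m (totf S) 1, diag_block_mat (map Mb dl), diag_block_mat (map Mc dl)] \<otimes>\<^sub>K 1\<^sub>m n =
       hcat (totf S * n) [0\<^sub>m (totf S * n) n, DB, DC]"
      by (subst kronecker_hcat) (use dM in \<open>auto simp: DB_def DC_def kronecker_zero\<close>)
    finally show ?thesis .
  qed
  define xx where "xx = x3 @\<^sub>v cX"
  have dxx: "dim_vec xx = n + \<nu> * n + toth S * n" using cd by (simp add: xx_def)
  have "blk x X Y w = xx @\<^sub>v (cY @\<^sub>v w)" by (simp only: blk_def xx_def append_vec_assoc cX_def cY_def x3_def)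
  then have "Mhat *\<^sub>v blk x X Y w = (boldM S \<otimes>\<^sub>K 1\<^sub>m n) *\<^sub>v xx"
    unfolding Mhat_def by (simp only:) (rule hcat_zero_form, use dim_boldM dxx cd bd in \<open>auto simp: algebra_simps\<close>)
  also have "\<dots> = hcat (totf S * n) [DA, 0\<^sub>m (totf S * n) n, 0\<^sub>m (totf S * n) (toth S * n)] *\<^sub>v xx - hcat (totf S * n) [0\<^sub>m (totf S * n) n, DB, DC] *\<^sub>v xx"
  proof -
    have r: "dim_row (hcat (totf S * n) [DA, 0\<^sub>m (totf S * n) n, 0\<^sub>m (totf S * n) (toth S * n)]) = totf S * n"
      "dim_row (hcat (totf S * n) [0\<^sub>m (totf S * n) n, DB, DC]) = totf S * n"
      by (rule dim_row_hcat; use dD in auto)+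
    show ?thesis unfolding \<open>boldM S \<otimes>\<^sub>K 1\<^sub>m n = _\<close> by (rule mmv_minus) (use r dD dxx in \<open>auto simp: dim_col_hcat\<close>)
  qed
  also have "hcat (totf S * n) [DA, 0\<^sub>m (totf S * n) n, 0\<^sub>m (totf S * n) (toth S * n)] *\<^sub>v xx = DA *\<^sub>v x1"
  proof -
    \<comment> \<open>The minuend of M pairs with the states at the newer endpoints and annihilates
      the oldest state; the subtrahend pairs with the older endpoints and annihilates the current
      state.\<close>
    have "xx = x1 @\<^sub>v x \<nu> @\<^sub>v cX" unfolding xx_def x3_def x1_def cv_ds_split(1) append_vec_assoc ..
    then have "hcat (totf S * n) [DA, 0\<^sub>m (totf S * n) n, 0\<^sub>m (totf S * n) (toth S * n)] *\<^sub>v xx =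
      DA *\<^sub>v x1 + (0\<^sub>m (totf S * n) n *\<^sub>v x \<nu> + 0\<^sub>m (totf S * n) (toth S * n) *\<^sub>v cX)"
      using dD cd bd by (simp only:) (rule hcat3_form, auto)
    then show ?thesis using dD cd bd by (simp add: mmv_zero_mat) (intro eq_vecI; simp)
  qed
  also have "hcat (totf S * n) [0\<^sub>m (totf S * n) n, DB, DC] *\<^sub>v xx = DB *\<^sub>v x2 + DC *\<^sub>v cX"
  proof -
    have "xx = x 0 @\<^sub>v x2 @\<^sub>v cX" unfolding xx_def x3_def x2_def cv_ds_split(2) append_vec_assoc ..
    then have "hcat (totf S * n) [0\<^sub>m (totf S * n) n, DB, DC] *\<^sub>v xx =
      0\<^sub>m (totf S * n) n *\<^sub>v x 0 + (DB *\<^sub>v x2 + DC *\<^sub>v cX)"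
      using dD cd bd by (simp only:) (rule hcat3_form, auto)
    then show ?thesis using dD cd bd by (simp add: mmv_zero_mat) (intro eq_vecI; simp)
  qed
  also have "DA *\<^sub>v x1 = cv (map (\<lambda>i. kv (lf i (- del S (i - 1))) (x (i - 1))) dl)"
  proof -
    have "DA *\<^sub>v x1 = cv (map (\<lambda>i. (Ma i \<otimes>\<^sub>K 1\<^sub>m n) *\<^sub>v x (i - 1)) dl)"
      unfolding DA_def x1_def kronecker_diag_block map_map comp_def by (rule diag_block_map_form) (use bd in \<open>auto simp: set_delay_idx\<close>)
    also have "\<dots> = cv (map (\<lambda>i. kv (lf i (- del S (i - 1))) (x (i - 1))) dl)"
      by (rule cv_map_cong) (use bd in \<open>auto simp: set_delay_idx intro!: Mab_form simp del: One_nat_def\<close>)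
    finally show ?thesis .
  qed
  also have "DB *\<^sub>v x2 = cv (map (\<lambda>i. kv (lf i (- del S i)) (x i)) dl)"
  proof -
    have "DB *\<^sub>v x2 = cv (map (\<lambda>i. (Mb i \<otimes>\<^sub>K 1\<^sub>m n) *\<^sub>v x i) dl)"
      unfolding DB_def x2_def kronecker_diag_block map_map comp_def by (rule diag_block_map_form) (use bd in \<open>auto simp: set_delay_idx\<close>)
    also have "\<dots> = cv (map (\<lambda>i. kv (lf i (- del S i)) (x i)) dl)"
      by (rule cv_map_cong) (use bd in \<open>auto simp: set_delay_idx intro!: Mab_form simp del: One_nat_def\<close>)
    finally show ?thesis .
  qed
  also have "DC *\<^sub>v cX = cv (map (\<lambda>i. (Mc i \<otimes>\<^sub>K 1\<^sub>m n) *\<^sub>v X i) dl)"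
    unfolding DC_def cX_def kronecker_diag_block map_map comp_def
    by (rule diag_block_map_form) (use bd cholH(1) in \<open>force simp: set_delay_idx\<close>)
  also have "cv (map (\<lambda>i. kv (lf i (- del S i)) (x i)) dl) + cv (map (\<lambda>i. (Mc i \<otimes>\<^sub>K 1\<^sub>m n) *\<^sub>v X i) dl) =
     cv (map (\<lambda>i. kv (lf i (- del S i)) (x i) + (Mc i \<otimes>\<^sub>K 1\<^sub>m n) *\<^sub>v X i) dl)"
    by (rule cv_map_add) (use bd cholF(4) dim_lf in \<open>force simp: set_delay_idx\<close>)
  also have "cv (map (\<lambda>i. kv (lf i (- del S (i - 1))) (x (i - 1))) dl) - \<dots> =
     cv (map (\<lambda>i. kv (lf i (- del S (i - 1))) (x (i - 1)) - (kv (lf i (- del S i)) (x i) + (Mc i \<otimes>\<^sub>K 1\<^sub>m n) *\<^sub>v X i)) dl)"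
    by (rule cv_map_minus) (use bd cholF(4) dim_lf in \<open>force simp: set_delay_idx\<close>)
  finally show ?thesis .
qed

abbreviation "Hc i \<equiv> mat_inv (cholF S i) * hcat (dimf S i) [0\<^sub>m (dimf S i) (dimvphi S i), 1\<^sub>m (dimf S i)] * cholH S i"

lemma hatI_form:
  assumes b: "bdims n x X Y w"
  shows "hatI S *\<^sub>v cv (map X dl) = cv (map (\<lambda>i. (Hc i \<otimes>\<^sub>K 1\<^sub>m n) *\<^sub>v X i) dl)"
  unfolding hatI_def kronecker_diag_block map_map comp_def
  by (rule diag_block_map_form) (use bdimsD[OF b] cholH(1) in \<open>force simp: set_delay_idx\<close>)

text \<open>The two block diagonals of \<Xi> cut the vector at different places, so each gets its
  own reading of the states. \<Lambda> is scalar on every block, which turns R \<Lambda> into the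
  factor r_i - r_{i-1}.\<close>

lemma Xi_form:
  assumes b: "bdims n x X Y w"
  shows "blk x X Y w \<bullet> (Xi S J Q R *\<^sub>v blk x X Y w) =
    (\<Sum>i\<in>idx. x (i - 1) \<bullet> (Q i *\<^sub>v x (i - 1)) + (del S i - del S (i - 1)) * (x (i - 1) \<bullet> (R i *\<^sub>v x (i - 1))))
    - (\<Sum>i\<in>idx. x i \<bullet> (Q i *\<^sub>v x i))
    - (\<Sum>i\<in>idx. X i \<bullet> ((1\<^sub>m (dimh S i) \<otimes>\<^sub>K R i) *\<^sub>v X i))
    - (\<Sum>i\<in>idx. Y i \<bullet> ((1\<^sub>m (dimphi S i) \<otimes>\<^sub>K R i) *\<^sub>v Y i)) - w \<bullet> (matJ3 J *\<^sub>v w)"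
proof -
  note bd = bdimsD[OF b] and cb = dim_cv_blocks[OF b]
  note dQ = dim_diagQ[of Q, OF dims_vars(7)] and dR = dim_diagQ[of R, OF dims_vars(8)]
  note dd = dQ dR dim_Lambda dim_diagR dims_supply(5)
  have q: "dim_row (Q i) = n" "dim_col (Q i) = n" "dim_row (R i) = n" "dim_col (R i) = n" if "i \<in> idx" for i
    using dims_vars(7,8)[OF that] by auto
  define x1 where "x1 = cv (map (\<lambda>i. x (i - 1)) dl)"
  define x2 where "x2 = cv (map x dl)"
  define cX where "cX = cv (map X dl)"
  define cY where "cY = cv (map Y dl)"
  note cd = cb[folded x1_def x2_def cX_def cY_def]
  define D1 where "D1 = diag_block_mat [diagQ S Q + diagQ S R * Lambda S, 0\<^sub>m n n, 0\<^sub>m (totg S * n) (totg S * n), 0\<^sub>m q q]"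
  define D2 where "D2 = diag_block_mat [0\<^sub>m n n, diagQ S Q, diag_block_mat (map (\<lambda>i. 1\<^sub>m (dimh S i) \<otimes>\<^sub>K R i) dl),
          diag_block_mat (map (\<lambda>i. 1\<^sub>m (dimphi S i) \<otimes>\<^sub>K R i) dl), matJ3 J]"
  have Xi: "Xi S J Q R = D1 - D2" by (simp only: Xi_def Let_def D1_def D2_def)
  have dD: "dim_row D1 = NN" "dim_col D1 = NN" "dim_row D2 = NN" "dim_col D2 = NN"
    using dd by (auto simp: D1_def D2_def Let_def beta_mult totg_eq algebra_simps)
  have e1: "blk x X Y w = x1 @\<^sub>v x \<nu> @\<^sub>v (cX @\<^sub>v cY) @\<^sub>v w"
    unfolding blk_split(2) x1_def cX_def cY_def append_vec_assoc ..
  have e2: "blk x X Y w = x 0 @\<^sub>v x2 @\<^sub>v cX @\<^sub>v cY @\<^sub>v w"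
    unfolding blk_split(1) x2_def cX_def cY_def ..
  have m1: "D1 *\<^sub>v blk x X Y w = ((diagQ S Q + diagQ S R * Lambda S) *\<^sub>v x1) @\<^sub>v (0\<^sub>m n n *\<^sub>v x \<nu>) @\<^sub>v (0\<^sub>m (totg S * n) (totg S * n) *\<^sub>v (cX @\<^sub>v cY)) @\<^sub>v (0\<^sub>m q q *\<^sub>v w)"
    unfolding D1_def e1 by (rule diag_block4_form) (use dd cd bd in \<open>auto simp: totg_eq distrib_right\<close>)
  have m2: "D2 *\<^sub>v blk x X Y w = (0\<^sub>m n n *\<^sub>v x 0) @\<^sub>v (diagQ S Q *\<^sub>v x2) @\<^sub>v (diag_block_mat (map (\<lambda>i. 1\<^sub>m (dimh S i) \<otimes>\<^sub>K R i) dl) *\<^sub>v cX) @\<^sub>v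
     (diag_block_mat (map (\<lambda>i. 1\<^sub>m (dimphi S i) \<otimes>\<^sub>K R i) dl) *\<^sub>v cY) @\<^sub>v (matJ3 J *\<^sub>v w)"
  proof -
    define DD where "DD = diag_block_mat [diagQ S Q, diag_block_mat (map (\<lambda>i. 1\<^sub>m (dimh S i) \<otimes>\<^sub>K R i) dl),
          diag_block_mat (map (\<lambda>i. 1\<^sub>m (dimphi S i) \<otimes>\<^sub>K R i) dl), matJ3 J]"
    have "D2 *\<^sub>v blk x X Y w = (0\<^sub>m n n *\<^sub>v x 0) @\<^sub>v (DD *\<^sub>v (x2 @\<^sub>v cX @\<^sub>v cY @\<^sub>v w))"
      unfolding D2_def DD_def e2 by (rule diag_block_Cons_form) (use dd cd bd in \<open>auto simp: Let_def\<close>)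
    also have "DD *\<^sub>v (x2 @\<^sub>v cX @\<^sub>v cY @\<^sub>v w) = (diagQ S Q *\<^sub>v x2) @\<^sub>v (diag_block_mat (map (\<lambda>i. 1\<^sub>m (dimh S i) \<otimes>\<^sub>K R i) dl) *\<^sub>v cX) @\<^sub>v
     (diag_block_mat (map (\<lambda>i. 1\<^sub>m (dimphi S i) \<otimes>\<^sub>K R i) dl) *\<^sub>v cY) @\<^sub>v (matJ3 J *\<^sub>v w)"
      unfolding DD_def by (rule diag_block4_form) (use dd cd bd in auto)
    finally show ?thesis .
  qed
  have f1: "blk x X Y w \<bullet> (D1 *\<^sub>v blk x X Y w) = x1 \<bullet> ((diagQ S Q + diagQ S R * Lambda S) *\<^sub>v x1)"
    unfolding m1 unfolding e1 using dd cd bd by (simp add: sp_append mmv_zero_mat sp_zero_right totg_eq distrib_right)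
  have f2: "blk x X Y w \<bullet> (D2 *\<^sub>v blk x X Y w) = x2 \<bullet> (diagQ S Q *\<^sub>v x2) + cX \<bullet> (diag_block_mat (map (\<lambda>i. 1\<^sub>m (dimh S i) \<otimes>\<^sub>K R i) dl) *\<^sub>v cX)
     + cY \<bullet> (diag_block_mat (map (\<lambda>i. 1\<^sub>m (dimphi S i) \<otimes>\<^sub>K R i) dl) *\<^sub>v cY) + w \<bullet> (matJ3 J *\<^sub>v w)"
    unfolding m2 unfolding e2 using dd cd bd by (simp add: sp_append mmv_zero_mat sp_zero_right)
  have g1: "x1 \<bullet> ((diagQ S Q + diagQ S R * Lambda S) *\<^sub>v x1) =
     (\<Sum>i\<in>idx. x (i - 1) \<bullet> (Q i *\<^sub>v x (i - 1)) + (del S i - del S (i - 1)) * (x (i - 1) \<bullet> (R i *\<^sub>v x (i - 1))))"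
  proof -
    have "(diagQ S Q + diagQ S R * Lambda S) *\<^sub>v x1 = diagQ S Q *\<^sub>v x1 + diagQ S R *\<^sub>v (Lambda S *\<^sub>v x1)"
      using dd cd by (subst mmv_add) (auto simp: mmv_mult)
    moreover have "Lambda S *\<^sub>v x1 = cv (map (\<lambda>i. (del S i - del S (i - 1)) \<cdot>\<^sub>v x (i - 1)) dl)"
    proof -
      have "Lambda S *\<^sub>v x1 = cv (map (\<lambda>i. ((del S i - del S (i - 1)) \<cdot>\<^sub>m 1\<^sub>m n) *\<^sub>v x (i - 1)) dl)"
        unfolding Lambda_def x1_def by (rule diag_block_map_form) (use bd in \<open>auto simp: set_delay_idx\<close>)
      also have "\<dots> = cv (map (\<lambda>i. (del S i - del S (i - 1)) \<cdot>\<^sub>v x (i - 1)) dl)"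
      proof (rule cv_map_cong)
        fix i assume "i \<in> set dl"
        then have i: "dim_vec (x (i - 1)) = n" using bd by (auto simp: set_delay_idx)
        show "((del S i - del S (i - 1)) \<cdot>\<^sub>m 1\<^sub>m n) *\<^sub>v x (i - 1) = (del S i - del S (i - 1)) \<cdot>\<^sub>v x (i - 1)"
          using i by (simp add: mmv_smult mmv_one)
      qed
      finally show ?thesis .
    qed
    moreover have "diagQ S R *\<^sub>v cv (map (\<lambda>i. (del S i - del S (i - 1)) \<cdot>\<^sub>v x (i - 1)) dl) = cv (map (\<lambda>i. R i *\<^sub>v ((del S i - del S (i - 1)) \<cdot>\<^sub>v x (i - 1))) dl)"
      unfolding diagQ_def by (rule diag_block_map_form) (use bd q in \<open>auto simp: set_delay_idx\<close>)
    moreover have "diagQ S Q *\<^sub>v x1 = cv (map (\<lambda>i. Q i *\<^sub>v x (i - 1)) dl)"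
      unfolding diagQ_def x1_def by (rule diag_block_map_form) (use bd q in \<open>auto simp: set_delay_idx\<close>)
    moreover have "cv (map (\<lambda>i. Q i *\<^sub>v x (i - 1)) dl) + cv (map (\<lambda>i. R i *\<^sub>v ((del S i - del S (i - 1)) \<cdot>\<^sub>v x (i - 1))) dl) =
       cv (map (\<lambda>i. Q i *\<^sub>v x (i - 1) + R i *\<^sub>v ((del S i - del S (i - 1)) \<cdot>\<^sub>v x (i - 1))) dl)"
      by (rule cv_map_add) (use q in \<open>auto simp: set_delay_idx\<close>)
    ultimately have "x1 \<bullet> ((diagQ S Q + diagQ S R * Lambda S) *\<^sub>v x1) =
       cv (map (\<lambda>i. x (i - 1)) dl) \<bullet> cv (map (\<lambda>i. Q i *\<^sub>v x (i - 1) + R i *\<^sub>v ((del S i - del S (i - 1)) \<cdot>\<^sub>v x (i - 1))) dl)"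
      by (simp add: x1_def)
    also have "\<dots> = (\<Sum>i\<leftarrow>dl. x (i - 1) \<bullet> (Q i *\<^sub>v x (i - 1) + R i *\<^sub>v ((del S i - del S (i - 1)) \<cdot>\<^sub>v x (i - 1))))"
      by (rule cv_map_scalar_prod) (use bd q in \<open>auto simp: set_delay_idx\<close>)
    also have "\<dots> = (\<Sum>i\<in>idx. x (i - 1) \<bullet> (Q i *\<^sub>v x (i - 1)) + (del S i - del S (i - 1)) * (x (i - 1) \<bullet> (R i *\<^sub>v x (i - 1))))"
      unfolding sum_delay_idx
    proof (rule sum.cong)
      fix i assume i: "i \<in> idx"
      then have xi: "dim_vec (x (i - 1)) = n" using bd by auto
      have "R i *\<^sub>v ((del S i - del S (i - 1)) \<cdot>\<^sub>v x (i - 1)) = (del S i - del S (i - 1)) \<cdot>\<^sub>v (R i *\<^sub>v x (i - 1))"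
        by (rule mult_mat_vec[OF dims_vars(8)[OF i] carrier_vecI[OF xi]])
      then show "x (i - 1) \<bullet> (Q i *\<^sub>v x (i - 1) + R i *\<^sub>v ((del S i - del S (i - 1)) \<cdot>\<^sub>v x (i - 1))) =
        x (i - 1) \<bullet> (Q i *\<^sub>v x (i - 1)) + (del S i - del S (i - 1)) * (x (i - 1) \<bullet> (R i *\<^sub>v x (i - 1)))"
        using q[OF i] xi by (simp add: sp_add_right)
    qed simp
    finally show ?thesis .
  qed
  have g2: "x2 \<bullet> (diagQ S Q *\<^sub>v x2) = (\<Sum>i\<in>idx. x i \<bullet> (Q i *\<^sub>v x i))"
  proof -
    have "diagQ S Q *\<^sub>v x2 = cv (map (\<lambda>i. Q i *\<^sub>v x i) dl)"
      unfolding diagQ_def x2_def by (rule diag_block_map_form) (use bd q in \<open>auto simp: set_delay_idx\<close>)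
    then have "x2 \<bullet> (diagQ S Q *\<^sub>v x2) = (\<Sum>i\<leftarrow>dl. x i \<bullet> (Q i *\<^sub>v x i))"
      unfolding x2_def by (simp only:) (rule cv_map_scalar_prod, use bd q in \<open>auto simp: set_delay_idx\<close>)
    then show ?thesis by (simp add: sum_delay_idx)
  qed
  have g3: "cX \<bullet> (diag_block_mat (map (\<lambda>i. 1\<^sub>m (dimh S i) \<otimes>\<^sub>K R i) dl) *\<^sub>v cX) = (\<Sum>i\<in>idx. X i \<bullet> ((1\<^sub>m (dimh S i) \<otimes>\<^sub>K R i) *\<^sub>v X i))"
  proof -
    have "diag_block_mat (map (\<lambda>i. 1\<^sub>m (dimh S i) \<otimes>\<^sub>K R i) dl) *\<^sub>v cX = cv (map (\<lambda>i. (1\<^sub>m (dimh S i) \<otimes>\<^sub>K R i) *\<^sub>v X i) dl)"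
      unfolding cX_def by (rule diag_block_map_form) (use bd q in \<open>auto simp: set_delay_idx\<close>)
    then have "cX \<bullet> (diag_block_mat (map (\<lambda>i. 1\<^sub>m (dimh S i) \<otimes>\<^sub>K R i) dl) *\<^sub>v cX) = (\<Sum>i\<leftarrow>dl. X i \<bullet> ((1\<^sub>m (dimh S i) \<otimes>\<^sub>K R i) *\<^sub>v X i))"
      unfolding cX_def by (simp only:) (rule cv_map_scalar_prod, use bd q in \<open>auto simp: set_delay_idx\<close>)
    then show ?thesis by (simp add: sum_delay_idx)
  qed
  have g4: "cY \<bullet> (diag_block_mat (map (\<lambda>i. 1\<^sub>m (dimphi S i) \<otimes>\<^sub>K R i) dl) *\<^sub>v cY) = (\<Sum>i\<in>idx. Y i \<bullet> ((1\<^sub>m (dimphi S i) \<otimes>\<^sub>K R i) *\<^sub>v Y i))"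
  proof -
    have "diag_block_mat (map (\<lambda>i. 1\<^sub>m (dimphi S i) \<otimes>\<^sub>K R i) dl) *\<^sub>v cY = cv (map (\<lambda>i. (1\<^sub>m (dimphi S i) \<otimes>\<^sub>K R i) *\<^sub>v Y i) dl)"
      unfolding cY_def by (rule diag_block_map_form) (use bd q in \<open>auto simp: set_delay_idx\<close>)
    then have "cY \<bullet> (diag_block_mat (map (\<lambda>i. 1\<^sub>m (dimphi S i) \<otimes>\<^sub>K R i) dl) *\<^sub>v cY) = (\<Sum>i\<leftarrow>dl. Y i \<bullet> ((1\<^sub>m (dimphi S i) \<otimes>\<^sub>K R i) *\<^sub>v Y i))"
      unfolding cY_def by (simp only:) (rule cv_map_scalar_prod, use bd q in \<open>auto simp: set_delay_idx\<close>)
    then show ?thesis by (simp add: sum_delay_idx)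
  qed
  have "Xi S J Q R *\<^sub>v blk x X Y w = D1 *\<^sub>v blk x X Y w - D2 *\<^sub>v blk x X Y w"
    unfolding Xi using dD dim_blk[OF b] by (intro mmv_minus) auto
  then have "blk x X Y w \<bullet> (Xi S J Q R *\<^sub>v blk x X Y w) = blk x X Y w \<bullet> (D1 *\<^sub>v blk x X Y w) - blk x X Y w \<bullet> (D2 *\<^sub>v blk x X Y w)"
    using dD by (simp add: sp_minus_right)
  then show ?thesis unfolding f1 f2 g1 g2 g3 g4 by simp
qed

end

subsection \<open>Square integrable functions and Gram matrices\<close>

lemma sq_int_mult_integrable:
  assumes "sq_int I f" "sq_int I g"
  shows "integrable (lebesgue_on I) (\<lambda>\<tau>. f \<tau> * g \<tau>)"
proof (rule Bochner_Integration.integrable_bound)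
  show "integrable (lebesgue_on I) (\<lambda>\<tau>. (f \<tau>)\<^sup>2 + (g \<tau>)\<^sup>2)" using assms by (auto simp: sq_int_def)
  show "(\<lambda>\<tau>. f \<tau> * g \<tau>) \<in> borel_measurable (lebesgue_on I)" using assms by (auto simp: sq_int_def)
  show "AE \<tau> in lebesgue_on I. norm (f \<tau> * g \<tau>) \<le> norm ((f \<tau>)\<^sup>2 + (g \<tau>)\<^sup>2)"
  proof (rule AE_I2)
    fix \<tau>
    have "2 * (\<bar>f \<tau>\<bar> * \<bar>g \<tau>\<bar>) \<le> (f \<tau>)\<^sup>2 + (g \<tau>)\<^sup>2"
      using sum_squares_bound[of "\<bar>f \<tau>\<bar>" "\<bar>g \<tau>\<bar>"] by (simp add: mult.assoc)
    moreover have "0 \<le> \<bar>f \<tau>\<bar> * \<bar>g \<tau>\<bar>" by simp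
    ultimately show "norm (f \<tau> * g \<tau>) \<le> norm ((f \<tau>)\<^sup>2 + (g \<tau>)\<^sup>2)" unfolding real_norm_def abs_mult by linarith
  qed
qed

lemma sq_int_cong: "sq_int I f \<Longrightarrow> (\<And>\<tau>. \<tau> \<in> I \<Longrightarrow> f \<tau> = g \<tau>) \<Longrightarrow> sq_int I g"
proof -
  assume f: "sq_int I f" and eq: "\<And>\<tau>. \<tau> \<in> I \<Longrightarrow> f \<tau> = g \<tau>"
  have "f \<in> borel_measurable (lebesgue_on I) \<longleftrightarrow> g \<in> borel_measurable (lebesgue_on I)"
    by (rule measurable_cong) (use eq in auto)
  moreover have "integrable (lebesgue_on I) (\<lambda>\<tau>. (f \<tau>)\<^sup>2) \<longleftrightarrow> integrable (lebesgue_on I) (\<lambda>\<tau>. (g \<tau>)\<^sup>2)"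
    by (rule Bochner_Integration.integrable_cong[OF refl]) (use eq in auto)
  ultimately show "sq_int I g" using f by (simp add: sq_int_def)
qed

lemma sq_int_cmult: "sq_int I f \<Longrightarrow> sq_int I (\<lambda>\<tau>. c * f \<tau>)"
  by (auto simp: sq_int_def power_mult_distrib)

lemma sq_int_zero: "sq_int I (\<lambda>\<tau>. 0)" by (simp add: sq_int_def)

lemma sq_int_add:
  assumes "sq_int I f" "sq_int I g"
  shows "sq_int I (\<lambda>\<tau>. f \<tau> + g \<tau>)"
proof -
  have "integrable (lebesgue_on I) (\<lambda>\<tau>. (f \<tau>)\<^sup>2 + (g \<tau>)\<^sup>2 + 2 * (f \<tau> * g \<tau>))"
    using assms sq_int_mult_integrable[OF assms] by (auto simp: sq_int_def)
  moreover have "(\<lambda>\<tau>. (f \<tau> + g \<tau>)\<^sup>2) = (\<lambda>\<tau>. (f \<tau>)\<^sup>2 + (g \<tau>)\<^sup>2 + 2 * (f \<tau> * g \<tau>))"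
    by (auto simp: power2_sum)
  ultimately show ?thesis using assms by (auto simp: sq_int_def)
qed

lemma sq_int_sum: "(\<And>j. j \<in> A \<Longrightarrow> sq_int I (f j)) \<Longrightarrow> sq_int I (\<lambda>\<tau>. \<Sum>j\<in>A. f j \<tau>)"
  by (induction A rule: infinite_finite_induct) (auto intro: sq_int_zero sq_int_add)

lemma sq_int_continuous:
  assumes "continuous_on {a..b} f"
  shows "sq_int {a..b} f"
  unfolding sq_int_def
  using assms by (auto intro!: continuous_imp_integrable_real continuous_imp_measurable_on_sets_lebesgue continuous_intros)

lemma sq_int_integrable:
  assumes "sq_int {a..b} f"
  shows "integrable (lebesgue_on {a..b}) f"
  using sq_int_mult_integrable[OF assms sq_int_continuous[of a b "\<lambda>_. 1"]] by simp

lemma L2_vecD: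
  assumes "u \<in> L2_vec I k"
  shows "\<tau> \<in> I \<Longrightarrow> dim_vec (u \<tau>) = k" "j < k \<Longrightarrow> sq_int I (\<lambda>\<tau>. u \<tau> $ j)"
  using assms by (auto simp: L2_vec_def)

lemma L2_vecI:
  assumes "\<And>\<tau>. \<tau> \<in> I \<Longrightarrow> dim_vec (u \<tau>) = k" "\<And>j. j < k \<Longrightarrow> sq_int I (\<lambda>\<tau>. u \<tau> $ j)"
  shows "u \<in> L2_vec I k"
  using assms by (auto simp: L2_vec_def intro: carrier_vecI)

lemma L2_vec_append:
  assumes u: "u \<in> L2_vec I k" and v: "v \<in> L2_vec I l"
  shows "(\<lambda>\<tau>. u \<tau> @\<^sub>v v \<tau>) \<in> L2_vec I (k + l)"
proof (rule L2_vecI)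
  fix j assume j: "j < k + l"
  show "sq_int I (\<lambda>\<tau>. (u \<tau> @\<^sub>v v \<tau>) $ j)"
  proof (cases "j < k")
    case True
    show ?thesis by (rule sq_int_cong[OF L2_vecD(2)[OF u True]]) (use True j L2_vecD(1)[OF u] L2_vecD(1)[OF v] in auto)
  next
    case False
    then have "j - k < l" using j by auto
    from L2_vecD(2)[OF v this] show ?thesis
      by (rule sq_int_cong) (use False j L2_vecD(1)[OF u] L2_vecD(1)[OF v] in auto)
  qed
qed (use L2_vecD(1)[OF u] L2_vecD(1)[OF v] in auto)

lemma L2_vec_mult:
  assumes u: "u \<in> L2_vec I k" and M: "M \<in> carrier_mat r k"
  shows "(\<lambda>\<tau>. M *\<^sub>v u \<tau>) \<in> L2_vec I r"
proof (rule L2_vecI)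
  fix j assume j: "j < r"
  have "sq_int I (\<lambda>\<tau>. \<Sum>c = 0..<k. M $$ (j, c) * u \<tau> $ c)"
    by (intro sq_int_sum sq_int_cmult L2_vecD(2)[OF u]) auto
  then show "sq_int I (\<lambda>\<tau>. (M *\<^sub>v u \<tau>) $ j)"
    by (rule sq_int_cong) (use L2_vecD(1)[OF u] M j in \<open>auto simp: scalar_prod_def intro!: sum.cong\<close>)
qed (use M in auto)

lemma L2_vec_minus:
  assumes u: "u \<in> L2_vec I k" and v: "v \<in> L2_vec I k"
  shows "(\<lambda>\<tau>. u \<tau> - v \<tau>) \<in> L2_vec I k"
proof (rule L2_vecI)
  fix j assume j: "j < k"
  have "sq_int I (\<lambda>\<tau>. u \<tau> $ j + (- 1) * v \<tau> $ j)"
    by (intro sq_int_add sq_int_cmult L2_vecD(2)[OF u] L2_vecD(2)[OF v] j)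
  then show "sq_int I (\<lambda>\<tau>. (u \<tau> - v \<tau>) $ j)"
    by (rule sq_int_cong) (use L2_vecD(1)[OF u] L2_vecD(1)[OF v] j in auto)
qed (use L2_vecD(1)[OF v] in auto)

section \<open>Gram matrices under linear maps\<close>

lemma cross_gram_index:
  assumes u: "u \<in> L2_vec I k" and v: "v \<in> L2_vec I l" and ab: "a < k" "b < l"
  shows "cross_gram I k u l v $$ (a, b) = (LINT \<tau>|lebesgue_on I. u \<tau> $ a * v \<tau> $ b)"
proof -
  have "cross_gram I k u l v $$ (a, b) = (LINT \<tau>|lebesgue_on I. (col_mat (u \<tau>) * (col_mat (v \<tau>))\<^sup>T) $$ (a, b))"
    using ab by (simp add: cross_gram_def int_mat_def)
  also have "\<dots> = (LINT \<tau>|lebesgue_on I. u \<tau> $ a * v \<tau> $ b)"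
  proof (rule Bochner_Integration.integral_cong[OF refl])
    fix \<tau> assume "\<tau> \<in> space (lebesgue_on I)"
    then have "\<tau> \<in> I" by simp
    then show "(col_mat (u \<tau>) * (col_mat (v \<tau>))\<^sup>T) $$ (a, b) = u \<tau> $ a * v \<tau> $ b"
      using L2_vecD(1)[OF u] L2_vecD(1)[OF v] ab
      by (simp add: col_mat_def mat_of_cols_def scalar_prod_def row_def col_def)
  qed
  finally show ?thesis .
qed

lemma cross_gram_transpose:
  assumes u: "u \<in> L2_vec I k" and v: "v \<in> L2_vec I l"
  shows "cross_gram I k u l v = (cross_gram I l v k u)\<^sup>T"
proof -
  have d: "cross_gram I k u l v \<in> carrier_mat k l" "cross_gram I l v k u \<in> carrier_mat l k"
    by (rule cross_gram_carrier)+
  show ?thesis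
    by (intro eq_matI) (use d in \<open>auto simp: cross_gram_index[OF u v] cross_gram_index[OF v u] mult.commute\<close>)
qed

lemma cross_gram_mult_left:
  assumes u: "u \<in> L2_vec I k" and v: "v \<in> L2_vec I l" and M: "M \<in> carrier_mat r k"
  shows "cross_gram I r (\<lambda>\<tau>. M *\<^sub>v u \<tau>) l v = M * cross_gram I k u l v"
proof (rule eq_matI)
  have d: "cross_gram I k u l v \<in> carrier_mat k l" "cross_gram I r (\<lambda>\<tau>. M *\<^sub>v u \<tau>) l v \<in> carrier_mat r l"
    by (rule cross_gram_carrier)+
  then show "dim_row (cross_gram I r (\<lambda>\<tau>. M *\<^sub>v u \<tau>) l v) = dim_row (M * cross_gram I k u l v)"
    "dim_col (cross_gram I r (\<lambda>\<tau>. M *\<^sub>v u \<tau>) l v) = dim_col (M * cross_gram I k u l v)" using M by auto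
  fix a b assume "a < dim_row (M * cross_gram I k u l v)" "b < dim_col (M * cross_gram I k u l v)"
  then have ab: "a < r" "b < l" using M d by auto
  have "cross_gram I r (\<lambda>\<tau>. M *\<^sub>v u \<tau>) l v $$ (a, b) = (LINT \<tau>|lebesgue_on I. (M *\<^sub>v u \<tau>) $ a * v \<tau> $ b)"
    by (rule cross_gram_index[OF L2_vec_mult[OF u M] v ab])
  also have "\<dots> = (LINT \<tau>|lebesgue_on I. (\<Sum>c = 0..<k. M $$ (a, c) * (u \<tau> $ c * v \<tau> $ b)))"
    by (rule Bochner_Integration.integral_cong[OF refl])
      (use L2_vecD(1)[OF u] M ab in \<open>auto simp: scalar_prod_def sum_distrib_right mult.assoc intro!: sum.cong\<close>)
  also have "\<dots> = (\<Sum>c = 0..<k. M $$ (a, c) * (LINT \<tau>|lebesgue_on I. u \<tau> $ c * v \<tau> $ b))"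
    by (subst Bochner_Integration.integral_sum) (auto intro!: sq_int_mult_integrable L2_vecD(2)[OF u] L2_vecD(2)[OF v] ab)
  also have "\<dots> = (M * cross_gram I k u l v) $$ (a, b)"
    using M d ab by (auto simp: scalar_prod_def cross_gram_index[OF u v _ ab(2)] intro!: sum.cong)
  finally show "cross_gram I r (\<lambda>\<tau>. M *\<^sub>v u \<tau>) l v $$ (a, b) = (M * cross_gram I k u l v) $$ (a, b)" .
qed

lemma cross_gram_mult:
  assumes u: "u \<in> L2_vec I k" and v: "v \<in> L2_vec I l" and M: "M \<in> carrier_mat r k" and N: "N \<in> carrier_mat s l"
  shows "cross_gram I r (\<lambda>\<tau>. M *\<^sub>v u \<tau>) s (\<lambda>\<tau>. N *\<^sub>v v \<tau>) = M * cross_gram I k u l v * N\<^sup>T"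
proof -
  note Nv = L2_vec_mult[OF v N]
  have G: "cross_gram I k u l v \<in> carrier_mat k l" by (rule cross_gram_carrier)
  have "cross_gram I k u s (\<lambda>\<tau>. N *\<^sub>v v \<tau>) = cross_gram I k u l v * N\<^sup>T"
    unfolding cross_gram_transpose[OF u Nv] cross_gram_mult_left[OF v u N] cross_gram_transpose[OF u v]
    using N cross_gram_carrier by (rule transpose_mult)
  then show ?thesis unfolding cross_gram_mult_left[OF u Nv M] using M G N by simp
qed

lemma cross_gram_minus_left:
  assumes u: "u \<in> L2_vec I k" and u': "u' \<in> L2_vec I k" and v: "v \<in> L2_vec I l"
  shows "cross_gram I k (\<lambda>\<tau>. u \<tau> - u' \<tau>) l v = cross_gram I k u l v - cross_gram I k u' l v"
proof (rule eq_matI)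
  have d: "cross_gram I k u l v \<in> carrier_mat k l" "cross_gram I k u' l v \<in> carrier_mat k l" "cross_gram I k (\<lambda>\<tau>. u \<tau> - u' \<tau>) l v \<in> carrier_mat k l"
    by (rule cross_gram_carrier)+
  then show "dim_row (cross_gram I k (\<lambda>\<tau>. u \<tau> - u' \<tau>) l v) = dim_row (cross_gram I k u l v - cross_gram I k u' l v)"
    "dim_col (cross_gram I k (\<lambda>\<tau>. u \<tau> - u' \<tau>) l v) = dim_col (cross_gram I k u l v - cross_gram I k u' l v)" by auto
  fix a b assume "a < dim_row (cross_gram I k u l v - cross_gram I k u' l v)" "b < dim_col (cross_gram I k u l v - cross_gram I k u' l v)"
  then have ab: "a < k" "b < l" using d by auto
  have "cross_gram I k (\<lambda>\<tau>. u \<tau> - u' \<tau>) l v $$ (a, b) = (LINT \<tau>|lebesgue_on I. (u \<tau> - u' \<tau>) $ a * v \<tau> $ b)"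
    by (rule cross_gram_index[OF L2_vec_minus[OF u u'] v ab])
  also have "\<dots> = (LINT \<tau>|lebesgue_on I. u \<tau> $ a * v \<tau> $ b - u' \<tau> $ a * v \<tau> $ b)"
    by (rule Bochner_Integration.integral_cong[OF refl]) (use L2_vecD(1)[OF u'] ab in \<open>auto simp: left_diff_distrib\<close>)
  also have "\<dots> = (LINT \<tau>|lebesgue_on I. u \<tau> $ a * v \<tau> $ b) - (LINT \<tau>|lebesgue_on I. u' \<tau> $ a * v \<tau> $ b)"
    by (intro Bochner_Integration.integral_diff sq_int_mult_integrable L2_vecD(2)[OF u] L2_vecD(2)[OF u'] L2_vecD(2)[OF v] ab)
  also have "\<dots> = (cross_gram I k u l v - cross_gram I k u' l v) $$ (a, b)"
    using d ab by (simp add: cross_gram_index[OF u v ab] cross_gram_index[OF u' v ab])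
  finally show "cross_gram I k (\<lambda>\<tau>. u \<tau> - u' \<tau>) l v $$ (a, b) = (cross_gram I k u l v - cross_gram I k u' l v) $$ (a, b)" .
qed

text \<open>L^{-1} (L L^T) L^{-T} = I: division by the Cholesky factor orthonormalises the
  functions.\<close>

lemma cholesky_whitening:
  assumes u: "u \<in> L2_vec I k" and ch: "cholesky (cross_gram I k u k u) L"
  shows "cross_gram I k (\<lambda>\<tau>. mat_inv L *\<^sub>v u \<tau>) k (\<lambda>\<tau>. mat_inv L *\<^sub>v u \<tau>) = 1\<^sub>m k"
proof -
  note c = cholesky_invertible[OF ch cross_gram_carrier]
  note i = mat_inv_inverse[OF c(1,2)]
  have "cross_gram I k u k u = L * L\<^sup>T" using ch by (simp add: cholesky_def)
  then have "cross_gram I k (\<lambda>\<tau>. mat_inv L *\<^sub>v u \<tau>) k (\<lambda>\<tau>. mat_inv L *\<^sub>v u \<tau>) = mat_inv L * (L * L\<^sup>T) * (mat_inv L)\<^sup>T"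
    using cross_gram_mult[OF u u i(1,1)] by simp
  also have "\<dots> = (mat_inv L * L) * (L\<^sup>T * (mat_inv L)\<^sup>T)"
    using c(1) i(1) by (simp add: assoc_mult_mat[of _ k k _ k _ k])
  also have "L\<^sup>T * (mat_inv L)\<^sup>T = (mat_inv L * L)\<^sup>T" using c(1) i(1) by (simp add: transpose_mult)
  finally show ?thesis using i by simp
qed

section \<open>Matrices and Kronecker products under the integral\<close>

lemma mult_int_vec:
  assumes M: "M \<in> carrier_mat r k" and d: "\<And>\<tau>. \<tau> \<in> I \<Longrightarrow> dim_vec (v \<tau>) = k"
    and i: "\<And>j. j < k \<Longrightarrow> integrable (lebesgue_on I) (\<lambda>\<tau>. v \<tau> $ j)"
  shows "M *\<^sub>v int_vec I k v = int_vec I r (\<lambda>\<tau>. M *\<^sub>v v \<tau>)"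
proof (rule eq_vecI)
  fix a assume "a < dim_vec (int_vec I r (\<lambda>\<tau>. M *\<^sub>v v \<tau>))"
  then have a: "a < r" by (simp add: int_vec_def)
  have "(LINT \<tau>|lebesgue_on I. (M *\<^sub>v v \<tau>) $ a) = (LINT \<tau>|lebesgue_on I. (\<Sum>c = 0..<k. M $$ (a, c) * v \<tau> $ c))"
    by (rule Bochner_Integration.integral_cong[OF refl]) (use d M a in \<open>auto simp: scalar_prod_def intro!: sum.cong\<close>)
  also have "\<dots> = (\<Sum>c = 0..<k. M $$ (a, c) * (LINT \<tau>|lebesgue_on I. v \<tau> $ c))"
    by (subst Bochner_Integration.integral_sum) (auto intro!: i)
  finally show "(M *\<^sub>v int_vec I k v) $ a = int_vec I r (\<lambda>\<tau>. M *\<^sub>v v \<tau>) $ a"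
    using M a by (auto simp: int_vec_def scalar_prod_def intro!: sum.cong)
qed (use M in \<open>simp add: int_vec_def\<close>)

lemma sp_int_vec:
  assumes u: "dim_vec u = k" and d: "\<And>\<tau>. \<tau> \<in> I \<Longrightarrow> dim_vec (v \<tau>) = k"
    and i: "\<And>j. j < k \<Longrightarrow> integrable (lebesgue_on I) (\<lambda>\<tau>. v \<tau> $ j)"
  shows "u \<bullet> int_vec I k v = (LINT \<tau>|lebesgue_on I. u \<bullet> v \<tau>)"
    and "integrable (lebesgue_on I) (\<lambda>\<tau>. u \<bullet> v \<tau>)"
proof -
  have c: "(\<Sum>c = 0..<k. u $ c * v \<tau> $ c) = u \<bullet> v \<tau>" if "\<tau> \<in> I" for \<tau>
    using d[OF that] by (simp add: scalar_prod_def)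
  have s: "integrable (lebesgue_on I) (\<lambda>\<tau>. \<Sum>c = 0..<k. u $ c * v \<tau> $ c)"
    by (intro Bochner_Integration.integrable_sum integrable_mult_right i) auto
  show "integrable (lebesgue_on I) (\<lambda>\<tau>. u \<bullet> v \<tau>)"
    by (rule Bochner_Integration.integrable_cong[THEN iffD1, OF refl _ s]) (use c in auto)
  have "(LINT \<tau>|lebesgue_on I. u \<bullet> v \<tau>) = (LINT \<tau>|lebesgue_on I. (\<Sum>c = 0..<k. u $ c * v \<tau> $ c))"
    by (rule Bochner_Integration.integral_cong[OF refl]) (use c in auto)
  also have "\<dots> = (\<Sum>c = 0..<k. u $ c * (LINT \<tau>|lebesgue_on I. v \<tau> $ c))"
    by (subst Bochner_Integration.integral_sum) (auto intro!: i)
  finally show "u \<bullet> int_vec I k v = (LINT \<tau>|lebesgue_on I. u \<bullet> v \<tau>)"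
    using u by (simp add: int_vec_def scalar_prod_def)
qed

lemma dim_int_vec[simp]: "dim_vec (int_vec I k v) = k" by (simp add: int_vec_def)

lemma kv_integrable:
  assumes u: "u \<in> L2_vec I k" and y: "y \<in> L2_vec I l" and j: "j < k * l"
  shows "integrable (lebesgue_on I) (\<lambda>\<tau>. kv (u \<tau>) (y \<tau>) $ j)"
proof -
  have "integrable (lebesgue_on I) (\<lambda>\<tau>. u \<tau> $ (j div l) * y \<tau> $ (j mod l))"
    using div_mod_less[OF j] by (intro sq_int_mult_integrable L2_vecD(2)[OF u] L2_vecD(2)[OF y]) auto
  then show ?thesis
    by (rule Bochner_Integration.integrable_cong[THEN iffD1, OF refl, rotated])
      (use L2_vecD(1)[OF u] L2_vecD(1)[OF y] j in \<open>auto simp: kv_def\<close>)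
qed

lemma kronecker_int_kv:
  assumes u: "u \<in> L2_vec I k" and y: "y \<in> L2_vec I l" and A: "A \<in> carrier_mat r k" and B: "B \<in> carrier_mat s l"
  shows "(A \<otimes>\<^sub>K B) *\<^sub>v int_vec I (k * l) (\<lambda>\<tau>. kv (u \<tau>) (y \<tau>)) = int_vec I (r * s) (\<lambda>\<tau>. kv (A *\<^sub>v u \<tau>) (B *\<^sub>v y \<tau>))"
proof -
  have "(A \<otimes>\<^sub>K B) *\<^sub>v int_vec I (k * l) (\<lambda>\<tau>. kv (u \<tau>) (y \<tau>)) = int_vec I (r * s) (\<lambda>\<tau>. (A \<otimes>\<^sub>K B) *\<^sub>v kv (u \<tau>) (y \<tau>))"
    by (rule mult_int_vec) (use A B L2_vecD(1)[OF u] L2_vecD(1)[OF y] kv_integrable[OF u y] in auto)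
  also have "\<dots> = int_vec I (r * s) (\<lambda>\<tau>. kv (A *\<^sub>v u \<tau>) (B *\<^sub>v y \<tau>))"
    unfolding int_vec_def
  proof (intro eq_vecI; simp)
    fix j
    show "(LINT \<tau>|lebesgue_on I. ((A \<otimes>\<^sub>K B) *\<^sub>v kv (u \<tau>) (y \<tau>)) $ j) = (LINT \<tau>|lebesgue_on I. kv (A *\<^sub>v u \<tau>) (B *\<^sub>v y \<tau>) $ j)"
      by (rule Bochner_Integration.integral_cong[OF refl])
        (use L2_vecD(1)[OF u] L2_vecD(1)[OF y] A B in \<open>auto simp: kronecker_mult_kv\<close>)
  qed
  finally show ?thesis .
qed

subsection \<open>Bessel's inequality\<close>

lemma integral_sum_cmult:
  fixes f :: "'i \<Rightarrow> real \<Rightarrow> real"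
  assumes "\<And>a. a \<in> A \<Longrightarrow> integrable M (f a)"
  shows "(LINT \<tau>|M. (\<Sum>a\<in>A. c a * f a \<tau>)) = (\<Sum>a\<in>A. c a * (LINT \<tau>|M. f a \<tau>))"
    and "integrable M (\<lambda>\<tau>. \<Sum>a\<in>A. c a * f a \<tau>)"
proof -
  show "integrable M (\<lambda>\<tau>. \<Sum>a\<in>A. c a * f a \<tau>)"
    by (intro Bochner_Integration.integrable_sum integrable_mult_right assms)
  show "(LINT \<tau>|M. (\<Sum>a\<in>A. c a * f a \<tau>)) = (\<Sum>a\<in>A. c a * (LINT \<tau>|M. f a \<tau>))"
    by (subst Bochner_Integration.integral_sum) (auto intro!: assms)
qed

lemma integral_double_sum_cmult:
  fixes f :: "'i \<Rightarrow> 'j \<Rightarrow> real \<Rightarrow> real"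
  assumes "\<And>a b. a \<in> A \<Longrightarrow> b \<in> B \<Longrightarrow> integrable M (f a b)"
  shows "(LINT \<tau>|M. (\<Sum>a\<in>A. \<Sum>b\<in>B. c a b * f a b \<tau>)) = (\<Sum>a\<in>A. \<Sum>b\<in>B. c a b * (LINT \<tau>|M. f a b \<tau>))"
    and "integrable M (\<lambda>\<tau>. \<Sum>a\<in>A. \<Sum>b\<in>B. c a b * f a b \<tau>)"
proof -
  have i: "integrable M (\<lambda>\<tau>. \<Sum>b\<in>B. c a b * f a b \<tau>)" if "a \<in> A" for a
    by (intro integral_sum_cmult(2) assms that)
  then show "integrable M (\<lambda>\<tau>. \<Sum>a\<in>A. \<Sum>b\<in>B. c a b * f a b \<tau>)"
    by (rule Bochner_Integration.integrable_sum)
  have "(LINT \<tau>|M. (\<Sum>a\<in>A. \<Sum>b\<in>B. c a b * f a b \<tau>)) = (\<Sum>a\<in>A. (LINT \<tau>|M. (\<Sum>b\<in>B. c a b * f a b \<tau>)))"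
    using i by (rule Bochner_Integration.integral_sum)
  also have "\<dots> = (\<Sum>a\<in>A. \<Sum>b\<in>B. c a b * (LINT \<tau>|M. f a b \<tau>))"
    by (intro sum.cong refl integral_sum_cmult(1) assms)
  finally show "(LINT \<tau>|M. (\<Sum>a\<in>A. \<Sum>b\<in>B. c a b * f a b \<tau>)) = (\<Sum>a\<in>A. \<Sum>b\<in>B. c a b * (LINT \<tau>|M. f a b \<tau>))" .
qed

lemma sum_pair_index: "(\<Sum>k = 0..<a * b. F (k div b) (k mod b)) = (\<Sum>i = 0..<a. \<Sum>j = 0..<b. F i j :: real)" for a b :: nat
proof -
  have "(\<Sum>k = 0..<a * b. F (k div b) (k mod b)) = (\<Sum>(i, j)\<in>{0..<a} \<times> {0..<b}. F i j)"
    by (rule sum.reindex_bij_witness[of _ "\<lambda>(i, j). i * b + j" "\<lambda>k. (k div b, k mod b)"])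
      (auto simp: div_mod_less pair_index_less)
  then show ?thesis by (simp add: sum.cartesian_product)
qed

text \<open>I \<otimes> R acts separately on k consecutive blocks of length n, and a n + j is the
  position of entry j of block a. Both index sums are split by quotient and remainder.\<close>

lemma one_kronecker_quadratic:
  assumes R: "R \<in> carrier_mat n n" and X: "dim_vec X = k * n"
  shows "X \<bullet> ((1\<^sub>m k \<otimes>\<^sub>K R) *\<^sub>v X) = (\<Sum>a = 0..<k. \<Sum>j = 0..<n. \<Sum>l = 0..<n. R $$ (j, l) * (X $ (a * n + j) * X $ (a * n + l)))"
proof -
  have "X \<bullet> ((1\<^sub>m k \<otimes>\<^sub>K R) *\<^sub>v X) = (\<Sum>i = 0..<k * n. X $ i * (\<Sum>i' = 0..<k * n. (1\<^sub>m k \<otimes>\<^sub>K R) $$ (i, i') * X $ i'))"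
    using R X by (simp add: scalar_prod_def row_def)
  also have "\<dots> = (\<Sum>i = 0..<k * n. (\<lambda>a j. X $ (a * n + j) * (\<Sum>l = 0..<n. R $$ (j, l) * X $ (a * n + l))) (i div n) (i mod n))"
  proof (rule sum.cong[OF refl])
    fix i assume "i \<in> {0..<k * n}"
    then have i: "i < k * n" by simp
    note im = div_mod_less[OF i]
    have "(\<Sum>i' = 0..<k * n. (1\<^sub>m k \<otimes>\<^sub>K R) $$ (i, i') * X $ i') =
      (\<Sum>i' = 0..<k * n. (\<lambda>a l. if a = i div n then R $$ (i mod n, l) * X $ (a * n + l) else 0) (i' div n) (i' mod n))"
    proof (rule sum.cong[OF refl])
      fix i' assume "i' \<in> {0..<k * n}"
      then have i': "i' < k * n" by simp
      show "(1\<^sub>m k \<otimes>\<^sub>K R) $$ (i, i') * X $ i' = (\<lambda>a l. if a = i div n then R $$ (i mod n, l) * X $ (a * n + l) else 0) (i' div n) (i' mod n)"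
      proof -
        have "X $ (i div n * n + i' mod n) = X $ i'" if "i' div n = i div n" using that by (metis div_mult_mod_eq)
        then show ?thesis using i i' im div_mod_less[OF i'] R by (auto simp: kronecker_def simp del: div_mult_mod_eq mod_div_mult_eq)
      qed
    qed
    also have "\<dots> = (\<Sum>a = 0..<k. \<Sum>l = 0..<n. if a = i div n then R $$ (i mod n, l) * X $ (a * n + l) else 0)"
      by (rule sum_pair_index)
    also have "\<dots> = (\<Sum>a = 0..<k. if a = i div n then \<Sum>l = 0..<n. R $$ (i mod n, l) * X $ (a * n + l) else 0)"
      by (intro sum.cong) auto
    also have "\<dots> = (\<Sum>l = 0..<n. R $$ (i mod n, l) * X $ (i div n * n + l))"
      using im by (simp add: sum.delta)
    finally show "X $ i * (\<Sum>i' = 0..<k * n. (1\<^sub>m k \<otimes>\<^sub>K R) $$ (i, i') * X $ i') =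
      (\<lambda>a j. X $ (a * n + j) * (\<Sum>l = 0..<n. R $$ (j, l) * X $ (a * n + l))) (i div n) (i mod n)" by simp
  qed
  also have "\<dots> = (\<Sum>a = 0..<k. \<Sum>j = 0..<n. X $ (a * n + j) * (\<Sum>l = 0..<n. R $$ (j, l) * X $ (a * n + l)))"
    by (rule sum_pair_index)
  finally show ?thesis by (simp add: sum_distrib_left mult_ac)
qed

lemma quadratic_form_sum:
  fixes y :: "real vec"
  assumes "R \<in> carrier_mat n n" "dim_vec y = n"
  shows "y \<bullet> (R *\<^sub>v y) = (\<Sum>j = 0..<n. \<Sum>l = 0..<n. R $$ (j, l) * (y $ j * y $ l))"
proof -
  have "y \<bullet> (R *\<^sub>v y) = (\<Sum>j = 0..<n. \<Sum>l = 0..<n. y $ j * (R $$ (j, l) * y $ l))"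
    using assms by (simp add: scalar_prod_def row_def sum_distrib_left)
  also have "\<dots> = (\<Sum>j = 0..<n. \<Sum>l = 0..<n. R $$ (j, l) * (y $ j * y $ l))"
    by (intro sum.cong refl mult.left_commute)
  finally show ?thesis .
qed

text \<open>The residual z of projecting y on the span of the functions u a is orthogonal to that
  span, so the integral of the nonnegative form of z is exactly the right side minus the left. The
  index type is arbitrary to allow the union of two orthonormal families.\<close>

lemma bessel_quadratic:
  fixes u :: "'i \<Rightarrow> real \<Rightarrow> real"
  assumes A: "finite A" and u: "\<And>a. a \<in> A \<Longrightarrow> sq_int I (u a)"
    and orth: "\<And>a b. a \<in> A \<Longrightarrow> b \<in> A \<Longrightarrow> (LINT \<tau>|lebesgue_on I. u a \<tau> * u b \<tau>) = (if a = b then 1 else 0)"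
    and y: "\<And>j. j < n \<Longrightarrow> sq_int I (y j)"
    and R: "\<And>v. dim_vec v = n \<Longrightarrow> 0 \<le> (\<Sum>j = 0..<n. \<Sum>l = 0..<n. R j l * (v $ j * v $ l))"
  shows "(\<Sum>a\<in>A. \<Sum>j = 0..<n. \<Sum>l = 0..<n. R j l * ((LINT \<tau>|lebesgue_on I. u a \<tau> * y j \<tau>) * (LINT \<tau>|lebesgue_on I. u a \<tau> * y l \<tau>)))
    \<le> (LINT \<tau>|lebesgue_on I. (\<Sum>j = 0..<n. \<Sum>l = 0..<n. R j l * (y j \<tau> * y l \<tau>)))"
proof -
  define c where "c a j = (LINT \<tau>|lebesgue_on I. u a \<tau> * y j \<tau>)" for a j
  define z where "z j \<tau> = y j \<tau> - (\<Sum>a\<in>A. c a j * u a \<tau>)" for j \<tau>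
  have zs: "sq_int I (z j)" if "j < n" for j
  proof -
    have "sq_int I (\<lambda>\<tau>. y j \<tau> + (- 1) * (\<Sum>a\<in>A. c a j * u a \<tau>))"
      by (intro sq_int_add sq_int_cmult sq_int_sum y that u)
    then show ?thesis by (simp add: z_def[abs_def])
  qed
  \<comment> \<open>The factors are expanded one at a time: orthogonality kills the projection part
    of the first, and the second leaves the products of the coefficients.\<close>
  have zz: "(LINT \<tau>|lebesgue_on I. z j \<tau> * z l \<tau>) = (LINT \<tau>|lebesgue_on I. y j \<tau> * y l \<tau>) - (\<Sum>a\<in>A. c a j * c a l)"
    if jl: "j < n" "l < n" for j l
  proof -
    have uz: "(LINT \<tau>|lebesgue_on I. u a \<tau> * z l \<tau>) = 0" if a: "a \<in> A" for a
    proof -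
      have "(LINT \<tau>|lebesgue_on I. u a \<tau> * z l \<tau>) = (LINT \<tau>|lebesgue_on I. u a \<tau> * y l \<tau> - (\<Sum>b\<in>A. c b l * (u a \<tau> * u b \<tau>)))"
        by (simp add: z_def right_diff_distrib sum_distrib_left mult_ac)
      also have "\<dots> = c a l - (\<Sum>b\<in>A. c b l * (LINT \<tau>|lebesgue_on I. u a \<tau> * u b \<tau>))"
        unfolding c_def[of a l]
        by (subst Bochner_Integration.integral_diff)
          (auto intro!: integral_sum_cmult sq_int_mult_integrable u y a jl)
      also have "(\<Sum>b\<in>A. c b l * (LINT \<tau>|lebesgue_on I. u a \<tau> * u b \<tau>)) = (\<Sum>b\<in>A. if a = b then c b l else 0)"
        using orth a by (intro sum.cong) auto
      also have "\<dots> = c a l" using A a by simp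
      finally show ?thesis by simp
    qed
    have "(LINT \<tau>|lebesgue_on I. z j \<tau> * z l \<tau>) = (LINT \<tau>|lebesgue_on I. y j \<tau> * z l \<tau> - (\<Sum>a\<in>A. c a j * (u a \<tau> * z l \<tau>)))"
      by (simp add: z_def[of j] left_diff_distrib sum_distrib_right mult.assoc)
    also have "\<dots> = (LINT \<tau>|lebesgue_on I. y j \<tau> * z l \<tau>) - (\<Sum>a\<in>A. c a j * (LINT \<tau>|lebesgue_on I. u a \<tau> * z l \<tau>))"
      by (subst Bochner_Integration.integral_diff)
        (auto intro!: integral_sum_cmult sq_int_mult_integrable u y zs jl)
    also have "(\<Sum>a\<in>A. c a j * (LINT \<tau>|lebesgue_on I. u a \<tau> * z l \<tau>)) = 0"
      using uz by simp
    also have "(LINT \<tau>|lebesgue_on I. y j \<tau> * z l \<tau>) = (LINT \<tau>|lebesgue_on I. y j \<tau> * y l \<tau> - (\<Sum>a\<in>A. c a l * (u a \<tau> * y j \<tau>)))"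
      by (simp add: z_def right_diff_distrib sum_distrib_left mult_ac)
    also have "\<dots> = (LINT \<tau>|lebesgue_on I. y j \<tau> * y l \<tau>) - (\<Sum>a\<in>A. c a l * (LINT \<tau>|lebesgue_on I. u a \<tau> * y j \<tau>))"
      by (subst Bochner_Integration.integral_diff)
        (auto intro!: integral_sum_cmult sq_int_mult_integrable u y zs jl)
    finally show ?thesis by (simp add: c_def[symmetric] mult.commute)
  qed
  have "0 \<le> (LINT \<tau>|lebesgue_on I. (\<Sum>j = 0..<n. \<Sum>l = 0..<n. R j l * (z j \<tau> * z l \<tau>)))"
  proof (rule Bochner_Integration.integral_nonneg)
    fix \<tau>
    show "0 \<le> (\<Sum>j = 0..<n. \<Sum>l = 0..<n. R j l * (z j \<tau> * z l \<tau>))"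
      using R[of "vec n (\<lambda>j. z j \<tau>)"] by simp
  qed
  also have "\<dots> = (\<Sum>j = 0..<n. \<Sum>l = 0..<n. R j l * (LINT \<tau>|lebesgue_on I. z j \<tau> * z l \<tau>))"
    by (intro integral_double_sum_cmult sq_int_mult_integrable zs) auto
  also have "\<dots> = (\<Sum>j = 0..<n. \<Sum>l = 0..<n. R j l * (LINT \<tau>|lebesgue_on I. y j \<tau> * y l \<tau>)) - (\<Sum>j = 0..<n. \<Sum>l = 0..<n. R j l * (\<Sum>a\<in>A. c a j * c a l))"
    unfolding sum_subtractf[symmetric] by (intro sum.cong refl) (simp add: zz right_diff_distrib)
  also have "(\<Sum>j = 0..<n. \<Sum>l = 0..<n. R j l * (\<Sum>a\<in>A. c a j * c a l)) = (\<Sum>a\<in>A. \<Sum>j = 0..<n. \<Sum>l = 0..<n. R j l * (c a j * c a l))"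
    unfolding sum_distrib_left by (subst (2) sum.swap, subst sum.swap) simp
  also have "(\<Sum>j = 0..<n. \<Sum>l = 0..<n. R j l * (LINT \<tau>|lebesgue_on I. y j \<tau> * y l \<tau>)) = (LINT \<tau>|lebesgue_on I. (\<Sum>j = 0..<n. \<Sum>l = 0..<n. R j l * (y j \<tau> * y l \<tau>)))"
    by (intro integral_double_sum_cmult(1)[symmetric] sq_int_mult_integrable y) auto
  finally show ?thesis by (simp add: c_def)
qed

context closed_loop begin

section \<open>Orthonormal coordinates for the kernel functions\<close>

lemma kdD:
  assumes "i \<in> idx"
  shows "fnf S i \<in> W12_vec (- del S i) (- del S (i - 1)) (dimf S i)"
     "fnvphi S i \<in> L2_vec (ivl S i) (dimvphi S i)"
     "fnphi S i \<in> L2_vec (ivl S i) (dimphi S i)"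
     "\<And>j. j < dimf S i \<Longrightarrow> weak_deriv (- del S i) (- del S (i - 1)) (\<lambda>\<tau>. fnf S i \<tau> $ j) (\<lambda>\<tau>. (matM S i *\<^sub>v fnh S i \<tau>) $ j)"
     "AE \<tau> in lebesgue_on (ivl S i).
        kerA S i \<tau> = hatA S i * (col_mat (fng S i \<tau>) \<otimes>\<^sub>K 1\<^sub>m n) \<and>
        kerB S i \<tau> = hatB S i * (col_mat (fng S i \<tau>) \<otimes>\<^sub>K 1\<^sub>m p) \<and>
        kerC S i \<tau> = hatC S i * (col_mat (fng S i \<tau>) \<otimes>\<^sub>K 1\<^sub>m n) \<and>
        kerE S i \<tau> = hatE S i * (col_mat (fng S i \<tau>) \<otimes>\<^sub>K 1\<^sub>m p)"
  using kd assms unfolding kernel_decomposition_def by auto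

lemma gramH_inv:
  assumes "i \<in> idx"
  shows "mat_inv (gramH S i) \<in> carrier_mat (dimh S i) (dimh S i)" "gramH S i * mat_inv (gramH S i) = 1\<^sub>m (dimh S i)"
    "mat_inv (gramH S i) * gramH S i = 1\<^sub>m (dimh S i)"
  by (rule mat_inv_inverse[OF dims_gram(2) cholH(3)[OF assms]])+

lemma L2_fn:
  assumes i: "i \<in> idx"
  shows "fnf S i \<in> L2_vec (ivl S i) (dimf S i)" "fnh S i \<in> L2_vec (ivl S i) (dimh S i)" "fng S i \<in> L2_vec (ivl S i) (dimg S i)"
    "fneps S i \<in> L2_vec (ivl S i) (dimphi S i)"
proof -
  show f: "fnf S i \<in> L2_vec (ivl S i) (dimf S i)" using kdD(1)[OF i] by (simp add: W12_vec_def ivl_def)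
  have "fnh S i \<in> L2_vec (ivl S i) (dimvphi S i + dimf S i)"
    using L2_vec_append[OF kdD(2)[OF i] f] by (simp add: fnh_def[abs_def])
  then show h: "fnh S i \<in> L2_vec (ivl S i) (dimh S i)" by (simp add: dimh_def add.commute)
  have "fng S i \<in> L2_vec (ivl S i) (dimphi S i + dimh S i)"
    using L2_vec_append[OF kdD(3)[OF i] h] by (simp add: fng_def[abs_def])
  then show "fng S i \<in> L2_vec (ivl S i) (dimg S i)" by (simp add: dimg_def dimh_def add.commute)
  have "Gam S i * mat_inv (gramH S i) \<in> carrier_mat (dimphi S i) (dimh S i)"
    using dims_gram(4)[of i] gramH_inv(1)[OF i] by auto
  from L2_vec_minus[OF kdD(3)[OF i] L2_vec_mult[OF h this]]
  show "fneps S i \<in> L2_vec (ivl S i) (dimphi S i)" by (simp add: fneps_def[abs_def])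
qed

definition lh :: "nat \<Rightarrow> real \<Rightarrow> real vec" where "lh i \<tau> = mat_inv (cholH S i) *\<^sub>v fnh S i \<tau>"
definition lep :: "nat \<Rightarrow> real \<Rightarrow> real vec" where "lep i \<tau> = mat_inv (cholE S i) *\<^sub>v fneps S i \<tau>"

lemma L2_orthonormal_basis:
  assumes i: "i \<in> idx"
  shows "lh i \<in> L2_vec (ivl S i) (dimh S i)" "lep i \<in> L2_vec (ivl S i) (dimphi S i)" "lf i \<in> L2_vec (ivl S i) (dimf S i)"
  unfolding lh_def[abs_def] lep_def[abs_def] lf_def[abs_def]
  by (rule L2_vec_mult; use i L2_fn cholH(4) cholE(4) cholF(4) in blast)+

lemma orth_lf: "i \<in> idx \<Longrightarrow> cross_gram (ivl S i) (dimf S i) (lf i) (dimf S i) (lf i) = 1\<^sub>m (dimf S i)"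
  unfolding lf_def[abs_def] by (rule cholesky_whitening[OF L2_fn(1)]) (use chol(1) in \<open>simp_all add: gramF_def\<close>)

lemma orth_lh: "i \<in> idx \<Longrightarrow> cross_gram (ivl S i) (dimh S i) (lh i) (dimh S i) (lh i) = 1\<^sub>m (dimh S i)"
  unfolding lh_def[abs_def] by (rule cholesky_whitening[OF L2_fn(2)]) (use chol(2) in \<open>simp_all add: gramH_def\<close>)

lemma orth_le: "i \<in> idx \<Longrightarrow> cross_gram (ivl S i) (dimphi S i) (lep i) (dimphi S i) (lep i) = 1\<^sub>m (dimphi S i)"
  unfolding lep_def[abs_def] by (rule cholesky_whitening[OF L2_fn(4)]) (use chol(3) in \<open>simp_all add: gramE_def\<close>)

text \<open>\<epsilon> is the residual of projecting \<phi> on h: its Gram matrix with h is \<Gamma>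
  - \<Gamma> H^{-1} H = 0, and the Cholesky factors only multiply it by constant matrices from both
  sides.\<close>

lemma orth_le_lh:
  assumes i: "i \<in> idx"
  shows "cross_gram (ivl S i) (dimphi S i) (lep i) (dimh S i) (lh i) = 0\<^sub>m (dimphi S i) (dimh S i)"
proof -
  note Hi = gramH_inv[OF i]
  have GH: "Gam S i * mat_inv (gramH S i) \<in> carrier_mat (dimphi S i) (dimh S i)"
    using dims_gram(4)[of i] Hi(1) by auto
  have "cross_gram (ivl S i) (dimphi S i) (fneps S i) (dimh S i) (fnh S i) =
     Gam S i - Gam S i * mat_inv (gramH S i) * gramH S i"
    unfolding fneps_def[abs_def] cross_gram_minus_left[OF kdD(3)[OF i] L2_vec_mult[OF L2_fn(2)[OF i] GH] L2_fn(2)[OF i]]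
      cross_gram_mult_left[OF L2_fn(2)[OF i] L2_fn(2)[OF i] GH]
    by (simp add: Gam_def gramH_def)
  also have "Gam S i * mat_inv (gramH S i) * gramH S i = Gam S i"
    using Hi dims_gram(2,4)[of i] by (simp add: assoc_mult_mat[of _ "dimphi S i" "dimh S i" _ "dimh S i"])
  also have "Gam S i - Gam S i = 0\<^sub>m (dimphi S i) (dimh S i)"
    using dims_gram(4)[of i] by (intro eq_matI) auto
  finally have z: "cross_gram (ivl S i) (dimphi S i) (fneps S i) (dimh S i) (fnh S i) = 0\<^sub>m (dimphi S i) (dimh S i)" .
  show ?thesis
    unfolding lh_def[abs_def] lep_def[abs_def] cross_gram_mult[OF L2_fn(4)[OF i] L2_fn(2)[OF i] cholE(4)[OF i] cholH(4)[OF i]] z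
    using cholE(4)[OF i] cholH(4)[OF i] by simp
qed

text \<open>The purpose of T, T~ and of the blocks in M and I-hat: in the coordinates
  \<open>lh\<close>, \<open>lep\<close> they produce g, the derivative of \<open>lf\<close>, and
  \<open>lf\<close> itself. Each claim follows by cancelling a Cholesky factor against its
  inverse.\<close>

lemma basis_expansion:
  assumes i: "i \<in> idx" and t: "\<tau> \<in> ivl S i"
  shows "matT S i *\<^sub>v lh i \<tau> + matTt S i *\<^sub>v lep i \<tau> = fng S i \<tau>"
    and "Mc i *\<^sub>v lh i \<tau> = mat_inv (cholF S i) *\<^sub>v (matM S i *\<^sub>v fnh S i \<tau>)"
    and "Hc i *\<^sub>v lh i \<tau> = lf i \<tau>"
proof -
  note d = dim_fn[OF i t] cholH[OF i] cholE[OF i] cholF[OF i] dims_gram[of i] gramH_inv[OF i] dims_hat(5)[OF i]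
  define G where "G = Gam S i * mat_inv (gramH S i)"
  have G: "G \<in> carrier_mat (dimphi S i) (dimh S i)" using d by (auto simp: G_def)
  have de: "dim_vec (fneps S i \<tau>) = dimphi S i" using L2_vecD(1)[OF L2_fn(4)[OF i] t] .
  have Lh: "cholH S i *\<^sub>v lh i \<tau> = fnh S i \<tau>"
  proof -
    have "cholH S i *\<^sub>v lh i \<tau> = (cholH S i * mat_inv (cholH S i)) *\<^sub>v fnh S i \<tau>"
      unfolding lh_def using d by (intro mmv_mult[symmetric]) auto
    then show ?thesis using d by (simp add: mmv_one)
  qed
  have Le: "cholE S i *\<^sub>v lep i \<tau> = fneps S i \<tau>"
  proof -
    have "cholE S i *\<^sub>v lep i \<tau> = (cholE S i * mat_inv (cholE S i)) *\<^sub>v fneps S i \<tau>"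
      unfolding lep_def using d de by (intro mmv_mult[symmetric]) auto
    then show ?thesis using d de by (simp add: mmv_one)
  qed
  have dl: "dim_vec (lh i \<tau>) = dimh S i" "dim_vec (lep i \<tau>) = dimphi S i" using d by (auto simp: lh_def lep_def)
  have T1: "matT S i *\<^sub>v lh i \<tau> = (G *\<^sub>v fnh S i \<tau>) @\<^sub>v fnh S i \<tau>"
  proof -
    have "matT S i *\<^sub>v lh i \<tau> = (G @\<^sub>r 1\<^sub>m (dimh S i)) *\<^sub>v (cholH S i *\<^sub>v lh i \<tau>)"
      unfolding matT_def G_def[symmetric] using d dl G by (intro mmv_mult) auto
    also have "\<dots> = (G *\<^sub>v fnh S i \<tau>) @\<^sub>v (1\<^sub>m (dimh S i) *\<^sub>v fnh S i \<tau>)"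
      unfolding Lh using d G by (intro append_rows_form) auto
    finally show ?thesis using d by (simp add: mmv_one)
  qed
  have T2: "matTt S i *\<^sub>v lep i \<tau> = fneps S i \<tau> @\<^sub>v 0\<^sub>v (dimh S i)"
  proof -
    have "matTt S i *\<^sub>v lep i \<tau> = (1\<^sub>m (dimphi S i) @\<^sub>r 0\<^sub>m (dimh S i) (dimphi S i)) *\<^sub>v (cholE S i *\<^sub>v lep i \<tau>)"
      unfolding matTt_def using d dl by (intro mmv_mult) auto
    also have "\<dots> = (1\<^sub>m (dimphi S i) *\<^sub>v fneps S i \<tau>) @\<^sub>v (0\<^sub>m (dimh S i) (dimphi S i) *\<^sub>v fneps S i \<tau>)"
      unfolding Le using de by (intro append_rows_form) auto
    finally show ?thesis using de by (simp add: mmv_one mmv_zero_mat)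
  qed
  have "matT S i *\<^sub>v lh i \<tau> + matTt S i *\<^sub>v lep i \<tau> = (G *\<^sub>v fnh S i \<tau> + fneps S i \<tau>) @\<^sub>v (fnh S i \<tau> + 0\<^sub>v (dimh S i))"
    unfolding T1 T2 by (rule append_vec_add) (use d de G in \<open>auto intro: carrier_vecI\<close>)
  also have "G *\<^sub>v fnh S i \<tau> + fneps S i \<tau> = fnphi S i \<tau>"
    unfolding fneps_def G_def[symmetric] using d G by (intro eq_vecI) auto
  also have "fnh S i \<tau> + 0\<^sub>v (dimh S i) = fnh S i \<tau>" using d by (intro eq_vecI) auto
  finally show "matT S i *\<^sub>v lh i \<tau> + matTt S i *\<^sub>v lep i \<tau> = fng S i \<tau>" by (simp add: fng_def)
  show "Mc i *\<^sub>v lh i \<tau> = mat_inv (cholF S i) *\<^sub>v (matM S i *\<^sub>v fnh S i \<tau>)"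
  proof -
    have "Mc i *\<^sub>v lh i \<tau> = (mat_inv (cholF S i) * matM S i) *\<^sub>v (cholH S i *\<^sub>v lh i \<tau>)"
      using d dl by (intro mmv_mult) auto
    then show ?thesis unfolding Lh using d by (simp add: mmv_mult)
  qed
  show "Hc i *\<^sub>v lh i \<tau> = lf i \<tau>"
  proof -
    define E where "E = hcat (dimf S i) [0\<^sub>m (dimf S i) (dimvphi S i), 1\<^sub>m (dimf S i)]"
    have dE: "dim_row E = dimf S i" "dim_col E = dimh S i"
      unfolding E_def by (rule dim_row_hcat, auto)[1] (simp add: dim_col_hcat dimh_def)
    have "Hc i *\<^sub>v lh i \<tau> = (mat_inv (cholF S i) * E) *\<^sub>v (cholH S i *\<^sub>v lh i \<tau>)"
      unfolding E_def[symmetric] using d dl dE by (intro mmv_mult) auto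
    also have "\<dots> = mat_inv (cholF S i) *\<^sub>v (E *\<^sub>v fnh S i \<tau>)" unfolding Lh using d dE by (intro mmv_mult) auto
    also have "E *\<^sub>v fnh S i \<tau> = 0\<^sub>m (dimf S i) (dimvphi S i) *\<^sub>v fnvphi S i \<tau> + hcat (dimf S i) [1\<^sub>m (dimf S i)] *\<^sub>v fnf S i \<tau>"
      unfolding E_def fnh_def by (rule hcat_Cons_form) (use d in auto)
    also have "hcat (dimf S i) [1\<^sub>m (dimf S i)] *\<^sub>v fnf S i \<tau> = 1\<^sub>m (dimf S i) *\<^sub>v fnf S i \<tau>"
      by (rule hcat_single_form) (use d in auto)
    also have "0\<^sub>m (dimf S i) (dimvphi S i) *\<^sub>v fnvphi S i \<tau> + 1\<^sub>m (dimf S i) *\<^sub>v fnf S i \<tau> = fnf S i \<tau>"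
      using d by (simp add: mmv_zero_mat mmv_one) (intro eq_vecI; simp)
    finally show ?thesis by (simp add: lf_def)
  qed
qed

section \<open>Moments of a history segment\<close>

definition Xv :: "nat \<Rightarrow> (real \<Rightarrow> real vec) \<Rightarrow> real vec" where
  "Xv i y = int_vec (ivl S i) (dimh S i * n) (\<lambda>\<tau>. kv (lh i \<tau>) (y \<tau>))"
definition Yv :: "nat \<Rightarrow> (real \<Rightarrow> real vec) \<Rightarrow> real vec" where
  "Yv i y = int_vec (ivl S i) (dimphi S i * n) (\<lambda>\<tau>. kv (lep i \<tau>) (y \<tau>))"
definition Fv :: "nat \<Rightarrow> (real \<Rightarrow> real vec) \<Rightarrow> real vec" where
  "Fv i y = int_vec (ivl S i) (dimf S i * n) (\<lambda>\<tau>. kv (lf i \<tau>) (y \<tau>))"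

lemma dim_moments[simp]: "dim_vec (Xv i y) = dimh S i * n" "dim_vec (Yv i y) = dimphi S i * n" "dim_vec (Fv i y) = dimf S i * n"
  by (simp_all add: Xv_def Yv_def Fv_def)

lemma Hc_Xv:
  assumes i: "i \<in> idx" and y: "y \<in> L2_vec (ivl S i) n"
  shows "(Hc i \<otimes>\<^sub>K 1\<^sub>m n) *\<^sub>v Xv i y = Fv i y"
proof -
  have d: "Hc i \<in> carrier_mat (dimf S i) (dimh S i)" using cholF(4)[OF i] cholH(1)[OF i] by auto
  show ?thesis unfolding Xv_def Fv_def kronecker_int_kv[OF L2_orthonormal_basis(1)[OF i] y d one_carrier_mat]
    by (rule int_vec_cong) (use basis_expansion[OF i] L2_vecD(1)[OF y] in \<open>simp add: mmv_one\<close>)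
qed

lemma Mc_Xv:
  assumes i: "i \<in> idx" and y: "y \<in> L2_vec (ivl S i) n"
  shows "(Mc i \<otimes>\<^sub>K 1\<^sub>m n) *\<^sub>v Xv i y =
    int_vec (ivl S i) (dimf S i * n) (\<lambda>\<tau>. kv (mat_inv (cholF S i) *\<^sub>v (matM S i *\<^sub>v fnh S i \<tau>)) (y \<tau>))"
proof -
  have d: "Mc i \<in> carrier_mat (dimf S i) (dimh S i)" using cholF(4)[OF i] cholH(1)[OF i] by auto
  show ?thesis unfolding Xv_def kronecker_int_kv[OF L2_orthonormal_basis(1)[OF i] y d one_carrier_mat]
    by (rule int_vec_cong) (use basis_expansion[OF i] L2_vecD(1)[OF y] in \<open>simp add: mmv_one\<close>)
qed

text \<open>Inserting g = T \<open>lh\<close> + T~ \<open>lep\<close> into the kernels and pulling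
  constant matrices out of the integrals expresses the distributed delay by moments; K passes to the
  state factor of each Kronecker vector. The kernels factor only almost everywhere, so the
  comparison is made between integrals.\<close>

lemma kernel_coupling:
  assumes i: "i \<in> idx" and y: "y \<in> L2_vec (ivl S i) n" and HA: "HA \<in> carrier_mat r (dimg S i * n)" and HB: "HB \<in> carrier_mat r (dimg S i * p)"
    and kA: "AE \<tau> in lebesgue_on (ivl S i). kA \<tau> = HA * (col_mat (fng S i \<tau>) \<otimes>\<^sub>K 1\<^sub>m n) \<and> kB \<tau> = HB * (col_mat (fng S i \<tau>) \<otimes>\<^sub>K 1\<^sub>m p)"
    and u: "dim_vec u = r"
    and mkA: "kA \<in> L2_mat (ivl S i) r n" and mkB: "kB \<in> L2_mat (ivl S i) r p"
  shows "u \<bullet> (HA *\<^sub>v ((matT S i \<otimes>\<^sub>K 1\<^sub>m n) *\<^sub>v Xv i y)) + u \<bullet> (HA *\<^sub>v ((matTt S i \<otimes>\<^sub>K 1\<^sub>m n) *\<^sub>v Yv i y))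
       + u \<bullet> (HB *\<^sub>v ((matT S i \<otimes>\<^sub>K 1\<^sub>m p) *\<^sub>v ((1\<^sub>m (dimh S i) \<otimes>\<^sub>K K) *\<^sub>v Xv i y)))
       + u \<bullet> (HB *\<^sub>v ((matTt S i \<otimes>\<^sub>K 1\<^sub>m p) *\<^sub>v ((1\<^sub>m (dimphi S i) \<otimes>\<^sub>K K) *\<^sub>v Yv i y)))
     = u \<bullet> int_vec (ivl S i) r (\<lambda>\<tau>. (kA \<tau> + kB \<tau> * K) *\<^sub>v y \<tau>)"
proof -
  note T = dim_matT[OF i] and l = L2_orthonormal_basis[OF i] and Kc = dims_vars(1)
  have yK: "(\<lambda>\<tau>. K *\<^sub>v y \<tau>) \<in> L2_vec (ivl S i) p" by (rule L2_vec_mult[OF y Kc])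
  have Tl: "(\<lambda>\<tau>. matT S i *\<^sub>v lh i \<tau>) \<in> L2_vec (ivl S i) (dimg S i)" "(\<lambda>\<tau>. matTt S i *\<^sub>v lep i \<tau>) \<in> L2_vec (ivl S i) (dimg S i)"
    by (rule L2_vec_mult[OF l(1) T(1)] L2_vec_mult[OF l(2) T(2)])+
  have m1: "HA *\<^sub>v ((matT S i \<otimes>\<^sub>K 1\<^sub>m n) *\<^sub>v Xv i y) = int_vec (ivl S i) r (\<lambda>\<tau>. HA *\<^sub>v kv (matT S i *\<^sub>v lh i \<tau>) (1\<^sub>m n *\<^sub>v y \<tau>))"
    unfolding Xv_def kronecker_int_kv[OF l(1) y T(1) one_carrier_mat]
    by (rule mult_int_vec[OF HA]) (use T L2_vecD(1)[OF y] kv_integrable[OF Tl(1) L2_vec_mult[OF y one_carrier_mat]] in auto)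
  have m2: "HA *\<^sub>v ((matTt S i \<otimes>\<^sub>K 1\<^sub>m n) *\<^sub>v Yv i y) = int_vec (ivl S i) r (\<lambda>\<tau>. HA *\<^sub>v kv (matTt S i *\<^sub>v lep i \<tau>) (1\<^sub>m n *\<^sub>v y \<tau>))"
    unfolding Yv_def kronecker_int_kv[OF l(2) y T(2) one_carrier_mat]
    by (rule mult_int_vec[OF HA]) (use T L2_vecD(1)[OF y] kv_integrable[OF Tl(2) L2_vec_mult[OF y one_carrier_mat]] in auto)
  have oh: "1\<^sub>m k \<in> carrier_mat k k" for k by simp
  have m3: "HB *\<^sub>v ((matT S i \<otimes>\<^sub>K 1\<^sub>m p) *\<^sub>v ((1\<^sub>m (dimh S i) \<otimes>\<^sub>K K) *\<^sub>v Xv i y)) =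
     int_vec (ivl S i) r (\<lambda>\<tau>. HB *\<^sub>v kv (matT S i *\<^sub>v (1\<^sub>m (dimh S i) *\<^sub>v lh i \<tau>)) (1\<^sub>m p *\<^sub>v (K *\<^sub>v y \<tau>)))"
    unfolding Xv_def kronecker_int_kv[OF l(1) y oh Kc] kronecker_int_kv[OF L2_vec_mult[OF l(1) oh] yK T(1) oh]
    by (rule mult_int_vec[OF HB]) (use T kv_integrable[OF L2_vec_mult[OF L2_vec_mult[OF l(1) oh] T(1)] L2_vec_mult[OF yK oh]] in auto)
  have m4: "HB *\<^sub>v ((matTt S i \<otimes>\<^sub>K 1\<^sub>m p) *\<^sub>v ((1\<^sub>m (dimphi S i) \<otimes>\<^sub>K K) *\<^sub>v Yv i y)) =
     int_vec (ivl S i) r (\<lambda>\<tau>. HB *\<^sub>v kv (matTt S i *\<^sub>v (1\<^sub>m (dimphi S i) *\<^sub>v lep i \<tau>)) (1\<^sub>m p *\<^sub>v (K *\<^sub>v y \<tau>)))"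
    unfolding Yv_def kronecker_int_kv[OF l(2) y oh Kc] kronecker_int_kv[OF L2_vec_mult[OF l(2) oh] yK T(2) oh]
    by (rule mult_int_vec[OF HB]) (use T kv_integrable[OF L2_vec_mult[OF L2_vec_mult[OF l(2) oh] T(2)] L2_vec_mult[OF yK oh]] in auto)
  have kvL2: "integrable (lebesgue_on (ivl S i)) (\<lambda>\<tau>. (H *\<^sub>v kv (v \<tau>) (z \<tau>)) $ j)"
    if H: "H \<in> carrier_mat r (k * l)" and v: "v \<in> L2_vec (ivl S i) k" and z: "z \<in> L2_vec (ivl S i) l" and j: "j < r" for H v z j k l
  proof -
    have "integrable (lebesgue_on (ivl S i)) (\<lambda>\<tau>. \<Sum>c = 0..<k * l. H $$ (j, c) * kv (v \<tau>) (z \<tau>) $ c)"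
      by (intro integral_sum_cmult(2) kv_integrable[OF v z]) auto
    then show ?thesis
      by (rule Bochner_Integration.integrable_cong[THEN iffD1, OF refl, rotated])
        (use H j L2_vecD(1)[OF v] L2_vecD(1)[OF z] in \<open>auto simp: scalar_prod_def intro!: sum.cong\<close>)
  qed
  note T1 = L2_vec_mult[OF y oh] and T2 = L2_vec_mult[OF yK oh]
  note I1 = sp_int_vec[OF u _ kvL2[OF HA Tl(1) T1]] and I2 = sp_int_vec[OF u _ kvL2[OF HA Tl(2) T1]]
   and I3 = sp_int_vec[OF u _ kvL2[OF HB L2_vec_mult[OF L2_vec_mult[OF l(1) oh] T(1)] T2]]
   and I4 = sp_int_vec[OF u _ kvL2[OF HB L2_vec_mult[OF L2_vec_mult[OF l(2) oh] T(2)] T2]]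
  have dr: "dim_row HA = r" "dim_row HB = r" using HA HB by auto
  have J1: "integrable (lebesgue_on (ivl S i)) (\<lambda>\<tau>. u \<bullet> (HA *\<^sub>v kv (matT S i *\<^sub>v lh i \<tau>) (1\<^sub>m n *\<^sub>v y \<tau>)))" by (rule I1(2)) (use dr in auto)
  have E1: "u \<bullet> int_vec (ivl S i) r (\<lambda>\<tau>. HA *\<^sub>v kv (matT S i *\<^sub>v lh i \<tau>) (1\<^sub>m n *\<^sub>v y \<tau>)) = (LINT \<tau>|lebesgue_on (ivl S i). u \<bullet> (HA *\<^sub>v kv (matT S i *\<^sub>v lh i \<tau>) (1\<^sub>m n *\<^sub>v y \<tau>)))"
    by (rule I1(1)) (use dr in auto)
  have J2: "integrable (lebesgue_on (ivl S i)) (\<lambda>\<tau>. u \<bullet> (HA *\<^sub>v kv (matTt S i *\<^sub>v lep i \<tau>) (1\<^sub>m n *\<^sub>v y \<tau>)))" by (rule I2(2)) (use dr in auto)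
  have E2: "u \<bullet> int_vec (ivl S i) r (\<lambda>\<tau>. HA *\<^sub>v kv (matTt S i *\<^sub>v lep i \<tau>) (1\<^sub>m n *\<^sub>v y \<tau>)) = (LINT \<tau>|lebesgue_on (ivl S i). u \<bullet> (HA *\<^sub>v kv (matTt S i *\<^sub>v lep i \<tau>) (1\<^sub>m n *\<^sub>v y \<tau>)))"
    by (rule I2(1)) (use dr in auto)
  have J3: "integrable (lebesgue_on (ivl S i)) (\<lambda>\<tau>. u \<bullet> (HB *\<^sub>v kv (matT S i *\<^sub>v (1\<^sub>m (dimh S i) *\<^sub>v lh i \<tau>)) (1\<^sub>m p *\<^sub>v (K *\<^sub>v y \<tau>))))" by (rule I3(2)) (use dr in auto)
  have E3: "u \<bullet> int_vec (ivl S i) r (\<lambda>\<tau>. HB *\<^sub>v kv (matT S i *\<^sub>v (1\<^sub>m (dimh S i) *\<^sub>v lh i \<tau>)) (1\<^sub>m p *\<^sub>v (K *\<^sub>v y \<tau>))) = (LINT \<tau>|lebesgue_on (ivl S i). u \<bullet> (HB *\<^sub>v kv (matT S i *\<^sub>v (1\<^sub>m (dimh S i) *\<^sub>v lh i \<tau>)) (1\<^sub>m p *\<^sub>v (K *\<^sub>v y \<tau>))))"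
    by (rule I3(1)) (use dr in auto)
  have J4: "integrable (lebesgue_on (ivl S i)) (\<lambda>\<tau>. u \<bullet> (HB *\<^sub>v kv (matTt S i *\<^sub>v (1\<^sub>m (dimphi S i) *\<^sub>v lep i \<tau>)) (1\<^sub>m p *\<^sub>v (K *\<^sub>v y \<tau>))))" by (rule I4(2)) (use dr in auto)
  have E4: "u \<bullet> int_vec (ivl S i) r (\<lambda>\<tau>. HB *\<^sub>v kv (matTt S i *\<^sub>v (1\<^sub>m (dimphi S i) *\<^sub>v lep i \<tau>)) (1\<^sub>m p *\<^sub>v (K *\<^sub>v y \<tau>))) = (LINT \<tau>|lebesgue_on (ivl S i). u \<bullet> (HB *\<^sub>v kv (matTt S i *\<^sub>v (1\<^sub>m (dimphi S i) *\<^sub>v lep i \<tau>)) (1\<^sub>m p *\<^sub>v (K *\<^sub>v y \<tau>))))"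
    by (rule I4(1)) (use dr in auto)
  have cA: "(\<lambda>\<tau>. (kA \<tau> + kB \<tau> * K) *\<^sub>v y \<tau>) \<tau> $ j = (\<Sum>c = 0..<n. kA \<tau> $$ (j, c) * y \<tau> $ c) + (\<Sum>c = 0..<p. kB \<tau> $$ (j, c) * (K *\<^sub>v y \<tau>) $ c)"
    if t: "\<tau> \<in> ivl S i" and j: "j < r" for \<tau> j
  proof -
    have c: "kA \<tau> \<in> carrier_mat r n" "kB \<tau> \<in> carrier_mat r p" "dim_vec (y \<tau>) = n"
      using mkA mkB t L2_vecD(1)[OF y t] by (auto simp: L2_mat_def)
    have "(kA \<tau> + kB \<tau> * K) *\<^sub>v y \<tau> = kA \<tau> *\<^sub>v y \<tau> + kB \<tau> *\<^sub>v (K *\<^sub>v y \<tau>)"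
      using c Kc by (subst mmv_add) (auto simp: mmv_mult)
    then show ?thesis using c Kc j by (simp add: scalar_prod_def)
  qed
  \<comment> \<open>Comparing integrals of functions that agree almost everywhere requires
    measurability of this side as well; it comes from the square integrability of the kernels
    themselves.\<close>
  have iK: "integrable (lebesgue_on (ivl S i)) (\<lambda>\<tau>. ((kA \<tau> + kB \<tau> * K) *\<^sub>v y \<tau>) $ j)" if j: "j < r" for j
  proof -
    have "integrable (lebesgue_on (ivl S i)) (\<lambda>\<tau>. (\<Sum>c = 0..<n. kA \<tau> $$ (j, c) * y \<tau> $ c) + (\<Sum>c = 0..<p. kB \<tau> $$ (j, c) * (K *\<^sub>v y \<tau>) $ c))"
      by (intro Bochner_Integration.integrable_add Bochner_Integration.integrable_sum sq_int_mult_integrable L2_vecD(2)[OF y] L2_vecD(2)[OF yK])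
        (use mkA mkB j in \<open>auto simp: L2_mat_def\<close>)
    then show ?thesis
      by (rule Bochner_Integration.integrable_cong[THEN iffD1, OF refl, rotated]) (use cA j in auto)
  qed
  have dK: "dim_vec ((kA \<tau> + kB \<tau> * K) *\<^sub>v y \<tau>) = r" if "\<tau> \<in> ivl S i" for \<tau>
    using mkA mkB that by (auto simp: L2_mat_def)
  have JK: "integrable (lebesgue_on (ivl S i)) (\<lambda>\<tau>. u \<bullet> ((kA \<tau> + kB \<tau> * K) *\<^sub>v y \<tau>))"
    by (rule sp_int_vec(2)[OF u dK iK])
  have EK: "u \<bullet> int_vec (ivl S i) r (\<lambda>\<tau>. (kA \<tau> + kB \<tau> * K) *\<^sub>v y \<tau>) = (LINT \<tau>|lebesgue_on (ivl S i). u \<bullet> ((kA \<tau> + kB \<tau> * K) *\<^sub>v y \<tau>))"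
    by (rule sp_int_vec(1)[OF u dK iK])
  have "(LINT \<tau>|lebesgue_on (ivl S i). u \<bullet> ((kA \<tau> + kB \<tau> * K) *\<^sub>v y \<tau>)) =
    (LINT \<tau>|lebesgue_on (ivl S i). u \<bullet> (HA *\<^sub>v kv (matT S i *\<^sub>v lh i \<tau>) (1\<^sub>m n *\<^sub>v y \<tau>)) + u \<bullet> (HA *\<^sub>v kv (matTt S i *\<^sub>v lep i \<tau>) (1\<^sub>m n *\<^sub>v y \<tau>))
     + u \<bullet> (HB *\<^sub>v kv (matT S i *\<^sub>v (1\<^sub>m (dimh S i) *\<^sub>v lh i \<tau>)) (1\<^sub>m p *\<^sub>v (K *\<^sub>v y \<tau>)))
     + u \<bullet> (HB *\<^sub>v kv (matTt S i *\<^sub>v (1\<^sub>m (dimphi S i) *\<^sub>v lep i \<tau>)) (1\<^sub>m p *\<^sub>v (K *\<^sub>v y \<tau>))))"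
  proof (rule integral_cong_AE)
    show "AE \<tau> in lebesgue_on (ivl S i). u \<bullet> ((kA \<tau> + kB \<tau> * K) *\<^sub>v y \<tau>) =
      u \<bullet> (HA *\<^sub>v kv (matT S i *\<^sub>v lh i \<tau>) (1\<^sub>m n *\<^sub>v y \<tau>)) + u \<bullet> (HA *\<^sub>v kv (matTt S i *\<^sub>v lep i \<tau>) (1\<^sub>m n *\<^sub>v y \<tau>))
     + u \<bullet> (HB *\<^sub>v kv (matT S i *\<^sub>v (1\<^sub>m (dimh S i) *\<^sub>v lh i \<tau>)) (1\<^sub>m p *\<^sub>v (K *\<^sub>v y \<tau>)))
     + u \<bullet> (HB *\<^sub>v kv (matTt S i *\<^sub>v (1\<^sub>m (dimphi S i) *\<^sub>v lep i \<tau>)) (1\<^sub>m p *\<^sub>v (K *\<^sub>v y \<tau>)))"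
      using kA AE_space
    proof eventually_elim
      case (elim \<tau>)
      then have t: "\<tau> \<in> ivl S i" by simp
      note be = basis_expansion(1)[OF i t]
      have dy: "dim_vec (y \<tau>) = n" using L2_vecD(1)[OF y t] .
      have dl: "dim_vec (lh i \<tau>) = dimh S i" "dim_vec (lep i \<tau>) = dimphi S i" "dim_vec (fng S i \<tau>) = dimg S i"
        using L2_vecD(1)[OF l(1) t] L2_vecD(1)[OF l(2) t] dim_fn[OF i t] by auto
      have "(kA \<tau> + kB \<tau> * K) *\<^sub>v y \<tau> = kA \<tau> *\<^sub>v y \<tau> + kB \<tau> *\<^sub>v (K *\<^sub>v y \<tau>)"
        using elim HA HB dl Kc dy by (subst mmv_add) (auto simp: mmv_mult)
      also have "kA \<tau> *\<^sub>v y \<tau> = HA *\<^sub>v kv (fng S i \<tau>) (y \<tau>)"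
        using elim HA dl dy by (simp add: mmv_mult col_mat_kronecker_one)
      also have "kB \<tau> *\<^sub>v (K *\<^sub>v y \<tau>) = HB *\<^sub>v kv (fng S i \<tau>) (K *\<^sub>v y \<tau>)"
        using elim HB Kc dl dy by (simp add: mmv_mult col_mat_kronecker_one)
      also have "HA *\<^sub>v kv (fng S i \<tau>) (y \<tau>) = HA *\<^sub>v kv (matT S i *\<^sub>v lh i \<tau>) (y \<tau>) + HA *\<^sub>v kv (matTt S i *\<^sub>v lep i \<tau>) (y \<tau>)"
        unfolding be[symmetric] using T HA dy by (simp add: kv_add_left mmv_vec_add)
      also have "HB *\<^sub>v kv (fng S i \<tau>) (K *\<^sub>v y \<tau>) = HB *\<^sub>v kv (matT S i *\<^sub>v lh i \<tau>) (K *\<^sub>v y \<tau>) + HB *\<^sub>v kv (matTt S i *\<^sub>v lep i \<tau>) (K *\<^sub>v y \<tau>)"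
        unfolding be[symmetric] using T HB Kc by (simp add: kv_add_left mmv_vec_add)
      finally show ?case using dy dl dr Kc by (simp add: mmv_one sp_add_right)
    qed
  qed (use J1 J2 J3 J4 JK in auto)
  also have "\<dots> = (LINT \<tau>|lebesgue_on (ivl S i). u \<bullet> (HA *\<^sub>v kv (matT S i *\<^sub>v lh i \<tau>) (1\<^sub>m n *\<^sub>v y \<tau>)))
     + (LINT \<tau>|lebesgue_on (ivl S i). u \<bullet> (HA *\<^sub>v kv (matTt S i *\<^sub>v lep i \<tau>) (1\<^sub>m n *\<^sub>v y \<tau>)))
     + (LINT \<tau>|lebesgue_on (ivl S i). u \<bullet> (HB *\<^sub>v kv (matT S i *\<^sub>v (1\<^sub>m (dimh S i) *\<^sub>v lh i \<tau>)) (1\<^sub>m p *\<^sub>v (K *\<^sub>v y \<tau>))))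
     + (LINT \<tau>|lebesgue_on (ivl S i). u \<bullet> (HB *\<^sub>v kv (matTt S i *\<^sub>v (1\<^sub>m (dimphi S i) *\<^sub>v lep i \<tau>)) (1\<^sub>m p *\<^sub>v (K *\<^sub>v y \<tau>))))"
    by (simp only: Bochner_Integration.integral_add[OF Bochner_Integration.integrable_add[OF Bochner_Integration.integrable_add[OF J1 J2] J3] J4]
      Bochner_Integration.integral_add[OF Bochner_Integration.integrable_add[OF J1 J2] J3] Bochner_Integration.integral_add[OF J1 J2])
  finally show ?thesis unfolding m1 m2 m3 m4 EK E1 E2 E3 E4 by (rule sym)
qed

definition theta :: "(real \<Rightarrow> real vec) \<Rightarrow> real \<Rightarrow> real vec \<Rightarrow> real vec" where
  "theta x t w = blk (\<lambda>i. x (t - del S i)) (\<lambda>i. Xv i (\<lambda>\<tau>. x (t + \<tau>))) (\<lambda>i. Yv i (\<lambda>\<tau>. x (t + \<tau>))) w"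

lemma theta_bdims:
  assumes "\<And>s. dim_vec (x s) = n" "dim_vec w = q"
  shows "bdims n (\<lambda>i. x (t - del S i)) (\<lambda>i. Xv i (\<lambda>\<tau>. x (t + \<tau>))) (\<lambda>i. Yv i (\<lambda>\<tau>. x (t + \<tau>))) w"
  using assms by (simp add: bdims_def)

lemma ker_L2:
  assumes "i \<in> idx"
  shows "kerA S i \<in> L2_mat (ivl S i) n n" "kerB S i \<in> L2_mat (ivl S i) n p"
    "kerC S i \<in> L2_mat (ivl S i) m n" "kerE S i \<in> L2_mat (ivl S i) m p"
  using vs assms by (auto simp: valid_system_def)

text \<open>The closed-loop equations in matrix form. State row and output row have the same shape,
  a \<open>rowmat\<close> plus a \<open>rowmat\<close> times the gain, so both are instances of one
  computation.\<close>

lemma closed_loop_theta: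
  assumes x: "\<And>s. dim_vec (x s) = n" "\<And>i. i \<in> idx \<Longrightarrow> (\<lambda>\<tau>. x (t + \<tau>)) \<in> L2_vec (ivl S i) n" and w: "dim_vec (w t) = q"
  shows "Omega S K *\<^sub>v theta x t (w t) = state_rhs S K w x t" "Sigma_cl S K *\<^sub>v theta x t (w t) = output_rhs S K w x t"
proof -
  note b = theta_bdims[of x "w t" t, OF x(1) w]
  have gen: "(rowmat r MA HA n D + rowmat r MB HB p (0\<^sub>m r q) * diag_block_mat [1\<^sub>m (beta S) \<otimes>\<^sub>K K, 0\<^sub>m q q]) *\<^sub>v theta x t (w t) =
     D *\<^sub>v w t + finsum_vec TYPE(real) r (\<lambda>i. (MA i + MB i * K) *\<^sub>v x (t - del S i)) {0..\<nu>}
     + finsum_vec TYPE(real) r (\<lambda>i. int_vec (ivl S i) r (\<lambda>\<tau>. (kA i \<tau> + kB i \<tau> * K) *\<^sub>v x (t + \<tau>))) {1..\<nu>}"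
    (is "?L = ?R")
    if MA: "\<And>i. i \<le> \<nu> \<Longrightarrow> MA i \<in> carrier_mat r n" "\<And>i. i \<in> idx \<Longrightarrow> HA i \<in> carrier_mat r (dimg S i * n)" "D \<in> carrier_mat r q"
    and MB: "\<And>i. i \<le> \<nu> \<Longrightarrow> MB i \<in> carrier_mat r p" "\<And>i. i \<in> idx \<Longrightarrow> HB i \<in> carrier_mat r (dimg S i * p)"
    and kA: "\<And>i. i \<in> idx \<Longrightarrow> AE \<tau> in lebesgue_on (ivl S i). kA i \<tau> = HA i * (col_mat (fng S i \<tau>) \<otimes>\<^sub>K 1\<^sub>m n) \<and> kB i \<tau> = HB i * (col_mat (fng S i \<tau>) \<otimes>\<^sub>K 1\<^sub>m p)"
    and mk: "\<And>i. i \<in> idx \<Longrightarrow> kA i \<in> L2_mat (ivl S i) r n" "\<And>i. i \<in> idx \<Longrightarrow> kB i \<in> L2_mat (ivl S i) r p"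
    for r MA HA D MB HB kA kB
  proof (rule vec_eq_by_forms)
    have d1: "dim_vec ((MA i + MB i * K) *\<^sub>v x (t - del S i)) = r" if "i \<in> {0..\<nu>}" for i
      using MA(1)[of i] MB(1)[of i] that by auto
    define F1 where "F1 = finsum_vec TYPE(real) r (\<lambda>i. (MA i + MB i * K) *\<^sub>v x (t - del S i)) {0..\<nu>}"
    define F2 where "F2 = finsum_vec TYPE(real) r (\<lambda>i. int_vec (ivl S i) r (\<lambda>\<tau>. (kA i \<tau> + kB i \<tau> * K) *\<^sub>v x (t + \<tau>))) {1..\<nu>}"
    have f1: "u \<bullet> F1 = (\<Sum>i = 0..\<nu>. u \<bullet> ((MA i + MB i * K) *\<^sub>v x (t - del S i)))" "dim_vec F1 = r" for u
      unfolding F1_def using d1 by (auto intro!: sp_finsum_vec)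
    have f2: "u \<bullet> F2 = (\<Sum>i\<in>idx. u \<bullet> int_vec (ivl S i) r (\<lambda>\<tau>. (kA i \<tau> + kB i \<tau> * K) *\<^sub>v x (t + \<tau>)))" "dim_vec F2 = r" for u
      unfolding F2_def by (auto intro!: sp_finsum_vec)
    have R: "?R = D *\<^sub>v w t + F1 + F2" by (simp only: F1_def F2_def)
    have dR: "dim_vec ?R = r" unfolding R using f2(2) by simp
    have dr1: "dim_row (rowmat r MB HB p (0\<^sub>m r q)) = r" using dim_rowmat[of MB r p HB "0\<^sub>m r q"] MB by auto
    show "dim_vec ?L = dim_vec ?R" using dR dr1 by (simp del: diag_block_mat.simps)
    fix u :: "real vec" assume "dim_vec u = dim_vec ?R"
    then have u: "dim_vec u = r" using dR by simp
    have "u \<bullet> ?L = (\<Sum>i = 0..\<nu>. u \<bullet> (MA i *\<^sub>v x (t - del S i)) + u \<bullet> (MB i *\<^sub>v (K *\<^sub>v x (t - del S i))))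
      + (\<Sum>i\<in>idx. u \<bullet> int_vec (ivl S i) r (\<lambda>\<tau>. (kA i \<tau> + kB i \<tau> * K) *\<^sub>v x (t + \<tau>))) + u \<bullet> (D *\<^sub>v w t)"
      unfolding theta_def
      by (rule trans[OF closed_loop_row_form[where MA = MA and HA = HA and D = D and MB = MB and HB = HB and r = r and u = u, OF MA MB b]])
        (assumption | intro arg_cong2[of _ _ _ _ "(+)"] sum.cong refl kernel_coupling x MA(2) MB(2) kA mk u)+
    also have "(\<Sum>i = 0..\<nu>. u \<bullet> (MA i *\<^sub>v x (t - del S i)) + u \<bullet> (MB i *\<^sub>v (K *\<^sub>v x (t - del S i)))) =
      (\<Sum>i = 0..\<nu>. u \<bullet> ((MA i + MB i * K) *\<^sub>v x (t - del S i)))"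
    proof (rule sum.cong[OF refl])
      fix i assume i: "i \<in> {0..\<nu>}"
      have "(MA i + MB i * K) *\<^sub>v x (t - del S i) = MA i *\<^sub>v x (t - del S i) + MB i *\<^sub>v (K *\<^sub>v x (t - del S i))"
        using MA(1)[of i] MB(1)[of i] i dims_vars(1) x(1) by (subst mmv_add) (auto simp: mmv_mult)
      then show "u \<bullet> (MA i *\<^sub>v x (t - del S i)) + u \<bullet> (MB i *\<^sub>v (K *\<^sub>v x (t - del S i))) = u \<bullet> ((MA i + MB i * K) *\<^sub>v x (t - del S i))"
        using MA(1)[of i] MB(1)[of i] i by (simp add: sp_add_right)
    qed
    also have "\<dots> + (\<Sum>i\<in>idx. u \<bullet> int_vec (ivl S i) r (\<lambda>\<tau>. (kA i \<tau> + kB i \<tau> * K) *\<^sub>v x (t + \<tau>))) + u \<bullet> (D *\<^sub>v w t) = u \<bullet> ?R"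
      unfolding R using MA(3) f1(2) f2(2) by (simp add: sp_add_right f1(1) f2(1))
    finally show "u \<bullet> ?L = u \<bullet> ?R" .
  qed
  show "Omega S K *\<^sub>v theta x t (w t) = state_rhs S K w x t"
    unfolding Omega_def bold_eq_rowmat state_rhs_def
    by (rule gen) (use dims_AB dims_hat dims_D kdD(5) ker_L2 in \<open>auto elim: AE_mp\<close>)
  show "Sigma_cl S K *\<^sub>v theta x t (w t) = output_rhs S K w x t"
    unfolding Sigma_cl_def bold_eq_rowmat output_rhs_def
    by (rule gen) (use dims_AB dims_hat dims_D kdD(5) ker_L2 in \<open>auto elim: AE_mp\<close>)
qed

text \<open>The first bound uses the combined family of \<open>lh\<close> and \<open>lep\<close>,
  which are mutually orthogonal, the second \<open>lf\<close> alone. The metric Z is left open: it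
  becomes R_i for the gap, Q_i for the lower bound of the functional, and the identity in
  \<open>eta_energy\<close>.\<close>

lemma bessel_blocks:
  assumes i: "i \<in> idx" and y: "y \<in> L2_vec (ivl S i) n" and Z: "Z \<in> carrier_mat n n" "\<And>v. dim_vec v = n \<Longrightarrow> 0 \<le> v \<bullet> (Z *\<^sub>v v)"
  shows "Xv i y \<bullet> ((1\<^sub>m (dimh S i) \<otimes>\<^sub>K Z) *\<^sub>v Xv i y) + Yv i y \<bullet> ((1\<^sub>m (dimphi S i) \<otimes>\<^sub>K Z) *\<^sub>v Yv i y)
      \<le> (LINT \<tau>|lebesgue_on (ivl S i). y \<tau> \<bullet> (Z *\<^sub>v y \<tau>))"
    and "Fv i y \<bullet> ((1\<^sub>m (dimf S i) \<otimes>\<^sub>K Z) *\<^sub>v Fv i y) \<le> (LINT \<tau>|lebesgue_on (ivl S i). y \<tau> \<bullet> (Z *\<^sub>v y \<tau>))"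
proof -
  note l = L2_orthonormal_basis[OF i]
  have psd: "0 \<le> (\<Sum>j = 0..<n. \<Sum>l = 0..<n. Z $$ (j, l) * (v $ j * v $ l))" if "dim_vec v = n" for v :: "real vec"
    using Z(2)[OF that] unfolding quadratic_form_sum[OF Z(1) that] .
  have Q: "int_vec (ivl S i) (k * n) (\<lambda>\<tau>. kv (u \<tau>) (y \<tau>)) \<bullet> ((1\<^sub>m k \<otimes>\<^sub>K Z) *\<^sub>v int_vec (ivl S i) (k * n) (\<lambda>\<tau>. kv (u \<tau>) (y \<tau>))) =
     (\<Sum>a\<in>{0..<k}. \<Sum>j = 0..<n. \<Sum>l = 0..<n. Z $$ (j, l) * ((LINT \<tau>|lebesgue_on (ivl S i). u \<tau> $ a * y \<tau> $ j) * (LINT \<tau>|lebesgue_on (ivl S i). u \<tau> $ a * y \<tau> $ l)))"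
    if u: "u \<in> L2_vec (ivl S i) k" for u k
  proof -
    have c: "int_vec (ivl S i) (k * n) (\<lambda>\<tau>. kv (u \<tau>) (y \<tau>)) $ (a * n + j) = (LINT \<tau>|lebesgue_on (ivl S i). u \<tau> $ a * y \<tau> $ j)"
      if aj: "a < k" "j < n" for a j
    proof -
      have lt: "a * n + j < k * n" using pair_index_less[OF aj] .
      then have "int_vec (ivl S i) (k * n) (\<lambda>\<tau>. kv (u \<tau>) (y \<tau>)) $ (a * n + j) = (LINT \<tau>|lebesgue_on (ivl S i). kv (u \<tau>) (y \<tau>) $ (a * n + j))"
        by (simp add: int_vec_def)
      also have "\<dots> = (LINT \<tau>|lebesgue_on (ivl S i). u \<tau> $ a * y \<tau> $ j)"
        by (rule Bochner_Integration.integral_cong[OF refl])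
          (use L2_vecD(1)[OF u] L2_vecD(1)[OF y] lt aj in \<open>auto simp: kv_def\<close>)
      finally show ?thesis .
    qed
    show ?thesis unfolding one_kronecker_quadratic[OF Z(1) dim_int_vec]
      by (intro sum.cong refl) (simp add: c)
  qed
  have yq: "sq_int (ivl S i) (\<lambda>\<tau>. y \<tau> $ j)" if "j < n" for j using L2_vecD(2)[OF y that] .
  have RHS: "(LINT \<tau>|lebesgue_on (ivl S i). (\<Sum>j = 0..<n. \<Sum>l = 0..<n. Z $$ (j, l) * (y \<tau> $ j * y \<tau> $ l))) = (LINT \<tau>|lebesgue_on (ivl S i). y \<tau> \<bullet> (Z *\<^sub>v y \<tau>))"
    by (rule Bochner_Integration.integral_cong[OF refl]) (use L2_vecD(1)[OF y] in \<open>simp add: quadratic_form_sum[OF Z(1)]\<close>)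
  have orthI: "(LINT \<tau>|lebesgue_on (ivl S i). u \<tau> $ a * v \<tau> $ b) = G $$ (a, b)"
    if "cross_gram (ivl S i) k u l v = G" "u \<in> L2_vec (ivl S i) k" "v \<in> L2_vec (ivl S i) l" "a < k" "b < l" for u v k l a b G
    using cross_gram_index[OF that(2-5)] that(1) by simp
  have "(\<Sum>a\<in>{0..<dimf S i}. \<Sum>j = 0..<n. \<Sum>l = 0..<n. Z $$ (j, l) * ((LINT \<tau>|lebesgue_on (ivl S i). lf i \<tau> $ a * y \<tau> $ j) * (LINT \<tau>|lebesgue_on (ivl S i). lf i \<tau> $ a * y \<tau> $ l)))
     \<le> (LINT \<tau>|lebesgue_on (ivl S i). (\<Sum>j = 0..<n. \<Sum>l = 0..<n. Z $$ (j, l) * (y \<tau> $ j * y \<tau> $ l)))"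
    by (rule bessel_quadratic[where u = "\<lambda>a \<tau>. lf i \<tau> $ a"])
      (use yq psd L2_vecD(2)[OF l(3)] orthI[OF orth_lf[OF i] l(3,3)] in auto)
  then show "Fv i y \<bullet> ((1\<^sub>m (dimf S i) \<otimes>\<^sub>K Z) *\<^sub>v Fv i y) \<le> (LINT \<tau>|lebesgue_on (ivl S i). y \<tau> \<bullet> (Z *\<^sub>v y \<tau>))"
    unfolding Fv_def Q[OF l(3)] RHS .
  \<comment> \<open>The disjoint sum of the two index sets enumerates the combined orthonormal
    family.\<close>
  define uu where "uu z \<tau> = (case z of Inl a \<Rightarrow> lh i \<tau> $ a | Inr a \<Rightarrow> lep i \<tau> $ a)" for z :: "nat + nat" and \<tau>
  have lhle: "cross_gram (ivl S i) (dimh S i) (lh i) (dimphi S i) (lep i) = 0\<^sub>m (dimh S i) (dimphi S i)"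
    unfolding cross_gram_transpose[OF l(1,2)] orth_le_lh[OF i] by simp
  have "(\<Sum>a\<in>{0..<dimh S i} <+> {0..<dimphi S i}. \<Sum>j = 0..<n. \<Sum>l = 0..<n. Z $$ (j, l) * ((LINT \<tau>|lebesgue_on (ivl S i). uu a \<tau> * y \<tau> $ j) * (LINT \<tau>|lebesgue_on (ivl S i). uu a \<tau> * y \<tau> $ l)))
     \<le> (LINT \<tau>|lebesgue_on (ivl S i). (\<Sum>j = 0..<n. \<Sum>l = 0..<n. Z $$ (j, l) * (y \<tau> $ j * y \<tau> $ l)))"
  proof (rule bessel_quadratic)
    show "finite ({0..<dimh S i} <+> {0..<dimphi S i})" by simp
    fix a assume "a \<in> {0..<dimh S i} <+> {0..<dimphi S i}"
    then show "sq_int (ivl S i) (uu a)" unfolding uu_def[abs_def] using L2_vecD(2)[OF l(1)] L2_vecD(2)[OF l(2)] by (cases a) auto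
  next
    fix a b assume "a \<in> {0..<dimh S i} <+> {0..<dimphi S i}" "b \<in> {0..<dimh S i} <+> {0..<dimphi S i}"
    then show "(LINT \<tau>|lebesgue_on (ivl S i). uu a \<tau> * uu b \<tau>) = (if a = b then 1 else 0)"
      unfolding uu_def
      using orthI[OF orth_lh[OF i] l(1,1)] orthI[OF orth_le[OF i] l(2,2)] orthI[OF lhle l(1,2)] orthI[OF orth_le_lh[OF i] l(2,1)]
      by (cases a; cases b) auto
  qed (use yq psd in auto)
  moreover have "(\<Sum>a\<in>{0..<dimh S i} <+> {0..<dimphi S i}. \<Sum>j = 0..<n. \<Sum>l = 0..<n. Z $$ (j, l) * ((LINT \<tau>|lebesgue_on (ivl S i). uu a \<tau> * y \<tau> $ j) * (LINT \<tau>|lebesgue_on (ivl S i). uu a \<tau> * y \<tau> $ l))) =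
     (\<Sum>a\<in>{0..<dimh S i}. \<Sum>j = 0..<n. \<Sum>l = 0..<n. Z $$ (j, l) * ((LINT \<tau>|lebesgue_on (ivl S i). lh i \<tau> $ a * y \<tau> $ j) * (LINT \<tau>|lebesgue_on (ivl S i). lh i \<tau> $ a * y \<tau> $ l)))
     + (\<Sum>a\<in>{0..<dimphi S i}. \<Sum>j = 0..<n. \<Sum>l = 0..<n. Z $$ (j, l) * ((LINT \<tau>|lebesgue_on (ivl S i). lep i \<tau> $ a * y \<tau> $ j) * (LINT \<tau>|lebesgue_on (ivl S i). lep i \<tau> $ a * y \<tau> $ l)))"
    by (subst sum.Plus) (simp_all add: uu_def comp_def)
  ultimately show "Xv i y \<bullet> ((1\<^sub>m (dimh S i) \<otimes>\<^sub>K Z) *\<^sub>v Xv i y) + Yv i y \<bullet> ((1\<^sub>m (dimphi S i) \<otimes>\<^sub>K Z) *\<^sub>v Yv i y)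
      \<le> (LINT \<tau>|lebesgue_on (ivl S i). y \<tau> \<bullet> (Z *\<^sub>v y \<tau>))"
    unfolding Xv_def Yv_def Q[OF l(1)] Q[OF l(2)] RHS by simp
qed

end

subsection \<open>Quadratic forms\<close>

lemma bilinear_form_sum:
  assumes "A \<in> carrier_mat k l" "dim_vec u = k" "dim_vec v = l"
  shows "u \<bullet> (A *\<^sub>v v) = (\<Sum>i = 0..<k. \<Sum>j = 0..<l. A $$ (i, j) * (u $ i * v $ j :: real))"
proof -
  have "u \<bullet> (A *\<^sub>v v) = (\<Sum>i = 0..<k. u $ i * (\<Sum>j = 0..<l. A $$ (i, j) * v $ j))"
    using assms by (simp add: scalar_prod_def)
  then show ?thesis by (simp add: sum_distrib_left mult_ac)
qed

lemma vnorm_nonneg: "0 \<le> vnorm v" by (simp add: vnorm_def sp_nonneg)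

lemma vnorm_power2: "(vnorm v)\<^sup>2 = v \<bullet> v" by (simp add: vnorm_def sp_nonneg)

lemma abs_index_le_vnorm:
  assumes "i < dim_vec v"
  shows "\<bar>v $ i\<bar> \<le> vnorm v"
proof -
  have "v \<bullet> v = (\<Sum>j = 0..<dim_vec v. (v $ j)\<^sup>2)" by (simp add: scalar_prod_def power2_eq_square)
  then have "(v $ i)\<^sup>2 \<le> v \<bullet> v"
    using member_le_sum[of i "{0..<dim_vec v}" "\<lambda>j. (v $ j)\<^sup>2"] assms by simp
  then show ?thesis unfolding vnorm_def by (simp add: real_le_rsqrt)
qed

lemma bilinear_form_bound:
  fixes A :: "real mat"
  assumes "A \<in> carrier_mat k l"
  obtains C where "0 \<le> C" "\<And>u v. dim_vec u = k \<Longrightarrow> dim_vec v = l \<Longrightarrow> \<bar>u \<bullet> (A *\<^sub>v v)\<bar> \<le> C * (vnorm u * vnorm v)"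
proof
  let ?C = "\<Sum>i = 0..<k. \<Sum>j = 0..<l. \<bar>A $$ (i, j)\<bar>"
  show "0 \<le> ?C" by (intro sum_nonneg) auto
  fix u v :: "real vec" assume d: "dim_vec u = k" "dim_vec v = l"
  have "\<bar>u \<bullet> (A *\<^sub>v v)\<bar> \<le> (\<Sum>i = 0..<k. \<Sum>j = 0..<l. \<bar>A $$ (i, j) * (u $ i * v $ j)\<bar>)"
    unfolding bilinear_form_sum[OF assms d] by (intro order_trans[OF sum_abs] sum_mono sum_abs)
  also have "\<dots> \<le> (\<Sum>i = 0..<k. \<Sum>j = 0..<l. \<bar>A $$ (i, j)\<bar> * (vnorm u * vnorm v))"
    unfolding abs_mult using d by (intro sum_mono mult_left_mono mult_mono abs_index_le_vnorm vnorm_nonneg) auto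
  finally show "\<bar>u \<bullet> (A *\<^sub>v v)\<bar> \<le> ?C * (vnorm u * vnorm v)" by (simp add: sum_distrib_right)
qed

lemma quadratic_form_bound:
  fixes A :: "real mat"
  assumes "A \<in> carrier_mat k k"
  obtains C where "0 \<le> C" "\<And>v. dim_vec v = k \<Longrightarrow> v \<bullet> (A *\<^sub>v v) \<le> C * (v \<bullet> v)"
proof -
  obtain C where C: "0 \<le> C" "\<And>u v. dim_vec u = k \<Longrightarrow> dim_vec v = k \<Longrightarrow> \<bar>u \<bullet> (A *\<^sub>v v)\<bar> \<le> C * (vnorm u * vnorm v)"
    using bilinear_form_bound[OF assms] by blast
  show thesis
  proof
    show "v \<bullet> (A *\<^sub>v v) \<le> C * (v \<bullet> v)" if "dim_vec v = k" for v
      using C(2)[OF that that] by (simp add: vnorm_power2[symmetric] power2_eq_square)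
  qed (fact C(1))
qed

text \<open>The constant is the minimum of the form on the unit sphere, extended by homogeneity. The
  sphere is placed in nat \<Rightarrow> real with the product topology, coordinates from k on fixed
  at 0, where it is a closed subset of a compact product of intervals.\<close>

lemma pos_def_coercive:
  fixes A :: "real mat"
  assumes pd: "pos_def A" and A: "A \<in> carrier_mat k k"
  obtains c where "0 < c" "\<And>v. dim_vec v = k \<Longrightarrow> c * (v \<bullet> v) \<le> v \<bullet> (A *\<^sub>v v)"
proof -
  define Sq where "Sq f = (\<Sum>i = 0..<k. (f i)\<^sup>2)" for f :: "nat \<Rightarrow> real"
  define qf where "qf f = (\<Sum>i = 0..<k. \<Sum>j = 0..<k. A $$ (i, j) * (f i * f j))" for f :: "nat \<Rightarrow> real"
  define K where "K = {f. Sq f = 1} \<inter> PiE UNIV (\<lambda>i. if i < k then {-1..1} else {0 :: real})"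
  have cc: "continuous_on X (\<lambda>f. f i)" for X :: "(nat \<Rightarrow> real) set" and i
    using continuous_on_product_coordinates[of i] continuous_on_subset by blast
  have cSq: "continuous_on X Sq" and cq: "continuous_on X qf" for X
    unfolding Sq_def qf_def by (intro continuous_intros cc)+
  have "compact (PiE UNIV (\<lambda>i. if i < k then {-1..1} else {0 :: real}))"
    using compactin_PiE[of "\<lambda>_ :: nat. euclidean :: real topology" UNIV "\<lambda>i. if i < k then {-1..1} else {0}"]
    by (simp add: euclidean_product_topology)
  moreover have "closed {f. Sq f = 1}"
    by (rule closed_Collect_eq[OF cSq continuous_on_const])
  ultimately have "compact K" unfolding K_def by (rule closed_Int_compact[rotated])
  have sp: "v \<bullet> v = Sq (\<lambda>i. v $ i)" "v \<bullet> (A *\<^sub>v v) = qf (\<lambda>i. v $ i)" if "dim_vec v = k" for v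
    using that unfolding bilinear_form_sum[OF A that that] by (auto simp: qf_def Sq_def scalar_prod_def power2_eq_square)
  have pos: "0 < qf f" if "Sq f \<noteq> 0" for f
  proof -
    have "vec k f \<noteq> 0\<^sub>v k"
    proof
      assume e: "vec k f = 0\<^sub>v k"
      have "f i = 0" if "i < k" for i using arg_cong[OF e, of "\<lambda>v. v $ i"] that by simp
      then show False using that by (simp add: Sq_def)
    qed
    then have "0 < vec k f \<bullet> (A *\<^sub>v vec k f)" using pd A by (auto simp: pos_def_def)
    also have "\<dots> = qf f" by (subst sp) (auto simp: qf_def)
    finally show ?thesis .
  qed
  have "\<exists>c>0. \<forall>f. Sq f = 1 \<longrightarrow> c \<le> qf f"
  proof (cases "K = {}")
    case False
    then obtain g where g: "g \<in> K" "\<And>f. f \<in> K \<Longrightarrow> qf g \<le> qf f"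
      using continuous_attains_inf[OF \<open>compact K\<close> _ cq] by blast
    show ?thesis
    proof (intro exI conjI allI impI)
      show "0 < qf g" using g(1) pos[of g] by (simp add: K_def)
      fix f assume f: "Sq f = 1"
      define f' where "f' i = (if i < k then f i else 0)" for i
      have b: "\<bar>f i\<bar> \<le> 1" if "i < k" for i
      proof -
        have "(f i)\<^sup>2 \<le> Sq f" unfolding Sq_def by (rule member_le_sum) (use that in auto)
        then have "(f i)\<^sup>2 \<le> 1" using f by simp
        then show ?thesis by (simp add: abs_square_le_1)
      qed
      have "f' \<in> K" using b f by (auto simp: K_def f'_def Sq_def abs_le_iff minus_le_iff)
      then have "qf g \<le> qf f'" by (rule g(2))
      also have "qf f' = qf f" by (simp add: qf_def f'_def)
      finally show "qf g \<le> qf f" .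
    qed
  next
    \<comment> \<open>K is empty only if there are no unit vectors at all, that is for k = 0, and
      then any constant works.\<close>
    case True
    have "Sq f \<noteq> 1" for f
    proof
      assume f: "Sq f = 1"
      have "\<bar>f i\<bar> \<le> 1" if "i < k" for i
      proof -
        have "(f i)\<^sup>2 \<le> Sq f" unfolding Sq_def by (rule member_le_sum) (use that in auto)
        then have "(f i)\<^sup>2 \<le> 1" using f by simp
        then show ?thesis by (simp add: abs_square_le_1)
      qed
      then have "(\<lambda>i. if i < k then f i else 0) \<in> K" using f by (auto simp: K_def Sq_def abs_le_iff minus_le_iff)
      then show False using True by simp
    qed
    then show ?thesis by (intro exI[of _ 1]) simp
  qed
  then obtain c where c: "0 < c" "\<And>f. Sq f = 1 \<Longrightarrow> c \<le> qf f" by blast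
  show thesis
  proof (rule that[OF c(1)])
    fix v :: "real vec" assume v: "dim_vec v = k"
    define s where "s = v \<bullet> v"
    show "c * (v \<bullet> v) \<le> v \<bullet> (A *\<^sub>v v)"
    proof (cases "s = 0")
      case True
      then have "\<forall>i<k. v $ i = 0" using sp(1)[OF v] by (simp add: s_def Sq_def sum_nonneg_eq_0_iff)
      then show ?thesis unfolding sp[OF v] by (simp add: qf_def Sq_def)
    next
      case False
      then have s: "0 < s" using sp_nonneg[of v] by (simp add: s_def)
      define f where "f i = v $ i / sqrt s" for i
      have "Sq f = (\<Sum>i = 0..<k. (v $ i)\<^sup>2 / s)"
        using s by (simp add: Sq_def f_def power_divide)
      also have "\<dots> = s / s" unfolding sum_divide_distrib[symmetric] by (simp add: s_def sp(1)[OF v] Sq_def)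
      finally have "Sq f = 1" using s by simp
      then have "c \<le> qf f" by (rule c(2))
      also have "qf f = (\<Sum>i = 0..<k. \<Sum>j = 0..<k. A $$ (i, j) * (v $ i * v $ j) / s)"
        using s by (simp add: qf_def f_def)
      also have "\<dots> = (v \<bullet> (A *\<^sub>v v)) / s" by (simp add: sum_divide_distrib sp(2)[OF v] qf_def)
      finally show ?thesis using s by (simp add: pos_le_divide_eq s_def)
    qed
  qed
qed

text \<open>Tested on the block vector that is v in block i and zero elsewhere; distinct indices let
  v occur only once.\<close>

lemma pos_def_diag_block:
  assumes pd: "pos_def (diag_block_mat (map Z js))" and i: "i \<in> set js" and "distinct js"
    and Z: "\<And>i. i \<in> set js \<Longrightarrow> Z i \<in> sym_mats k"
  shows "pos_def (Z i)"
proof -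
  let ?D = "diag_block_mat (map Z js)"
  have d: "dim_row (Z j) = k" "dim_col (Z j) = k" if "j \<in> set js" for j using Z[OF that] by (auto simp: sym_mats_def)
  have "0 < v \<bullet> (Z i *\<^sub>v v)" if v: "dim_vec v = k" "v \<noteq> 0\<^sub>v k" for v :: "real vec"
  proof -
    define f where "f j = (if j = i then v else 0\<^sub>v k)" for j
    have df: "dim_vec (f j) = k" for j using v by (simp add: f_def)
    have dc: "dim_vec (cv (map f js)) = dim_row ?D"
      using d df by (simp add: dim_cv dim_diag_block_mat comp_def) (rule arg_cong[of _ _ sum_list], simp)
    have sum: "cv (map f js) \<bullet> cv (map g js) = v \<bullet> g i" if "\<And>j. j \<in> set js \<Longrightarrow> dim_vec (g j) = k" for g
    proof -
      have "cv (map f js) \<bullet> cv (map g js) = (\<Sum>j\<leftarrow>js. f j \<bullet> g j)"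
        by (rule cv_map_scalar_prod) (use that df in auto)
      also have "\<dots> = (\<Sum>j\<in>set js. f j \<bullet> g j)" by (rule sum_list_distinct_conv_sum_set[OF \<open>distinct js\<close>])
      also have "\<dots> = (\<Sum>j\<in>set js. if j = i then v \<bullet> g i else 0)"
        by (rule sum.cong) (use that in \<open>auto simp: f_def sp_zero_left\<close>)
      finally show ?thesis using i by simp
    qed
    have "cv (map f js) \<bullet> cv (map f js) = v \<bullet> v" using sum[of f] df by (simp add: f_def)
    moreover have "v \<bullet> v \<noteq> 0"
    proof
      assume "v \<bullet> v = 0"
      then have "vnorm v = 0" by (simp add: vnorm_def)
      then have "v = 0\<^sub>v k" using abs_index_le_vnorm[of _ v] v(1) by (intro eq_vecI) auto
      then show False using v by simp
    qed
    ultimately have "cv (map f js) \<noteq> 0\<^sub>v (dim_row ?D)" using dc by (auto simp: sp_zero_left)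
    then have "0 < cv (map f js) \<bullet> (?D *\<^sub>v cv (map f js))" using pd dc unfolding pos_def_def by (auto intro: carrier_vecI)
    also have "?D *\<^sub>v cv (map f js) = cv (map (\<lambda>j. Z j *\<^sub>v f j) js)"
      by (rule diag_block_map_form) (use df d in auto)
    also have "cv (map f js) \<bullet> \<dots> = v \<bullet> (Z i *\<^sub>v v)" using sum[of "\<lambda>j. Z j *\<^sub>v f j"] d by (simp add: f_def)
    finally show ?thesis .
  qed
  then show ?thesis using Z[OF i] d[OF i] by (auto simp: pos_def_def)
qed

subsection \<open>Curves of vectors\<close>

text \<open>The dimension is fixed at all times so that block boundaries in concatenations do not
  move.\<close>

definition vec_has_derivative :: "(real \<Rightarrow> real vec) \<Rightarrow> real vec \<Rightarrow> real \<Rightarrow> bool" where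
  "vec_has_derivative u u' t \<longleftrightarrow> (\<forall>s. dim_vec (u s) = dim_vec u') \<and>
     (\<forall>a < dim_vec u'. ((\<lambda>s. u s $ a) has_real_derivative u' $ a) (at t))"

lemma vec_has_derivative_append:
  assumes "vec_has_derivative u u' t" "vec_has_derivative v v' t"
  shows "vec_has_derivative (\<lambda>s. u s @\<^sub>v v s) (u' @\<^sub>v v') t"
  using assms unfolding vec_has_derivative_def
  by (auto simp: index_append_vec(1)[unfolded carrier_vec_def])

lemma vec_has_derivative_cv:
  assumes "\<And>i. i \<in> set is \<Longrightarrow> vec_has_derivative (u i) (u' i) t"
  shows "vec_has_derivative (\<lambda>s. cv (map (\<lambda>i. u i s) is)) (cv (map u' is)) t"
  using assms
proof (induction "is")
  case Nil
  then show ?case by (simp add: vec_has_derivative_def)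
next
  case (Cons i "is")
  then show ?case using vec_has_derivative_append[of "u i" "u' i" t] by simp
qed

text \<open>Symmetry of A merges the two terms of the product rule.\<close>

lemma vec_has_derivative_quadratic:
  assumes u: "vec_has_derivative u u' t" and A: "A \<in> carrier_mat k k" "A\<^sup>T = A" and k: "dim_vec u' = k"
  shows "((\<lambda>s. u s \<bullet> (A *\<^sub>v u s)) has_real_derivative 2 * (u t \<bullet> (A *\<^sub>v u'))) (at t)"
proof -
  have d: "dim_vec (u s) = k" for s using u k by (simp add: vec_has_derivative_def)
  have "((\<lambda>s. \<Sum>i = 0..<k. \<Sum>j = 0..<k. A $$ (i, j) * (u s $ i * u s $ j)) has_real_derivative
     (\<Sum>i = 0..<k. \<Sum>j = 0..<k. A $$ (i, j) * (u' $ i * u t $ j + u t $ i * u' $ j))) (at t)"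
    using u k unfolding vec_has_derivative_def
    by (intro DERIV_sum) (auto intro!: derivative_eq_intros)
  moreover have "(\<Sum>i = 0..<k. \<Sum>j = 0..<k. A $$ (i, j) * (u' $ i * u t $ j + u t $ i * u' $ j)) = u' \<bullet> (A *\<^sub>v u t) + u t \<bullet> (A *\<^sub>v u')"
    unfolding bilinear_form_sum[OF A(1) k d] bilinear_form_sum[OF A(1) d k] by (simp add: distrib_left sum.distrib)
  moreover have "u' \<bullet> (A *\<^sub>v u t) = u t \<bullet> (A *\<^sub>v u')"
    using sp_transpose[of "u t" A u'] A k d by auto
  ultimately show ?thesis unfolding bilinear_form_sum[OF A(1) d d] by simp
qed

definition vec_abs_cont_on :: "real \<Rightarrow> real \<Rightarrow> nat \<Rightarrow> (real \<Rightarrow> real vec) \<Rightarrow> bool" where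
  "vec_abs_cont_on a b k u \<longleftrightarrow> (\<forall>s. dim_vec (u s) = k) \<and> (\<forall>j < k. abs_cont_on a b (\<lambda>s. u s $ j))"

lemma vec_abs_cont_on_append:
  assumes "vec_abs_cont_on a b k u" "vec_abs_cont_on a b l v"
  shows "vec_abs_cont_on a b (k + l) (\<lambda>s. u s @\<^sub>v v s)"
  unfolding vec_abs_cont_on_def
proof (intro conjI allI impI)
  show "dim_vec (u s @\<^sub>v v s) = k + l" for s using assms by (simp add: vec_abs_cont_on_def)
  fix j assume j: "j < k + l"
  show "abs_cont_on a b (\<lambda>s. (u s @\<^sub>v v s) $ j)"
    using assms j by (cases "j < k") (auto simp: vec_abs_cont_on_def)
qed

lemma vec_abs_cont_on_cv:
  assumes "\<And>i. i \<in> set is \<Longrightarrow> vec_abs_cont_on a b (k i) (u i)"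
  shows "vec_abs_cont_on a b (\<Sum>i\<leftarrow>is. k i) (\<lambda>s. cv (map (\<lambda>i. u i s) is))"
  using assms
proof (induction "is")
  case Nil
  then show ?case by (simp add: vec_abs_cont_on_def)
next
  case (Cons i "is")
  then show ?case using vec_abs_cont_on_append[of a b "k i" "u i"] by simp
qed

lemma vec_abs_cont_on_quadratic:
  assumes u: "vec_abs_cont_on a b k u" and A: "A \<in> carrier_mat k k"
  shows "abs_cont_on a b (\<lambda>s. u s \<bullet> (A *\<^sub>v u s))"
proof -
  have d: "dim_vec (u s) = k" for s using u by (simp add: vec_abs_cont_on_def)
  show ?thesis unfolding bilinear_form_sum[OF A d d] using u unfolding vec_abs_cont_on_def
    by (intro abs_cont_on_sum abs_cont_on_mult abs_cont_on_const) auto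
qed

lemma lebesgue_integral_continuous_mult:
  fixes f y :: "real \<Rightarrow> real"
  assumes "sq_int {a..b} f" "continuous_on {a..b} y"
  shows "(LINT \<tau>|lebesgue_on {a..b}. f \<tau> * y \<tau>) = integral {a..b} (\<lambda>\<tau>. f \<tau> * y \<tau>)"
  by (rule lebesgue_integral_eq_integral) (use assms in \<open>auto intro!: sq_int_mult_integrable sq_int_continuous\<close>)

lemma sq_int_absolutely_integrable: "sq_int {a..b} g \<Longrightarrow> g absolutely_integrable_on {a..b}"
  using sq_int_integrable integrable_restrict_space[of "{a..b}" lebesgue g]
  by (auto simp: set_integrable_def)

lemma continuous_on_translate:
  fixes y :: "real \<Rightarrow> real"
  shows "continuous_on UNIV y \<Longrightarrow> continuous_on X (\<lambda>\<tau>. y (t + \<tau>))"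
  by (rule continuous_on_compose2[of UNIV y]) (auto intro!: continuous_intros)

text \<open>The derivative formula in terms of Lebesgue integrals. On a bounded time interval the
  derivative is bounded because y is, so the window integral is Lipschitz there and hence absolutely
  continuous.\<close>

lemma sliding_window:
  fixes f g y :: "real \<Rightarrow> real"
  assumes ab: "a \<le> b" and f2: "sq_int {a..b} f" and g2: "sq_int {a..b} g"
    and f: "\<And>t. t \<in> {a..b} \<Longrightarrow> f t = f a + integral {a..t} g" and y: "continuous_on UNIV y"
  shows "((\<lambda>t. LINT \<tau>|lebesgue_on {a..b}. f \<tau> * y (t + \<tau>)) has_real_derivative
     f b * y (t + b) - f a * y (t + a) - (LINT \<tau>|lebesgue_on {a..b}. g \<tau> * y (t + \<tau>))) (at t)"
    and "abs_cont_on c d (\<lambda>t. LINT \<tau>|lebesgue_on {a..b}. f \<tau> * y (t + \<tau>))"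
proof -
  note e = lebesgue_integral_continuous_mult[OF f2 continuous_on_translate[OF y]]
    lebesgue_integral_continuous_mult[OF g2 continuous_on_translate[OF y]]
  have ga: "g absolutely_integrable_on {a..b}" by (rule sq_int_absolutely_integrable[OF g2])
  show der: "((\<lambda>t. LINT \<tau>|lebesgue_on {a..b}. f \<tau> * y (t + \<tau>)) has_real_derivative
     f b * y (t + b) - f a * y (t + a) - (LINT \<tau>|lebesgue_on {a..b}. g \<tau> * y (t + \<tau>))) (at t)" for t
    unfolding e using sliding_window_derivative[OF ab ga f y] .
  have "continuous_on {c + a..d + b} y" using y continuous_on_subset by blast
  then obtain B where B: "\<And>s. s \<in> {c + a..d + b} \<Longrightarrow> \<bar>y s\<bar> \<le> B"
    using continuous_on_interval_bound by blast
  define G where "G = (LINT \<tau>|lebesgue_on {a..b}. \<bar>g \<tau>\<bar>)"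
  have gi: "integrable (lebesgue_on {a..b}) g" by (rule sq_int_integrable[OF g2])
  show "abs_cont_on c d (\<lambda>t. LINT \<tau>|lebesgue_on {a..b}. f \<tau> * y (t + \<tau>))"
  proof (rule abs_cont_on_deriv_bounded[OF der])
    fix t assume t: "t \<in> {c..d}"
    have B0: "0 \<le> B" using B[of "t + a"] t ab by fastforce
    have "\<bar>LINT \<tau>|lebesgue_on {a..b}. g \<tau> * y (t + \<tau>)\<bar> \<le> (LINT \<tau>|lebesgue_on {a..b}. \<bar>g \<tau> * y (t + \<tau>)\<bar>)"
      by (rule integral_abs_bound)
    also have "\<dots> \<le> (LINT \<tau>|lebesgue_on {a..b}. B * \<bar>g \<tau>\<bar>)"
    proof (rule integral_mono)
      show "integrable (lebesgue_on {a..b}) (\<lambda>\<tau>. \<bar>g \<tau> * y (t + \<tau>)\<bar>)"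
        by (intro Bochner_Integration.integrable_abs sq_int_mult_integrable[OF g2] sq_int_continuous continuous_on_translate[OF y])
      show "integrable (lebesgue_on {a..b}) (\<lambda>\<tau>. B * \<bar>g \<tau>\<bar>)" using gi by simp
      fix \<tau> assume "\<tau> \<in> space (lebesgue_on {a..b})"
      then have "\<bar>y (t + \<tau>)\<bar> \<le> B" using t by (intro B) auto
      then show "\<bar>g \<tau> * y (t + \<tau>)\<bar> \<le> B * \<bar>g \<tau>\<bar>" by (simp add: abs_mult mult.commute[of "\<bar>g \<tau>\<bar>"] mult_right_mono)
    qed
    also have "\<dots> = B * G" by (simp add: G_def)
    finally have 1: "\<bar>LINT \<tau>|lebesgue_on {a..b}. g \<tau> * y (t + \<tau>)\<bar> \<le> B * G" .
    have 2: "\<bar>f b * y (t + b)\<bar> \<le> \<bar>f b\<bar> * B" "\<bar>f a * y (t + a)\<bar> \<le> \<bar>f a\<bar> * B"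
      unfolding abs_mult using t ab by (intro mult_left_mono B; auto)+
    show "\<bar>f b * y (t + b) - f a * y (t + a) - (LINT \<tau>|lebesgue_on {a..b}. g \<tau> * y (t + \<tau>))\<bar> \<le> \<bar>f b\<bar> * B + \<bar>f a\<bar> * B + B * G"
      using 1 2 by linarith
  qed
qed

subsection \<open>Quadratic functionals\<close>

text \<open>The supremum in \<open>cnorm\<close> is meaningful only over a set that is bounded
  above, which compactness provides.\<close>

lemma vnorm_le_cnorm:
  assumes g: "g \<in> cspace {a..b} k" and t: "t \<in> {a..b}"
  shows "vnorm (g t) \<le> cnorm {a..b} g"
proof -
  have d: "dim_vec (g s) = k" if "s \<in> {a..b}" for s using g that by (auto simp: cspace_def PiE_def Pi_def)
  have c: "continuous_on {a..b} (\<lambda>s. vnorm (g s))"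
  proof -
    have "continuous_on {a..b} (\<lambda>s. sqrt (\<Sum>j = 0..<k. g s $ j * g s $ j))"
      using g by (intro continuous_intros) (auto simp: cspace_def)
    then show ?thesis by (rule continuous_on_eq) (use d in \<open>simp add: vnorm_def scalar_prod_def\<close>)
  qed
  have "bdd_above ((\<lambda>s. vnorm (g s)) ` {a..b})"
    by (intro bounded_imp_bdd_above compact_imp_bounded compact_continuous_image[OF c]) simp
  then show ?thesis unfolding cnorm_def by (rule cSUP_upper[OF t])
qed

lemma cspaceD:
  assumes "g \<in> cspace {a..b} k"
  shows "\<theta> \<in> {a..b} \<Longrightarrow> dim_vec (g \<theta>) = k" "j < k \<Longrightarrow> continuous_on {a..b} (\<lambda>\<theta>. g \<theta> $ j)"
  using assms by (auto simp: cspace_def PiE_def Pi_def)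

lemma cadd_cspace:
  assumes "g \<in> cspace {a..b} k" "h \<in> cspace {a..b} k"
  shows "cadd {a..b} g h \<in> cspace {a..b} k"
  unfolding cspace_def
proof (safe)
  fix \<theta> assume t: "\<theta> \<in> {a..b}"
  then show "cadd {a..b} g h \<theta> \<in> carrier_vec k"
    using cspaceD(1)[OF assms(2) t] by (auto simp: cadd_def intro!: carrier_vecI)
next
  fix j assume j: "j < k"
  have "continuous_on {a..b} (\<lambda>\<theta>. g \<theta> $ j + h \<theta> $ j)"
    using cspaceD(2)[OF assms(1) j] cspaceD(2)[OF assms(2) j] by (intro continuous_intros)
  then show "continuous_on {a..b} (\<lambda>\<theta>. cadd {a..b} g h \<theta> $ j)"
    by (rule continuous_on_eq) (use cspaceD(1)[OF assms(2)] j in \<open>simp add: cadd_def\<close>)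
qed (auto simp: cadd_def)

text \<open>The derivative at \<psi> sends h to B \<psi> h + B h \<psi>. The remainder is B h h, of
  second order in h, and the derivative is itself linear in \<psi>, with operator norm at most 2 C
  times the norm of \<psi>.\<close>

lemma C1_functional_quadratic:
  assumes ab: "a \<le> b"
    and add_left: "\<And>f g h. f \<in> cspace {a..b} k \<Longrightarrow> g \<in> cspace {a..b} k \<Longrightarrow> h \<in> cspace {a..b} k \<Longrightarrow> B (cadd {a..b} f g) h = B f h + B g h"
    and add_right: "\<And>f g h. f \<in> cspace {a..b} k \<Longrightarrow> g \<in> cspace {a..b} k \<Longrightarrow> h \<in> cspace {a..b} k \<Longrightarrow> B h (cadd {a..b} f g) = B h f + B h g"
    and scale: "\<And>c g h. g \<in> cspace {a..b} k \<Longrightarrow> h \<in> cspace {a..b} k \<Longrightarrow> B (cscale {a..b} c g) h = c * B g h"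
        "\<And>c g h. g \<in> cspace {a..b} k \<Longrightarrow> h \<in> cspace {a..b} k \<Longrightarrow> B g (cscale {a..b} c h) = c * B g h"
    and C: "0 \<le> C" "\<And>g h. g \<in> cspace {a..b} k \<Longrightarrow> h \<in> cspace {a..b} k \<Longrightarrow> \<bar>B g h\<bar> \<le> C * (cnorm {a..b} g * cnorm {a..b} h)"
  shows "C1_functional {a..b} k (\<lambda>\<psi>. B \<psi> \<psi>)"
  unfolding C1_functional_def
proof (intro exI[of _ "\<lambda>\<psi> h. B \<psi> h + B h \<psi>"] ballI conjI allI impI)
  fix \<psi> assume p: "\<psi> \<in> cspace {a..b} k"
  have nn: "0 \<le> cnorm {a..b} g" if "g \<in> cspace {a..b} k" for g
    using vnorm_le_cnorm[OF that, of a] ab vnorm_nonneg[of "g a"] by simp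
  show "bounded_linear_functional {a..b} k (\<lambda>h. B \<psi> h + B h \<psi>)"
    unfolding bounded_linear_functional_def
  proof (intro conjI ballI allI exI)
    fix g h assume "g \<in> cspace {a..b} k" "h \<in> cspace {a..b} k"
    then show "B \<psi> (cadd {a..b} g h) + B (cadd {a..b} g h) \<psi> = B \<psi> g + B g \<psi> + (B \<psi> h + B h \<psi>)"
      using p by (simp add: add_left add_right)
  next
    fix c h assume "h \<in> cspace {a..b} k"
    then show "B \<psi> (cscale {a..b} c h) + B (cscale {a..b} c h) \<psi> = c * (B \<psi> h + B h \<psi>)"
      using p by (simp add: scale distrib_left)
  next
    fix h assume h: "h \<in> cspace {a..b} k"
    show "\<bar>B \<psi> h + B h \<psi>\<bar> \<le> (2 * C * cnorm {a..b} \<psi>) * cnorm {a..b} h"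
      using C(2)[OF p h] C(2)[OF h p] by (simp add: mult_ac)
  qed
  show "\<exists>\<delta>>0. \<forall>h\<in>cspace {a..b} k. cnorm {a..b} h < \<delta> \<longrightarrow>
      \<bar>B (cadd {a..b} \<psi> h) (cadd {a..b} \<psi> h) - B \<psi> \<psi> - (B \<psi> h + B h \<psi>)\<bar> \<le> \<epsilon> * cnorm {a..b} h" if e: "\<epsilon> > 0" for \<epsilon>
  proof (intro exI[of _ "\<epsilon> / (C + 1)"] conjI ballI impI)
    show "0 < \<epsilon> / (C + 1)" using e C(1) by simp
    fix h assume h: "h \<in> cspace {a..b} k" and s: "cnorm {a..b} h < \<epsilon> / (C + 1)"
    note ph = cadd_cspace[OF p h]
    have "B (cadd {a..b} \<psi> h) (cadd {a..b} \<psi> h) - B \<psi> \<psi> - (B \<psi> h + B h \<psi>) = B h h"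
      by (simp add: add_left[OF p h ph] add_right[OF p h p] add_right[OF p h h])
    moreover have "\<bar>B h h\<bar> \<le> C * cnorm {a..b} h * cnorm {a..b} h" using C(2)[OF h h] by (simp add: mult_ac)
    moreover have "C * cnorm {a..b} h \<le> \<epsilon>"
    proof -
      have "C * cnorm {a..b} h \<le> C * (\<epsilon> / (C + 1))" using s C(1) by (intro mult_left_mono) auto
      also have "\<dots> \<le> \<epsilon>" using C(1) e by (simp add: field_simps)
      finally show ?thesis .
    qed
    ultimately show "\<bar>B (cadd {a..b} \<psi> h) (cadd {a..b} \<psi> h) - B \<psi> \<psi> - (B \<psi> h + B h \<psi>)\<bar> \<le> \<epsilon> * cnorm {a..b} h"
      using mult_right_mono[of "C * cnorm {a..b} h" \<epsilon> "cnorm {a..b} h"] nn[OF h] by linarith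
  qed
  show "\<exists>\<delta>>0. \<forall>g\<in>cspace {a..b} k. cnorm {a..b} g < \<delta> \<longrightarrow> (\<forall>h\<in>cspace {a..b} k.
      \<bar>B (cadd {a..b} \<psi> g) h + B h (cadd {a..b} \<psi> g) - (B \<psi> h + B h \<psi>)\<bar> \<le> \<epsilon> * cnorm {a..b} h)" if e: "\<epsilon> > 0" for \<epsilon>
  proof (intro exI[of _ "\<epsilon> / (2 * C + 1)"] conjI ballI impI)
    show "0 < \<epsilon> / (2 * C + 1)" using e C(1) by simp
    fix g h assume g: "g \<in> cspace {a..b} k" and h: "h \<in> cspace {a..b} k" and s: "cnorm {a..b} g < \<epsilon> / (2 * C + 1)"
    have "B (cadd {a..b} \<psi> g) h + B h (cadd {a..b} \<psi> g) - (B \<psi> h + B h \<psi>) = B g h + B h g"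
      by (simp add: add_left[OF p g h] add_right[OF p g h])
    moreover have "\<bar>B g h + B h g\<bar> \<le> 2 * C * cnorm {a..b} g * cnorm {a..b} h"
      using C(2)[OF g h] C(2)[OF h g] by (simp add: mult_ac)
    moreover have "2 * C * cnorm {a..b} g \<le> \<epsilon>"
    proof -
      have "2 * C * cnorm {a..b} g \<le> 2 * C * (\<epsilon> / (2 * C + 1))" using s C(1) by (intro mult_left_mono) auto
      also have "\<dots> \<le> \<epsilon>" using C(1) e by (simp add: field_simps)
      finally show ?thesis .
    qed
    ultimately show "\<bar>B (cadd {a..b} \<psi> g) h + B h (cadd {a..b} \<psi> g) - (B \<psi> h + B h \<psi>)\<bar> \<le> \<epsilon> * cnorm {a..b} h"
      using mult_right_mono[of "2 * C * cnorm {a..b} g" \<epsilon> "cnorm {a..b} h"] nn[OF h] by linarith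
  qed
qed

lemma lebesgue_integral_bound:
  fixes f :: "real \<Rightarrow> real"
  assumes ab: "a \<le> b" and f: "continuous_on {a..b} f" and B: "\<And>\<tau>. \<tau> \<in> {a..b} \<Longrightarrow> \<bar>f \<tau>\<bar> \<le> B"
  shows "\<bar>LINT \<tau>|lebesgue_on {a..b}. f \<tau>\<bar> \<le> (b - a) * B"
proof -
  have "\<bar>LINT \<tau>|lebesgue_on {a..b}. f \<tau>\<bar> \<le> (LINT \<tau>|lebesgue_on {a..b}. \<bar>f \<tau>\<bar>)" by (rule integral_abs_bound)
  also have "\<dots> \<le> (LINT \<tau>|lebesgue_on {a..b}. B)"
    by (rule integral_mono) (use f B in \<open>auto intro!: continuous_imp_integrable_real continuous_intros\<close>)
  also have "\<dots> = (b - a) * B" using ab by (simp add: measure_restrict_space)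
  finally show ?thesis .
qed

lemma cv_map_smult: "c \<cdot>\<^sub>v cv (map u is) = cv (map (\<lambda>i. c \<cdot>\<^sub>v u i) is)"
proof (induction "is")
  case Nil
  then show ?case by (intro eq_vecI) auto
next
  case (Cons i "is")
  have "c \<cdot>\<^sub>v cv (map u (i # is)) = (c \<cdot>\<^sub>v u i) @\<^sub>v (c \<cdot>\<^sub>v cv (map u is))" by (intro eq_vecI) auto
  then show ?case using Cons by simp
qed

lemma sp_smult: "dim_vec u = dim_vec v \<Longrightarrow> (c \<cdot>\<^sub>v u) \<bullet> v = c * (u \<bullet> (v :: real vec))" "u \<bullet> (c \<cdot>\<^sub>v v) = c * (u \<bullet> (v :: real vec))"
  by (auto simp: scalar_prod_def sum_distrib_left mult_ac)

lemma mmv_vec_smult: "dim_vec v = dim_col A \<Longrightarrow> A *\<^sub>v (c \<cdot>\<^sub>v v) = c \<cdot>\<^sub>v (A *\<^sub>v (v :: real vec))"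
  by (intro eq_vecI) (auto simp: sp_smult)

lemma one_kronecker_one_mat: "1\<^sub>m k \<otimes>\<^sub>K 1\<^sub>m l = 1\<^sub>m (k * l)"
proof (rule eq_matI)
  fix i j assume "i < dim_row (1\<^sub>m (k * l))" "j < dim_col (1\<^sub>m (k * l))"
  then have l: "i < k * l" "j < k * l" by auto
  have "(i div l = j div l \<and> i mod l = j mod l) \<longleftrightarrow> i = j" by (metis div_mult_mod_eq)
  then show "(1\<^sub>m k \<otimes>\<^sub>K 1\<^sub>m l) $$ (i, j) = 1\<^sub>m (k * l) $$ (i, j)"
    using l div_mod_less[OF l(1)] div_mod_less[OF l(2)] by (auto simp: kronecker_def)
qed auto

context closed_loop begin

text \<open>Values outside the history interval are free, in contrast to \<open>cspace\<close>, so
  that translates of a trajectory qualify without being cut off.\<close>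

definition continuous_segment :: "(real \<Rightarrow> real vec) \<Rightarrow> bool" where
  "continuous_segment y \<longleftrightarrow> (\<forall>\<theta> \<in> hist S. dim_vec (y \<theta>) = n) \<and> (\<forall>j < n. continuous_on (hist S) (\<lambda>\<theta>. y \<theta> $ j))"

lemma cspace_continuous_segment: "y \<in> cspace (hist S) n \<Longrightarrow> continuous_segment y"
  unfolding hist_def continuous_segment_def by (auto dest: cspaceD)

lemma hist_pos: "0 < del S \<nu>" "0 \<in> hist S" "hist S = {- del S \<nu>..0}"
proof -
  have "del S (\<nu> - 1) < del S \<nu>" using delay_less[of \<nu>] dims_pos by simp
  then show "0 < del S \<nu>" using delay_mono[of 0 "\<nu> - 1"] delay_0 by simp
  then show "0 \<in> hist S" "hist S = {- del S \<nu>..0}" by (auto simp: hist_def)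
qed

lemma segment_L2:
  assumes "continuous_segment y" "i \<in> idx"
  shows "y \<in> L2_vec (ivl S i) n"
proof (rule L2_vecI)
  show "dim_vec (y \<tau>) = n" if "\<tau> \<in> ivl S i" for \<tau> using assms that ivl_endpoints(3) by (auto simp: continuous_segment_def)
  fix j assume "j < n"
  then have "continuous_on (ivl S i) (\<lambda>\<tau>. y \<tau> $ j)"
    using continuous_on_subset[OF _ ivl_endpoints(3)[OF assms(2)], of "\<lambda>\<tau>. y \<tau> $ j"] assms(1) by (auto simp: continuous_segment_def)
  then show "sq_int (ivl S i) (\<lambda>\<tau>. y \<tau> $ j)" unfolding ivl_def by (rule sq_int_continuous)
qed

lemma segment_bilinear:
  assumes "continuous_segment g" "continuous_segment h" "A \<in> carrier_mat n n" "i \<in> idx"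
  shows "continuous_on (ivl S i) (\<lambda>\<tau>. g \<tau> \<bullet> (A *\<^sub>v h \<tau>))" "integrable (lebesgue_on (ivl S i)) (\<lambda>\<tau>. g \<tau> \<bullet> (A *\<^sub>v h \<tau>))"
     "continuous_on (ivl S i) (\<lambda>\<tau>. (\<tau> + c) * (g \<tau> \<bullet> (A *\<^sub>v h \<tau>)))" "integrable (lebesgue_on (ivl S i)) (\<lambda>\<tau>. (\<tau> + c) * (g \<tau> \<bullet> (A *\<^sub>v h \<tau>)))"
proof -
  have sub: "\<tau> \<in> hist S" if "\<tau> \<in> ivl S i" for \<tau> using that ivl_endpoints(3)[OF assms(4)] by blast
  have "continuous_on (ivl S i) (\<lambda>\<tau>. \<Sum>j = 0..<n. \<Sum>l = 0..<n. A $$ (j, l) * (g \<tau> $ j * h \<tau> $ l))"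
    using assms(1,2) continuous_on_subset[OF _ ivl_endpoints(3)[OF assms(4)]]
    by (intro continuous_intros) (auto simp: continuous_segment_def)
  then show c: "continuous_on (ivl S i) (\<lambda>\<tau>. g \<tau> \<bullet> (A *\<^sub>v h \<tau>))"
    by (rule continuous_on_eq) (use assms(1,2) sub in \<open>simp add: continuous_segment_def bilinear_form_sum[OF assms(3)]\<close>)
  then show "continuous_on (ivl S i) (\<lambda>\<tau>. (\<tau> + c) * (g \<tau> \<bullet> (A *\<^sub>v h \<tau>)))" by (intro continuous_intros)
  with c show "integrable (lebesgue_on (ivl S i)) (\<lambda>\<tau>. g \<tau> \<bullet> (A *\<^sub>v h \<tau>))" "integrable (lebesgue_on (ivl S i)) (\<lambda>\<tau>. (\<tau> + c) * (g \<tau> \<bullet> (A *\<^sub>v h \<tau>)))"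
    unfolding ivl_def by (auto intro: continuous_imp_integrable_real)
qed

subsection \<open>The Lyapunov-Krasovskii functional\<close>

definition eta :: "(real \<Rightarrow> real vec) \<Rightarrow> real vec" where
  "eta y = y 0 @\<^sub>v cv (map (\<lambda>i. Fv i y) dl)"

text \<open>The storage function polarised to a bilinear functional, so that smoothness reduces to
  bilinearity and boundedness.\<close>

definition LK :: "(real \<Rightarrow> real vec) \<Rightarrow> (real \<Rightarrow> real vec) \<Rightarrow> real" where
  "LK g h = eta g \<bullet> (PP *\<^sub>v eta h) + (\<Sum>i\<in>idx. LINT \<tau>|lebesgue_on (ivl S i).
     g \<tau> \<bullet> (Q i *\<^sub>v h \<tau>) + (\<tau> + del S i) * (g \<tau> \<bullet> (R i *\<^sub>v h \<tau>)))"

text \<open>The yardstick that links the estimates: it dominates the functional and, for zero input,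
  is dominated by the rate at which the functional decays.\<close>

definition energy :: "(real \<Rightarrow> real vec) \<Rightarrow> real" where
  "energy y = y 0 \<bullet> y 0 + (\<Sum>i\<in>idx. LINT \<tau>|lebesgue_on (ivl S i). y \<tau> \<bullet> y \<tau>)"

lemma dim_eta: "dim_vec (y 0) = n \<Longrightarrow> dim_vec (eta y) = n + totf S * n"
  using sum_list_idx_mult[of "dimf S" n] by (simp add: eta_def dim_cv comp_def totf_def)

lemma PP_sym: "PP \<in> carrier_mat (n + totf S * n) (n + totf S * n)" "PP\<^sup>T = PP"
proof -
  show "PP \<in> carrier_mat (n + totf S * n) (n + totf S * n)" using dims_vars by auto
  show "PP\<^sup>T = PP" unfolding sym_block_def
    using transpose_four_block_mat[OF dims_vars(2) dims_vars(4) transpose_carrier_mat[THEN iffD2, OF dims_vars(4)] dims_vars(5)] dims_vars(3,6) by simp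
qed

lemma Fv_linear:
  assumes i: "i \<in> idx" and g: "continuous_segment g" and h: "continuous_segment h"
  shows "Fv i (cadd (hist S) g h) = Fv i g + Fv i h" "Fv i (cscale (hist S) c g) = c \<cdot>\<^sub>v Fv i g"
proof -
  note kg = kv_integrable[OF L2_orthonormal_basis(3)[OF i] segment_L2[OF g i]] and kh = kv_integrable[OF L2_orthonormal_basis(3)[OF i] segment_L2[OF h i]]
  have d: "dim_vec (lf i \<tau>) = dimf S i" "dim_vec (g \<tau>) = n" "dim_vec (h \<tau>) = n" "\<tau> \<in> hist S" if "\<tau> \<in> ivl S i" for \<tau>
    using that dim_lf[OF i] L2_vecD(1)[OF segment_L2[OF g i] that] L2_vecD(1)[OF segment_L2[OF h i] that] ivl_endpoints(3)[OF i] by auto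
  show "Fv i (cadd (hist S) g h) = Fv i g + Fv i h"
  proof (rule eq_vecI)
    fix k assume "k < dim_vec (Fv i g + Fv i h)"
    then have k: "k < dimf S i * n" by simp
    have "Fv i (cadd (hist S) g h) $ k = (LINT \<tau>|lebesgue_on (ivl S i). kv (lf i \<tau>) (g \<tau>) $ k + kv (lf i \<tau>) (h \<tau>) $ k)"
      unfolding Fv_def int_vec_def index_vec[OF k]
      by (rule Bochner_Integration.integral_cong) (use d k div_mod_less[OF k] in \<open>auto simp: kv_def cadd_def distrib_left\<close>)
    also have "\<dots> = Fv i g $ k + Fv i h $ k"
      using k by (simp add: Fv_def int_vec_def Bochner_Integration.integral_add[OF kg kh])
    finally show "Fv i (cadd (hist S) g h) $ k = (Fv i g + Fv i h) $ k" using k by simp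
  qed simp
  show "Fv i (cscale (hist S) c g) = c \<cdot>\<^sub>v Fv i g"
  proof (rule eq_vecI)
    fix k assume "k < dim_vec (c \<cdot>\<^sub>v Fv i g)"
    then have k: "k < dimf S i * n" by simp
    have "Fv i (cscale (hist S) c g) $ k = (LINT \<tau>|lebesgue_on (ivl S i). c * kv (lf i \<tau>) (g \<tau>) $ k)"
      unfolding Fv_def int_vec_def index_vec[OF k]
      by (rule Bochner_Integration.integral_cong) (use d k div_mod_less[OF k] in \<open>auto simp: kv_def cscale_def\<close>)
    also have "\<dots> = c * Fv i g $ k" using k by (simp add: Fv_def int_vec_def)
    finally show "Fv i (cscale (hist S) c g) $ k = (c \<cdot>\<^sub>v Fv i g) $ k" using k by simp
  qed simp
qed

lemma eta_linear:
  assumes g: "continuous_segment g" and h: "continuous_segment h"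
  shows "eta (cadd (hist S) g h) = eta g + eta h" "eta (cscale (hist S) c g) = c \<cdot>\<^sub>v eta g"
proof -
  have d: "dim_vec (g 0) = n" "dim_vec (h 0) = n" using g h hist_pos(2) by (auto simp: continuous_segment_def)
  have "cv (map (\<lambda>i. Fv i (cadd (hist S) g h)) dl) = cv (map (\<lambda>i. Fv i g) dl) + cv (map (\<lambda>i. Fv i h) dl)"
    by (subst cv_map_add) (auto intro!: cv_map_cong Fv_linear(1) g h simp: set_delay_idx)
  then show "eta (cadd (hist S) g h) = eta g + eta h"
    unfolding eta_def using d hist_pos(2) by (intro eq_vecI) (auto simp: cadd_def dim_cv comp_def)
  have "cv (map (\<lambda>i. Fv i (cscale (hist S) c g)) dl) = c \<cdot>\<^sub>v cv (map (\<lambda>i. Fv i g) dl)"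
    unfolding cv_map_smult by (rule cv_map_cong) (use g Fv_linear(2)[OF _ g g] in \<open>auto simp: set_delay_idx\<close>)
  then show "eta (cscale (hist S) c g) = c \<cdot>\<^sub>v eta g"
    unfolding eta_def using d hist_pos(2) by (intro eq_vecI) (auto simp: cscale_def dim_cv comp_def)
qed

text \<open>Bessel's inequality with the identity as metric, applied on each delay interval.\<close>

lemma eta_energy:
  assumes y: "continuous_segment y"
  shows "eta y \<bullet> eta y \<le> energy y"
proof -
  have "eta y \<bullet> eta y = y 0 \<bullet> y 0 + cv (map (\<lambda>i. Fv i y) dl) \<bullet> cv (map (\<lambda>i. Fv i y) dl)"
    by (simp add: eta_def sp_append)
  also have "cv (map (\<lambda>i. Fv i y) dl) \<bullet> cv (map (\<lambda>i. Fv i y) dl) = (\<Sum>i\<in>idx. Fv i y \<bullet> Fv i y)"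
    unfolding sum_delay_idx[symmetric] by (rule cv_map_scalar_prod) simp
  also have "\<dots> \<le> (\<Sum>i\<in>idx. LINT \<tau>|lebesgue_on (ivl S i). y \<tau> \<bullet> y \<tau>)"
  proof (rule sum_mono)
    fix i assume i: "i \<in> idx"
    have d: "dim_vec (y \<tau>) = n" if "\<tau> \<in> ivl S i" for \<tau> using L2_vecD(1)[OF segment_L2[OF y i] that] .
    have "Fv i y \<bullet> ((1\<^sub>m (dimf S i) \<otimes>\<^sub>K 1\<^sub>m n) *\<^sub>v Fv i y) \<le> (LINT \<tau>|lebesgue_on (ivl S i). y \<tau> \<bullet> (1\<^sub>m n *\<^sub>v y \<tau>))"
      by (rule bessel_blocks(2)[OF i segment_L2[OF y i]]) (auto simp: mmv_one sp_nonneg)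
    also have "\<dots> = (LINT \<tau>|lebesgue_on (ivl S i). y \<tau> \<bullet> y \<tau>)"
      by (rule Bochner_Integration.integral_cong) (use d in \<open>auto simp: mmv_one\<close>)
    finally show "Fv i y \<bullet> Fv i y \<le> (LINT \<tau>|lebesgue_on (ivl S i). y \<tau> \<bullet> y \<tau>)"
      by (simp add: one_kronecker_one_mat mmv_one)
  qed
  finally show ?thesis by (simp add: energy_def)
qed

lemma segment_energy_density:
  assumes "continuous_segment y" "i \<in> idx"
  shows "continuous_on (ivl S i) (\<lambda>\<tau>. y \<tau> \<bullet> y \<tau>)" "integrable (lebesgue_on (ivl S i)) (\<lambda>\<tau>. y \<tau> \<bullet> y \<tau>)"
proof -
  have "continuous_on (ivl S i) (\<lambda>\<tau>. y \<tau> \<bullet> (1\<^sub>m n *\<^sub>v y \<tau>))" by (rule segment_bilinear[OF assms(1,1) one_carrier_mat assms(2)])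
  then show c: "continuous_on (ivl S i) (\<lambda>\<tau>. y \<tau> \<bullet> y \<tau>)"
    by (rule continuous_on_eq) (use L2_vecD(1)[OF segment_L2[OF assms]] in \<open>simp add: mmv_one\<close>)
  then show "integrable (lebesgue_on (ivl S i)) (\<lambda>\<tau>. y \<tau> \<bullet> y \<tau>)" unfolding ivl_def by (rule continuous_imp_integrable_real)
qed

lemma cnorm_pos: "g \<in> cspace (hist S) n \<Longrightarrow> 0 \<le> cnorm (hist S) g"
  using vnorm_le_cnorm[of g "- del S \<nu>" 0 n 0] hist_pos vnorm_nonneg[of "g 0"] by simp

lemma energy_le_cnorm:
  assumes g: "g \<in> cspace (hist S) n"
  shows "energy g \<le> (1 + (\<Sum>i\<in>idx. del S i - del S (i - 1))) * (cnorm (hist S) g)\<^sup>2"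
proof -
  have b: "g \<tau> \<bullet> g \<tau> \<le> (cnorm (hist S) g)\<^sup>2" if "\<tau> \<in> hist S" for \<tau>
    unfolding vnorm_power2[symmetric] by (rule power_mono) (use vnorm_le_cnorm[of g "- del S \<nu>" 0 n \<tau>] g that hist_pos(3) vnorm_nonneg in auto)
  have "(LINT \<tau>|lebesgue_on (ivl S i). g \<tau> \<bullet> g \<tau>) \<le> (del S i - del S (i - 1)) * (cnorm (hist S) g)\<^sup>2" if i: "i \<in> idx" for i
  proof -
    have "\<bar>LINT \<tau>|lebesgue_on {- del S i..- del S (i - 1)}. g \<tau> \<bullet> g \<tau>\<bar> \<le> (- del S (i - 1) - (- del S i)) * (cnorm (hist S) g)\<^sup>2"
      by (rule lebesgue_integral_bound)
        (use delay_less[OF i] segment_energy_density(1)[OF cspace_continuous_segment[OF g] i] b ivl_endpoints(3)[OF i] sp_nonneg in \<open>auto simp: ivl_def subset_iff\<close>)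
    then show ?thesis by (simp add: ivl_def)
  qed
  then have "(\<Sum>i\<in>idx. LINT \<tau>|lebesgue_on (ivl S i). g \<tau> \<bullet> g \<tau>) \<le> (\<Sum>i\<in>idx. (del S i - del S (i - 1)) * (cnorm (hist S) g)\<^sup>2)"
    by (rule sum_mono)
  then show ?thesis using b[OF hist_pos(2)] by (simp add: energy_def distrib_right sum_distrib_right)
qed

text \<open>The moments in \<open>eta\<close> are bounded by the supremum norm through
  \<open>energy\<close>. In the integrals the integrand is bounded pointwise, with weight at most
  r_i, and the length of the interval becomes a factor.\<close>

lemma LK_bound:
  obtains C where "0 \<le> C" "\<And>g h. g \<in> cspace (hist S) n \<Longrightarrow> h \<in> cspace (hist S) n \<Longrightarrow> \<bar>LK g h\<bar> \<le> C * (cnorm (hist S) g * cnorm (hist S) h)"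
proof -
  define L where "L = (\<Sum>i\<in>idx. del S i - del S (i - 1))"
  have L: "0 \<le> L" unfolding L_def by (rule sum_nonneg) (use delay_less in \<open>auto intro: less_imp_le simp: less_imp_le\<close>)
  obtain CP where CP: "0 \<le> CP" "\<And>u v. dim_vec u = n + totf S * n \<Longrightarrow> dim_vec v = n + totf S * n \<Longrightarrow> \<bar>u \<bullet> (PP *\<^sub>v v)\<bar> \<le> CP * (vnorm u * vnorm v)"
    using bilinear_form_bound[OF PP_sym(1)] by blast
  have "\<exists>C. 0 \<le> C \<and> (\<forall>u v. dim_vec u = n \<longrightarrow> dim_vec v = n \<longrightarrow> \<bar>u \<bullet> (Z *\<^sub>v v)\<bar> \<le> C * (vnorm u * vnorm v))" if "Z \<in> carrier_mat n n" for Z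
    using bilinear_form_bound[OF that] by metis
  then obtain CZ where CZ: "\<And>Z. Z \<in> carrier_mat n n \<Longrightarrow> 0 \<le> CZ Z"
    "\<And>Z u v. Z \<in> carrier_mat n n \<Longrightarrow> dim_vec u = n \<Longrightarrow> dim_vec v = n \<Longrightarrow> \<bar>u \<bullet> (Z *\<^sub>v v)\<bar> \<le> CZ Z * (vnorm u * vnorm v)"
    by metis
  define Ci where "Ci i = (del S i - del S (i - 1)) * (CZ (Q i) + del S i * CZ (R i))" for i
  show thesis
  proof
    have dp: "0 \<le> del S i" if "i \<in> idx" for i using delay_mono[of 0 i] delay_0 that by simp
    have "0 \<le> Ci i" if i: "i \<in> idx" for i
      unfolding Ci_def using delay_less[OF i] dp[OF i] CZ(1) dims_vars(7,8)[OF i] by simp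
    then show "0 \<le> CP * (1 + L) + (\<Sum>i\<in>idx. Ci i)" using CP(1) L by (intro add_nonneg_nonneg mult_nonneg_nonneg sum_nonneg) auto
    fix g h assume g: "g \<in> cspace (hist S) n" and h: "h \<in> cspace (hist S) n"
    let ?N = "cnorm (hist S) g * cnorm (hist S) h"
    note cg = cspace_continuous_segment[OF g] and chh = cspace_continuous_segment[OF h]
    have e: "vnorm (eta f) \<le> sqrt (1 + L) * cnorm (hist S) f" if f: "f \<in> cspace (hist S) n" for f
    proof -
      have "eta f \<bullet> eta f \<le> (1 + L) * (cnorm (hist S) f)\<^sup>2"
        using eta_energy[OF cspace_continuous_segment[OF f]] energy_le_cnorm[OF f] by (simp add: L_def)
      then have "vnorm (eta f) \<le> sqrt ((1 + L) * (cnorm (hist S) f)\<^sup>2)" by (simp add: vnorm_def)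
      then show ?thesis using cnorm_pos[OF f] by (simp add: real_sqrt_mult)
    qed
    have de: "dim_vec (eta g) = n + totf S * n" "dim_vec (eta h) = n + totf S * n"
      using cg chh hist_pos(2) by (auto intro!: dim_eta simp: continuous_segment_def)
    have "\<bar>eta g \<bullet> (PP *\<^sub>v eta h)\<bar> \<le> CP * (vnorm (eta g) * vnorm (eta h))" by (rule CP(2)[OF de])
    also have "\<dots> \<le> CP * ((sqrt (1 + L) * cnorm (hist S) g) * (sqrt (1 + L) * cnorm (hist S) h))"
      using L cnorm_pos[OF g] by (intro mult_left_mono mult_mono e g h CP(1) vnorm_nonneg) auto
    also have "\<dots> = CP * ((sqrt (1 + L) * sqrt (1 + L)) * ?N)" by (simp only: mult_ac)
    also have "sqrt (1 + L) * sqrt (1 + L) = 1 + L" using L by simp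
    finally have 1: "\<bar>eta g \<bullet> (PP *\<^sub>v eta h)\<bar> \<le> CP * (1 + L) * ?N" by (simp add: mult_ac)
    have 2: "\<bar>LINT \<tau>|lebesgue_on (ivl S i). g \<tau> \<bullet> (Q i *\<^sub>v h \<tau>) + (\<tau> + del S i) * (g \<tau> \<bullet> (R i *\<^sub>v h \<tau>))\<bar> \<le> Ci i * ?N" if i: "i \<in> idx" for i
    proof -
      note Zi = dims_vars(7,8)[OF i]
      have "\<bar>LINT \<tau>|lebesgue_on {- del S i..- del S (i - 1)}. g \<tau> \<bullet> (Q i *\<^sub>v h \<tau>) + (\<tau> + del S i) * (g \<tau> \<bullet> (R i *\<^sub>v h \<tau>))\<bar>
         \<le> (- del S (i - 1) - (- del S i)) * (CZ (Q i) * ?N + del S i * (CZ (R i) * ?N))"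
      proof (rule lebesgue_integral_bound)
        show "- del S i \<le> - del S (i - 1)" using delay_less[OF i] by simp
        show "continuous_on {- del S i..- del S (i - 1)} (\<lambda>\<tau>. g \<tau> \<bullet> (Q i *\<^sub>v h \<tau>) + (\<tau> + del S i) * (g \<tau> \<bullet> (R i *\<^sub>v h \<tau>)))"
          using segment_bilinear(1)[OF cg chh Zi(1) i] segment_bilinear(3)[OF cg chh Zi(2) i] unfolding ivl_def by (intro continuous_on_add)
        fix \<tau> assume t: "\<tau> \<in> {- del S i..- del S (i - 1)}"
        then have th: "\<tau> \<in> {- del S \<nu>..0}" using ivl_endpoints(3)[OF i] hist_pos(3) by (auto simp: ivl_def)
        have d: "dim_vec (g \<tau>) = n" "dim_vec (h \<tau>) = n" using cg chh th hist_pos(3) by (auto simp: continuous_segment_def)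
        have vv: "vnorm (g \<tau>) * vnorm (h \<tau>) \<le> ?N"
          using vnorm_le_cnorm[OF _ th] g h hist_pos(3) cnorm_pos[OF g] by (intro mult_mono vnorm_nonneg) auto
        have z: "\<bar>g \<tau> \<bullet> (Z *\<^sub>v h \<tau>)\<bar> \<le> CZ Z * ?N" if Z: "Z \<in> carrier_mat n n" for Z
          using CZ(2)[OF Z d] mult_left_mono[OF vv CZ(1)[OF Z]] by simp
        have "\<bar>(\<tau> + del S i) * (g \<tau> \<bullet> (R i *\<^sub>v h \<tau>))\<bar> \<le> del S i * (CZ (R i) * ?N)"
          unfolding abs_mult using t th dp[OF i] by (intro mult_mono z Zi) auto
        then show "\<bar>g \<tau> \<bullet> (Q i *\<^sub>v h \<tau>) + (\<tau> + del S i) * (g \<tau> \<bullet> (R i *\<^sub>v h \<tau>))\<bar> \<le> CZ (Q i) * ?N + del S i * (CZ (R i) * ?N)"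
          using z[OF Zi(1)] by linarith
      qed
      then show ?thesis by (simp add: Ci_def ivl_def algebra_simps)
    qed
    have "\<bar>\<Sum>i\<in>idx. LINT \<tau>|lebesgue_on (ivl S i). g \<tau> \<bullet> (Q i *\<^sub>v h \<tau>) + (\<tau> + del S i) * (g \<tau> \<bullet> (R i *\<^sub>v h \<tau>))\<bar> \<le> (\<Sum>i\<in>idx. Ci i * ?N)"
      by (rule order_trans[OF sum_abs sum_mono]) (rule 2)
    then have "\<bar>LK g h\<bar> \<le> CP * (1 + L) * ?N + (\<Sum>i\<in>idx. Ci i * ?N)" using 1 unfolding LK_def by linarith
    then show "\<bar>LK g h\<bar> \<le> (CP * (1 + L) + (\<Sum>i\<in>idx. Ci i)) * ?N" by (simp add: distrib_right sum_distrib_right)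
  qed
qed

lemma LK_linear:
  assumes f: "f \<in> cspace (hist S) n" and g: "g \<in> cspace (hist S) n" and h: "h \<in> cspace (hist S) n"
  shows "LK (cadd (hist S) f g) h = LK f h + LK g h" "LK h (cadd (hist S) f g) = LK h f + LK h g"
    "LK (cscale (hist S) c g) h = c * LK g h" "LK g (cscale (hist S) c h) = c * LK g h"
proof -
  note cf = cspace_continuous_segment[OF f] and cg = cspace_continuous_segment[OF g] and chh = cspace_continuous_segment[OF h]
  have de: "dim_vec (eta f) = n + totf S * n" "dim_vec (eta g) = n + totf S * n" "dim_vec (eta h) = n + totf S * n"
    using cf cg chh hist_pos(2) by (auto intro!: dim_eta simp: continuous_segment_def)
  have dP: "dim_row PP = n + totf S * n" "dim_col PP = n + totf S * n" using PP_sym(1) by auto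
  let ?I = "\<lambda>i g h \<tau>. g \<tau> \<bullet> (Q i *\<^sub>v h \<tau>) + (\<tau> + del S i) * (g \<tau> \<bullet> (R i *\<^sub>v h \<tau>))"
  have int: "integrable (lebesgue_on (ivl S i)) (?I i g' h')" if "continuous_segment g'" "continuous_segment h'" "i \<in> idx" for i g' h'
    using segment_bilinear(2)[OF that(1,2) dims_vars(7)[OF that(3)] that(3)] segment_bilinear(4)[OF that(1,2) dims_vars(8)[OF that(3)] that(3)]
    by (rule Bochner_Integration.integrable_add)
  have d: "dim_vec (f \<tau>) = n" "dim_vec (g \<tau>) = n" "dim_vec (h \<tau>) = n" "\<tau> \<in> hist S" "dim_row (Q i) = n" "dim_col (Q i) = n" "dim_row (R i) = n" "dim_col (R i) = n"
    if "\<tau> \<in> ivl S i" "i \<in> idx" for \<tau> i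
    using that ivl_endpoints(3)[OF that(2)] dims_vars(7,8)[OF that(2)] cf cg chh by (auto simp: continuous_segment_def)
  have "(LINT \<tau>|lebesgue_on (ivl S i). ?I i (cadd (hist S) f g) h \<tau>) = (LINT \<tau>|lebesgue_on (ivl S i). ?I i f h \<tau>) + (LINT \<tau>|lebesgue_on (ivl S i). ?I i g h \<tau>)"
    if i: "i \<in> idx" for i
    unfolding Bochner_Integration.integral_add[OF int[OF cf chh i] int[OF cg chh i], symmetric]
    by (rule Bochner_Integration.integral_cong) (use d i in \<open>auto simp: cadd_def sp_add_left distrib_left\<close>)
  then show "LK (cadd (hist S) f g) h = LK f h + LK g h"
    unfolding LK_def eta_linear(1)[OF cf cg] using de dP by (simp add: sp_add_left sum.distrib)
  have "(LINT \<tau>|lebesgue_on (ivl S i). ?I i h (cadd (hist S) f g) \<tau>) = (LINT \<tau>|lebesgue_on (ivl S i). ?I i h f \<tau>) + (LINT \<tau>|lebesgue_on (ivl S i). ?I i h g \<tau>)"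
    if i: "i \<in> idx" for i
    unfolding Bochner_Integration.integral_add[OF int[OF chh cf i] int[OF chh cg i], symmetric]
    by (rule Bochner_Integration.integral_cong) (use d i in \<open>auto simp: cadd_def mmv_vec_add sp_add_right distrib_left\<close>)
  then show "LK h (cadd (hist S) f g) = LK h f + LK h g"
    unfolding LK_def eta_linear(1)[OF cf cg] using de dP by (simp add: mmv_vec_add sp_add_right sum.distrib)
  have "(LINT \<tau>|lebesgue_on (ivl S i). ?I i (cscale (hist S) c g) h \<tau>) = c * (LINT \<tau>|lebesgue_on (ivl S i). ?I i g h \<tau>)"
    if i: "i \<in> idx" for i
    unfolding Bochner_Integration.integral_mult_right_zero[symmetric]
    by (rule Bochner_Integration.integral_cong) (use d i in \<open>auto simp: cscale_def sp_smult distrib_left mult.left_commute\<close>)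
  then show "LK (cscale (hist S) c g) h = c * LK g h"
    unfolding LK_def eta_linear(2)[OF cg cg] using de dP by (simp add: sp_smult distrib_left sum_distrib_left)
  have "(LINT \<tau>|lebesgue_on (ivl S i). ?I i g (cscale (hist S) c h) \<tau>) = c * (LINT \<tau>|lebesgue_on (ivl S i). ?I i g h \<tau>)"
    if i: "i \<in> idx" for i
    unfolding Bochner_Integration.integral_mult_right_zero[symmetric]
    by (rule Bochner_Integration.integral_cong) (use d i in \<open>auto simp: cscale_def mmv_vec_smult sp_smult distrib_left mult.left_commute\<close>)
  then show "LK g (cscale (hist S) c h) = c * LK g h"
    unfolding LK_def eta_linear(2)[OF chh chh] using de dP by (simp add: mmv_vec_smult sp_smult distrib_left sum_distrib_left)
qed

lemma C1_LK: "C1_functional (hist S) n (\<lambda>\<psi>. LK \<psi> \<psi>)"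
proof -
  obtain C where C: "0 \<le> C" "\<And>g h. g \<in> cspace (hist S) n \<Longrightarrow> h \<in> cspace (hist S) n \<Longrightarrow> \<bar>LK g h\<bar> \<le> C * (cnorm (hist S) g * cnorm (hist S) h)"
    using LK_bound by blast
  show ?thesis
    unfolding hist_pos(3)
    by (rule C1_functional_quadratic[where C = C]) (use hist_pos(1) LK_linear C in \<open>simp_all add: hist_pos(3)\<close>)
qed

subsection \<open>The functional along trajectories\<close>

text \<open>Continuity on the whole line, before the initial time as well, spares side conditions on
  the windows; solutions acquire it through \<open>extension\<close>.\<close>

definition trajectory :: "(real \<Rightarrow> real vec) \<Rightarrow> bool" where
  "trajectory x \<longleftrightarrow> (\<forall>s. dim_vec (x s) = n) \<and> (\<forall>j < n. continuous_on UNIV (\<lambda>s. x s $ j))"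

lemma trajectory_segment: "trajectory x \<Longrightarrow> continuous_segment (\<lambda>\<tau>. x (t + \<tau>))"
  unfolding trajectory_def continuous_segment_def using continuous_on_translate[of "\<lambda>s. x s $ _"] by auto

lemma trajectory_bilinear:
  assumes "trajectory x" "A \<in> carrier_mat n n"
  shows "continuous_on UNIV (\<lambda>s. x s \<bullet> (A *\<^sub>v x s))"
proof -
  have d: "dim_vec (x s) = n" for s using assms by (simp add: trajectory_def)
  show ?thesis unfolding bilinear_form_sum[OF assms(2) d d]
    using assms(1) by (intro continuous_intros) (auto simp: trajectory_def)
qed

definition lf' :: "nat \<Rightarrow> real \<Rightarrow> real vec" where "lf' i \<tau> = mat_inv (cholF S i) *\<^sub>v (matM S i *\<^sub>v fnh S i \<tau>)"

lemma lf'_L2: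
  assumes i: "i \<in> idx"
  shows "(\<lambda>\<tau>. matM S i *\<^sub>v fnh S i \<tau>) \<in> L2_vec (ivl S i) (dimf S i)" "lf' i \<in> L2_vec (ivl S i) (dimf S i)"
proof -
  show *: "(\<lambda>\<tau>. matM S i *\<^sub>v fnh S i \<tau>) \<in> L2_vec (ivl S i) (dimf S i)" by (rule L2_vec_mult[OF L2_fn(2)[OF i] dims_hat(5)[OF i]])
  show "lf' i \<in> L2_vec (ivl S i) (dimf S i)" unfolding lf'_def[abs_def] by (rule L2_vec_mult[OF * cholF(4)[OF i]])
qed

text \<open>Here the weak differential equation for f becomes an integral equation; the constant
  matrix in \<open>lf\<close> passes through the integral by linearity.\<close>

lemma lf_FTC:
  assumes i: "i \<in> idx" and a: "a < dimf S i" and t: "t \<in> ivl S i"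
  shows "lf i t $ a = lf i (- del S i) $ a + integral {- del S i..t} (\<lambda>\<tau>. lf' i \<tau> $ a)"
proof -
  let ?L = "mat_inv (cholF S i)" and ?g = "\<lambda>b \<tau>. (matM S i *\<^sub>v fnh S i \<tau>) $ b" and ?N = "{0..<dimf S i}"
  have L: "dim_row ?L = dimf S i" "dim_col ?L = dimf S i" using cholF(4)[OF i] by auto
  have g: "integrable (lebesgue_on {- del S i..- del S (i - 1)}) (?g b)" if "b < dimf S i" for b
    using L2_vecD(2)[OF lf'_L2(1)[OF i] that] unfolding ivl_def by (rule sq_int_integrable)
  have f: "fnf S i t $ b = fnf S i (- del S i) $ b + integral {- del S i..t} (?g b)" if b: "b < dimf S i" for b
  proof (rule weak_deriv_FTC[OF _ g[OF b] kdD(4)[OF i b]])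
    show "continuous_on {- del S i..- del S (i - 1)} (\<lambda>\<tau>. fnf S i \<tau> $ b)" using kdD(1)[OF i] b by (simp add: W12_vec_def)
  qed (use delay_less[OF i] t in \<open>auto simp: ivl_def\<close>)
  have gi: "?g b integrable_on {- del S i..t}" if b: "b < dimf S i" for b
    using g[OF b] t integrable_on_subinterval[of "?g b" "{- del S i..- del S (i - 1)}" "- del S i" t]
    by (auto simp: ivl_def integrable_on_lebesgue_on)
  have e: "lf i s $ a = (\<Sum>b\<in>?N. ?L $$ (a, b) * fnf S i s $ b)" if "s \<in> ivl S i" for s
    unfolding lf_def using a L dim_fn(1)[OF i that] by (simp add: scalar_prod_def)
  have "integral {- del S i..t} (\<lambda>\<tau>. lf' i \<tau> $ a) = integral {- del S i..t} (\<lambda>\<tau>. \<Sum>b\<in>?N. ?L $$ (a, b) * ?g b \<tau>)"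
    unfolding lf'_def using a L dims_hat(5)[OF i] by (simp add: scalar_prod_def)
  also have "\<dots> = (\<Sum>b\<in>?N. integral {- del S i..t} (\<lambda>\<tau>. ?L $$ (a, b) * ?g b \<tau>))"
    by (rule integral_sum) (use gi in \<open>auto intro: integrable_on_mult_right\<close>)
  also have "\<dots> = (\<Sum>b\<in>?N. ?L $$ (a, b) * integral {- del S i..t} (?g b))" by simp
  finally have I: "integral {- del S i..t} (\<lambda>\<tau>. lf' i \<tau> $ a) = (\<Sum>b\<in>?N. ?L $$ (a, b) * integral {- del S i..t} (?g b))" .
  have "lf i t $ a = (\<Sum>b\<in>?N. ?L $$ (a, b) * fnf S i (- del S i) $ b + ?L $$ (a, b) * integral {- del S i..t} (?g b))"
    unfolding e[OF t] by (rule sum.cong) (use f in \<open>auto simp: distrib_left\<close>)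
  then show ?thesis unfolding I e[OF ivl_endpoints(1)[OF i]] by (simp add: sum.distrib)
qed

lemma Fv_window:
  assumes x: "trajectory x" and i: "i \<in> idx" and k: "k < dimf S i * n"
  shows "Fv i (\<lambda>\<tau>. x (s + \<tau>)) $ k = (LINT \<tau>|lebesgue_on {- del S i..- del S (i - 1)}. lf i \<tau> $ (k div n) * x (s + \<tau>) $ (k mod n))"
  unfolding Fv_def int_vec_def index_vec[OF k] ivl_def
  by (rule Bochner_Integration.integral_cong) (use k x dim_lf[OF i] div_mod_less[OF k] in \<open>auto simp: kv_def trajectory_def\<close>)

text \<open>Entry k of the moment pairs component k div n of \<open>lf\<close> with component k mod
  n of x, and each such scalar is a sliding window. The derivative exists at every t although x is
  merely continuous.\<close>

lemma Fv_trajectory: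
  assumes x: "trajectory x" and i: "i \<in> idx"
  shows "vec_has_derivative (\<lambda>s. Fv i (\<lambda>\<tau>. x (s + \<tau>)))
      (kv (lf i (- del S (i - 1))) (x (t - del S (i - 1))) - (kv (lf i (- del S i)) (x (t - del S i)) + (Mc i \<otimes>\<^sub>K 1\<^sub>m n) *\<^sub>v Xv i (\<lambda>\<tau>. x (t + \<tau>)))) t"
      (is "vec_has_derivative _ ?D t")
    and "vec_abs_cont_on a b (dimf S i * n) (\<lambda>s. Fv i (\<lambda>\<tau>. x (s + \<tau>)))"
proof -
  have xd: "dim_vec (x s) = n" for s using x by (simp add: trajectory_def)
  let ?a = "- del S i" and ?b = "- del S (i - 1)"
  have Mc: "(Mc i \<otimes>\<^sub>K 1\<^sub>m n) *\<^sub>v Xv i (\<lambda>\<tau>. x (t + \<tau>)) = int_vec (ivl S i) (dimf S i * n) (\<lambda>\<tau>. kv (lf' i \<tau>) (x (t + \<tau>)))"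
    unfolding lf'_def by (rule Mc_Xv[OF i segment_L2[OF trajectory_segment[OF x] i]])
  have dD: "dim_vec ?D = dimf S i * n" unfolding Mc using dim_lf[OF i] xd by simp
  have *: "((\<lambda>s. Fv i (\<lambda>\<tau>. x (s + \<tau>)) $ k) has_real_derivative ?D $ k) (at t)" "abs_cont_on a b (\<lambda>s. Fv i (\<lambda>\<tau>. x (s + \<tau>)) $ k)"
    if k: "k < dimf S i * n" for k
  proof -
    note dm = conjunct1[OF div_mod_less[OF k]] conjunct2[OF div_mod_less[OF k]]
    have y: "continuous_on UNIV (\<lambda>s. x s $ (k mod n))" using x dm by (simp add: trajectory_def)
    have f2: "sq_int {?a..?b} (\<lambda>\<tau>. lf i \<tau> $ (k div n))" using L2_vecD(2)[OF L2_orthonormal_basis(3)[OF i] dm(1)] by (simp add: ivl_def)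
    have g2: "sq_int {?a..?b} (\<lambda>\<tau>. lf' i \<tau> $ (k div n))" using L2_vecD(2)[OF lf'_L2(2)[OF i] dm(1)] by (simp add: ivl_def)
    have ab: "?a \<le> ?b" using delay_less[OF i] by simp
    have F: "lf i t $ (k div n) = lf i ?a $ (k div n) + integral {?a..t} (\<lambda>\<tau>. lf' i \<tau> $ (k div n))" if "t \<in> {?a..?b}" for t
      by (rule lf_FTC[OF i dm(1)]) (use that in \<open>simp add: ivl_def\<close>)
    note sw = sliding_window[OF ab f2 g2 F y]
    have I: "int_vec (ivl S i) (dimf S i * n) (\<lambda>\<tau>. kv (lf' i \<tau>) (x (t + \<tau>))) $ k = (LINT \<tau>|lebesgue_on {?a..?b}. lf' i \<tau> $ (k div n) * x (t + \<tau>) $ (k mod n))"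
      unfolding int_vec_def index_vec[OF k] ivl_def
      by (rule Bochner_Integration.integral_cong) (use k xd L2_vecD(1)[OF lf'_L2(2)[OF i]] dm in \<open>auto simp: kv_def ivl_def\<close>)
    have "?D $ k = lf i ?b $ (k div n) * x (t + ?b) $ (k mod n) - lf i ?a $ (k div n) * x (t + ?a) $ (k mod n)
       - (LINT \<tau>|lebesgue_on {?a..?b}. lf' i \<tau> $ (k div n) * x (t + \<tau>) $ (k mod n))"
      unfolding Mc using k dm xd dim_lf[OF i] I by (simp add: kv_def)
    then show "((\<lambda>s. Fv i (\<lambda>\<tau>. x (s + \<tau>)) $ k) has_real_derivative ?D $ k) (at t)"
      unfolding Fv_window[OF x i k] using sw(1) by simp
    show "abs_cont_on a b (\<lambda>s. Fv i (\<lambda>\<tau>. x (s + \<tau>)) $ k)"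
      unfolding Fv_window[OF x i k] by (rule sw(2))
  qed
  show "vec_has_derivative (\<lambda>s. Fv i (\<lambda>\<tau>. x (s + \<tau>))) ?D t"
    unfolding vec_has_derivative_def dD using *(1) by simp
  show "vec_abs_cont_on a b (dimf S i * n) (\<lambda>s. Fv i (\<lambda>\<tau>. x (s + \<tau>)))"
    unfolding vec_abs_cont_on_def using *(2) by simp
qed

text \<open>Two sliding windows: Q_i with weight 1 and R_i with weight \<tau> + r_i, whose
  derivatives are 0 and 1. The second weight is r_i - r_{i-1} at the newer end and 0 at the older
  one.\<close>

lemma delay_window:
  assumes x: "trajectory x" and i: "i \<in> idx"
  shows "((\<lambda>s. LINT \<tau>|lebesgue_on (ivl S i). x (s + \<tau>) \<bullet> (Q i *\<^sub>v x (s + \<tau>)) + (\<tau> + del S i) * (x (s + \<tau>) \<bullet> (R i *\<^sub>v x (s + \<tau>))))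
     has_real_derivative
       x (t - del S (i - 1)) \<bullet> (Q i *\<^sub>v x (t - del S (i - 1))) + (del S i - del S (i - 1)) * (x (t - del S (i - 1)) \<bullet> (R i *\<^sub>v x (t - del S (i - 1))))
       - x (t - del S i) \<bullet> (Q i *\<^sub>v x (t - del S i)) - (LINT \<tau>|lebesgue_on (ivl S i). x (t + \<tau>) \<bullet> (R i *\<^sub>v x (t + \<tau>)))) (at t)"
    and "abs_cont_on a b (\<lambda>s. LINT \<tau>|lebesgue_on (ivl S i). x (s + \<tau>) \<bullet> (Q i *\<^sub>v x (s + \<tau>)) + (\<tau> + del S i) * (x (s + \<tau>) \<bullet> (R i *\<^sub>v x (s + \<tau>))))"
proof -
  let ?a = "- del S i" and ?b = "- del S (i - 1)"
  let ?yQ = "\<lambda>s. x s \<bullet> (Q i *\<^sub>v x s)" and ?yR = "\<lambda>s. x s \<bullet> (R i *\<^sub>v x s)"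
  have ab: "?a \<le> ?b" using delay_less[OF i] by simp
  note cQ = trajectory_bilinear[OF x dims_vars(7)[OF i]] and cR = trajectory_bilinear[OF x dims_vars(8)[OF i]]
  have s: "sq_int {?a..?b} (\<lambda>_. c)" "sq_int {?a..?b} (\<lambda>\<tau>. \<tau> + del S i)" for c :: real
    by (auto intro!: sq_int_continuous continuous_intros)
  have "1 = 1 + integral {?a..\<tau>} (\<lambda>_. 0 :: real)" for \<tau> by simp
  note w1 = sliding_window[OF ab s(1)[of 1] s(1)[of 0] this cQ, unfolded mult_1_left mult_zero_left]
  have "\<tau> + del S i = ?a + del S i + integral {?a..\<tau>} (\<lambda>_. 1)" if "\<tau> \<in> {?a..?b}" for \<tau> using that by simp
  note w2 = sliding_window[OF ab s(2) s(1)[of 1] this cR]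
  have i2: "integrable (lebesgue_on (ivl S i)) (\<lambda>\<tau>. ?yQ (s + \<tau>))" "integrable (lebesgue_on (ivl S i)) (\<lambda>\<tau>. (\<tau> + del S i) * ?yR (s + \<tau>))" for s
    using segment_bilinear(2)[OF trajectory_segment[OF x] trajectory_segment[OF x] dims_vars(7)[OF i] i]
      segment_bilinear(4)[OF trajectory_segment[OF x] trajectory_segment[OF x] dims_vars(8)[OF i] i] by auto
  have e: "(LINT \<tau>|lebesgue_on (ivl S i). ?yQ (s + \<tau>) + (\<tau> + del S i) * ?yR (s + \<tau>)) =
     (LINT \<tau>|lebesgue_on (ivl S i). ?yQ (s + \<tau>)) + (LINT \<tau>|lebesgue_on (ivl S i). (\<tau> + del S i) * ?yR (s + \<tau>))" for s
    by (rule Bochner_Integration.integral_add[OF i2])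
  show "((\<lambda>s. LINT \<tau>|lebesgue_on (ivl S i). ?yQ (s + \<tau>) + (\<tau> + del S i) * ?yR (s + \<tau>)) has_real_derivative
       ?yQ (t - del S (i - 1)) + (del S i - del S (i - 1)) * ?yR (t - del S (i - 1)) - ?yQ (t - del S i) - (LINT \<tau>|lebesgue_on (ivl S i). ?yR (t + \<tau>))) (at t)"
    unfolding e unfolding ivl_def by (rule DERIV_cong[OF DERIV_add[OF w1(1)[of t] w2(1)[of t]]])
      (simp only: add_uminus_conv_diff uminus_add_conv_diff mult_1_left Bochner_Integration.integral_zero, simp)
  show "abs_cont_on a b (\<lambda>s. LINT \<tau>|lebesgue_on (ivl S i). ?yQ (s + \<tau>) + (\<tau> + del S i) * ?yR (s + \<tau>))"
    unfolding e unfolding ivl_def by (rule abs_cont_on_add[OF w1(2) w2(2)])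
qed

lemma eta_abs_cont:
  assumes x: "trajectory x" and ac: "vec_abs_cont_on a b n x"
  shows "vec_abs_cont_on a b (n + totf S * n) (\<lambda>s. eta (\<lambda>\<tau>. x (s + \<tau>)))"
proof -
  have "vec_abs_cont_on a b (\<Sum>i\<leftarrow>dl. dimf S i * n) (\<lambda>s. cv (map (\<lambda>i. Fv i (\<lambda>\<tau>. x (s + \<tau>))) dl))"
    by (rule vec_abs_cont_on_cv) (use Fv_trajectory(2)[OF x] in \<open>auto simp: set_delay_idx\<close>)
  then have "vec_abs_cont_on a b (totf S * n) (\<lambda>s. cv (map (\<lambda>i. Fv i (\<lambda>\<tau>. x (s + \<tau>))) dl))"
    by (simp only: sum_list_idx_mult totf_def)
  from vec_abs_cont_on_append[OF ac this] show ?thesis by (simp add: eta_def)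
qed

lemma eta_derivative:
  assumes x: "trajectory x" and w: "dim_vec w = q" and x': "vec_has_derivative x x' t"
  shows "vec_has_derivative (\<lambda>s. eta (\<lambda>\<tau>. x (s + \<tau>))) (x' @\<^sub>v (Mhat *\<^sub>v theta x t w)) t"
proof -
  have xd: "dim_vec (x s) = n" for s using x by (simp add: trajectory_def)
  have "vec_has_derivative (\<lambda>s. cv (map (\<lambda>i. Fv i (\<lambda>\<tau>. x (s + \<tau>))) dl)) (Mhat *\<^sub>v theta x t w) t"
    unfolding theta_def Mhat_form[OF theta_bdims[of x w t, OF xd w]]
    by (rule vec_has_derivative_cv) (use Fv_trajectory(1)[OF x] in \<open>simp only: set_delay_idx\<close>)
  from vec_has_derivative_append[OF x' this] show ?thesis by (simp add: eta_def)
qed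

lemma LK_abs_cont:
  assumes x: "trajectory x" and ac: "vec_abs_cont_on a b n x"
  shows "abs_cont_on a b (\<lambda>s. LK (\<lambda>\<tau>. x (s + \<tau>)) (\<lambda>\<tau>. x (s + \<tau>)))"
  unfolding LK_def
  by (intro abs_cont_on_add abs_cont_on_sum vec_abs_cont_on_quadratic[OF _ PP_sym(1)] delay_window(2) eta_abs_cont x ac)

text \<open>S keeps the current state, and its block I-hat converts moments against
  \<open>lh\<close> into moments against \<open>lf\<close>.\<close>

lemma matS_theta:
  assumes x: "trajectory x" and w: "dim_vec w = q"
  shows "matS S *\<^sub>v theta x t w = eta (\<lambda>\<tau>. x (t + \<tau>))"
proof -
  have xd: "dim_vec (x s) = n" for s using x by (simp add: trajectory_def)
  note b = theta_bdims[of x w t, OF xd w]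
  note cb = dim_cv_blocks[OF b]
  have "matS S *\<^sub>v theta x t w = x (t - del S 0) @\<^sub>v (hatI S *\<^sub>v cv (map (\<lambda>i. Xv i (\<lambda>\<tau>. x (t + \<tau>))) dl))"
    unfolding theta_def blk_split(1) by (rule matS_form) (use cb xd w in auto)
  also have "hatI S *\<^sub>v cv (map (\<lambda>i. Xv i (\<lambda>\<tau>. x (t + \<tau>))) dl) = cv (map (\<lambda>i. Fv i (\<lambda>\<tau>. x (t + \<tau>))) dl)"
    unfolding hatI_form[OF b]
    by (rule cv_map_cong) (use Hc_Xv segment_L2[OF trajectory_segment[OF x]] in \<open>simp add: set_delay_idx\<close>)
  finally show ?thesis by (simp add: eta_def delay_0)
qed

text \<open>The choice of y solves J1 y = - J~ z, the stationarity condition of 2 y^T J~ z + y^T J1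
  y in y, and the stationary value is - z^T J~^T J1^{-1} J~ z. This trades the inverse in the supply
  rate for terms that occur in the dissipation matrix.\<close>

lemma supply_form:
  assumes z: "dim_vec z = m" and w: "dim_vec w = q"
  defines "y \<equiv> - (mat_inv (matJ1 J) *\<^sub>v (matJt J *\<^sub>v z))"
  shows "supply_rate J z w = 2 * (w \<bullet> ((matJ2 J)\<^sup>T *\<^sub>v z)) + w \<bullet> (matJ3 J *\<^sub>v w) - 2 * (y \<bullet> (matJt J *\<^sub>v z)) - y \<bullet> (matJ1 J *\<^sub>v y)"
    and "dim_vec y = m"
proof -
  note ds = dims_supply
  note inv = mat_inv_inverse[OF ds(2,7)]
  let ?jz = "matJt J *\<^sub>v z"
  have d: "dim_row (matJt J) = m" "dim_col (matJt J) = m" "dim_row (matJ1 J) = m" "dim_col (matJ1 J) = m"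
    "dim_row (mat_inv (matJ1 J)) = m" "dim_col (mat_inv (matJ1 J)) = m" "dim_row (matJ2 J) = m" "dim_col (matJ2 J) = q" using ds inv(1) by auto
  show dy: "dim_vec y = m" using d by (simp add: y_def)
  have "matJ1 J *\<^sub>v y = - (matJ1 J *\<^sub>v (mat_inv (matJ1 J) *\<^sub>v ?jz))"
    unfolding y_def by (intro eq_vecI) (use d in auto)
  also have "matJ1 J *\<^sub>v (mat_inv (matJ1 J) *\<^sub>v ?jz) = ?jz"
    using inv(2) d by (simp add: mmv_mult[symmetric] mmv_one)
  finally have 1: "y \<bullet> (matJ1 J *\<^sub>v y) = - (y \<bullet> ?jz)" by (simp add: sp_uminus_right)
  have 2: "y \<bullet> ?jz = - (z \<bullet> (((matJt J)\<^sup>T * mat_inv (matJ1 J) * matJt J) *\<^sub>v z))"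
  proof -
    have "z \<bullet> (((matJt J)\<^sup>T * mat_inv (matJ1 J) * matJt J) *\<^sub>v z) = z \<bullet> ((matJt J)\<^sup>T *\<^sub>v (mat_inv (matJ1 J) *\<^sub>v ?jz))"
      using d z by (simp add: mmv_mult)
    also have "\<dots> = (mat_inv (matJ1 J) *\<^sub>v ?jz) \<bullet> ?jz" by (rule sp_transpose) (use d z in auto)
    finally show ?thesis unfolding y_def using d by simp
  qed
  have "supply_rate J z w = z \<bullet> (((matJt J)\<^sup>T * mat_inv (matJ1 J) * matJt J) *\<^sub>v z) + z \<bullet> (matJ2 J *\<^sub>v w) + z \<bullet> (matJ2 J *\<^sub>v w) + w \<bullet> (matJ3 J *\<^sub>v w)"
    unfolding supply_rate_def by (rule sym_block_form) (use d ds z w in auto)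
  moreover have "w \<bullet> ((matJ2 J)\<^sup>T *\<^sub>v z) = z \<bullet> (matJ2 J *\<^sub>v w)" by (rule sp_transpose) (use d z w in auto)
  ultimately show "supply_rate J z w = 2 * (w \<bullet> ((matJ2 J)\<^sup>T *\<^sub>v z)) + w \<bullet> (matJ3 J *\<^sub>v w) - 2 * (y \<bullet> ?jz) - y \<bullet> (matJ1 J *\<^sub>v y)"
    using 1 2 by simp
qed

definition bessel_gap :: "nat \<Rightarrow> (real \<Rightarrow> real vec) \<Rightarrow> real" where
  "bessel_gap i y = (LINT \<tau>|lebesgue_on (ivl S i). y \<tau> \<bullet> (R i *\<^sub>v y \<tau>))
     - (Xv i y \<bullet> ((1\<^sub>m (dimh S i) \<otimes>\<^sub>K R i) *\<^sub>v Xv i y) + Yv i y \<bullet> ((1\<^sub>m (dimphi S i) \<otimes>\<^sub>K R i) *\<^sub>v Yv i y))"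

text \<open>An exact identity; both conclusions follow from the signs of its terms. Twice
  \<open>half_Psi\<close> is the derivative of the quadratic part minus the J2 terms, \<Xi> supplies
  the boundary terms of the windows and the moments, and the moments combine with the integrals of
  the R_i forms to the gaps. The J~ and J1 terms cancel by \<open>supply_form\<close>.\<close>

lemma LK_derivative:
  assumes x: "trajectory x" and w: "dim_vec w = q"
    and x': "vec_has_derivative x (Omega S K *\<^sub>v theta x t w) t" and z: "z = Sigma_cl S K *\<^sub>v theta x t w"
  defines "\<zeta> \<equiv> theta x t w @\<^sub>v - (mat_inv (matJ1 J) *\<^sub>v (matJt J *\<^sub>v z))"
  shows "((\<lambda>s. LK (\<lambda>\<tau>. x (s + \<tau>)) (\<lambda>\<tau>. x (s + \<tau>))) has_real_derivative
     supply_rate J z w + \<zeta> \<bullet> (dissipation_matrix S J K P1 P2 P3 Q R *\<^sub>v \<zeta>) - (\<Sum>i\<in>idx. bessel_gap i (\<lambda>\<tau>. x (t + \<tau>)))) (at t)"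
proof -
  let ?y = "\<lambda>\<tau>. x (t + \<tau>)" and ?th = "theta x t w" and ?v = "- (mat_inv (matJ1 J) *\<^sub>v (matJt J *\<^sub>v z))"
  have xd: "dim_vec (x s) = n" for s using x by (simp add: trajectory_def)
  note b = theta_bdims[of x w t, OF xd w]
  have dth: "dim_vec ?th = NN" unfolding theta_def by (rule dim_blk[OF b])
  have dz: "dim_vec z = m" unfolding z using dim_Omega by simp
  have dv: "dim_vec ?v = m" by (rule supply_form(2)[OF dz w])
  define e' where "e' = (Omega S K *\<^sub>v ?th) @\<^sub>v (Mhat *\<^sub>v ?th)"
  have de': "dim_vec e' = n + totf S * n" using dim_Omega dim_Mhat by (simp add: e'_def)
  have "((\<lambda>s. eta (\<lambda>\<tau>. x (s + \<tau>)) \<bullet> (PP *\<^sub>v eta (\<lambda>\<tau>. x (s + \<tau>)))) has_real_derivative 2 * (eta ?y \<bullet> (PP *\<^sub>v e'))) (at t)"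
    using vec_has_derivative_quadratic[OF eta_derivative[OF x w x'] PP_sym] de' by (simp add: e'_def)
  note D = DERIV_add[OF this DERIV_sum[where S = idx, OF delay_window(1)[OF x, of _ t]]]
  have vl: "vec_last ?th q = w"
    unfolding theta_def blk_def by (simp only: append_vec_assoc[symmetric]) (rule vec_last_append[OF w])
  have half_Psi: "half_Psi ?th ?th = eta ?y \<bullet> (PP *\<^sub>v e') - w \<bullet> ((matJ2 J)\<^sup>T *\<^sub>v z)"
    unfolding half_Psi_def vl matS_theta[OF x w] e'_def z ..
  have Mf: "\<zeta> \<bullet> (dissipation_matrix S J K P1 P2 P3 Q R *\<^sub>v \<zeta>) = half_Psi ?th ?th + half_Psi ?th ?th + ?th \<bullet> (Xi S J Q R *\<^sub>v ?th)
     + ?v \<bullet> (matJt J *\<^sub>v z) + ?v \<bullet> (matJt J *\<^sub>v z) + ?v \<bullet> (matJ1 J *\<^sub>v ?v)"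
    unfolding \<zeta>_def dissipation_matrix_form[OF dth dth dv dv] z[symmetric] ..
  show ?thesis
    unfolding LK_def
  proof (rule DERIV_cong[OF D])
    have X: "?th \<bullet> (Xi S J Q R *\<^sub>v ?th) = (\<Sum>i\<in>idx. x (t - del S (i - 1)) \<bullet> (Q i *\<^sub>v x (t - del S (i - 1))) + (del S i - del S (i - 1)) * (x (t - del S (i - 1)) \<bullet> (R i *\<^sub>v x (t - del S (i - 1)))))
      - (\<Sum>i\<in>idx. x (t - del S i) \<bullet> (Q i *\<^sub>v x (t - del S i)))
      - (\<Sum>i\<in>idx. Xv i ?y \<bullet> ((1\<^sub>m (dimh S i) \<otimes>\<^sub>K R i) *\<^sub>v Xv i ?y))
      - (\<Sum>i\<in>idx. Yv i ?y \<bullet> ((1\<^sub>m (dimphi S i) \<otimes>\<^sub>K R i) *\<^sub>v Yv i ?y)) - w \<bullet> (matJ3 J *\<^sub>v w)"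
      unfolding theta_def by (rule Xi_form[OF b])
    show "2 * (eta ?y \<bullet> (PP *\<^sub>v e')) + (\<Sum>i\<in>idx. x (t - del S (i - 1)) \<bullet> (Q i *\<^sub>v x (t - del S (i - 1))) +
        (del S i - del S (i - 1)) * (x (t - del S (i - 1)) \<bullet> (R i *\<^sub>v x (t - del S (i - 1))))
        - x (t - del S i) \<bullet> (Q i *\<^sub>v x (t - del S i)) - (LINT \<tau>|lebesgue_on (ivl S i). x (t + \<tau>) \<bullet> (R i *\<^sub>v x (t + \<tau>))))
      = supply_rate J z w + \<zeta> \<bullet> (dissipation_matrix S J K P1 P2 P3 Q R *\<^sub>v \<zeta>) - (\<Sum>i\<in>idx. bessel_gap i ?y)"
      unfolding Mf half_Psi supply_form(1)[OF dz w] X bessel_gap_def sum_subtractf sum.distrib by simp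
  qed
qed

end

lemma quadratic_form_uminus: "dim_vec v = dim_col A \<Longrightarrow> v \<bullet> (- A *\<^sub>v v) = - (v \<bullet> (A *\<^sub>v (v :: real vec)))"
proof -
  assume "dim_vec v = dim_col A"
  then have "- A *\<^sub>v v = - (A *\<^sub>v v)" by (intro eq_vecI) auto
  then show ?thesis by (simp add: sp_uminus_right)
qed

subsection \<open>Consequences of the matrix inequalities\<close>

locale closed_loop_lmi = closed_loop +
  assumes lmi_P: "pos_def (sym_block P1 P2 P3 + diag_block_mat [0\<^sub>m (dimx S) (dimx S),
             diag_block_mat (map (\<lambda>i. 1\<^sub>m (dimf S i) \<otimes>\<^sub>K Q i) (delay_idx S))])"
    and lmi_Q: "pos_def (diagQ S Q)" and lmi_R: "pos_def (diagQ S R)"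
    and lmi_D: "neg_def (dissipation_matrix S J K P1 P2 P3 Q R)"
begin

lemma QR_pos_def:
  assumes i: "i \<in> idx"
  shows "pos_def (Q i)" "pos_def (R i)"
proof -
  have d: "i \<in> set dl" "distinct dl" using i by (auto simp: set_delay_idx) (simp add: delay_idx_def)
  show "pos_def (Q i)" "pos_def (R i)"
    by (rule pos_def_diag_block[where k = n and js = dl]; use d lmi_Q lmi_R dims_vars in \<open>auto simp: diagQ_def sym_mats_def set_delay_idx\<close>)+
qed

lemma bessel_gap_nonneg: "i \<in> idx \<Longrightarrow> continuous_segment y \<Longrightarrow> 0 \<le> bessel_gap i y"
  using bessel_blocks(1)[OF _ segment_L2 dims_vars(8), of i y i] pos_def_quadratic[OF QR_pos_def(2) dims_vars(8)]
  by (simp add: bessel_gap_def)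

lemma dissipation_coercive:
  obtains \<epsilon> where "0 < \<epsilon>" "\<And>\<zeta>. dim_vec \<zeta> = NN + m \<Longrightarrow> \<zeta> \<bullet> (dissipation_matrix S J K P1 P2 P3 Q R *\<^sub>v \<zeta>) \<le> - (\<epsilon> * (\<zeta> \<bullet> \<zeta>))"
proof -
  let ?D = "dissipation_matrix S J K P1 P2 P3 Q R"
  have d: "?D \<in> carrier_mat (NN + m) (NN + m)" using dim_Psi dims_supply(2) by (auto simp: dissipation_matrix_def)
  then obtain \<epsilon> where e: "0 < \<epsilon>" "\<And>\<zeta>. dim_vec \<zeta> = NN + m \<Longrightarrow> \<epsilon> * (\<zeta> \<bullet> \<zeta>) \<le> \<zeta> \<bullet> (- ?D *\<^sub>v \<zeta>)"
    using pos_def_coercive[of "- ?D" "NN + m"] lmi_D by (auto simp: neg_def_def)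
  show thesis
  proof (rule that[OF e(1)])
    fix \<zeta> :: "real vec" assume z: "dim_vec \<zeta> = NN + m"
    show "\<zeta> \<bullet> (?D *\<^sub>v \<zeta>) \<le> - (\<epsilon> * (\<zeta> \<bullet> \<zeta>))" using e(2)[OF z] z d quadratic_form_uminus[of \<zeta> ?D] by auto
  qed
qed

lemma energy_parts_nonneg:
  assumes "continuous_segment y"
  shows "0 \<le> (LINT \<tau>|lebesgue_on (ivl S i). y \<tau> \<bullet> y \<tau>)" "0 \<le> energy y"
proof -
  show *: "0 \<le> (LINT \<tau>|lebesgue_on (ivl S i). y \<tau> \<bullet> y \<tau>)" for i by (rule integral_nonneg_AE) (simp add: sp_nonneg)
  show "0 \<le> energy y" unfolding energy_def using * by (intro add_nonneg_nonneg sum_nonneg sp_nonneg)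
qed

text \<open>Each term is bounded by \<open>energy\<close>: the quadratic form of \<open>eta\<close>
  through Bessel, the R_i terms by replacing the weight \<tau> + r_i with its upper bound r_i, which
  is allowed because R_i is positive.\<close>

lemma LK_upper:
  obtains C where "0 < C" "\<And>y. continuous_segment y \<Longrightarrow> LK y y \<le> C * energy y"
proof -
  obtain CP where CP: "0 \<le> CP" "\<And>v. dim_vec v = n + totf S * n \<Longrightarrow> v \<bullet> (PP *\<^sub>v v) \<le> CP * (v \<bullet> v)"
    using quadratic_form_bound[OF PP_sym(1)] by blast
  have "\<exists>C. 0 \<le> C \<and> (\<forall>v. dim_vec v = n \<longrightarrow> v \<bullet> (Z *\<^sub>v v) \<le> C * (v \<bullet> v))" if "Z \<in> carrier_mat n n" for Z :: "real mat"
    using quadratic_form_bound[OF that] by metis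
  then obtain CZ where CZ: "\<And>Z :: real mat. Z \<in> carrier_mat n n \<Longrightarrow> 0 \<le> CZ Z"
    "\<And>Z v. Z \<in> carrier_mat n n \<Longrightarrow> dim_vec v = n \<Longrightarrow> v \<bullet> (Z *\<^sub>v v) \<le> CZ Z * (v \<bullet> v)"
    by metis
  define Ci where "Ci i = CZ (Q i) + del S i * CZ (R i)" for i
  have dp: "0 \<le> del S i" if "i \<in> idx" for i using delay_mono[of 0 i] delay_0 that by simp
  have Ci: "0 \<le> Ci i" if i: "i \<in> idx" for i
    unfolding Ci_def using dp[OF i] CZ(1) dims_vars(7,8)[OF i] by simp
  show thesis
  proof
    have "0 \<le> (\<Sum>i\<in>idx. Ci i)" using Ci by (rule sum_nonneg)
    \<comment> \<open>The summand 1 only makes the constant positive.\<close>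
    then show "0 < CP + (\<Sum>i\<in>idx. Ci i) + 1" using CP(1) by simp
    fix y assume y: "continuous_segment y"
    let ?E = "\<lambda>i. LINT \<tau>|lebesgue_on (ivl S i). y \<tau> \<bullet> y \<tau>"
    have "eta y \<bullet> (PP *\<^sub>v eta y) \<le> CP * (eta y \<bullet> eta y)"
      by (rule CP(2), rule dim_eta) (use y hist_pos(2) in \<open>simp add: continuous_segment_def\<close>)
    also have "\<dots> \<le> CP * energy y" by (intro mult_left_mono eta_energy y CP(1))
    finally have 1: "eta y \<bullet> (PP *\<^sub>v eta y) \<le> CP * energy y" .
    have 2: "(LINT \<tau>|lebesgue_on (ivl S i). y \<tau> \<bullet> (Q i *\<^sub>v y \<tau>) + (\<tau> + del S i) * (y \<tau> \<bullet> (R i *\<^sub>v y \<tau>))) \<le> Ci i * energy y" if i: "i \<in> idx" for i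
    proof -
      note Zi = dims_vars(7,8)[OF i]
      have "(LINT \<tau>|lebesgue_on (ivl S i). y \<tau> \<bullet> (Q i *\<^sub>v y \<tau>) + (\<tau> + del S i) * (y \<tau> \<bullet> (R i *\<^sub>v y \<tau>))) \<le> (LINT \<tau>|lebesgue_on (ivl S i). Ci i * (y \<tau> \<bullet> y \<tau>))"
      proof (rule integral_mono)
        show "integrable (lebesgue_on (ivl S i)) (\<lambda>\<tau>. y \<tau> \<bullet> (Q i *\<^sub>v y \<tau>) + (\<tau> + del S i) * (y \<tau> \<bullet> (R i *\<^sub>v y \<tau>)))"
          using segment_bilinear(2)[OF y y Zi(1) i] segment_bilinear(4)[OF y y Zi(2) i] by (rule Bochner_Integration.integrable_add)
        show "integrable (lebesgue_on (ivl S i)) (\<lambda>\<tau>. Ci i * (y \<tau> \<bullet> y \<tau>))" using segment_energy_density(2)[OF y i] by simp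
        fix \<tau> assume "\<tau> \<in> space (lebesgue_on (ivl S i))"
        then have t: "\<tau> \<in> ivl S i" by simp
        have d: "dim_vec (y \<tau>) = n" using L2_vecD(1)[OF segment_L2[OF y i] t] .
        have "0 \<le> \<tau> + del S i" "\<tau> + del S i \<le> del S i" using t dp[of "i - 1"] ivl_endpoints(3)[OF i] hist_pos(3) by (auto simp: ivl_def)
        then have "(\<tau> + del S i) * (y \<tau> \<bullet> (R i *\<^sub>v y \<tau>)) \<le> del S i * (CZ (R i) * (y \<tau> \<bullet> y \<tau>))"
          using pos_def_quadratic[OF QR_pos_def(2)[OF i] Zi(2) d] CZ(2)[OF Zi(2) d] by (intro mult_mono) auto
        then show "y \<tau> \<bullet> (Q i *\<^sub>v y \<tau>) + (\<tau> + del S i) * (y \<tau> \<bullet> (R i *\<^sub>v y \<tau>)) \<le> Ci i * (y \<tau> \<bullet> y \<tau>)"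
          using CZ(2)[OF Zi(1) d] by (simp add: Ci_def distrib_right mult.assoc)
      qed
      also have "\<dots> = Ci i * ?E i" by simp
      also have "?E i \<le> energy y"
        unfolding energy_def using member_le_sum[OF i, of ?E] energy_parts_nonneg(1)[OF y] sp_nonneg[of "y 0"] by simp
      finally show ?thesis using Ci[OF i] by (simp add: mult_left_mono)
    qed
    have "LK y y \<le> CP * energy y + (\<Sum>i\<in>idx. Ci i * energy y)" unfolding LK_def by (intro add_mono 1 sum_mono 2)
    also have "\<dots> \<le> (CP + (\<Sum>i\<in>idx. Ci i) + 1) * energy y"
      using energy_parts_nonneg(2)[OF y] by (simp add: distrib_right sum_distrib_right)
    finally show "LK y y \<le> (CP + (\<Sum>i\<in>idx. Ci i) + 1) * energy y" .
  qed
qed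

lemma LK_lower:
  obtains c where "0 < c" "\<And>y. continuous_segment y \<Longrightarrow> c * (y 0 \<bullet> y 0) \<le> LK y y"
proof -
  let ?B = "diag_block_mat (map (\<lambda>i. 1\<^sub>m (dimf S i) \<otimes>\<^sub>K Q i) dl)"
  let ?Z = "diag_block_mat [0\<^sub>m n n, ?B]"
  have dB: "dim_row ?B = totf S * n" "dim_col ?B = totf S * n"
    unfolding dim_diag_block_mat map_map comp_def totf_def sum_list_idx_mult[symmetric]
    by (rule sum_list_cong; use dims_vars(7) in \<open>force simp: set_delay_idx\<close>)+
  have d: "PP + ?Z \<in> carrier_mat (n + totf S * n) (n + totf S * n)"
    using PP_sym(1) dB by (intro carrier_matI) auto
  obtain c where c: "0 < c" "\<And>v. dim_vec v = n + totf S * n \<Longrightarrow> c * (v \<bullet> v) \<le> v \<bullet> ((PP + ?Z) *\<^sub>v v)"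
    using pos_def_coercive[OF lmi_P d] by blast
  show thesis
  proof (rule that[OF c(1)])
    fix y assume y: "continuous_segment y"
    have y0: "dim_vec (y 0) = n" using y hist_pos(2) by (simp add: continuous_segment_def)
    note de = dim_eta[of y, OF y0]
    let ?F = "cv (map (\<lambda>i. Fv i y) dl)"
    have dF: "dim_vec ?F = totf S * n" using de y0 by (simp add: eta_def)
    have "c * (y 0 \<bullet> y 0) \<le> c * (eta y \<bullet> eta y)"
      using c(1) sp_nonneg[of ?F] by (simp add: eta_def sp_append)
    also have "\<dots> \<le> eta y \<bullet> ((PP + ?Z) *\<^sub>v eta y)" by (rule c(2)[OF de])
    also have "\<dots> = eta y \<bullet> (PP *\<^sub>v eta y) + eta y \<bullet> (?Z *\<^sub>v eta y)"
    proof -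
      have dP: "dim_row PP = n + totf S * n" "dim_col PP = n + totf S * n" using PP_sym(1) by auto
      have dZ: "dim_row ?Z = n + totf S * n" "dim_col ?Z = n + totf S * n" using dB by simp_all
      have "(PP + ?Z) *\<^sub>v eta y = PP *\<^sub>v eta y + ?Z *\<^sub>v eta y" by (rule mmv_add) (simp_all only: dP dZ de)
      moreover have "dim_vec (PP *\<^sub>v eta y) = dim_vec (?Z *\<^sub>v eta y)" by (simp only: dim_mult_mat_vec dP dZ)
      ultimately show ?thesis by (simp only: sp_add_right)
    qed
    also have "?Z *\<^sub>v eta y = (0\<^sub>m n n *\<^sub>v y 0) @\<^sub>v (diag_block_mat [?B] *\<^sub>v ?F)"
      unfolding eta_def by (rule diag_block_Cons_form) (use y0 dF dB in auto)
    \<comment> \<open>A list of blocks unfolds to a trailing empty block, for which an empty vector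
      is split off.\<close>
    also have "diag_block_mat [?B] *\<^sub>v ?F = diag_block_mat [?B] *\<^sub>v (?F @\<^sub>v vNil)" by (simp only: append_vNil)
    also have "\<dots> = (?B *\<^sub>v ?F) @\<^sub>v (diag_block_mat [] *\<^sub>v vNil)"
      by (rule diag_block_Cons_form) (use dF dB in auto)
    also have "diag_block_mat [] *\<^sub>v vNil = (vNil :: real vec)" by (intro eq_vecI) auto
    also have "?B *\<^sub>v ?F = cv (map (\<lambda>i. (1\<^sub>m (dimf S i) \<otimes>\<^sub>K Q i) *\<^sub>v Fv i y) dl)"
      by (rule diag_block_map_form) (use dims_vars(7) in \<open>force simp: set_delay_idx\<close>)
    also have "eta y \<bullet> ((0\<^sub>m n n *\<^sub>v y 0) @\<^sub>v cv (map (\<lambda>i. (1\<^sub>m (dimf S i) \<otimes>\<^sub>K Q i) *\<^sub>v Fv i y) dl) @\<^sub>v vNil) =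
       ?F \<bullet> cv (map (\<lambda>i. (1\<^sub>m (dimf S i) \<otimes>\<^sub>K Q i) *\<^sub>v Fv i y) dl)"
    proof -
      have "dim_vec (cv (map (\<lambda>i. (1\<^sub>m (dimf S i) \<otimes>\<^sub>K Q i) *\<^sub>v Fv i y) dl)) = totf S * n"
        unfolding dim_cv map_map comp_def totf_def sum_list_idx_mult[symmetric]
        by (rule sum_list_cong) (use dims_vars(7) in \<open>force simp: set_delay_idx\<close>)
      then show ?thesis using y0 dF by (simp add: eta_def append_vNil sp_append mmv_zero_mat sp_zero_right)
    qed
    also have "\<dots> = (\<Sum>i\<in>idx. Fv i y \<bullet> ((1\<^sub>m (dimf S i) \<otimes>\<^sub>K Q i) *\<^sub>v Fv i y))"
      unfolding sum_delay_idx[symmetric] by (rule cv_map_scalar_prod) (use dims_vars(7) in \<open>force simp: set_delay_idx\<close>)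
    also have "\<dots> \<le> (\<Sum>i\<in>idx. LINT \<tau>|lebesgue_on (ivl S i). y \<tau> \<bullet> (Q i *\<^sub>v y \<tau>) + (\<tau> + del S i) * (y \<tau> \<bullet> (R i *\<^sub>v y \<tau>)))"
    proof (rule sum_mono)
      fix i assume i: "i \<in> idx"
      note Zi = dims_vars(7,8)[OF i]
      have "Fv i y \<bullet> ((1\<^sub>m (dimf S i) \<otimes>\<^sub>K Q i) *\<^sub>v Fv i y) \<le> (LINT \<tau>|lebesgue_on (ivl S i). y \<tau> \<bullet> (Q i *\<^sub>v y \<tau>))"
        by (rule bessel_blocks(2)[OF i segment_L2[OF y i] Zi(1)]) (rule pos_def_quadratic[OF QR_pos_def(1)[OF i] Zi(1)])
      also have "\<dots> \<le> (LINT \<tau>|lebesgue_on (ivl S i). y \<tau> \<bullet> (Q i *\<^sub>v y \<tau>) + (\<tau> + del S i) * (y \<tau> \<bullet> (R i *\<^sub>v y \<tau>)))"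
      proof (rule integral_mono)
        show "integrable (lebesgue_on (ivl S i)) (\<lambda>\<tau>. y \<tau> \<bullet> (Q i *\<^sub>v y \<tau>) + (\<tau> + del S i) * (y \<tau> \<bullet> (R i *\<^sub>v y \<tau>)))"
          using segment_bilinear(2)[OF y y Zi(1) i] segment_bilinear(4)[OF y y Zi(2) i] by (rule Bochner_Integration.integrable_add)
        show "integrable (lebesgue_on (ivl S i)) (\<lambda>\<tau>. y \<tau> \<bullet> (Q i *\<^sub>v y \<tau>))" by (rule segment_bilinear(2)[OF y y Zi(1) i])
        fix \<tau> assume "\<tau> \<in> space (lebesgue_on (ivl S i))"
        then have t: "\<tau> \<in> ivl S i" by simp
        have "0 \<le> y \<tau> \<bullet> (R i *\<^sub>v y \<tau>)"
          by (rule pos_def_quadratic[OF QR_pos_def(2)[OF i] Zi(2) L2_vecD(1)[OF segment_L2[OF y i] t]])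
        then show "y \<tau> \<bullet> (Q i *\<^sub>v y \<tau>) \<le> y \<tau> \<bullet> (Q i *\<^sub>v y \<tau>) + (\<tau> + del S i) * (y \<tau> \<bullet> (R i *\<^sub>v y \<tau>))"
          using t by (simp add: ivl_def)
      qed
      finally show "Fv i y \<bullet> ((1\<^sub>m (dimf S i) \<otimes>\<^sub>K Q i) *\<^sub>v Fv i y) \<le> \<dots>" .
    qed
    finally show "c * (y 0 \<bullet> y 0) \<le> LK y y" unfolding LK_def by simp
  qed
qed

lemma theta_square:
  assumes x: "trajectory x" and w: "dim_vec w = q"
  shows "theta x t w \<bullet> theta x t w = (\<Sum>i = 0..\<nu>. x (t - del S i) \<bullet> x (t - del S i)) + (\<Sum>i\<in>idx. Xv i (\<lambda>\<tau>. x (t + \<tau>)) \<bullet> Xv i (\<lambda>\<tau>. x (t + \<tau>)))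
     + (\<Sum>i\<in>idx. Yv i (\<lambda>\<tau>. x (t + \<tau>)) \<bullet> Yv i (\<lambda>\<tau>. x (t + \<tau>))) + w \<bullet> w"
proof -
  have "cv (map u ds) \<bullet> cv (map u ds) = (\<Sum>i = 0..\<nu>. u i \<bullet> u i)" for u
    by (subst cv_map_scalar_prod) (auto simp: sum_list_distinct_conv_sum_set atLeastLessThanSuc_atLeastAtMost simp del: upt_Suc)
  moreover have "cv (map u dl) \<bullet> cv (map u dl) = (\<Sum>i\<in>idx. u i \<bullet> u i)" for u
    unfolding sum_delay_idx[symmetric] by (rule cv_map_scalar_prod) simp
  ultimately show ?thesis unfolding theta_def blk_def by (simp add: sp_append del: upt_Suc)
qed

text \<open>The bracket is what the decay of the functional provides. With R_i bounded below by cR,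
  the integral of |x|^2 over a window is at most 1 / cR times the gap plus the R_i forms of the
  moments; the moments are blocks of \<open>theta\<close>, as is the current state.\<close>

lemma energy_control:
  assumes e: "0 < \<epsilon>"
  obtains A where "0 < A" "\<And>x t (w :: real vec). trajectory x \<Longrightarrow> dim_vec w = q \<Longrightarrow>
     energy (\<lambda>\<tau>. x (t + \<tau>)) \<le> A * (\<epsilon> * (theta x t w \<bullet> theta x t w) + (\<Sum>i\<in>idx. bessel_gap i (\<lambda>\<tau>. x (t + \<tau>))))"
proof -
  have "\<exists>C. 0 \<le> C \<and> (\<forall>v. dim_vec v = k * n \<longrightarrow> v \<bullet> ((1\<^sub>m k \<otimes>\<^sub>K R i) *\<^sub>v v) \<le> C * (v \<bullet> v))" if "i \<in> idx" for i k
  proof -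
    have "1\<^sub>m k \<otimes>\<^sub>K R i \<in> carrier_mat (k * n) (k * n)" using dims_vars(8)[OF that] by auto
    from quadratic_form_bound[OF this] show ?thesis by metis
  qed
  then obtain CR where CR: "\<And>i k. i \<in> idx \<Longrightarrow> 0 \<le> CR i k"
    "\<And>i k v. i \<in> idx \<Longrightarrow> dim_vec v = k * n \<Longrightarrow> v \<bullet> ((1\<^sub>m k \<otimes>\<^sub>K R i) *\<^sub>v v) \<le> CR i k * (v \<bullet> v)" by metis
  have "\<exists>c>0. \<forall>v. dim_vec v = n \<longrightarrow> c * (v \<bullet> v) \<le> v \<bullet> (R i *\<^sub>v v)" if "i \<in> idx" for i
    using pos_def_coercive[OF QR_pos_def(2)[OF that] dims_vars(8)[OF that]] by metis
  then obtain cR where cR: "\<And>i. i \<in> idx \<Longrightarrow> 0 < cR i" "\<And>i v. i \<in> idx \<Longrightarrow> dim_vec v = n \<Longrightarrow> cR i * (v \<bullet> v) \<le> v \<bullet> (R i *\<^sub>v v)" by metis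
  define Ci where "Ci i = CR i (dimh S i) + CR i (dimphi S i)" for i
  have Ci: "0 \<le> Ci i" if "i \<in> idx" for i using CR(1)[OF that] by (simp add: Ci_def)
  \<comment> \<open>A1 collects the coefficients of |theta|^2, the summand 1 stemming from the
    current state, and A2 those of the gaps. Dividing A1 by \<epsilon> then matches the
    bracket.\<close>
  define A1 A2 where "A1 = 1 + (\<Sum>i\<in>idx. Ci i / cR i)" and "A2 = (\<Sum>i\<in>idx. 1 / cR i)"
  have A: "0 < A1" "0 \<le> A2"
    unfolding A1_def A2_def by (intro add_pos_nonneg sum_nonneg divide_nonneg_pos Ci cR(1); simp)+
  show thesis
  proof (rule that[of "A1 / \<epsilon> + A2"])
    show "0 < A1 / \<epsilon> + A2" using A e by (simp add: add_pos_nonneg)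
    fix x t and w :: "real vec" assume x: "trajectory x" and w: "dim_vec w = q"
    let ?y = "\<lambda>\<tau>. x (t + \<tau>)" and ?th = "theta x t w"
    define T where "T = ?th \<bullet> ?th"
    define G where "G = (\<Sum>i\<in>idx. bessel_gap i ?y)"
    note y = trajectory_segment[OF x, of t]
    have T0: "0 \<le> T" by (simp add: T_def sp_nonneg)
    have g0: "0 \<le> bessel_gap i ?y" if "i \<in> idx" for i by (rule bessel_gap_nonneg[OF that y])
    have G0: "0 \<le> G" unfolding G_def using g0 by (rule sum_nonneg)
    note ts = theta_square[OF x w, of t]
    have mem: "f i \<bullet> f i \<le> (\<Sum>i\<in>X. f i \<bullet> f i)" if "i \<in> X" "finite X" for f :: "nat \<Rightarrow> real vec" and i X
      by (rule member_le_sum) (use that sp_nonneg in auto)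
    have nn: "0 \<le> (\<Sum>i\<in>X. f i \<bullet> f i)" for f :: "nat \<Rightarrow> real vec" and X by (rule sum_nonneg) (rule sp_nonneg)
    have x0: "?y 0 \<bullet> ?y 0 \<le> T"
    proof -
      have "?y 0 \<bullet> ?y 0 \<le> (\<Sum>i = 0..\<nu>. x (t - del S i) \<bullet> x (t - del S i))"
        using mem[of 0 "{0..\<nu>}" "\<lambda>i. x (t - del S i)"] by (simp add: delay_0)
      then show ?thesis unfolding T_def ts using nn[of "\<lambda>i. Xv i ?y" idx] nn[of "\<lambda>i. Yv i ?y" idx] sp_nonneg[of w] by linarith
    qed
    have Ei: "(LINT \<tau>|lebesgue_on (ivl S i). ?y \<tau> \<bullet> ?y \<tau>) \<le> (1 / cR i) * G + (Ci i / cR i) * T" if i: "i \<in> idx" for i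
    proof -
      have X: "Xv i ?y \<bullet> Xv i ?y \<le> T" "Yv i ?y \<bullet> Yv i ?y \<le> T"
        unfolding T_def ts using mem[OF i, of "\<lambda>i. Xv i ?y"] mem[OF i, of "\<lambda>i. Yv i ?y"] sp_nonneg[of w]
          nn[of "\<lambda>i. x (t - del S i)" "{0..\<nu>}"] nn[of "\<lambda>i. Xv i ?y" idx] nn[of "\<lambda>i. Yv i ?y" idx] by simp_all
      have "cR i * (LINT \<tau>|lebesgue_on (ivl S i). ?y \<tau> \<bullet> ?y \<tau>) = (LINT \<tau>|lebesgue_on (ivl S i). cR i * (?y \<tau> \<bullet> ?y \<tau>))" by simp
      also have "\<dots> \<le> (LINT \<tau>|lebesgue_on (ivl S i). ?y \<tau> \<bullet> (R i *\<^sub>v ?y \<tau>))"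
      proof (rule integral_mono)
        show "integrable (lebesgue_on (ivl S i)) (\<lambda>\<tau>. cR i * (?y \<tau> \<bullet> ?y \<tau>))" using segment_energy_density(2)[OF y i] by simp
        show "integrable (lebesgue_on (ivl S i)) (\<lambda>\<tau>. ?y \<tau> \<bullet> (R i *\<^sub>v ?y \<tau>))" by (rule segment_bilinear(2)[OF y y dims_vars(8)[OF i] i])
      qed (use cR(2)[OF i] x in \<open>simp add: trajectory_def\<close>)
      also have "\<dots> = bessel_gap i ?y + (Xv i ?y \<bullet> ((1\<^sub>m (dimh S i) \<otimes>\<^sub>K R i) *\<^sub>v Xv i ?y) + Yv i ?y \<bullet> ((1\<^sub>m (dimphi S i) \<otimes>\<^sub>K R i) *\<^sub>v Yv i ?y))"
        by (simp add: bessel_gap_def)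
      also have "\<dots> \<le> G + (CR i (dimh S i) * T + CR i (dimphi S i) * T)"
      proof (intro add_mono)
        show "bessel_gap i ?y \<le> G" unfolding G_def by (rule member_le_sum) (use i g0 in auto)
        show "Xv i ?y \<bullet> ((1\<^sub>m (dimh S i) \<otimes>\<^sub>K R i) *\<^sub>v Xv i ?y) \<le> CR i (dimh S i) * T"
          by (rule order_trans[OF CR(2)[OF i] mult_left_mono[OF X(1) CR(1)[OF i]]]) simp
        show "Yv i ?y \<bullet> ((1\<^sub>m (dimphi S i) \<otimes>\<^sub>K R i) *\<^sub>v Yv i ?y) \<le> CR i (dimphi S i) * T"
          by (rule order_trans[OF CR(2)[OF i] mult_left_mono[OF X(2) CR(1)[OF i]]]) simp
      qed
      finally have "cR i * (LINT \<tau>|lebesgue_on (ivl S i). ?y \<tau> \<bullet> ?y \<tau>) \<le> G + Ci i * T" by (simp add: Ci_def distrib_right)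
      then show ?thesis using cR(1)[OF i] by (simp add: field_simps)
    qed
    have "energy ?y \<le> T + (\<Sum>i\<in>idx. (1 / cR i) * G + (Ci i / cR i) * T)"
      unfolding energy_def by (intro add_mono sum_mono Ei x0)
    also have "\<dots> = A1 * T + A2 * G" by (simp add: A1_def A2_def sum.distrib sum_distrib_right distrib_right)
    also have "\<dots> \<le> (A1 / \<epsilon> + A2) * (\<epsilon> * T + G)"
      using A e T0 G0 by (simp add: field_simps)
    finally show "energy ?y \<le> (A1 / \<epsilon> + A2) * (\<epsilon> * (?th \<bullet> ?th) + (\<Sum>i\<in>idx. bessel_gap i ?y))" unfolding T_def G_def .
  qed
qed

text \<open>Solutions are undetermined before the initial interval; the constant extension makes them continuous on
  the whole line.\<close>

definition extension :: "(real \<Rightarrow> real vec) \<Rightarrow> real \<Rightarrow> real vec" where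
  "extension x s = x (max s (tinit S - del S \<nu>))"

lemma extension_eq: "tinit S \<le> t \<Longrightarrow> \<theta> \<in> hist S \<Longrightarrow> extension x (t + \<theta>) = x (t + \<theta>)"
  by (simp add: extension_def hist_def)

lemma extension_eq_delay: "tinit S \<le> t \<Longrightarrow> i \<in> {0..\<nu>} \<Longrightarrow> extension x (t - del S i) = x (t - del S i)"
  using delay_mono[of i \<nu>] by (simp add: extension_def)

lemma extension_rhs:
  assumes t: "tinit S \<le> t"
  shows "state_rhs S K w (extension x) t = state_rhs S K w x t" "output_rhs S K w (extension x) t = output_rhs S K w x t"
proof -
  have i: "int_vec (ivl S i) r (\<lambda>\<tau>. F \<tau> *\<^sub>v extension x (t + \<tau>)) = int_vec (ivl S i) r (\<lambda>\<tau>. F \<tau> *\<^sub>v x (t + \<tau>))"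
    if "i \<in> idx" for i r and F :: "real \<Rightarrow> real mat"
    by (rule int_vec_cong) (use extension_eq[OF t] ivl_endpoints(3)[OF that] in auto)
  have dr: "dim_row (matB S j) = n" "dim_row (matE S j) = m" if "j \<le> \<nu>" for j using dims_AB[OF that] by auto
  show "state_rhs S K w (extension x) t = state_rhs S K w x t"
    unfolding state_rhs_def
    by (intro arg_cong2[of _ _ _ _ "(+)"] refl finsum_vec_cong_dim) (use i dr extension_eq_delay[OF t] in auto)
  show "output_rhs S K w (extension x) t = output_rhs S K w x t"
    unfolding output_rhs_def
    by (intro arg_cong2[of _ _ _ _ "(+)"] refl finsum_vec_cong_dim) (use i dr extension_eq_delay[OF t] in auto)
qed

text \<open>Up to the initial time the extension is \<psi> with its argument clamped to the history
  interval, afterwards it is the absolutely continuous solution; the two pieces agree where they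
  meet.\<close>

lemma extension_trajectory:
  assumes p: "\<psi> \<in> cspace (hist S) n" and sol: "state_solution S K \<psi> w x"
  shows "trajectory (extension x)" "tinit S \<le> T \<Longrightarrow> vec_abs_cont_on (tinit S) T n (extension x)"
proof -
  have d: "dim_vec (extension x s) = n" for s
    using sol by (auto simp: state_solution_def extension_def)
  have ac: "abs_cont_on (tinit S) T (\<lambda>s. extension x s $ j)" if "tinit S \<le> T" "j < n" for T j
  proof (rule abs_cont_on_cong)
    show "abs_cont_on (tinit S) T (\<lambda>s. x s $ j)" using sol that by (simp add: state_solution_def)
    show "x s $ j = extension x s $ j" if "tinit S \<le> s" for s using that hist_pos(1) by (simp add: extension_def)
  qed
  show "tinit S \<le> T \<Longrightarrow> vec_abs_cont_on (tinit S) T n (extension x)" using d ac by (simp add: vec_abs_cont_on_def)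
  have "continuous_on UNIV (\<lambda>s. extension x s $ j)" if j: "j < n" for j
  proof -
    have c1: "continuous_on {..tinit S} (\<lambda>s. extension x s $ j)"
    proof -
      have "continuous_on {..tinit S} (\<lambda>s. \<psi> (max (s - tinit S) (- del S \<nu>)) $ j)"
        by (rule continuous_on_compose2[of "hist S" "\<lambda>\<theta>. \<psi> \<theta> $ j"])
          (use p j hist_pos in \<open>auto simp: cspace_def intro!: continuous_intros\<close>)
      then show ?thesis
      proof (rule continuous_on_eq)
        fix s assume s: "s \<in> {..tinit S}"
        have "max (s - tinit S) (- del S \<nu>) \<in> hist S" using s hist_pos by auto
        then have "x (tinit S + max (s - tinit S) (- del S \<nu>)) = \<psi> (max (s - tinit S) (- del S \<nu>))"
          using sol by (simp add: state_solution_def)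
        moreover have "tinit S + max (s - tinit S) (- del S \<nu>) = max s (tinit S - del S \<nu>)" by (simp add: max_def)
        ultimately show "\<psi> (max (s - tinit S) (- del S \<nu>)) $ j = extension x s $ j" by (simp add: extension_def)
      qed
    qed
    show ?thesis
    proof (rule continuous_at_imp_continuous_on, intro ballI)
      fix s :: real
      \<comment> \<open>A bound beyond s, so that s is an interior point, and not before the initial
        time, so that two closed pieces cover the half line below it.\<close>
      define T where "T = max (tinit S) (s + 1)"
      have "{..T} = {..tinit S} \<union> {tinit S..T}" by (auto simp: T_def)
      moreover have "continuous_on ({..tinit S} \<union> {tinit S..T}) (\<lambda>s. extension x s $ j)"
        by (intro continuous_on_closed_Un c1 abs_cont_on_continuous ac j) (auto simp: T_def)
      ultimately have "continuous_on {..T} (\<lambda>s. extension x s $ j)" by simp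
      then have "continuous_on {..<T} (\<lambda>s. extension x s $ j)" by (rule continuous_on_subset) auto
      then show "isCont (\<lambda>s. extension x s $ j) s"
        by (rule continuous_on_interior) (auto simp: T_def interior_open)
    qed
  qed
  then show "trajectory (extension x)" using d by (simp add: trajectory_def)
qed

lemma extension_derivative:
  assumes p: "\<psi> \<in> cspace (hist S) n" and sol: "state_solution S K \<psi> w x" and t: "tinit S \<le> t" and w: "dim_vec (w t) = q"
    and x': "\<forall>j < n. ((\<lambda>s. x s $ j) has_real_derivative state_rhs S K w x t $ j) (at t)"
  shows "vec_has_derivative (extension x) (Omega S K *\<^sub>v theta (extension x) t (w t)) t"
    "output_rhs S K w x t = Sigma_cl S K *\<^sub>v theta (extension x) t (w t)"
proof -
  note tr = extension_trajectory(1)[OF p sol]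
  have d: "dim_vec (extension x s) = n" for s using tr by (simp add: trajectory_def)
  note cl = closed_loop_theta[of "extension x" t w, OF d segment_L2[OF trajectory_segment[OF tr]] w, unfolded extension_rhs[OF t]]
  show "output_rhs S K w x t = Sigma_cl S K *\<^sub>v theta (extension x) t (w t)" using cl(2) by simp
  have "((\<lambda>s. extension x s $ j) has_real_derivative state_rhs S K w x t $ j) (at t)" if "j < n" for j
    by (rule has_field_derivative_transform_within_open[where S = "{tinit S - del S \<nu><..}", OF x'[rule_format, OF that]])
      (use t hist_pos(1) in \<open>auto simp: extension_def\<close>)
  then show "vec_has_derivative (extension x) (Omega S K *\<^sub>v theta (extension x) t (w t)) t"
    unfolding vec_has_derivative_def cl(1) using d dim_Omega(1) cl(1)[symmetric] by simp
qed

text \<open>Allows \<open>segment\<close>, which is undefined outside the history interval, to be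
  exchanged for a translate of the extension, and the latter for \<psi> at the initial time.\<close>

lemma LK_cong:
  assumes "\<And>\<theta>. \<theta> \<in> hist S \<Longrightarrow> g \<theta> = h \<theta>"
  shows "LK g g = LK h h" "energy g = energy h"
proof -
  have e: "g \<tau> = h \<tau>" if "i \<in> idx" "\<tau> \<in> ivl S i" for i \<tau> using assms ivl_endpoints(3)[OF that(1)] that(2) by blast
  have "cv (map (\<lambda>i. Fv i g) dl) = cv (map (\<lambda>i. Fv i h) dl)"
    unfolding Fv_def by (intro cv_map_cong int_vec_cong) (use e in \<open>auto simp: set_delay_idx\<close>)
  then have "eta g = eta h" using assms[OF hist_pos(2)] by (simp add: eta_def)
  then show "LK g g = LK h h"
    unfolding LK_def by (intro arg_cong2[of _ _ _ _ "(+)"] sum.cong Bochner_Integration.integral_cong refl) (use e in auto)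
  show "energy g = energy h"
    unfolding energy_def by (intro arg_cong2[of _ _ _ _ "(+)"] sum.cong Bochner_Integration.integral_cong refl) (use e assms[OF hist_pos(2)] in auto)
qed

text \<open>The functional on \<open>segment\<close> is identified with the one on the extension
  only from the initial time on, and a two-sided derivative needs an open neighbourhood.\<close>

lemma AE_after_start: "AE t in lebesgue_on {tinit S..}. tinit S < t"
proof -
  have "AE t in lborel. t \<noteq> tinit S" by (rule AE_lborel_singleton)
  then have "AE t in lebesgue. t \<noteq> tinit S" by (rule AE_completion)
  then show ?thesis by (subst AE_restrict_space_iff) (auto elim!: eventually_mono)
qed

end

context closed_loop_lmi begin

lemma dissipation_nonpos:
  assumes "dim_vec \<zeta> = NN + m"
  shows "\<zeta> \<bullet> (dissipation_matrix S J K P1 P2 P3 Q R *\<^sub>v \<zeta>) \<le> 0"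
proof -
  obtain \<epsilon> where "0 < \<epsilon>" "\<zeta> \<bullet> (dissipation_matrix S J K P1 P2 P3 Q R *\<^sub>v \<zeta>) \<le> - (\<epsilon> * (\<zeta> \<bullet> \<zeta>))"
    using dissipation_coercive assms by metis
  moreover have "0 \<le> \<epsilon> * (\<zeta> \<bullet> \<zeta>)" using \<open>0 < \<epsilon>\<close> sp_nonneg[of \<zeta>] by simp
  ultimately show ?thesis by linarith
qed

lemma dim_zeta:
  assumes "trajectory x" "dim_vec w = q"
  shows "dim_vec (theta x t w) = NN" "dim_vec (theta x t w @\<^sub>v - (mat_inv (matJ1 J) *\<^sub>v v)) = NN + m"
proof -
  show *: "dim_vec (theta x t w) = NN"
    unfolding theta_def by (rule dim_blk, rule theta_bdims) (use assms in \<open>auto simp: trajectory_def\<close>)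
  have "dim_row (mat_inv (matJ1 J)) = m" using mat_inv_inverse(1)[OF dims_supply(2,7)] by auto
  then show "dim_vec (theta x t w @\<^sub>v - (mat_inv (matJ1 J) *\<^sub>v v)) = NN + m" using * by simp
qed

subsection \<open>Dissipativity and exponential stability\<close>

text \<open>In \<open>LK_derivative\<close> the dissipation form is nonpositive and the gaps are
  nonnegative, which leaves at most the supply rate.\<close>

lemma closed_loop_dissipative: "dissipative S K J"
  unfolding dissipative_def
proof (intro exI[of _ "\<lambda>\<psi>. LK \<psi> \<psi>"] conjI C1_LK ballI allI impI, elim conjE)
  fix \<psi> w x z
  assume p: "\<psi> \<in> cspace (hist S) n" and w: "w \<in> L2_vec {tinit S..} q" and sol: "state_solution S K \<psi> w x" and out: "output_equation S K w x z"
  define X where "X = extension x"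
  note tr = extension_trajectory(1)[OF p sol, folded X_def]
  have "AE t in lebesgue_on {tinit S..}. \<forall>j < n. ((\<lambda>s. x s $ j) has_real_derivative state_rhs S K w x t $ j) (at t)"
    using sol by (simp add: state_solution_def)
  moreover have "AE t in lebesgue_on {tinit S..}. z t = output_rhs S K w x t" using out by (simp add: output_equation_def)
  ultimately show "AE t in lebesgue_on {tinit S..}. \<exists>D. ((\<lambda>s. LK (segment S x s) (segment S x s)) has_real_derivative D) (at t) \<and> D - supply_rate J (z t) (w t) \<le> 0"
    using AE_after_start
  proof eventually_elim
    case (elim t)
    then have t: "tinit S \<le> t" by simp
    have wt: "dim_vec (w t) = q" using w t by (auto simp: L2_vec_def)
    note ed = extension_derivative[OF p sol t, OF wt elim(1), folded X_def]
    define \<zeta> where "\<zeta> = theta X t (w t) @\<^sub>v - (mat_inv (matJ1 J) *\<^sub>v (matJt J *\<^sub>v z t))"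
    define D where "D = supply_rate J (z t) (w t) + \<zeta> \<bullet> (dissipation_matrix S J K P1 P2 P3 Q R *\<^sub>v \<zeta>) - (\<Sum>i\<in>idx. bessel_gap i (\<lambda>\<tau>. X (t + \<tau>)))"
    have "((\<lambda>s. LK (\<lambda>\<tau>. X (s + \<tau>)) (\<lambda>\<tau>. X (s + \<tau>))) has_real_derivative D) (at t)"
      unfolding D_def \<zeta>_def by (rule LK_derivative[OF tr wt ed(1)]) (simp add: elim(2) ed(2))
    then have "((\<lambda>s. LK (segment S x s) (segment S x s)) has_real_derivative D) (at t)"
    proof (rule has_field_derivative_transform_within_open[where S = "{tinit S<..}"])
      fix s assume "s \<in> {tinit S<..}"
      then show "LK (\<lambda>\<tau>. X (s + \<tau>)) (\<lambda>\<tau>. X (s + \<tau>)) = LK (segment S x s) (segment S x s)"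
        by (intro LK_cong(1)) (simp add: X_def extension_eq segment_def)
    qed (use elim(3) in auto)
    moreover have "D - supply_rate J (z t) (w t) \<le> 0"
      using dissipation_nonpos[OF dim_zeta(2)[OF tr wt, of t "matJt J *\<^sub>v z t"], folded \<zeta>_def]
        sum_nonneg[of idx "\<lambda>i. bessel_gap i (\<lambda>\<tau>. X (t + \<tau>))"] bessel_gap_nonneg[OF _ trajectory_segment[OF tr]]
      unfolding D_def by fastforce
    ultimately show ?case by blast
  qed
qed

text \<open>For w = 0 only the block J~^T J1^{-1} J~ of the supply rate remains, and its
  semidefiniteness makes the supply nonpositive: dissipation becomes decay.\<close>

lemma supply_zero_input:
  assumes z: "dim_vec z = m"
  shows "supply_rate J z (0\<^sub>v q) \<le> 0"
proof -
  let ?U = "(matJt J)\<^sup>T * mat_inv (matJ1 J) * matJt J"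
  have d: "?U \<in> carrier_mat m m" using dims_supply(1) mat_inv_inverse(1)[OF dims_supply(2,7)] by auto
  have "supply_rate J z (0\<^sub>v q) = z \<bullet> (?U *\<^sub>v z) + z \<bullet> (matJ2 J *\<^sub>v 0\<^sub>v q) + z \<bullet> (matJ2 J *\<^sub>v 0\<^sub>v q) + 0\<^sub>v q \<bullet> (matJ3 J *\<^sub>v 0\<^sub>v q)"
    unfolding supply_rate_def by (rule sym_block_form[OF d dims_supply(4,5)]) (use z in auto)
  moreover have "matJ2 J *\<^sub>v 0\<^sub>v q = 0\<^sub>v m" using dims_supply(4) by (intro eq_vecI) (auto simp: sp_zero_right)
  moreover have "0\<^sub>v q \<bullet> (matJ3 J *\<^sub>v 0\<^sub>v q) = 0" using dims_supply(5) by (intro sp_zero_left) auto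
  moreover have "z \<bullet> (?U *\<^sub>v z) \<le> 0"
  proof -
    have "neg_semidef ?U" using vsup by (simp add: valid_supply_def)
    moreover have "dim_row ?U = m" using d by blast
    ultimately show ?thesis using z carrier_vecI[of z m] unfolding neg_semidef_def by metis
  qed
  ultimately show ?thesis by (simp add: sp_zero_right)
qed

text \<open>With nonpositive supply, coercivity of the dissipation form bounds - D from below by
  \<epsilon> |theta|^2 plus the gaps; the square of the block v is discarded.
  \<open>energy_control\<close> turns this into a bound on the energy. Stability speaks of the state
  alone, so the output z is defined from the trajectory.\<close>

lemma closed_loop_decay:
  obtains A where "0 < A" "\<And>x t. trajectory x \<Longrightarrow> vec_has_derivative x (Omega S K *\<^sub>v theta x t (0\<^sub>v q)) t \<Longrightarrow>
    \<exists>D. ((\<lambda>s. LK (\<lambda>\<tau>. x (s + \<tau>)) (\<lambda>\<tau>. x (s + \<tau>))) has_real_derivative D) (at t) \<and> energy (\<lambda>\<tau>. x (t + \<tau>)) \<le> - (A * D)"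
proof -
  obtain \<epsilon> where e: "0 < \<epsilon>" "\<And>\<zeta>. dim_vec \<zeta> = NN + m \<Longrightarrow> \<zeta> \<bullet> (dissipation_matrix S J K P1 P2 P3 Q R *\<^sub>v \<zeta>) \<le> - (\<epsilon> * (\<zeta> \<bullet> \<zeta>))"
    using dissipation_coercive by blast
  obtain A where A: "0 < A" "\<And>x t (w :: real vec). trajectory x \<Longrightarrow> dim_vec w = q \<Longrightarrow>
     energy (\<lambda>\<tau>. x (t + \<tau>)) \<le> A * (\<epsilon> * (theta x t w \<bullet> theta x t w) + (\<Sum>i\<in>idx. bessel_gap i (\<lambda>\<tau>. x (t + \<tau>))))"
    using energy_control[OF e(1)] by metis
  show thesis
  proof (rule that[OF A(1)])
    fix x t assume x: "trajectory x" and x': "vec_has_derivative x (Omega S K *\<^sub>v theta x t (0\<^sub>v q)) t"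
    have w: "dim_vec (0\<^sub>v q :: real vec) = q" by simp
    define z where "z = Sigma_cl S K *\<^sub>v theta x t (0\<^sub>v q)"
    define v where "v = - (mat_inv (matJ1 J) *\<^sub>v (matJt J *\<^sub>v z))"
    define G where "G = (\<Sum>i\<in>idx. bessel_gap i (\<lambda>\<tau>. x (t + \<tau>)))"
    define D where "D = supply_rate J z (0\<^sub>v q) + (theta x t (0\<^sub>v q) @\<^sub>v v) \<bullet> (dissipation_matrix S J K P1 P2 P3 Q R *\<^sub>v (theta x t (0\<^sub>v q) @\<^sub>v v)) - G"
    have der: "((\<lambda>s. LK (\<lambda>\<tau>. x (s + \<tau>)) (\<lambda>\<tau>. x (s + \<tau>))) has_real_derivative D) (at t)"
      unfolding D_def v_def G_def by (rule LK_derivative[OF x w x' z_def])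
    have dz: "dim_vec z = m" using dim_Omega(2) by (simp add: z_def)
    let ?T = "theta x t (0\<^sub>v q) \<bullet> theta x t (0\<^sub>v q)"
    have "D \<le> - (\<epsilon> * ((theta x t (0\<^sub>v q) @\<^sub>v v) \<bullet> (theta x t (0\<^sub>v q) @\<^sub>v v))) - G"
      unfolding D_def using supply_zero_input[OF dz] e(2)[OF dim_zeta(2)[OF x w, of t "matJt J *\<^sub>v z"], folded v_def] by linarith
    also have "\<dots> \<le> - (\<epsilon> * ?T) - G"
      using e(1) sp_nonneg[of v] by (simp add: sp_append)
    finally have "\<epsilon> * ?T + G \<le> - D" by simp
    then have "A * (\<epsilon> * ?T + G) \<le> A * - D" using A(1) by (intro mult_left_mono) auto
    then have "energy (\<lambda>\<tau>. x (t + \<tau>)) \<le> - (A * D)" using A(2)[OF x w, of t] unfolding G_def by simp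
    with der show "\<exists>D. ((\<lambda>s. LK (\<lambda>\<tau>. x (s + \<tau>)) (\<lambda>\<tau>. x (s + \<tau>))) has_real_derivative D) (at t) \<and> energy (\<lambda>\<tau>. x (t + \<tau>)) \<le> - (A * D)" by blast
  qed
qed

text \<open>V \<le> C energy and energy \<le> - A V' give V' \<le> - k V with k = 1 / (A C), almost
  everywhere, so V times a growing exponential of rate k is nonincreasing by absolute continuity. V
  bounds the square of the norm of x, so x decays at the rate k / 2.\<close>

lemma closed_loop_exponentially_stable: "exponentially_stable S K"
proof -
  obtain A where A: "0 < A" "\<And>x t. trajectory x \<Longrightarrow> vec_has_derivative x (Omega S K *\<^sub>v theta x t (0\<^sub>v q)) t \<Longrightarrow>
    \<exists>D. ((\<lambda>s. LK (\<lambda>\<tau>. x (s + \<tau>)) (\<lambda>\<tau>. x (s + \<tau>))) has_real_derivative D) (at t) \<and> energy (\<lambda>\<tau>. x (t + \<tau>)) \<le> - (A * D)"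
    using closed_loop_decay by blast
  obtain C where C: "0 < C" "\<And>y. continuous_segment y \<Longrightarrow> LK y y \<le> C * energy y" using LK_upper by blast
  obtain c where c: "0 < c" "\<And>y. continuous_segment y \<Longrightarrow> c * (y 0 \<bullet> y 0) \<le> LK y y" using LK_lower by blast
  define L where "L = 1 + (\<Sum>i\<in>idx. del S i - del S (i - 1))"
  have L: "0 < L" unfolding L_def by (intro add_pos_nonneg sum_nonneg) (use delay_less in \<open>auto intro: less_imp_le simp: less_imp_le\<close>)
  define k where "k = 1 / (A * C)"
  have k: "0 < k" using A(1) C(1) by (simp add: k_def)
  \<comment> \<open>From c |x|^2 \<le> V and the initial bound of V by C L times the squared norm of
    \<psi>, after taking roots.\<close>
  define \<alpha> where "\<alpha> = sqrt (C * L / c)"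
  have main: "vnorm (x t) \<le> \<alpha> * exp (- (k / 2) * (t - tinit S)) * cnorm (hist S) \<psi>"
    if p: "\<psi> \<in> cspace (hist S) n" and sol: "state_solution S K \<psi> (\<lambda>t. 0\<^sub>v q) x" and t: "tinit S \<le> t" for \<psi> x t
  proof -
    define X where "X = extension x"
    note tr = extension_trajectory(1)[OF p sol, folded X_def]
    note seg = trajectory_segment[OF tr]
    define V where "V s = LK (\<lambda>\<tau>. X (s + \<tau>)) (\<lambda>\<tau>. X (s + \<tau>))" for s
    define u where "u s = exp (k * (s - tinit S)) * V s" for s
    have acV: "abs_cont_on (tinit S) t V"
      unfolding V_def by (rule LK_abs_cont[OF tr extension_trajectory(2)[OF p sol t, folded X_def]])
    have acE: "abs_cont_on (tinit S) t (\<lambda>s. exp (k * (s - tinit S)))"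
    proof (rule abs_cont_on_deriv_bounded)
      show "((\<lambda>s. exp (k * (s - tinit S))) has_real_derivative k * exp (k * (s - tinit S))) (at s)" for s
        by (auto intro!: derivative_eq_intros)
      show "\<bar>k * exp (k * (s - tinit S))\<bar> \<le> k * exp (k * (t - tinit S))" if "s \<in> {tinit S..t}" for s
        using that k by (simp add: abs_mult)
    qed
    have acu: "abs_cont_on (tinit S) t u" unfolding u_def by (rule abs_cont_on_mult[OF acE acV])
    have "AE s in lebesgue_on {tinit S..}. \<forall>j < n. ((\<lambda>s. x s $ j) has_real_derivative state_rhs S K (\<lambda>t. 0\<^sub>v q) x s $ j) (at s)"
      using sol by (simp add: state_solution_def)
    then have "AE s in lebesgue. s \<in> {tinit S..} \<longrightarrow> (\<forall>j < n. ((\<lambda>s. x s $ j) has_real_derivative state_rhs S K (\<lambda>t. 0\<^sub>v q) x s $ j) (at s))"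
      by (subst (asm) AE_restrict_space_iff) auto
    then obtain N where N: "N \<in> null_sets lebesgue"
      "\<And>s. s \<notin> N \<Longrightarrow> s \<in> {tinit S..} \<Longrightarrow> \<forall>j < n. ((\<lambda>s. x s $ j) has_real_derivative state_rhs S K (\<lambda>t. 0\<^sub>v q) x s $ j) (at s)"
      by (elim AE_E3) auto
    have "u t \<le> u (tinit S)"
    proof (rule abs_cont_on_nonincreasing[OF t acu])
      show "negligible N" using N(1) by (simp add: negligible_iff_null_sets)
      fix s assume s: "s \<in> {tinit S..t} - N"
      have "vec_has_derivative X (Omega S K *\<^sub>v theta X s (0\<^sub>v q)) s"
        unfolding X_def by (rule extension_derivative(1)[OF p sol]) (use s N(2) in auto)
      from A(2)[OF tr this] obtain D where D: "(V has_real_derivative D) (at s)" "energy (\<lambda>\<tau>. X (s + \<tau>)) \<le> - (A * D)"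
        unfolding V_def by blast
      have "k * V s \<le> k * (C * energy (\<lambda>\<tau>. X (s + \<tau>)))" unfolding V_def by (intro mult_left_mono C(2) seg) (use k in simp)
      also have "\<dots> = energy (\<lambda>\<tau>. X (s + \<tau>)) / A" using A(1) C(1) by (simp add: k_def)
      also have "\<dots> \<le> - D" using D(2) A(1) by (simp add: divide_le_eq mult.commute)
      finally have neg: "exp (k * (s - tinit S)) * (k * V s + D) \<le> 0" by (simp add: mult_le_0_iff)
      have "(u has_real_derivative exp (k * (s - tinit S)) * (k * V s + D)) (at s)"
        unfolding u_def by (auto intro!: derivative_eq_intros D(1) simp: algebra_simps)
      with neg show "\<exists>D\<le>0. (u has_real_derivative D) (at s)" by blast
    qed
    then have "exp (k * (t - tinit S)) * V t \<le> V (tinit S)" by (simp add: u_def)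
    then have Vt: "V t \<le> exp (- k * (t - tinit S)) * V (tinit S)"
      using mult_left_mono[of "exp (k * (t - tinit S)) * V t" "V (tinit S)" "exp (- k * (t - tinit S))"]
      by (simp add: mult.assoc[symmetric] exp_add[symmetric])
    have "energy (\<lambda>\<tau>. X (tinit S + \<tau>)) = energy \<psi>"
      by (rule LK_cong(2)) (use sol in \<open>simp add: X_def extension_eq state_solution_def\<close>)
    then have "V (tinit S) \<le> C * energy \<psi>" using C(2)[OF seg, of "tinit S"] by (simp add: V_def)
    also have "\<dots> \<le> C * (L * (cnorm (hist S) \<psi>)\<^sup>2)" using energy_le_cnorm[OF p] C(1) by (simp add: L_def)
    finally have V0: "V (tinit S) \<le> C * (L * (cnorm (hist S) \<psi>)\<^sup>2)" .
    have "X t = x t" using t hist_pos(1) by (simp add: X_def extension_def)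
    then have "c * (x t \<bullet> x t) \<le> V t" using c(2)[OF seg, of t] by (simp add: V_def)
    also have "V t \<le> exp (- k * (t - tinit S)) * (C * (L * (cnorm (hist S) \<psi>)\<^sup>2))"
      by (rule order_trans[OF Vt mult_left_mono[OF V0]]) simp
    finally have "x t \<bullet> x t \<le> exp (- k * (t - tinit S)) * (C * (L * (cnorm (hist S) \<psi>)\<^sup>2)) / c"
      using c(1) by (simp add: pos_le_divide_eq mult.commute)
    also have "\<dots> = (\<alpha> * exp (- (k / 2) * (t - tinit S)) * cnorm (hist S) \<psi>)\<^sup>2"
    proof -
      have "(exp (- (k / 2) * (t - tinit S)))\<^sup>2 = exp (- k * (t - tinit S))"
        by (simp add: power2_eq_square exp_add[symmetric] field_simps)
      then show ?thesis using C(1) L c(1) by (simp add: \<alpha>_def power_mult_distrib)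
    qed
    finally show ?thesis
      unfolding vnorm_power2[symmetric]
      by (rule power2_le_imp_le) (use C(1) L c(1) cnorm_pos[OF p] in \<open>simp add: \<alpha>_def\<close>)
  qed
  have "0 < \<alpha>" "0 < k / 2" using C(1) L c(1) k by (simp_all add: \<alpha>_def)
  with main show ?thesis unfolding exponentially_stable_def by blast
qed

end

theorem theorem1:
  fixes S :: decomposed_system and J :: supply_data
    and K P1 P2 P3 :: "real mat" and Q R :: "nat \<Rightarrow> real mat"
  assumes "valid_system S" and "kernel_decomposition S" and "cholesky_factors S"
    and "valid_supply (dimz S) (dimw S) J"
    and "decision_variables (dimx S) (dimu S) (ndel S) (totf S) K P1 P2 P3 Q R"
    and "pos_def (sym_block P1 P2 P3 +
           diag_block_mat [0\<^sub>m (dimx S) (dimx S),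
             diag_block_mat (map (\<lambda>i. 1\<^sub>m (dimf S i) \<otimes>\<^sub>K Q i) (delay_idx S))])"
    and "pos_def (diagQ S Q)" and "pos_def (diagQ S R)"
    and "neg_def (dissipation_matrix S J K P1 P2 P3 Q R)"
  shows "dissipation_matrix S J K P1 P2 P3 Q R
           = Sy ((boldP S P1 P2)\<^sup>T * boldPi S K) + boldPhi S J K P2 P3 Q R
    \<and> dissipative S K J
    \<and> exponentially_stable S K
    \<and> real (num_unknowns (dimx S) (dimu S) (ndel S) (totf S))
        = (0.5 * (real (totf S))\<^sup>2 + real (totf S) + real (ndel S) + 0.5) * (real (dimx S))\<^sup>2
          + (0.5 * real (totf S) + 0.5 + real (ndel S) + real (dimu S)) * real (dimx S)
    \<and> (\<forall>c. (\<lambda>(n, p, nd, d). real (num_unknowns n p nd d))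
          \<in> O[principal (size_range c)](\<lambda>(n, p, nd, d). (real d)\<^sup>2 * (real n)\<^sup>2))"
proof -
  interpret closed_loop_lmi S J K P1 P2 P3 Q R by unfold_locales (fact assms)+
  show ?thesis
    by (intro conjI allI dissipation_matrix_eq closed_loop_dissipative closed_loop_exponentially_stable
      num_unknowns_eq num_unknowns_bigo)
qed

end
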